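(* Let $c=m/n$ with $m,n$ coprime positive integers, let $0\le\ell<n-1$, $\mu_\ell=(n-\ell,1^\ell)$, and let $I_\ell$ be the unique maximal proper submodule of $\Delta_c(\mu_\ell)$. Let $(\mathbf a,T)\in\mathbb Z_{\ge0}^n\times\mathrm{SYT}(\mu_\ell)$, and denote by $i_\ell$ the label in $T$ of the box of $\mu_\ell$ with smallest content. Then $v(\mathbf a,T)\in I_\ell$ if and only if either * $a_{g_{\mathbf a}^{-1}(n)}-m>a_{g_{\mathbf a}^{-1}(i_\ell)}$, or * $a_{g_{\mathbf a}^{-1}(n)}-m=a_{g_{\mathbf a}^{-1}(i_\ell)}$ and $g_{\mathbf a}^{-1}(n)>g_{\mathbf a}^{-1}(i_\ell)$. It follows that $L_c(\mu_\ell)=\Delta_c(\mu_\ell)/I_\ell$ has a weight basis (a basis of simultaneous eigenvectors of $u_1,\dots,u_n$) indexed by the pairs $(\mathbf a,T)\in\mathbb Z_{\ge0}^n\times\mathrm{SYT}(\mu_\ell)$ such that * $a_{g_{\mathbf a}^{-1}(n)}-m<a_{g_{\mathbf a}^{-1}(i_\ell)}$, or * $a_{g_{\mathbf a}^{-1}(n)}-m=a_{g_{\mathbf a}^{-1}(i_\ell)}$ and $g_{\mathbf a}^{-1}(n)<g_{\mathbf a}^{-1}(i_\ell)$.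
   Context: $H_c=H_{1,c}(\mathcal S_n,\mathbb C^n)$ is the quotient of $\mathbb C\langle x_1,\dots,x_n,y_1,\dots,y_n\rangle\rtimes\mathcal S_n$ by $[x_i,x_j]=[y_i,y_j]=0$, $[y_i,x_j]=c\,(ij)$ for $i\ne j$, $[y_i,x_i]=1-c\sum_{j\ne i}(ij)$; $u_i=x_iy_i-c\sum_{j<i}(ij)$. For a partition $\mu$ of $n$ with irreducible $\mathcal S_n$-module $V_\mu$ ($V_{(n)}$ trivial), $\Delta_c(\mu)=\mathrm{Ind}_{\mathbb C[y_1,\dots,y_n]\rtimes\mathcal S_n}^{H_c}V_\mu$, the $y_i$ acting by $0$ on $V_\mu$; $L_c(\mu)$ is its unique irreducible quotient. $\mathrm{SYT}(\mu)$ is the set of standard Young tableaux of shape $\mu$, and $\mathrm{ct}_T(i)$ is the content (column minus row) of the box of $T$ labeled $i$. For $\mathbf a\in\mathbb Z_{\ge0}^n$, $g_{\mathbf a}\in\mathcal S_n$ is the minimal length permutation sorting $\mathbf a$ non-decreasingly: $g_{\mathbf a}(i)=\#\{j:a_j<a_i\}+\#\{j\le i:a_j=a_i\}$. For $c=m/n$, $\Delta_c(\mu)$ is the direct sum over $(\mathbf a,T)\in\mathbb Z^n_{\ge0}\times\mathrm{SYT}(\mu)$ of one-dimensional simultaneous eigenspaces of $u_1,\dots,u_n$ with pairwise distinct eigenvalue vectors $\mathtt w_i(\mathbf a,T)=a_i-\mathrm{ct}_T(g_{\mathbf a}(i))c$; $v(\mathbf a,T)$ is a nonzero vector in the corresponding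 eigenspace. *)

theory Defs
  imports
    Complex_Main
    "HOL-Library.Poly_Mapping"
    "HOL-Combinatorics.Permutations"
    "HOL-Algebra.QuotRing"
    "HOL-Algebra.Module"
    "HOL-Algebra.Generated_Groups"
begin

section \<open>Crossed products with symmetric groups\<close>

text \<open>
  All indices are natural numbers starting from 1, and the symmetric group on \<open>n\<close> letters is
  \<open>{f. f permutes {1..n}}\<close>.  A crossed product of a monoid algebra with a symmetric group is the
  monoid algebra of the semidirect product of the monoid with the group, with product
  \<open>(w, f) (w', f') = (w f(w'), f o f')\<close>.  The type \<^typ>\<open>'k \<Rightarrow>\<^sub>0 complex\<close> of \<^theory>\<open>HOL-Library.Poly_Mapping\<close>
  is the monoid algebra of \<open>'k\<close>, provided the monoid structure of \<open>'k\<close> is written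
  additively; this is the reason for the (noncommutative) \<open>+\<close> on the next two types.
\<close>

datatype letter = LX nat | LY nat

fun act_letter :: "(nat \<Rightarrow> nat) \<Rightarrow> letter \<Rightarrow> letter" where
  "act_letter f (LX i) = LX (f i)"
| "act_letter f (LY i) = LY (f i)"

fun letter_index :: "letter \<Rightarrow> nat" where
  "letter_index (LX i) = i"
| "letter_index (LY i) = i"

datatype wperm = WPerm (wp_word: "letter list") (wp_perm: "nat \<Rightarrow> nat")

instantiation wperm :: monoid_add
begin

definition zero_wperm :: wperm where
  "zero_wperm = WPerm [] id"

definition plus_wperm :: "wperm \<Rightarrow> wperm \<Rightarrow> wperm" where
  "plus_wperm p q =
     WPerm (wp_word p @ map (act_letter (wp_perm p)) (wp_word q)) (wp_perm p \<circ> wp_perm q)"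

instance
proof
  have comp: "act_letter (f \<circ> g) = act_letter f \<circ> act_letter g" for f g
  proof
    fix l show "act_letter (f \<circ> g) l = (act_letter f \<circ> act_letter g) l" by (cases l) auto
  qed
  have ident: "act_letter id = id"
  proof
    fix l show "act_letter id l = id l" by (cases l) auto
  qed
  fix p q r :: wperm
  show "p + q + r = p + (q + r)"
    by (simp add: plus_wperm_def comp comp_assoc)
  show "0 + p = p" "p + 0 = p"
    by (simp_all add: plus_wperm_def zero_wperm_def ident)
qed

end

datatype yperm = YPerm (yp_mon: "nat multiset") (yp_perm: "nat \<Rightarrow> nat")

instantiation yperm :: monoid_add
begin

definition zero_yperm :: yperm where
  "zero_yperm = YPerm {#} id"

definition plus_yperm :: "yperm \<Rightarrow> yperm \<Rightarrow> yperm" where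
  "plus_yperm p q =
     YPerm (yp_mon p + image_mset (yp_perm p) (yp_mon q)) (yp_perm p \<circ> yp_perm q)"

instance
  by standard (auto simp: plus_yperm_def zero_yperm_def multiset.map_comp comp_assoc)

end

text \<open>The algebra \<open>\<complex>\<langle>x\<^sub>1,\<dots>,x\<^sub>n,y\<^sub>1,\<dots>,y\<^sub>n\<rangle> \<rtimes> S\<^sub>n\<close>.\<close>

definition free_crossed :: "nat \<Rightarrow> (wperm \<Rightarrow>\<^sub>0 complex) ring" where
  "free_crossed n =
     \<lparr>carrier = {f. \<forall>p \<in> Poly_Mapping.keys f.
                    letter_index ` set (wp_word p) \<subseteq> {1..n} \<and> wp_perm p permutes {1..n}},
      mult = (*), one = 1, zero = 0, add = (+)\<rparr>"

text \<open>The algebra \<open>\<complex>[y\<^sub>1,\<dots>,y\<^sub>n] \<rtimes> S\<^sub>n\<close>; a commutative monomial in the \<open>y\<^sub>i\<close> is encoded by the multiset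
  of the indices of its factors.\<close>

definition y_crossed :: "nat \<Rightarrow> (yperm \<Rightarrow>\<^sub>0 complex) ring" where
  "y_crossed n =
     \<lparr>carrier = {f. \<forall>p \<in> Poly_Mapping.keys f.
                    set_mset (yp_mon p) \<subseteq> {1..n} \<and> yp_perm p permutes {1..n}},
      mult = (*), one = 1, zero = 0, add = (+)\<rparr>"

section \<open>The rational Cherednik algebra\<close>

definition scalar :: "complex \<Rightarrow> wperm \<Rightarrow>\<^sub>0 complex" where
  "scalar z = Poly_Mapping.single 0 z"

definition gx :: "nat \<Rightarrow> wperm \<Rightarrow>\<^sub>0 complex" where
  "gx i = Poly_Mapping.single (WPerm [LX i] id) 1"

definition gy :: "nat \<Rightarrow> wperm \<Rightarrow>\<^sub>0 complex" where
  "gy i = Poly_Mapping.single (WPerm [LY i] id) 1"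

definition transp :: "nat \<Rightarrow> nat \<Rightarrow> wperm \<Rightarrow>\<^sub>0 complex" where
  "transp i j = Poly_Mapping.single (WPerm [] (Transposition.transpose i j)) 1"

definition cherednik_relations :: "nat \<Rightarrow> complex \<Rightarrow> (wperm \<Rightarrow>\<^sub>0 complex) set" where
  "cherednik_relations n c =
     {gx i * gx j - gx j * gx i | i j. i \<in> {1..n} \<and> j \<in> {1..n}} \<union>
     {gy i * gy j - gy j * gy i | i j. i \<in> {1..n} \<and> j \<in> {1..n}} \<union>
     {gy i * gx j - gx j * gy i - scalar c * transp i j | i j.
        i \<in> {1..n} \<and> j \<in> {1..n} \<and> i \<noteq> j} \<union>
     {gy i * gx i - gx i * gy i - (1 - scalar c * (\<Sum>j \<in> {1..n} - {i}. transp i j)) | i.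
        i \<in> {1..n}}"

definition cherednik_ideal :: "nat \<Rightarrow> complex \<Rightarrow> (wperm \<Rightarrow>\<^sub>0 complex) set" where
  "cherednik_ideal n c = Idl\<^bsub>free_crossed n\<^esub> (cherednik_relations n c)"

definition cherednik :: "nat \<Rightarrow> complex \<Rightarrow> (wperm \<Rightarrow>\<^sub>0 complex) set ring" where
  "cherednik n c = free_crossed n Quot cherednik_ideal n c"

definition cherednik_class :: "nat \<Rightarrow> complex \<Rightarrow> (wperm \<Rightarrow>\<^sub>0 complex) \<Rightarrow> (wperm \<Rightarrow>\<^sub>0 complex) set" where
  "cherednik_class n c f = cherednik_ideal n c +>\<^bsub>free_crossed n\<^esub> f"

definition u_elem :: "nat \<Rightarrow> complex \<Rightarrow> nat \<Rightarrow> (wperm \<Rightarrow>\<^sub>0 complex) set" where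
  "u_elem n c i = cherednik_class n c (gx i * gy i - scalar c * (\<Sum>j \<in> {1..<i}. transp i j))"

text \<open>The canonical homomorphism \<open>\<complex>[y\<^sub>1,\<dots>,y\<^sub>n] \<rtimes> S\<^sub>n \<rightarrow> H\<^sub>c\<close>.  The order in which a monomial is written
  as a word is immaterial, since the \<open>y\<^sub>i\<close> commute in \<open>H\<^sub>c\<close>.\<close>

definition y_to_cherednik :: "nat \<Rightarrow> complex \<Rightarrow> (yperm \<Rightarrow>\<^sub>0 complex) \<Rightarrow> (wperm \<Rightarrow>\<^sub>0 complex) set" where
  "y_to_cherednik n c b = cherednik_class n c
     (\<Sum>p \<in> Poly_Mapping.keys b.
        Poly_Mapping.single (WPerm (map LY (sorted_list_of_multiset (yp_mon p))) (yp_perm p))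
          (Poly_Mapping.lookup b p))"

section \<open>Left modules\<close>

text \<open>
  Left modules over a not necessarily commutative ring use the record type of
  \<^theory>\<open>HOL-Algebra.Module\<close>, whose ring fields \<open>mult\<close> and \<open>one\<close> are irrelevant.  The predicate
  \<^const>\<open>submodule\<close> of that theory does not require commutativity.
\<close>

definition quotient_module :: "('r, 'a) module \<Rightarrow> 'a set \<Rightarrow> ('r, 'a set) module" where
  "quotient_module M N =
     \<lparr>carrier = a_rcosets\<^bsub>M\<^esub> N, mult = undefined, one = undefined,
      zero = N, add = set_add M,
      smult = (\<lambda>r C. \<Union>x \<in> C. N +>\<^bsub>M\<^esub> (r \<odot>\<^bsub>M\<^esub> x))\<rparr>"

definition irreducible_module :: "('r, 's) ring_scheme \<Rightarrow> ('r, 'a) module \<Rightarrow> bool" where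
  "irreducible_module R M \<longleftrightarrow>
     carrier M \<noteq> {\<zero>\<^bsub>M\<^esub>} \<and> (\<forall>N. submodule N R M \<longrightarrow> N = {\<zero>\<^bsub>M\<^esub>} \<or> N = carrier M)"

definition maximal_submodule :: "('r, 's) ring_scheme \<Rightarrow> ('r, 'a) module \<Rightarrow> 'a set \<Rightarrow> bool" where
  "maximal_submodule R M N \<longleftrightarrow>
     submodule N R M \<and> N \<noteq> carrier M \<and>
     (\<forall>N'. submodule N' R M \<and> N \<subseteq> N' \<longrightarrow> N' = N \<or> N' = carrier M)"

definition the_maximal_submodule :: "('r, 's) ring_scheme \<Rightarrow> ('r, 'a) module \<Rightarrow> 'a set" where
  "the_maximal_submodule R M = (THE N. maximal_submodule R M N)"

definition irreducible_quotient ::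
    "('r, 's) ring_scheme \<Rightarrow> ('r, 'a) module \<Rightarrow> ('r, 'a set) module" where
  "irreducible_quotient R M =
     quotient_module M
       (THE N. submodule N R M \<and> irreducible_module R (quotient_module M N))"

text \<open>
  For a homomorphism \<open>\<phi> : B \<rightarrow> R\<close> and a left \<open>B\<close>-module \<open>V\<close>, the induced module is the tensor product
  of \<open>R\<close> with \<open>V\<close> over \<open>B\<close>: the free abelian group on \<open>R \<times> V\<close> modulo biadditivity and
  \<open>r \<phi>(b) \<otimes> v = r \<otimes> b v\<close>, where \<open>r\<close> acts by \<open>r (s \<otimes> v) = (r s) \<otimes> v\<close>.  Before passing to the quotient
  the latter is only an operation, not a module structure.
\<close>

definition free_tensor ::
    "('r, 's) ring_scheme \<Rightarrow> ('b, 'v) module \<Rightarrow> ('r, ('r \<times> 'v) \<Rightarrow>\<^sub>0 int) module" where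
  "free_tensor R V =
     \<lparr>carrier = {z. Poly_Mapping.keys z \<subseteq> carrier R \<times> carrier V},
      mult = undefined, one = undefined, zero = 0, add = (+),
      smult = (\<lambda>r z. \<Sum>(s, v) \<in> Poly_Mapping.keys z.
                 Poly_Mapping.single (r \<otimes>\<^bsub>R\<^esub> s, v) (Poly_Mapping.lookup z (s, v)))\<rparr>"

definition tensor_relations ::
    "('r, 's) ring_scheme \<Rightarrow> ('b, 't) ring_scheme \<Rightarrow> ('b \<Rightarrow> 'r) \<Rightarrow> ('b, 'v) module \<Rightarrow>
     (('r \<times> 'v) \<Rightarrow>\<^sub>0 int) set" where
  "tensor_relations R B \<phi> V =
     (let pure = (\<lambda>r v. Poly_Mapping.single (r, v) (1::int)) in
      {pure (r \<oplus>\<^bsub>R\<^esub> s) v - pure r v - pure s v | r s v.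
         r \<in> carrier R \<and> s \<in> carrier R \<and> v \<in> carrier V} \<union>
      {pure r (v \<oplus>\<^bsub>V\<^esub> w) - pure r v - pure r w | r v w.
         r \<in> carrier R \<and> v \<in> carrier V \<and> w \<in> carrier V} \<union>
      {pure (r \<otimes>\<^bsub>R\<^esub> \<phi> b) v - pure r (b \<odot>\<^bsub>V\<^esub> v) | r b v.
         r \<in> carrier R \<and> b \<in> carrier B \<and> v \<in> carrier V})"

definition induced_module ::
    "('r, 's) ring_scheme \<Rightarrow> ('b, 't) ring_scheme \<Rightarrow> ('b \<Rightarrow> 'r) \<Rightarrow> ('b, 'v) module \<Rightarrow>
     ('r, (('r \<times> 'v) \<Rightarrow>\<^sub>0 int) set) module" where
  "induced_module R B \<phi> V =
     quotient_module (free_tensor R V)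
       (generate (add_monoid (free_tensor R V)) (tensor_relations R B \<phi> V))"

section \<open>Partitions, tableaux and the irreducible modules of the symmetric group\<close>

text \<open>
  A partition is the weakly decreasing list of its positive parts.  Boxes are pairs
  \<open>(row, column)\<close> counted from 0; this does not affect contents.
\<close>

definition boxes :: "nat list \<Rightarrow> (nat \<times> nat) set" where
  "boxes \<mu> = {(r, k). r < length \<mu> \<and> k < \<mu> ! r}"

definition box_content :: "nat \<times> nat \<Rightarrow> int" where
  "box_content b = int (snd b) - int (fst b)"

definition hook :: "nat \<Rightarrow> nat \<Rightarrow> nat list" where
  "hook n l = (n - l) # replicate l 1"

definition SYT :: "nat list \<Rightarrow> (nat \<times> nat \<Rightarrow> nat) set" where
  "SYT \<mu> = {T \<in> boxes \<mu> \<rightarrow>\<^sub>E {1..sum_list \<mu>}.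
      bij_betw T (boxes \<mu>) {1..sum_list \<mu>} \<and>
      (\<forall>r k k'. (r, k) \<in> boxes \<mu> \<and> (r, k') \<in> boxes \<mu> \<and> k < k' \<longrightarrow> T (r, k) < T (r, k')) \<and>
      (\<forall>r r' k. (r, k) \<in> boxes \<mu> \<and> (r', k) \<in> boxes \<mu> \<and> r < r' \<longrightarrow> T (r, k) < T (r', k))}"

definition ct :: "nat list \<Rightarrow> (nat \<times> nat \<Rightarrow> nat) \<Rightarrow> nat \<Rightarrow> int" where
  "ct \<mu> T i = box_content (inv_into (boxes \<mu>) T i)"

definition min_content_label :: "nat list \<Rightarrow> (nat \<times> nat \<Rightarrow> nat) \<Rightarrow> nat" where
  "min_content_label \<mu> T = T (arg_min_on box_content (boxes \<mu>))"

text \<open>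
  The irreducible module \<open>V\<^sub>\<mu>\<close> is the left ideal \<open>\<complex>[S\<^sub>n] a\<^sub>\<mu> b\<^sub>\<mu>\<close>, where the Young symmetrizer
  \<open>a\<^sub>\<mu> b\<^sub>\<mu>\<close> is that of the tableau filled with \<open>1, 2, \<dots>, n\<close> row by row: \<open>a\<^sub>\<mu>\<close> is the sum over
  the row stabilizer, and \<open>b\<^sub>\<mu>\<close> is the signed sum over the column stabilizer.  In particular the
  partition with one part gives the trivial module.  The group algebra \<open>\<complex>[S\<^sub>n]\<close> is realized as
  the subalgebra of \<open>\<complex>[y\<^sub>1,\<dots>,y\<^sub>n] \<rtimes> S\<^sub>n\<close> whose elements involve no \<open>y\<^sub>i\<close>.
\<close>

definition row_filling :: "nat list \<Rightarrow> nat \<times> nat \<Rightarrow> nat" where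
  "row_filling \<mu> b = sum_list (take (fst b) \<mu>) + snd b + 1"

definition row_stabilizer :: "nat list \<Rightarrow> (nat \<Rightarrow> nat) set" where
  "row_stabilizer \<mu> = {f. f permutes {1..sum_list \<mu>} \<and>
     (\<forall>r. f ` (row_filling \<mu> ` {b \<in> boxes \<mu>. fst b = r}) = row_filling \<mu> ` {b \<in> boxes \<mu>. fst b = r})}"

definition column_stabilizer :: "nat list \<Rightarrow> (nat \<Rightarrow> nat) set" where
  "column_stabilizer \<mu> = {f. f permutes {1..sum_list \<mu>} \<and>
     (\<forall>k. f ` (row_filling \<mu> ` {b \<in> boxes \<mu>. snd b = k}) = row_filling \<mu> ` {b \<in> boxes \<mu>. snd b = k})}"

definition young_symmetrizer :: "nat list \<Rightarrow> yperm \<Rightarrow>\<^sub>0 complex" where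
  "young_symmetrizer \<mu> =
     (\<Sum>f \<in> row_stabilizer \<mu>. Poly_Mapping.single (YPerm {#} f) 1) *
     (\<Sum>f \<in> column_stabilizer \<mu>. Poly_Mapping.single (YPerm {#} f) (of_int (sign f)))"

definition group_algebra :: "nat \<Rightarrow> (yperm \<Rightarrow>\<^sub>0 complex) set" where
  "group_algebra n = {f. \<forall>p \<in> Poly_Mapping.keys f. yp_mon p = {#} \<and> yp_perm p permutes {1..n}}"

definition y_to_zero :: "(yperm \<Rightarrow>\<^sub>0 complex) \<Rightarrow> yperm \<Rightarrow>\<^sub>0 complex" where
  "y_to_zero b = (\<Sum>p \<in> {p \<in> Poly_Mapping.keys b. yp_mon p = {#}}.
     Poly_Mapping.single p (Poly_Mapping.lookup b p))"

definition irrep :: "nat list \<Rightarrow> (yperm \<Rightarrow>\<^sub>0 complex, yperm \<Rightarrow>\<^sub>0 complex) module" where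
  "irrep \<mu> =
     \<lparr>carrier = {s * young_symmetrizer \<mu> | s. s \<in> group_algebra (sum_list \<mu>)},
      mult = undefined, one = undefined, zero = 0, add = (+),
      smult = (\<lambda>b v. y_to_zero b * v)\<rparr>"

section \<open>Standard modules, their irreducible quotients and weights\<close>

type_synonym cherednik_elem = "(wperm \<Rightarrow>\<^sub>0 complex) set"
type_synonym standard_elem = "((cherednik_elem \<times> (yperm \<Rightarrow>\<^sub>0 complex)) \<Rightarrow>\<^sub>0 int) set"

definition standard_module :: "complex \<Rightarrow> nat list \<Rightarrow> (cherednik_elem, standard_elem) module" where
  "standard_module c \<mu> = (let n = sum_list \<mu> in
     induced_module (cherednik n c) (y_crossed n) (y_to_cherednik n c) (irrep \<mu>))"

definition simple_module :: "complex \<Rightarrow> nat list \<Rightarrow> (cherednik_elem, standard_elem set) module" where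
  "simple_module c \<mu> = irreducible_quotient (cherednik (sum_list \<mu>) c) (standard_module c \<mu>)"

definition exponents :: "nat \<Rightarrow> (nat \<Rightarrow> nat) set" where
  "exponents n = {1..n} \<rightarrow>\<^sub>E UNIV"

definition sorting_perm :: "nat \<Rightarrow> (nat \<Rightarrow> nat) \<Rightarrow> nat \<Rightarrow> nat" where
  "sorting_perm n a i = card {j \<in> {1..n}. a j < a i} + card {j \<in> {1..n}. j \<le> i \<and> a j = a i}"

definition sorting_inv :: "nat \<Rightarrow> (nat \<Rightarrow> nat) \<Rightarrow> nat \<Rightarrow> nat" where
  "sorting_inv n a = inv_into {1..n} (sorting_perm n a)"

definition weight :: "complex \<Rightarrow> nat list \<Rightarrow> (nat \<Rightarrow> nat) \<Rightarrow> (nat \<times> nat \<Rightarrow> nat) \<Rightarrow> nat \<Rightarrow> complex" where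
  "weight c \<mu> a T i = of_nat (a i) - of_int (ct \<mu> T (sorting_perm (sum_list \<mu>) a i)) * c"

definition weight_vector ::
    "nat \<Rightarrow> complex \<Rightarrow> (cherednik_elem, 'v) module \<Rightarrow> (nat \<Rightarrow> complex) \<Rightarrow> 'v \<Rightarrow> bool" where
  "weight_vector n c M w v \<longleftrightarrow>
     v \<in> carrier M \<and> v \<noteq> \<zero>\<^bsub>M\<^esub> \<and>
     (\<forall>i \<in> {1..n}. u_elem n c i \<odot>\<^bsub>M\<^esub> v = cherednik_class n c (scalar (w i)) \<odot>\<^bsub>M\<^esub> v)"

text \<open>Modules over \<open>H\<^sub>c\<close> are complex vector spaces via the scalars in \<open>H\<^sub>c\<close>.\<close>

definition is_basis ::
    "nat \<Rightarrow> complex \<Rightarrow> (cherednik_elem, 'v) module \<Rightarrow> 'i set \<Rightarrow> ('i \<Rightarrow> 'v) \<Rightarrow> bool" where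
  "is_basis n c M S e \<longleftrightarrow>
     e ` S \<subseteq> carrier M \<and>
     (\<forall>v \<in> carrier M. \<exists>!f :: 'i \<Rightarrow>\<^sub>0 complex.
        Poly_Mapping.keys f \<subseteq> S \<and>
        v = (\<Oplus>\<^bsub>M\<^esub>s \<in> Poly_Mapping.keys f.
               cherednik_class n c (scalar (Poly_Mapping.lookup f s)) \<odot>\<^bsub>M\<^esub> e s))"

end

theory Submission
  imports Defs
begin

text \<open>
  An affine permutation is a bijection \<open>P\<close> of \<open>\<int>\<close> with \<open>P (z + n) = P z + n\<close>; it stands for the weight
  with entries \<open>- P i / n\<close>.  The pair \<open>(a, T)\<close> corresponds to \<open>P i = m ct\<^sub>T (g\<^sub>a i) - n a\<^sub>i\<close>.

  The algebra \<open>H\<^sub>c\<close> acts on functions of affine permutations: the simple reflections act by Young's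
  orthogonal form, and \<open>x\<^sub>1\<close>, \<open>y\<^sub>1\<close> act, up to a cycle, by shifting the argument of \<open>P\<close>.  The
  coefficients that lead out of the region \<open>J\<close> of the permutations satisfying the second set of
  inequalities of the theorem vanish, so the finitely supported functions on \<open>J\<close> form a module with
  simple spectrum; \<open>e0\<close>, the indicator of the highest weight \<open>P0\<close>, is an eigenvector of the Young
  symmetrizer and is killed by all \<open>y\<^sub>i\<close>.

  The standard module is cyclic, \<open>\<Delta> = H\<^sub>c / K\<close>, and \<open>K\<close> annihilates \<open>e0\<close>.  Any two weights in \<open>J\<close> are
  linked by intertwiners that are invertible on weight spaces of every quotient of \<open>H\<^sub>c\<close> by a left
  ideal, so all these weight spaces of \<open>\<Delta>\<close> are carried to that of \<open>P0\<close>.  The latter is one-dimensional: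
  the Euler element reduces it to degree 0, where \<open>a s b \<in> \<complex> a b\<close> for the Young symmetrizer \<open>a b\<close>.
  Hence a submodule containing an element that does not kill \<open>e0\<close> contains the generator, and the
  annihilator of \<open>e0\<close> gives the maximal submodule.  It contains the weight vectors with weight
  outside \<open>J\<close>, because these weights do not occur in the module of functions on \<open>J\<close>, and none with
  weight in \<open>J\<close>.  This does not require the PBW theorem.
\<close>

text \<open>Coprimality of m and n makes m times the contents a complete residue system modulo n;
  this turns weights into bijections of the integers and separates them. Swapping two neighbouring
  values that differ by d costs the factor 1 - (m/d)^2, which vanishes only for d = m and d = -m,
  that is, for consecutive contents up to a period. Inside the shape such a pair consists of
  adjacent boxes, already ordered by standardness. The only other pair joins the end of the arm to
  the end of the leg: m (n - l) = m (- l) + n m, so the arm end at position n a + i is compared with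
  the leg end at position n a' + i' + n m. Comparing the two numbers lexicographically gives the
  shift by m and the tie-break of the theorem. The label n may stand for the arm end because it sits
  at one of the two ends, and at the leg end it makes the comparison automatic. The shift by one
  position costs the factor \<open>P 0\<close> up to a constant, which vanishes when the corner box
  is about to leave the positive positions. This fixes the annihilator of \<open>e0\<close>; the
  remaining work is to show that every proper submodule lies in the one it defines.\<close>

unbundle no m_inv_syntax

section \<open>The symmetric group generated by adjacent transpositions\<close>

abbreviation adj :: "nat \<Rightarrow> nat \<Rightarrow> nat" where
  "adj i \<equiv> Transposition.transpose i (Suc i)"

lemma adj_permutes: "a \<le> i \<Longrightarrow> Suc i \<le> b \<Longrightarrow> adj i permutes {a..b}"
  by (rule permutes_swap_id) auto

text \<open>Composing on the left with the transposition at \<open>g (Suc b)\<close> raises that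
  value by one, so after \<open>d = Suc b - g (Suc b)\<close> steps \<open>Suc b\<close> is fixed
  and the induction on the upper bound takes over. The arbitrary lower bound lets the rule serve the
  row group, the leg group and the stabilizer of 1 as well.\<close>

lemma adjacent_induct [consumes 1, case_names id adj]:
  fixes P :: "(nat \<Rightarrow> nat) \<Rightarrow> bool"
  assumes "h permutes {a..b}" "P id"
    and "\<And>i g. a \<le> i \<Longrightarrow> Suc i \<le> b \<Longrightarrow> g permutes {a..b} \<Longrightarrow> P g \<Longrightarrow> P (adj i \<circ> g)"
  shows "P h"
  using assms
proof (induction b arbitrary: h)
  case 0
  have "h = id"
  proof (cases "a = 0")
    case True
    then show ?thesis using 0(1) by (simp add: permutes_sing)
  next
    case False
    then show ?thesis using 0(1) by simp
  qed
  then show ?case using 0 by simp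
next
  case (Suc b)
  note step = Suc.prems(3)
  show ?case
  proof (cases "a \<le> Suc b")
    case False
    then have "h = id" using Suc.prems(1) by simp
    then show ?thesis using Suc.prems by simp
  next
    case True
    have "P g" if "g permutes {a..Suc b}" "Suc b - g (Suc b) = d" for g d
      using that
    proof (induction d arbitrary: g)
      case 0
      have gb: "g (Suc b) \<in> {a..Suc b}"
        using 0(1) True permutes_in_image[of g "{a..Suc b}" "Suc b"] by simp
      then have "g (Suc b) = Suc b" using 0 by simp
      then have "g permutes {a..b}"
        by (intro permutes_superset[OF 0(1)]) (auto simp: le_Suc_eq)
      then show ?case
      proof (rule Suc.IH)
        show "P id" by (rule Suc.prems)
        fix i g assume "a \<le> i" "Suc i \<le> b" "g permutes {a..b}" "P g"
        moreover from this have "g permutes {a..Suc b}" by (auto intro: permutes_subset)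
        ultimately show "P (adj i \<circ> g)" using Suc.prems(3)[of i g] le_SucI by blast
      qed
    next
      case (Suc d)
      define j where "j = g (Suc b)"
      have j: "a \<le> j" "Suc j \<le> Suc b"
        using Suc(2,3) True permutes_in_image[of g "{a..Suc b}" "Suc b"] by (auto simp: j_def)
      have p: "adj j \<circ> g permutes {a..Suc b}"
        using Suc(2) j by (intro permutes_compose adj_permutes) auto
      have "P (adj j \<circ> g)"
        by (rule Suc.IH[OF p]) (use Suc(3) j in \<open>auto simp: j_def\<close>)
      with p have "P (adj j \<circ> (adj j \<circ> g))" using j step by blast
      then show ?case by (simp add: o_assoc)
    qed
    then show ?thesis using Suc.prems(1) by blast
  qed
qed

section \<open>Extending Coxeter generators to an action of the symmetric group\<close>

fun chain :: "(nat \<Rightarrow> 'f \<Rightarrow> 'f) \<Rightarrow> nat \<Rightarrow> nat \<Rightarrow> 'f \<Rightarrow> 'f" where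
  "chain T j 0 x = x"
| "chain T j (Suc d) x = T j (chain T (Suc j) d x)"

locale coxeter_action =
  fixes T :: "nat \<Rightarrow> 'f \<Rightarrow> 'f" and N :: nat
  assumes invol: "1 \<le> i \<Longrightarrow> i < N \<Longrightarrow> T i (T i x) = x"
    and braid: "1 \<le> i \<Longrightarrow> Suc i < N \<Longrightarrow> T i (T (Suc i) (T i x)) = T (Suc i) (T i (T (Suc i) x))"
    and comm: "1 \<le> i \<Longrightarrow> Suc i < j \<Longrightarrow> j < N \<Longrightarrow> T i (T j x) = T j (T i x)"
begin

lemma chain_low: "1 \<le> i \<Longrightarrow> Suc i < j \<Longrightarrow> j + d \<le> N \<Longrightarrow> T i (chain T j d x) = chain T j d (T i x)"
proof (induction d arbitrary: j)
  case (Suc d)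
  then show ?case using comm[of i j] by simp
qed simp

text \<open>After commuting past the earlier factors, one braid move at the factors i - 1 and i
  turns T_i into T_(i-1), which then passes the remaining factors.\<close>

lemma chain_high:
  "1 \<le> j \<Longrightarrow> j < i \<Longrightarrow> i < j + d \<Longrightarrow> j + d \<le> N \<Longrightarrow> T i (chain T j d x) = chain T j d (T (i - 1) x)"
proof (induction d arbitrary: j)
  case (Suc d)
  show ?case
  proof (cases "i = Suc j")
    case True
    with Suc obtain e where d: "d = Suc e" by (cases d) auto
    have "T (Suc j) (T j (T (Suc j) y)) = T j (T (Suc j) (T j y))" for y
      using braid[of j y] Suc by simp
    moreover have "T j (chain T (Suc (Suc j)) e x) = chain T (Suc (Suc j)) e (T j x)"
      using Suc d by (intro chain_low) auto
    ultimately show ?thesis by (simp add: True d)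
  next
    case False
    then have "T i (chain T (Suc j) d x) = chain T (Suc j) d (T (i - 1) x)"
      using Suc by (intro Suc.IH) auto
    moreover have "T i (T j y) = T j (T i y)" for y
      using Suc False by (intro comm[symmetric]) auto
    ultimately show ?thesis by simp
  qed
qed simp

end

lemma adj_braid: "adj i \<circ> (adj (Suc i) \<circ> (adj i \<circ> g)) = adj (Suc i) \<circ> (adj i \<circ> (adj (Suc i) \<circ> g))"
  by (auto simp: fun_eq_iff Transposition.transpose_def)

lemma adj_commute: "Suc i < j \<Longrightarrow> adj i \<circ> (adj j \<circ> g) = adj j \<circ> (adj i \<circ> g)"
  by (auto simp: fun_eq_iff Transposition.transpose_def)

text \<open>Left multiplication satisfies the same relations, so the lemmas on \<open>chain\<close>
  also rewrite permutations. Here \<open>chain\<close> started at \<open>id\<close> is the cycle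
  representing a coset of S_M in S_(M+1).\<close>

interpretation perm_action: coxeter_action "\<lambda>i g. adj i \<circ> g" N for N
  using adj_braid adj_commute by unfold_locales (simp_all only: o_assoc transpose_comp_involutory id_comp)

lemma chain_comp: "chain (\<lambda>i g. adj i \<circ> g) j d g = chain (\<lambda>i g. adj i \<circ> g) j d id \<circ> g"
  by (induction d arbitrary: j) (simp_all add: o_assoc[symmetric])

lemma chain_comp_apply: "chain (\<lambda>i g. adj i \<circ> g) j d g x = chain (\<lambda>i g. adj i \<circ> g) j d id (g x)"
  using fun_cong[OF chain_comp[of j d g], of x] by (simp only: o_apply)

lemma chain_permutes: "a \<le> j \<Longrightarrow> j + d \<le> b \<Longrightarrow> chain (\<lambda>i g. adj i \<circ> g) j d id permutes {a..b}"
proof (induction d arbitrary: j)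
  case (Suc d)
  have "chain (\<lambda>i g. adj i \<circ> g) (Suc j) d id permutes {a..b}" by (rule Suc.IH) (use Suc.prems in auto)
  then have "adj j \<circ> chain (\<lambda>i g. adj i \<circ> g) (Suc j) d id permutes {a..b}"
    by (rule permutes_compose) (use Suc.prems in \<open>auto intro!: adj_permutes\<close>)
  then show ?case by (simp only: chain.simps)
qed (simp add: permutes_id)

lemma chain_top: "chain (\<lambda>i g. adj i \<circ> g) j d id (j + d) = j"
proof (induction d arbitrary: j)
  case (Suc d)
  from Suc[of "Suc j"] show ?case by simp
qed simp

context coxeter_action
begin

text \<open>Demanding only compatibility with left multiplication by generators avoids any
  comparison of words. Each h in S_(M+1) is a coset representative, determined by j =
  \<open>h (Suc M)\<close>, times an element of S_M; this normal form defines the action, and the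
  relations are used only to multiply a normal form by one generator.\<close>

lemma rep_exists:
  "M \<le> N \<Longrightarrow> \<exists>\<rho> :: (nat \<Rightarrow> nat) \<Rightarrow> 'f \<Rightarrow> 'f. (\<forall>x. \<rho> id x = x) \<and>
     (\<forall>i g x. 1 \<le> i \<longrightarrow> i < M \<longrightarrow> g permutes {1..M} \<longrightarrow> \<rho> (adj i \<circ> g) x = T i (\<rho> g x))"
proof (induction M)
  case 0
  then show ?case by (intro exI[of _ "\<lambda>_ x. x"]) simp
next
  case (Suc M)
  let ?c = "chain (\<lambda>i g. adj i \<circ> g)"
  from Suc obtain \<rho>' :: "(nat \<Rightarrow> nat) \<Rightarrow> 'f \<Rightarrow> 'f" where r0: "\<And>x. \<rho>' id x = x"
    and r1: "\<And>i g x. 1 \<le> i \<Longrightarrow> i < M \<Longrightarrow> g permutes {1..M} \<Longrightarrow> \<rho>' (adj i \<circ> g) x = T i (\<rho>' g x)"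
    using Suc_leD by blast
  define \<rho> where "\<rho> h x = (let j = h (Suc M); d = Suc M - j in
     chain T j d (\<rho>' (inv (?c j d id) \<circ> h) x))" for h :: "nat \<Rightarrow> nat" and x
  have perm: "?c j d g permutes {1..Suc M}" if "g permutes {1..M}" "1 \<le> j" "j + d = Suc M" for g j d
    unfolding chain_comp[of j d g]
    by (rule permutes_compose[OF permutes_subset[OF that(1)] chain_permutes]) (use that in auto)
  have key: "\<rho> (?c j d g) x = chain T j d (\<rho>' g x)"
    if "g permutes {1..M}" "1 \<le> j" "j + d = Suc M" for g j d x
  proof -
    have "g (Suc M) = Suc M" using that(1) by (auto simp: permutes_def)
    then have top: "?c j d g (Suc M) = j"
      using chain_comp_apply[of j d g "Suc M"] chain_top[of j d] that by (simp only:)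
    have "bij (?c j d id)" using chain_permutes[of 1 j d "Suc M"] that permutes_bij by auto
    then have "inv (?c j d id) (?c j d g y) = g y" for y
      using inv_f_f[OF bij_is_inj, of "?c j d id" "g y"] by (simp only: chain_comp_apply[of j d g y])
    then have "inv (?c j d id) \<circ> ?c j d g = g"
      by (intro ext) (simp only: o_apply)
    moreover have "Suc M - j = d" using that by simp
    ultimately show ?thesis unfolding \<rho>_def top Let_def by simp
  qed
  have form: "\<exists>j d g. g permutes {1..M} \<and> 1 \<le> j \<and> j + d = Suc M \<and> h = ?c j d g"
    if h: "h permutes {1..Suc M}" for h
  proof -
    define j where "j = h (Suc M)"
    define d where "d = Suc M - j"
    have j: "1 \<le> j" "j + d = Suc M"
      using permutes_in_image[OF h, of "Suc M"] by (auto simp: j_def d_def)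
    have cp: "?c j d id permutes {1..Suc M}" using j by (intro chain_permutes) auto
    define g where "g = inv (?c j d id) \<circ> h"
    have "g permutes {1..Suc M}"
      unfolding g_def by (intro permutes_compose h permutes_inv cp)
    moreover have "g (Suc M) = Suc M"
    proof -
      have "g (Suc M) = inv (?c j d id) j"
        using o_apply[of "inv (?c j d id)" h "Suc M", folded g_def j_def] .
      also have "\<dots> = j + d"
        using permutes_inverses(2)[OF cp, of "j + d", unfolded chain_top[of j d]] .
      also have "\<dots> = Suc M" by (rule j)
      finally show ?thesis .
    qed
    ultimately have "g permutes {1..M}"
      using permutes_superset[of g "{1..Suc M}" "{1..M}"] by (auto simp: le_Suc_eq)
    moreover have "h = ?c j d g"
      unfolding chain_comp[of j d g] unfolding g_def o_assoc permutes_inv_o(1)[OF cp] id_comp ..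
    ultimately show ?thesis using j by blast
  qed
  have "\<rho> (adj i \<circ> h) x = T i (\<rho> h x)" if i: "1 \<le> i" "i < Suc M" and h: "h permutes {1..Suc M}" for i h x
  proof -
    obtain j d g where g: "g permutes {1..M}" and j: "1 \<le> j" "j + d = Suc M" and hc: "h = ?c j d g"
      using form[OF h] by blast
    \<comment> \<open>In turn: the generator passes the representative unchanged, lengthens it,
      shortens it, or passes it with its index lowered by one.\<close>
    consider "Suc i < j" | "Suc i = j" | "i = j" | "j < i" by linarith
    then show ?thesis
    proof cases
      case 1
      have ih: "adj i \<circ> h = ?c j d (adj i \<circ> g)"
        unfolding hc by (rule perm_action.chain_low[where N = "j + d"]) (use 1 i in auto)
      have g': "adj i \<circ> g permutes {1..M}"
        using g 1 i j by (intro permutes_compose adj_permutes) auto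
      have "T i (chain T j d (\<rho>' g x)) = chain T j d (T i (\<rho>' g x))"
        using 1 i j Suc.prems by (intro chain_low) auto
      moreover have "\<rho>' (adj i \<circ> g) x = T i (\<rho>' g x)" using 1 i j g by (intro r1) auto
      ultimately show ?thesis unfolding ih unfolding key[OF g' j] unfolding hc unfolding key[OF g j] by (simp only:)
    next
      case 2
      have ih: "adj i \<circ> h = ?c i (Suc d) g" unfolding hc 2[symmetric] chain.simps ..
      have "i + Suc d = Suc M" using 2 j by simp
      show ?thesis
        unfolding ih unfolding key[OF g i(1) \<open>i + Suc d = Suc M\<close>] unfolding hc unfolding key[OF g j] unfolding 2[symmetric] chain.simps by (rule refl)
    next
      case 3
      with i j obtain e where d: "d = Suc e" by (cases d) auto
      have ih: "adj i \<circ> h = ?c (Suc j) e g"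
        unfolding hc d 3 chain.simps o_assoc transpose_comp_involutory id_comp ..
      have j': "1 \<le> Suc j" "Suc j + e = Suc M" using d j by auto
      have "j < N" using 3 i Suc.prems by simp
      show ?thesis
        unfolding ih unfolding key[OF g j'] unfolding hc unfolding key[OF g j] unfolding d 3 chain.simps invol[OF j(1) \<open>j < N\<close>] ..
    next
      case 4
      have ih: "adj i \<circ> h = ?c j d (adj (i - 1) \<circ> g)"
        unfolding hc by (rule perm_action.chain_high[where N = "j + d"]) (use 4 i j in auto)
      have g': "adj (i - 1) \<circ> g permutes {1..M}"
        using g 4 i j by (intro permutes_compose adj_permutes) auto
      have "T i (chain T j d (\<rho>' g x)) = chain T j d (T (i - 1) (\<rho>' g x))"
        using 4 i j Suc.prems by (intro chain_high) auto
      moreover have "\<rho>' (adj (i - 1) \<circ> g) x = T (i - 1) (\<rho>' g x)" using 4 i j g by (intro r1) auto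
      ultimately show ?thesis unfolding ih unfolding key[OF g' j] unfolding hc unfolding key[OF g j] by (simp only:)
    qed
  qed
  moreover have "\<rho> id x = x" for x
  proof -
    have "\<rho> (?c (Suc M) 0 id) x = chain T (Suc M) 0 (\<rho>' id x)"
      by (rule key) (auto simp: permutes_id)
    then show ?thesis by (simp only: chain.simps r0)
  qed
  ultimately show ?case by blast
qed

definition \<rho> :: "(nat \<Rightarrow> nat) \<Rightarrow> 'f \<Rightarrow> 'f" where
  "\<rho> = (SOME \<rho>. (\<forall>x. \<rho> id x = x) \<and>
     (\<forall>i g x. 1 \<le> i \<longrightarrow> i < N \<longrightarrow> g permutes {1..N} \<longrightarrow> \<rho> (adj i \<circ> g) x = T i (\<rho> g x)))"

lemma rho_id [simp]: "\<rho> id x = x"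
  and rho_adj_comp: "1 \<le> i \<Longrightarrow> i < N \<Longrightarrow> g permutes {1..N} \<Longrightarrow> \<rho> (adj i \<circ> g) x = T i (\<rho> g x)"
  using someI_ex[OF rep_exists[OF order_refl], folded \<rho>_def] by auto

lemma rho_adj: "1 \<le> i \<Longrightarrow> i < N \<Longrightarrow> \<rho> (adj i) x = T i x"
  using rho_adj_comp[of i id x] by (simp add: permutes_id)

lemma rho_comp:
  "g permutes {1..N} \<Longrightarrow> h permutes {1..N} \<Longrightarrow> \<rho> (g \<circ> h) x = \<rho> g (\<rho> h x)"
proof (induction g rule: adjacent_induct)
  case (adj i g)
  have "\<rho> (adj i \<circ> (g \<circ> h)) x = T i (\<rho> (g \<circ> h) x)"
    using adj by (intro rho_adj_comp permutes_compose) auto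
  moreover have "\<rho> (adj i \<circ> g) (\<rho> h x) = T i (\<rho> g (\<rho> h x))"
    using adj by (intro rho_adj_comp) auto
  moreover have "\<rho> (g \<circ> h) x = \<rho> g (\<rho> h x)" using adj by blast
  ultimately show ?case by (simp only: o_assoc)
qed simp

end

section \<open>Operators on functions of affine permutations\<close>

definition tau :: "nat \<Rightarrow> int \<Rightarrow> int \<Rightarrow> int" where
  "tau n i z = (if int n dvd z - i then z + 1 else if int n dvd z - i - 1 then z - 1 else z)"

text \<open>The sum over a period is not normalised: the translation z -> z + 1 belongs to this
  group, and it is what models x_1 and y_1.\<close>

definition aff :: "nat \<Rightarrow> (int \<Rightarrow> int) \<Rightarrow> bool" where
  "aff n P \<longleftrightarrow> (\<forall>z. P (z + int n) = P z + int n) \<and> bij P"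

lemma not_dvd_both:
  assumes "2 \<le> n" "int n dvd a" "int n dvd b" "a = b + 1 \<or> b = a + 1"
  shows False
proof -
  have "int n dvd a - b" using assms by simp
  then have "int n dvd 1" using assms(4) by auto
  then show False using assms(1) by simp
qed

lemma tau_shift: "tau n (i + 1) (z + 1) = tau n i z + 1"
  by (simp add: tau_def)

lemma tau_shift': "tau n (i + 1) z = tau n i (z - 1) + 1"
  using tau_shift[of n i "z - 1"] by simp

lemma tau_periodic: "tau n i (z + int n) = tau n i z + int n"
proof -
  have "int n dvd z + int n - i \<longleftrightarrow> int n dvd z - i"
    "int n dvd z + int n - i - 1 \<longleftrightarrow> int n dvd z - i - 1"
    using dvd_add_left_iff[of "int n" "int n" "z - i"] dvd_add_left_iff[of "int n" "int n" "z - i - 1"]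
    by (simp_all add: algebra_simps)
  then show ?thesis by (simp add: tau_def)
qed

lemma tau_index_periodic: "tau n (i + int n) z = tau n i z"
proof -
  have "int n dvd z - (i + int n) \<longleftrightarrow> int n dvd z - i"
    "int n dvd z - (i + int n) - 1 \<longleftrightarrow> int n dvd z - i - 1"
    using dvd_diff_right_iff[of "int n" "z - i"] dvd_add_left_iff[of "int n" "int n" "z - i - int n"]
      dvd_add_left_iff[of "int n" "int n" "z - i - 1 - int n"]
    by (simp_all add: algebra_simps)
  then show ?thesis by (simp add: tau_def)
qed

lemma tau_cases:
  obtains "int n dvd z - i" "tau n i z = z + 1"
  | "\<not> int n dvd z - i" "int n dvd z - i - 1" "tau n i z = z - 1"
  | "\<not> int n dvd z - i" "\<not> int n dvd z - i - 1" "tau n i z = z"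
  by (auto simp: tau_def)

lemma tau_invol:
  assumes "2 \<le> n" shows "tau n i (tau n i z) = z"
proof (cases n i z rule: tau_cases)
  case 1
  then have "\<not> int n dvd z + 1 - i"
    using not_dvd_both[OF assms, of "z - i" "z + 1 - i"] by auto
  then show ?thesis using 1 by (simp add: tau_def)
next
  case 2
  then have "int n dvd (z - 1) - i" by (simp add: algebra_simps)
  then show ?thesis using 2 by (simp add: tau_def)
qed (simp_all add: tau_def)

lemma tau_same [simp]: "tau n i i = i + 1"
  by (simp add: tau_def)

lemma tau_next: "2 \<le> n \<Longrightarrow> tau n i (i + 1) = i"
  using tau_invol[of n i i] by simp

lemma tau_other: "\<not> int n dvd z - i \<Longrightarrow> \<not> int n dvd z - i - 1 \<Longrightarrow> tau n i z = z"
  by (simp add: tau_def)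

lemma tau_mult_periodic: "tau n i (z + k * int n) = tau n i z + k * int n"
proof -
  have "int n dvd z + k * int n - i \<longleftrightarrow> int n dvd z - i"
    "int n dvd z + k * int n - i - 1 \<longleftrightarrow> int n dvd z - i - 1"
    using dvd_add_times_triv_right_iff[of "int n" "z - i" k]
      dvd_add_times_triv_right_iff[of "int n" "z - i - 1" k]
    by (simp_all add: algebra_simps)
  then show ?thesis by (simp add: tau_def)
qed

lemma dvd_diffE:
  assumes "int n dvd z - i" obtains k where "z = i + k * int n"
  using assms by (metis dvd_def add.commute diff_add_cancel mult.commute)

lemma tau_comm:
  assumes n: "2 \<le> n" and d: "\<not> int n dvd i - j" "\<not> int n dvd i - j - 1" "\<not> int n dvd i - j + 1"
  shows "tau n i (tau n j z) = tau n j (tau n i z)"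
proof -
  have sym: "int n dvd a \<longleftrightarrow> int n dvd - a" for a by simp
  have d': "\<not> int n dvd j - i" "\<not> int n dvd j - i - 1" "\<not> int n dvd j - i + 1"
    using d sym[of "i - j"] sym[of "i - j + 1"] sym[of "i - j - 1"] by (auto simp: algebra_simps)
  have f: "tau n j i = i" "tau n j (i + 1) = i + 1" "tau n i j = j" "tau n i (j + 1) = j + 1"
    by (rule tau_other; use d d' in \<open>simp add: algebra_simps\<close>)+
  consider "int n dvd z - i" | "int n dvd z - (i + 1)" | "int n dvd z - j" | "int n dvd z - (j + 1)"
    | "\<not> int n dvd z - i" "\<not> int n dvd z - i - 1" "\<not> int n dvd z - j" "\<not> int n dvd z - j - 1"
    by (auto simp: algebra_simps)
  then show ?thesis
  proof cases
    case 5
    then show ?thesis by (simp add: tau_other)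
  qed (erule dvd_diffE, simp add: tau_mult_periodic f tau_next[OF n])+
qed

lemma tau_braid:
  assumes n: "3 \<le> n"
  shows "tau n i (tau n (i + 1) (tau n i z)) = tau n (i + 1) (tau n i (tau n (i + 1) z))"
proof -
  have nd: "\<not> int n dvd 1" "\<not> int n dvd 2" "\<not> int n dvd -1" "\<not> int n dvd -2"
    using n by (auto dest: zdvd_imp_le)
  have f: "tau n i (i + 2) = i + 2" "tau n (i + 1) i = i"
    by (rule tau_other; use nd in simp)+
  have g: "tau n i (i + 1) = i" "tau n (i + 1) (i + 1) = i + 2" "tau n (i + 1) (i + 2) = i + 1"
    using tau_next[of n i] tau_next[of n "i + 1"] n by (simp_all add: add.assoc)
  note fg = f g f[unfolded add.commute[of i]] g[unfolded add.commute[of i 2]]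
  consider "int n dvd z - i" | "int n dvd z - (i + 1)" | "int n dvd z - (i + 2)"
    | "\<not> int n dvd z - i" "\<not> int n dvd z - i - 1" "\<not> int n dvd z - (i + 2)"
    by (auto simp: algebra_simps)
  then show ?thesis
  proof cases
    case 4
    then show ?thesis by (simp add: tau_def algebra_simps)
  qed (erule dvd_diffE, simp add: tau_mult_periodic fg)+
qed

lemma aff_per: "aff n P \<Longrightarrow> P (z + int n) = P z + int n"
  by (simp add: aff_def)

lemma aff_per': "aff n P \<Longrightarrow> P (z - int n) = P z - int n"
  using aff_per[of n P "z - int n"] by simp

lemma aff_eq: "aff n P \<Longrightarrow> P y = P z \<longleftrightarrow> y = z"
  by (auto simp: aff_def bij_def inj_def)

lemma aff_tau [simp]:
  assumes "2 \<le> n" shows "aff n (\<lambda>z. P (tau n i z)) \<longleftrightarrow> aff n P"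
proof -
  have b: "bij (tau n i)" using tau_invol[OF assms] by (intro involuntory_imp_bij) auto
  have "aff n (\<lambda>z. P (tau n i z))" if "aff n P" for P
  proof -
    have "bij (P \<circ> tau n i)" using that b by (intro bij_comp) (auto simp: aff_def)
    then show ?thesis using that by (simp add: aff_def tau_periodic o_def)
  qed
  from this[of P] this[of "\<lambda>z. P (tau n i z)"] show ?thesis by (auto simp: tau_invol[OF assms])
qed

lemma aff_tauI: "2 \<le> n \<Longrightarrow> aff n P \<Longrightarrow> aff n (\<lambda>z. P (tau n i z))"
  by simp

lemma aff_shift [simp]: "aff n (\<lambda>z. P (z + a)) \<longleftrightarrow> aff n P"
proof -
  have "aff n (\<lambda>z. P (z + a))" if "aff n P" for P a
  proof -
    have "bij (P \<circ> (\<lambda>z. z + a))" using that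
      by (intro bij_comp) (auto simp: aff_def intro!: bij_betw_byWitness[where f' = "\<lambda>z. z - a"])
    then show ?thesis using that aff_per[OF that] by (simp add: aff_def o_def add.assoc add.left_commute)
      (metis add.assoc add.commute)
  qed
  from this[of P a] this[of "\<lambda>z. P (z + a)" "-a"] show ?thesis by auto
qed

lemma aff_shift_diff [simp]: "aff n (\<lambda>z. P (z - a)) \<longleftrightarrow> aff n P"
  using aff_shift[of n P "-a"] by simp

section \<open>Young's orthogonal form on functions of affine permutations\<close>

text \<open>F1 to F6 stand for the values of f on the orbit of P under two neighbouring reflections;
  a, b, c are m divided by the differences q - p, r - q, r - p of the three values involved, and x,
  y, z the off-diagonal entries. The first hypothesis is the additivity of these differences; z
  enters both sides alike.\<close>

lemma braid_identity:
  fixes a b c x y z :: complex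
  assumes "a * b = c * (a + b)" "x * x = 1 - a * a" "y * y = 1 - b * b"
  shows "a * (b * (a * F1 + x * F2) + y * (c * F3 + z * F4)) + x * (c * (- a * F2 + x * F1) + z * (b * F5 + y * F6))
    = b * (a * (b * F1 + y * F3) + x * (c * F2 + z * F5)) + y * (c * (- b * F3 + y * F1) + z * (a * F4 + x * F6))"
proof -
  have "a * (b * (a * F1 + x * F2) + y * (c * F3 + z * F4)) + x * (c * (- a * F2 + x * F1) + z * (b * F5 + y * F6))
      - (b * (a * (b * F1 + y * F3) + x * (c * F2 + z * F5)) + y * (c * (- b * F3 + y * F1) + z * (a * F4 + x * F6)))
    = F1 * (a * a * b + (x * x) * c - a * b * b - (y * y) * c)
      + x * F2 * (a * b - c * (a + b)) - y * F3 * (a * b - c * (a + b))"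
    by (simp add: algebra_simps)
  also have "a * a * b + (x * x) * c - a * b * b - (y * y) * c = (a - b) * (a * b - c * (a + b))"
    unfolding assms(2,3) by (simp add: algebra_simps)
  finally show ?thesis using assms(1) by simp
qed

text \<open>Only the square of d enters, so the function is even; this makes the two off-diagonal
  entries of each block equal.\<close>

definition csq :: "nat \<Rightarrow> int \<Rightarrow> complex" where
  "csq m d = csqrt (1 - (of_nat m / of_int d) * (of_nat m / of_int d))"

lemma csq_minus [simp]: "csq m (- d) = csq m d"
  by (simp add: csq_def)

lemma csq_minus' : "csq m (a - b) = csq m (b - a)"
  using csq_minus[of m "b - a"] by simp

lemma csq_sq: "csq m d * csq m d = 1 - (of_nat m / of_int d) * (of_nat m / of_int d)"
  unfolding csq_def by (metis power2_csqrt power2_eq_square)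

type_synonym affine_fun = "(int \<Rightarrow> int) \<Rightarrow> complex"

locale affine_model =
  fixes n m :: nat
  assumes n2: "2 \<le> n"
begin

text \<open>Young's orthogonal form, with \<open>d = P (i + 1) - P i\<close> divided by \<open>m\<close> as axial distance.  The
  coefficient of the second term vanishes for \<open>d = \<plusminus>m\<close>; it is complex because \<open>\<bar>d\<bar> < m\<close> occurs.\<close>

definition T :: "nat \<Rightarrow> affine_fun \<Rightarrow> affine_fun" where
  "T i f P = (if aff n P then of_nat m / of_int (P (int i + 1) - P (int i)) * f P
     + csq m (P (int i + 1) - P (int i)) * f (\<lambda>z. P (tau n (int i) z)) else f P)"

text \<open>\<open>Phi\<close> and \<open>Psi\<close> are the actions of \<open>x\<^sub>1\<close> times the cycle \<open>1 \<mapsto> 2 \<mapsto> \<dots> \<mapsto> n \<mapsto> 1\<close> and of the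
  inverse cycle times \<open>y\<^sub>1\<close>.\<close>

definition Phi :: "affine_fun \<Rightarrow> affine_fun" where
  "Phi f P = f (\<lambda>z. P (z + 1))"

definition Psi :: "affine_fun \<Rightarrow> affine_fun" where
  "Psi f P = - of_int (P 0) / of_nat n * f (\<lambda>z. P (z - 1))"

definition U :: "nat \<Rightarrow> affine_fun \<Rightarrow> affine_fun" where
  "U i f P = - of_int (P (int i)) / of_nat n * f P"

definition c :: complex where "c = of_nat m / of_nat n"

lemma small_dvd: "int n dvd a \<Longrightarrow> \<bar>a\<bar> < int n \<Longrightarrow> a = 0"
  using dvd_imp_le_int[of a "int n"] by fastforce

text \<open>Each block has diagonal entries m/d and - m/d and off-diagonal entries whose square is 1
  - (m/d)^2. Off the affine permutations \<open>T i\<close> is the identity by definition, so the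
  relation holds for all functions, as \<open>coxeter_action\<close> demands.\<close>

lemma T_invol: "T i (T i f) = f"
proof
  fix P :: "int \<Rightarrow> int"
  show "T i (T i f) P = f P"
  proof (cases "aff n P")
    case True
    define d where "d = P (int i + 1) - P (int i)"
    have d': "P (int i) - P (int i + 1) = - d" by (simp add: d_def)
    have "T i (T i f) P = (of_nat m / of_int d) * ((of_nat m / of_int d) * f P + csq m d * f (\<lambda>z. P (tau n (int i) z)))
       + csq m d * (of_nat m / of_int (- d) * f (\<lambda>z. P (tau n (int i) z)) + csq m (- d) * f P)"
      using True n2 by (simp add: T_def tau_next tau_invol flip: d_def d')
    also have "\<dots> = (of_nat m / of_int d) * (of_nat m / of_int d) * f P + (csq m d * csq m d) * f P"
      by (simp add: algebra_simps)
    also have "\<dots> = f P" unfolding csq_sq by (simp add: algebra_simps)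
    finally show ?thesis .
  qed (simp add: T_def)
qed

lemma T_comm:
  assumes "1 \<le> i" "Suc i < j" "j < n"
  shows "T i (T j f) = T j (T i f)"
proof
  fix P :: "int \<Rightarrow> int"
  show "T i (T j f) P = T j (T i f) P"
  proof (cases "aff n P")
    case True
    have nd: "\<not> int n dvd a" if "a \<noteq> 0" "\<bar>a\<bar> < int n" for a using small_dvd that by blast
    have comm: "tau n (int i) (tau n (int j) z) = tau n (int j) (tau n (int i) z)" for z
      by (rule tau_comm[OF n2]; rule nd) (use assms in auto)
    have fix1: "tau n (int i) (int j) = int j" "tau n (int i) (int j + 1) = int j + 1"
      "tau n (int j) (int i) = int i" "tau n (int j) (int i + 1) = int i + 1"
      by (rule tau_other; rule nd; use assms in auto)+
    have comm_id: "a * (b * F0 + y * F1) + x * (b * F2 + y * F3) = b * (a * F0 + x * F2) + y * (a * F1 + x * F3)"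
      for a b x y F0 F1 F2 F3 :: complex by (simp add: algebra_simps)
    show ?thesis
      by (simp only: T_def aff_tau[OF n2] True if_True fix1 comm comm_id)
  qed (simp add: T_def)
qed

lemma T_braid:
  assumes i: "1 \<le> i" "Suc i < n"
  shows "T i (T (Suc i) (T i f)) = T (Suc i) (T i (T (Suc i) f))"
proof
  fix P :: "int \<Rightarrow> int"
  show "T i (T (Suc i) (T i f)) P = T (Suc i) (T i (T (Suc i) f)) P"
  proof (cases "aff n P")
    case True
    define k where "k = int i"
    let ?t = "tau n k" and ?s = "tau n (k + 1)"
    have ix: "int i = k" "int (Suc i) = k + 1" "k + 1 + 1 = k + 2" by (simp_all add: k_def)
    have nd: "\<not> int n dvd a" if "a \<noteq> 0" "\<bar>a\<bar> < int n" for a using small_dvd that by blast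
    have n3: "3 \<le> n" using i by simp
    have fix1: "?t (k + 2) = k + 2" "?s k = k"
      by (rule tau_other; rule nd; use n3 in auto)+
    have ts: "?t (k + 1) = k" "?s (k + 1) = k + 2" "?s (k + 2) = k + 1"
      using tau_next[OF n2, of k] tau_next[OF n2, of "k + 1"] by (simp_all add: add.assoc)
    define p q r where "p = P k" and "q = P (k + 1)" and "r = P (k + 2)"
    have dist: "p \<noteq> q" "q \<noteq> r" "p \<noteq> r" by (simp_all add: p_def q_def r_def aff_eq[OF True])
    define a b e where "a = (of_nat m / of_int (q - p) :: complex)"
      and "b = (of_nat m / of_int (r - q) :: complex)" and "e = (of_nat m / of_int (r - p) :: complex)"
    have a': "of_nat m / of_int (p - q) = - a" "of_nat m / of_int (q - r) = - b"
      using dist by (simp_all add: a_def b_def field_simps)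
    define x y z where "x = csq m (q - p)" and "y = csq m (r - q)" and "z = csq m (r - p)"
    have x': "csq m (p - q) = x" "csq m (q - r) = y"
      by (simp_all add: x_def y_def csq_minus'[of m p] csq_minus'[of m q r])
    have nz: "(of_int (q - p) :: complex) \<noteq> 0" "(of_int (r - q) :: complex) \<noteq> 0" "(of_int (r - p) :: complex) \<noteq> 0"
      using dist by (simp_all only: of_int_eq_0_iff)
    \<comment> \<open>Partial fractions: 1/(X Y) = (1/X + 1/Y)/(X + Y) for X = q - p and Y = r - q,
      whose sum is r - p.\<close>
    have ab: "a * b = e * (a + b)"
    proof -
      have *: "M / X * (M / Y) = M / (X + Y) * (M / X + M / Y)"
        if "X \<noteq> 0" "Y \<noteq> 0" "X + Y \<noteq> 0" for M X Y :: complex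
      proof -
        have "M / X + M / Y = M * (X + Y) / (X * Y)"
          using that by (simp add: add_frac_eq algebra_simps)
        then show ?thesis using that by simp
      qed
      have "of_int (r - p) = (of_int (q - p) :: complex) + of_int (r - q)" by simp
      then show ?thesis using *[OF nz(1,2), of "of_nat m"] nz(3) unfolding a_def b_def e_def by metis
    qed
    have xx: "x * x = 1 - a * a" "y * y = 1 - b * b" by (simp_all add: x_def y_def a_def b_def csq_sq)
    have T1: "T i F Q = of_nat m / of_int (Q (k + 1) - Q k) * F Q + csq m (Q (k + 1) - Q k) * F (\<lambda>z. Q (?t z))"
      if "aff n Q" for F Q using that by (simp add: T_def k_def)
    have T2: "T (Suc i) F Q = of_nat m / of_int (Q (k + 2) - Q (k + 1)) * F Q
        + csq m (Q (k + 2) - Q (k + 1)) * F (\<lambda>z. Q (?s z))"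
      if "aff n Q" for F Q using that by (simp add: T_def k_def add.commute)
    have af: "aff n (\<lambda>z. P (?t z))" "aff n (\<lambda>z. P (?s z))" "aff n (\<lambda>z. P (?t (?s z)))"
      "aff n (\<lambda>z. P (?s (?t z)))"
      by (rule aff_tauI[OF n2 True] aff_tauI[OF n2 aff_tauI[OF n2 True], of k]
          aff_tauI[OF n2 aff_tauI[OF n2 True], of "k + 1"])+
    have t0: "?t k = k + 1" "?s (k + 1) = k + 2" by (simp_all add: tau_def)
    note ev = t0 fix1 ts tau_invol[OF n2] p_def[symmetric] q_def[symmetric] r_def[symmetric] a' x'
      a_def[symmetric] b_def[symmetric] e_def[symmetric] x_def[symmetric] y_def[symmetric] z_def[symmetric]
    note R = T1[OF True, unfolded ev ev] T1[OF af(1), unfolded ev ev] T1[OF af(2), unfolded ev ev] T1[OF af(3), unfolded ev ev]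
      T2[OF True, unfolded ev ev] T2[OF af(1), unfolded ev ev] T2[OF af(2), unfolded ev ev] T2[OF af(4), unfolded ev ev]
    have l: "T i (T (Suc i) (T i f)) P =
      a * (b * (a * f P + x * f (\<lambda>z. P (?t z))) + y * (e * f (\<lambda>z. P (?s z)) + z * f (\<lambda>z. P (?s (?t z)))))
       + x * (e * (- a * f (\<lambda>z. P (?t z)) + x * f P)
          + z * (b * f (\<lambda>z. P (?t (?s z))) + y * f (\<lambda>z. P (?t (?s (?t z))))))"
      by (simp only: R)
    have r: "T (Suc i) (T i (T (Suc i) f)) P =
      b * (a * (b * f P + y * f (\<lambda>z. P (?s z))) + x * (e * f (\<lambda>z. P (?t z)) + z * f (\<lambda>z. P (?t (?s z)))))
       + y * (e * (- b * f (\<lambda>z. P (?s z)) + y * f P)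
          + z * (a * f (\<lambda>z. P (?s (?t z))) + x * f (\<lambda>z. P (?s (?t (?s z))))))"
      by (simp only: R)
    have br: "(\<lambda>z. P (?t (?s (?t z)))) = (\<lambda>z. P (?s (?t (?s z))))"
      using tau_braid[OF n3, of k] by simp
    show ?thesis unfolding l r br by (rule braid_identity[OF ab xx])
  qed (simp add: T_def)
qed

sublocale coxeter_action T n
  using T_braid T_comm by unfold_locales (simp_all only: T_invol)

lemma T_at:
  "aff n Q \<Longrightarrow> T i f Q = of_nat m / of_int (Q (int i + 1) - Q (int i)) * f Q
     + csq m (Q (int i + 1) - Q (int i)) * f (\<lambda>z. Q (tau n (int i) z))"
  "\<not> aff n Q \<Longrightarrow> T i f Q = f Q"
  by (simp_all only: T_def if_True if_False)

lemma int_Suc: "int (Suc i) = int i + 1"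
  by simp

section \<open>Relations between the shifts and the reflections\<close>

lemma Phi_T: "Phi (T i f) = T (Suc i) (Phi f)"
proof
  fix P :: "int \<Rightarrow> int"
  show "Phi (T i f) P = T (Suc i) (Phi f) P"
  proof (cases "aff n P")
    case True
    have a: "aff n (\<lambda>z. P (z + 1))" using True aff_shift[of n P 1] by blast
    show ?thesis unfolding T_at(1)[OF True] Phi_def T_at(1)[OF a] int_Suc tau_shift ..
  next
    case False
    have "\<not> aff n (\<lambda>z. P (z + 1))" using False aff_shift[of n P 1] by blast
    then show ?thesis unfolding T_at(2)[OF False] Phi_def by (rule T_at(2))
  qed
qed

lemma Psi_T:
  assumes "1 \<le> i" "Suc i < n"
  shows "Psi (T (Suc i) f) = T i (Psi f)"
proof
  fix P :: "int \<Rightarrow> int"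
  have t: "tau n (int i) 0 = 0"
    by (rule tau_other) (use small_dvd[of "- int i"] small_dvd[of "- int i - 1"] assms in auto)
  have s: "tau n (int i) (z - 1) = tau n (int i + 1) z - 1" for z
    by (simp add: tau_shift')
  show "Psi (T (Suc i) f) P = T i (Psi f) P"
  proof (cases "aff n P")
    case True
    have a: "aff n (\<lambda>z. P (z - 1))" using True aff_shift_diff[of n P 1] by blast
    have "int i + 1 + 1 - 1 = int i + 1" "int i + 1 - 1 = int i" by simp_all
    then show ?thesis unfolding T_at(1)[OF True] Psi_def t s T_at(1)[OF a] int_Suc
      by (simp only: ring_distribs mult_ac)
  next
    case False
    have "\<not> aff n (\<lambda>z. P (z - 1))" using False aff_shift_diff[of n P 1] by blast
    note * = T_at(2)[OF this, of "Suc i" f]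
    show ?thesis unfolding T_at(2)[OF False] Psi_def * ..
  qed
qed

lemma last_index: "int (n - 1) = int n - 1"
  using n2 by simp

lemma tau_last: "tau n (int n - 1) z = tau n 0 (z + 1) - 1" "tau n (int n - 1) z = tau n 1 (z + 2) - 2"
proof -
  have "tau n (int n - 1 + 1) (z + 1) = tau n (int n - 1) z + 1"
    "tau n (int n - 1 + 1 + 1) (z + 1 + 1) = tau n (int n - 1) z + 1 + 1"
    by (simp_all only: tau_shift)
  then show "tau n (int n - 1) z = tau n 0 (z + 1) - 1" "tau n (int n - 1) z = tau n 1 (z + 2) - 2"
    using tau_index_periodic[of n 0] tau_index_periodic[of n 1] by (simp_all add: add.commute)
qed

text \<open>One shift takes the reflection n - 1 to the affine reflection 0, which lies outside the
  finite symmetric group; the second shift takes it on to 1. This is the relation behind the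
  commutation of x_1 and x_2.\<close>

lemma Phi_Phi_T: "Phi (Phi (T (n - 1) f)) = T 1 (Phi (Phi f))"
proof
  fix P :: "int \<Rightarrow> int"
  show "Phi (Phi (T (n - 1) f)) P = T 1 (Phi (Phi f)) P"
  proof (cases "aff n P")
    case True
    have "aff n (\<lambda>z. P (z + 1 + 1))" using aff_shift[of n P 2] True by (simp add: add.assoc)
    note * = T_at(1)[OF this, of "n - 1" f]
    have "P (int (n - 1) + 1 + 1 + 1) = P (2 + int n)" "P (int (n - 1) + 1 + 1) = P (1 + int n)"
      unfolding last_index by (simp_all add: add.commute)
    note e = this[unfolded aff_per[OF True]]
    have t: "tau n (int (n - 1)) z + 1 + 1 = tau n 1 (z + 1 + 1)" for z
      unfolding last_index tau_last(2) by (simp add: add.assoc)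
    have "T 1 (Phi (Phi f)) P = of_nat m / of_int (P 2 - P 1) * f (\<lambda>z. P (z + 1 + 1))
        + csq m (P 2 - P 1) * f (\<lambda>z. P (tau n 1 (z + 1 + 1)))"
      using T_at(1)[OF True, of 1] by (simp add: Phi_def)
    then show ?thesis unfolding Phi_def[of "Phi _"] Phi_def[of "T _ _"] * e t by simp
  next
    case False
    have "\<not> aff n (\<lambda>z. P (z + 1 + 1))" using False aff_shift[of n P 2] by (simp add: add.assoc)
    then show ?thesis unfolding T_at(2)[OF False] Phi_def by (rule T_at(2))
  qed
qed

text \<open>In addition to the wraparound, the scalars of the two steps must agree after positions
  -1 and 0 are swapped; they do because they enter as the product of \<open>P 0\<close> and
  \<open>P (-1)\<close>.\<close>

lemma Psi_Psi_T: "Psi (Psi (T 1 f)) = T (n - 1) (Psi (Psi f))"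
proof
  fix P :: "int \<Rightarrow> int"
  have Q: "Psi (Psi g) P = of_int (P 0) * of_int (P (-1)) / (of_nat n * of_nat n) * g (\<lambda>z. P (z - 1 - 1))"
    for g and P :: "int \<Rightarrow> int" by (simp add: Psi_def)
  have v: "tau n (int n - 1) 0 = -1" "tau n (int n - 1) (-1) = 0"
    using tau_next[OF n2, of 1] by (simp_all add: tau_last(2))
  show "Psi (Psi (T 1 f)) P = T (n - 1) (Psi (Psi f)) P"
  proof (cases "aff n P")
    case True
    have a: "aff n (\<lambda>z. P (z - 1 - 1))" using aff_shift_diff[of n P 2] True by simp
    have "P (int (n - 1) + 1) = P (0 + int n)" "P (int (n - 1)) = P (-1 + int n)"
      unfolding last_index by simp_all
    note e = this[unfolded aff_per[OF True]]
    have t: "tau n (int n - 1) (z - 1 - 1) = tau n 1 z - 1 - 1" for z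
      unfolding tau_last(2) by simp
    have l: "T 1 f (\<lambda>z. P (z - 1 - 1)) = of_nat m / of_int (P 0 - P (-1)) * f (\<lambda>z. P (z - 1 - 1))
        + csq m (P 0 - P (-1)) * f (\<lambda>z. P (tau n 1 z - 1 - 1))"
      using T_at(1)[OF a, of 1] by simp
    show ?thesis unfolding T_at(1)[OF True] e Q unfolding l last_index v t
      by (simp add: ring_distribs mult_ac)
  next
    case False
    have "\<not> aff n (\<lambda>z. P (z - 1 - 1))" using False aff_shift_diff[of n P 2] by simp
    note * = T_at(2)[OF this, of 1 f]
    show ?thesis unfolding T_at(2)[OF False] Q * ..
  qed
qed

text \<open>This explains the factor in \<open>Psi\<close>: the two cycles cancel, and x_1 y_1 = u_1
  has to act with eigenvalue - P 1 / n.\<close>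

lemma Phi_Psi: "Phi (Psi f) = U 1 f"
  by (simp add: Phi_def Psi_def U_def fun_eq_iff)

lemma Psi_Phi: "aff n P \<Longrightarrow> Psi (Phi f) P = U n f P + f P"
  using aff_per[of n P 0] n2 by (simp add: Phi_def Psi_def U_def field_simps)

text \<open>The relation between y_1 and x_2, stripped of the cycles. The off-diagonal terms agree;
  the diagonal ones differ by c because the factor of \<open>Psi\<close> is read at
  \<open>P 0\<close> on one side and at \<open>P 1\<close> on the other, and their difference
  cancels the denominator.\<close>

lemma Psi_T_Phi:
  assumes "aff n P"
  shows "Psi (T 1 (Phi f)) P = Phi (T (n - 1) (Psi f)) P + c * f P"
proof -
  have t1: "tau n 1 (z + 1 - 1) - 1 = tau n 1 z - 1" "tau n 1 (z + 1) - 1 = tau n 0 z" for z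
    using tau_shift'[of n 0 "z + 1"] by simp_all
  have t2: "tau n 0 1 = 0" using tau_next[OF n2, of 0] by simp
  have "P (int (n - 1) + 1 + 1) = P (1 + int n)" "P (int (n - 1) + 1) = P (0 + int n)"
    unfolding last_index by (simp_all add: add.commute)
  note e = this[unfolded aff_per[OF assms]]
  have nz: "(of_int (P 1 - P 0) :: complex) \<noteq> 0"
    using assms by (simp only: of_int_eq_0_iff) (simp add: aff_eq)
  let ?B = "csq m (P 1 - P 0) * f (\<lambda>z. P (tau n 0 z))"
  have a: "aff n (\<lambda>z. P (z - 1))" "aff n (\<lambda>z. P (z + 1))"
    using assms aff_shift[of n P] aff_shift_diff[of n P] by blast+
  have "T 1 (Phi f) (\<lambda>z. P (z - 1)) = of_nat m / of_int (P 1 - P 0) * f P + ?B"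
    using T_at(1)[OF a(1), of 1] by (simp add: Phi_def t1)
  then have 1: "Psi (T 1 (Phi f)) P = - of_int (P 0) / of_nat n * (of_nat m / of_int (P 1 - P 0) * f P + ?B)"
    by (simp only: Psi_def)
  have "T (n - 1) (Psi f) (\<lambda>z. P (z + 1))
      = of_nat m / of_int (P 1 - P 0) * (- of_int (P 1) / of_nat n * f P) - of_int (P 0) / of_nat n * ?B"
    unfolding T_at(1)[OF a(2)] e unfolding last_index tau_last(1) by (simp add: Psi_def t2)
  then have 2: "Phi (T (n - 1) (Psi f)) P
      = of_nat m / of_int (P 1 - P 0) * (- of_int (P 1) / of_nat n * f P) - of_int (P 0) / of_nat n * ?B"
    by (simp only: Phi_def)
  have 3: "- X / N * (M / (Y - X) * F) = M / (Y - X) * (- Y / N * F) + M / N * F"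
    if "Y - X \<noteq> 0" for X Y M N F :: complex
  proof -
    define q where "q = M / (Y - X)"
    have M: "M = q * (Y - X)" using that by (simp add: q_def)
    show ?thesis unfolding q_def[symmetric] unfolding M by (simp add: diff_divide_distrib algebra_simps)
  qed
  show ?thesis unfolding 1 2 c_def distrib_left using 3[of "of_int (P 1)" "of_int (P 0)"] nz by simp
qed

text \<open>The degenerate affine Hecke relation. The constant arises because the difference of two
  eigenvalues cancels the denominator of the diagonal entry of \<open>T i\<close>.\<close>

lemma T_U:
  assumes "aff n P"
  shows "T i (U i f) P = U (Suc i) (T i f) P + c * f P"
proof -
  have nz: "(of_int (P (int i + 1)) - of_int (P (int i)) :: complex) \<noteq> 0"
    using assms aff_eq[of n P "int i + 1" "int i"] by (simp flip: of_int_diff)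
  have 3: "- X / N * F * (M / (Y - X)) = - Y / N * (M / (Y - X) * F) + M / N * F"
    if "Y - X \<noteq> 0" for X Y M N F :: complex
  proof -
    define q where "q = M / (Y - X)"
    have M: "M = q * (Y - X)" using that by (simp add: q_def)
    show ?thesis unfolding q_def[symmetric] unfolding M by (simp add: diff_divide_distrib algebra_simps)
  qed
  have s: "int (Suc i) = int i + 1" by simp
  show ?thesis
    unfolding T_at(1)[OF assms] U_def[of "Suc i"] U_def[of i] s tau_next[OF n2] tau_same c_def
    using 3[OF nz, of "of_nat n" "f P" "of_nat m"]
    by (simp add: distrib_left mult_ac)
qed

end

section \<open>The action of the generators\<close>

declare One_nat_def [simp del]

lemma permutes_if_inverse:
  assumes "\<And>x. p (q x) = x" "\<And>x. q (p x) = x" "\<And>x. x \<notin> S \<Longrightarrow> p x = x"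
  shows "p permutes S"
  unfolding permutes_def using assms by metis

lemma permutes_shrink:
  assumes "h permutes {1..n}" "h 1 = 1"
  shows "h permutes {2..n::nat}"
proof (rule permutes_superset[OF assms(1)])
  fix x assume "x \<in> {1..n} - {2..n}"
  then have "x = 1" by auto
  then show "h x = x" using assms(2) by simp
qed

lemma permutes_grow: "h permutes {2..n::nat} \<Longrightarrow> h permutes {1..n}"
  by (erule permutes_subset) auto

lemma transpose_conj: "bij g \<Longrightarrow> g \<circ> Transposition.transpose a b = Transposition.transpose (g a) (g b) \<circ> g"
  by (auto simp: fun_eq_iff Transposition.transpose_def bij_def inj_eq)

text \<open>Periodicity and injectivity of P enter \<open>Psi_Phi\<close>, \<open>Psi_T_Phi\<close>
  and \<open>T_U\<close>, so the Cherednik relations are established on functions with this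
  support.\<close>

definition affsupp :: "nat \<Rightarrow> affine_fun \<Rightarrow> bool" where
  "affsupp n f \<longleftrightarrow> (\<forall>P. \<not> aff n P \<longrightarrow> f P = 0)"

context affine_model
begin

abbreviation perm :: "(nat \<Rightarrow> nat) \<Rightarrow> bool" where
  "perm g \<equiv> g permutes {1..n}"

lemma rho_ident [simp]: "\<rho> (\<lambda>a. a) x = x"
  using rho_id[of x] unfolding id_def .

lemma perm_transpose: "i \<in> {1..n} \<Longrightarrow> j \<in> {1..n} \<Longrightarrow> perm (Transposition.transpose i j)"
  by (rule permutes_swap_id)

lemma rho_rho: "perm g \<Longrightarrow> perm h \<Longrightarrow> \<rho> g (\<rho> h f) = \<rho> (g \<circ> h) f"
  by (simp add: rho_comp)

lemma rho_inv: "perm g \<Longrightarrow> \<rho> g (\<rho> (inv g) f) = f"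
  by (simp add: rho_rho permutes_inv permutes_inv_o)

lemma T_rho: "1 \<le> i \<Longrightarrow> i < n \<Longrightarrow> T i f = \<rho> (adj i) f"
  by (simp add: rho_adj)

lemma T_add: "T i (\<lambda>P. a P + b P) = (\<lambda>P. T i a P + T i b P)"
proof
  fix P show "T i (\<lambda>P. a P + b P) P = T i a P + T i b P"
    by (cases "aff n P") (simp_all add: T_at ring_distribs)
qed

lemma T_scale: "T i (\<lambda>P. z * a P) = (\<lambda>P. z * T i a P)"
proof
  fix P show "T i (\<lambda>P. z * a P) P = z * T i a P"
    by (cases "aff n P") (simp_all add: T_at ring_distribs mult_ac)
qed

lemma rho_add: "perm g \<Longrightarrow> \<rho> g (\<lambda>P. a P + b P) = (\<lambda>P. \<rho> g a P + \<rho> g b P)"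
proof (induction g rule: adjacent_induct)
  case (adj i g)
  then have i: "1 \<le> i" "i < n" by auto
  show ?case unfolding rho_adj_comp[OF i adj(3)] adj(4) T_add ..
qed simp

lemma rho_scale: "perm g \<Longrightarrow> \<rho> g (\<lambda>P. z * a P) = (\<lambda>P. z * \<rho> g a P)"
proof (induction g rule: adjacent_induct)
  case (adj i g)
  then have i: "1 \<le> i" "i < n" by auto
  show ?case unfolding rho_adj_comp[OF i adj(3)] adj(4) T_scale ..
qed simp

lemma rho_zero: "perm g \<Longrightarrow> \<rho> g (\<lambda>P. 0) = (\<lambda>P. 0)"
  using rho_scale[of g 0] by simp

lemma rho_sum: "finite S \<Longrightarrow> perm g \<Longrightarrow> \<rho> g (\<lambda>P. \<Sum>j\<in>S. b j P) = (\<lambda>P. \<Sum>j\<in>S. \<rho> g (b j) P)"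
  by (induction S rule: finite_induct) (simp_all add: rho_zero rho_add)

lemma rho_comb:
  assumes "finite S" "perm g"
  shows "\<rho> g (\<lambda>P. a P - z * (\<Sum>j\<in>S. b j P)) = (\<lambda>P. \<rho> g a P - z * (\<Sum>j\<in>S. \<rho> g (b j) P))"
  using rho_add[OF assms(2), of a "\<lambda>P. - z * (\<Sum>j\<in>S. b j P)"]
    rho_scale[OF assms(2), of "- z" "\<lambda>P. \<Sum>j\<in>S. b j P"] rho_sum[OF assms, of b] by simp

lemma affsupp_T: "affsupp n f \<Longrightarrow> affsupp n (T i f)"
  by (simp add: affsupp_def T_at)

lemma affsupp_rho: "perm g \<Longrightarrow> affsupp n f \<Longrightarrow> affsupp n (\<rho> g f)"
proof (induction g rule: adjacent_induct)
  case (adj i g)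
  then have i: "1 \<le> i" "i < n" by auto
  show ?case unfolding rho_adj_comp[OF i adj(3)] using adj by (intro affsupp_T) auto
qed simp

lemma affsupp_Phi: "affsupp n f \<Longrightarrow> affsupp n (Phi f)"
  by (simp add: affsupp_def Phi_def)

lemma affsupp_Psi: "affsupp n f \<Longrightarrow> affsupp n (Psi f)"
  by (simp add: affsupp_def Psi_def)

section \<open>The operators of the x_i and y_i\<close>

definition wc :: "nat \<Rightarrow> nat" where
  "wc z = (if z = n then 1 else if 1 \<le> z \<and> z < n then z + 1 else z)"

definition wi :: "nat \<Rightarrow> nat" where
  "wi z = (if z = 1 then n else if 2 \<le> z \<and> z \<le> n then z - 1 else z)"

lemma wc_wi [simp]: "wc (wi z) = z" "wi (wc z) = z"
  using n2 by (auto simp: wc_def wi_def)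

lemma perm_wc: "perm wc" and perm_wi: "perm wi"
  by (rule permutes_if_inverse[where q = wi] permutes_if_inverse[where q = wc];
      use n2 in \<open>auto simp: wc_def wi_def\<close>)+

lemma wc_o_wi: "wc \<circ> wi = id" "wi \<circ> wc = id"
  by (simp_all add: fun_eq_iff)

definition X1 :: "affine_fun \<Rightarrow> affine_fun" where "X1 f = Phi (\<rho> wi f)"
definition Y1 :: "affine_fun \<Rightarrow> affine_fun" where "Y1 f = \<rho> wc (Psi f)"

lemma wi_adj: "2 \<le> i \<Longrightarrow> Suc i \<le> n \<Longrightarrow> adj (i - 1) \<circ> wi = wi \<circ> adj i"
  using transpose_conj[OF permutes_bij[OF perm_wi], of i "Suc i"] by (simp add: wi_def)

lemma wc_adj: "2 \<le> i \<Longrightarrow> Suc i \<le> n \<Longrightarrow> adj i \<circ> wc = wc \<circ> adj (i - 1)"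
proof -
  assume i: "2 \<le> i" "Suc i \<le> n"
  then have "wc (i - 1) = i" "wc i = Suc i" "Suc (i - 1) = i" by (auto simp: wc_def)
  then show ?thesis
    using transpose_conj[OF permutes_bij[OF perm_wc], of "i - 1" i] by simp
qed

text \<open>The inverse cycle turns a permutation fixing 1 into one of the letters 1 to n - 1, and
  \<open>Phi_T\<close> shifts it back up; the wraparound reflection never occurs.\<close>

lemma X1_comm: "h permutes {2..n} \<Longrightarrow> \<rho> h (X1 f) = X1 (\<rho> h f)"
proof (induction h rule: adjacent_induct)
  case (adj i g)
  then have i: "1 \<le> i" "i < n" "1 \<le> i - 1" "i - 1 < n" "Suc (i - 1) = i" by auto
  have g: "perm g" by (rule permutes_grow) fact
  have p: "perm (adj i)" "perm (adj (i - 1))" by (rule adj_permutes; use i in simp)+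
  have "\<rho> (adj i \<circ> g) (X1 f) = T i (Phi (\<rho> wi (\<rho> g f)))"
    unfolding rho_adj_comp[OF i(1,2) g] adj(4) unfolding X1_def ..
  also have "\<dots> = Phi (T (i - 1) (\<rho> wi (\<rho> g f)))"
    using Phi_T[of "i - 1"] i(5) by simp
  also have "\<dots> = Phi (\<rho> (adj (i - 1) \<circ> wi) (\<rho> g f))"
    unfolding T_rho[OF i(3,4)] rho_rho[OF p(2) perm_wi] ..
  also have "\<dots> = X1 (\<rho> (adj i \<circ> g) f)"
    unfolding wi_adj[OF adj(1,2)] X1_def rho_comp[OF perm_wi p(1)] rho_comp[OF p(1) g] ..
  finally show ?case .
qed simp

lemma Y1_comm: "h permutes {2..n} \<Longrightarrow> \<rho> h (Y1 f) = Y1 (\<rho> h f)"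
proof (induction h rule: adjacent_induct)
  case (adj i g)
  then have i: "1 \<le> i" "i < n" "1 \<le> i - 1" "i - 1 < n" "Suc (i - 1) = i" "Suc (i - 1) < n" by auto
  have g: "perm g" by (rule permutes_grow) fact
  have p: "perm (adj i)" "perm (adj (i - 1))" by (rule adj_permutes; use i in simp)+
  have "\<rho> (adj i \<circ> g) (Y1 f) = \<rho> (adj i) (\<rho> wc (Psi (\<rho> g f)))"
    unfolding rho_comp[OF p(1) g] adj(4) unfolding Y1_def ..
  also have "\<dots> = \<rho> wc (\<rho> (adj (i - 1)) (Psi (\<rho> g f)))"
    unfolding rho_rho[OF p(1) perm_wc] wc_adj[OF adj(1,2)] rho_comp[OF perm_wc p(2)] ..
  also have "\<dots> = \<rho> wc (Psi (T i (\<rho> g f)))"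
    unfolding T_rho[OF i(3,4), symmetric] using Psi_T[OF i(3,6)] i(5) by simp
  also have "\<dots> = Y1 (\<rho> (adj i \<circ> g) f)"
    unfolding T_rho[OF i(1,2)] Y1_def rho_comp[OF p(1) g] ..
  finally show ?case .
qed simp

text \<open>Transpositions are only a convenient choice of conjugators: when Z commutes with the
  stabilizer of 1, every permutation taking 1 to i gives the same operator.\<close>

definition fam :: "(affine_fun \<Rightarrow> affine_fun) \<Rightarrow> nat \<Rightarrow> affine_fun \<Rightarrow> affine_fun" where
  "fam Z i f = \<rho> (Transposition.transpose 1 i) (Z (\<rho> (Transposition.transpose 1 i) f))"

lemma fam_equiv:
  assumes Z: "\<And>h f. h permutes {2..n} \<Longrightarrow> \<rho> h (Z f) = Z (\<rho> h f)"
    and g: "perm g" and i: "i \<in> {1..n}"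
  shows "\<rho> g (fam Z i f) = fam Z (g i) (\<rho> g f)"
proof -
  define t where "t = Transposition.transpose 1 i"
  define t' where "t' = Transposition.transpose 1 (g i)"
  have gi: "g i \<in> {1..n}" using permutes_in_image[OF g] i by simp
  have t: "perm t" "perm t'" unfolding t_def t'_def using i gi n2 by (auto intro!: perm_transpose)
  have tt: "t \<circ> t = id" "t' \<circ> t' = id" by (simp_all add: t_def t'_def)
  \<comment> \<open>This conjugate of g fixes 1, so it commutes with Z by assumption.\<close>
  define h where "h = t' \<circ> g \<circ> t"
  have hp: "perm h" unfolding h_def by (intro permutes_compose t g)
  have h1: "h permutes {2..n}"
    by (rule permutes_shrink[OF hp]) (simp add: h_def t_def t'_def)
  have th: "t' \<circ> h = g \<circ> t" unfolding h_def o_assoc tt by simp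
  have ht: "h \<circ> t = t' \<circ> g" unfolding h_def o_assoc[symmetric] tt by simp
  have "\<rho> g (fam Z i f) = \<rho> (t' \<circ> h) (Z (\<rho> t f))"
    unfolding fam_def t_def[symmetric] rho_rho[OF g t(1)] th ..
  also have "\<dots> = \<rho> t' (Z (\<rho> (h \<circ> t) f))"
    unfolding rho_comp[OF t(2) hp] Z[OF h1] rho_comp[OF hp t(1)] ..
  also have "\<dots> = fam Z (g i) (\<rho> g f)"
    unfolding ht rho_comp[OF t(2) g] unfolding fam_def t'_def ..
  finally show ?thesis .
qed

definition X :: "nat \<Rightarrow> affine_fun \<Rightarrow> affine_fun" where "X = fam X1"
definition Y :: "nat \<Rightarrow> affine_fun \<Rightarrow> affine_fun" where "Y = fam Y1"

lemma rho_X: "perm g \<Longrightarrow> i \<in> {1..n} \<Longrightarrow> \<rho> g (X i f) = X (g i) (\<rho> g f)"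
  unfolding X_def by (rule fam_equiv[OF X1_comm])

lemma rho_Y: "perm g \<Longrightarrow> i \<in> {1..n} \<Longrightarrow> \<rho> g (Y i f) = Y (g i) (\<rho> g f)"
  unfolding Y_def by (rule fam_equiv[OF Y1_comm])

lemma X_1: "X 1 f = X1 f" and Y_1: "Y 1 f = Y1 f"
  by (simp_all add: X_def Y_def fam_def del: One_nat_def)

abbreviation s1 :: "nat \<Rightarrow> nat" where "s1 \<equiv> Transposition.transpose 1 2"

lemma perm_s1: "perm s1" using n2 by (intro perm_transpose) auto

lemma s1_s1: "s1 \<circ> s1 = id" by simp

lemma X_2: "X 2 f = \<rho> s1 (X1 (\<rho> s1 f))" and Y_2: "Y 2 f = \<rho> s1 (Y1 (\<rho> s1 f))"
  by (simp_all add: X_def Y_def fam_def)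

lemma wi_s1: "wi \<circ> s1 permutes {2..n}" and s1_wc: "s1 \<circ> wc permutes {2..n}"
proof -
  show "wi \<circ> s1 permutes {2..n}"
    by (rule permutes_shrink[OF permutes_compose[OF perm_s1 perm_wi]]) (simp add: wi_def n2)
  show "s1 \<circ> wc permutes {2..n}"
    by (rule permutes_shrink[OF permutes_compose[OF perm_wc perm_s1]]) (use n2 in \<open>simp add: wc_def\<close>)
qed

definition sl :: "nat \<Rightarrow> nat" where "sl = adj (n - 1)"

lemma perm_sl: "perm sl" unfolding sl_def using n2 by (intro adj_permutes) auto

lemma sl_wi: "sl \<circ> (wi \<circ> (wi \<circ> s1)) = wi \<circ> wi"
proof
  fix z :: nat
  have w: "wi 1 = n" "wi 2 = 1" "wi n = n - 1" using n2 by (auto simp: wi_def)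
  consider "z = 1" | "z = 2" | "z \<noteq> 1" "z \<noteq> 2" by blast
  then show "(sl \<circ> (wi \<circ> (wi \<circ> s1))) z = (wi \<circ> wi) z"
  proof cases
    case 3
    have "wi z \<noteq> wi 1" "wi z \<noteq> wi 2" using 3 wc_wi(1)[of z] wc_wi(1)[of 1] wc_wi(1)[of 2] by metis+
    then have "wi (wi z) \<noteq> wi n" "wi (wi z) \<noteq> wi 1"
      using wc_wi(1)[of "wi z"] wc_wi(1)[of n] wc_wi(1)[of 1] unfolding w(1,2) by metis+
    then have "wi (wi z) \<noteq> n - 1" "wi (wi z) \<noteq> Suc (n - 1)" unfolding w using n2 by auto
    then show ?thesis using 3 by (simp add: sl_def)
  qed (use n2 in \<open>auto simp: w sl_def Transposition.transpose_def\<close>)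
qed

lemma wc_sl: "s1 \<circ> (wc \<circ> (wc \<circ> sl)) = wc \<circ> wc"
proof
  fix z :: nat
  have "sl z = wi (wi (s1 (wc (wc z))))"
    using fun_cong[OF sl_wi, of "s1 (wc (wc z))"] by simp
  then show "(s1 \<circ> (wc \<circ> (wc \<circ> sl))) z = (wc \<circ> wc) z" by simp
qed

lemma s1_Phi_Phi: "\<rho> s1 (Phi (Phi f)) = Phi (Phi (\<rho> sl f))"
proof -
  have "adj 1 = s1" by (simp add: numeral_2_eq_2)
  then have "T 1 g = \<rho> s1 g" "T (n - 1) g = \<rho> sl g" for g
    using T_rho[of 1 g] T_rho[of "n - 1" g] n2 by (simp_all add: sl_def)
  then show ?thesis using Phi_Phi_T[of f] by simp
qed

lemma Psi_Psi_s1: "Psi (Psi (\<rho> s1 f)) = \<rho> sl (Psi (Psi f))"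
proof -
  have "adj 1 = s1" by (simp add: numeral_2_eq_2)
  then have "T 1 g = \<rho> s1 g" "T (n - 1) g = \<rho> sl g" for g
    using T_rho[of 1 g] T_rho[of "n - 1" g] n2 by (simp_all add: sl_def)
  then show ?thesis using Psi_Psi_T[of f] by simp
qed

lemmas pc = permutes_compose[OF _ perm_wi] permutes_compose[OF _ perm_s1]
  permutes_compose[OF _ perm_wc] permutes_compose[OF _ perm_sl]

section \<open>Verification of the Cherednik relations\<close>

text \<open>Both orders reduce to \<open>Phi\<close> applied twice after the square of the inverse
  cycle; the second order needs the wraparound relation to get there.\<close>

lemma X12: "X 1 (X 2 f) = X 2 (X 1 f)"
proof -
  have ps: "perm (wi \<circ> s1)" "perm (wi \<circ> (wi \<circ> s1))" by (rule pc perm_s1)+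
  have "X 1 (X 2 f) = Phi (\<rho> (wi \<circ> s1) (X1 (\<rho> s1 f)))"
    unfolding X_1 X_2 unfolding X1_def[of "\<rho> s1 _"] rho_rho[OF perm_wi perm_s1] ..
  also have "\<dots> = Phi (X1 (\<rho> (wi \<circ> s1 \<circ> s1) f))"
    unfolding X1_comm[OF wi_s1] rho_rho[OF ps(1) perm_s1] ..
  also have "\<dots> = Phi (Phi (\<rho> (wi \<circ> wi) f))"
    unfolding o_assoc[symmetric] s1_s1 comp_id X1_def rho_rho[OF perm_wi perm_wi] ..
  finally have l: "X 1 (X 2 f) = Phi (Phi (\<rho> (wi \<circ> wi) f))" .
  have "X 2 (X 1 f) = \<rho> s1 (Phi (\<rho> (wi \<circ> s1) (X1 f)))"
    unfolding X_1 X_2 unfolding X1_def[of "\<rho> s1 _"] rho_rho[OF perm_wi perm_s1] ..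
  also have "\<dots> = \<rho> s1 (Phi (Phi (\<rho> (wi \<circ> (wi \<circ> s1)) f)))"
    unfolding X1_comm[OF wi_s1] unfolding X1_def rho_rho[OF perm_wi ps(1)] ..
  also have "\<dots> = Phi (Phi (\<rho> (wi \<circ> wi) f))"
    unfolding s1_Phi_Phi rho_rho[OF perm_sl ps(2)] sl_wi ..
  finally show ?thesis unfolding l ..
qed

lemma Y12: "Y 1 (Y 2 f) = Y 2 (Y 1 f)"
proof -
  have ps: "perm (s1 \<circ> wc)" "perm (wc \<circ> wc)" "perm (wc \<circ> sl)" "perm (wc \<circ> (wc \<circ> sl))"
    by (rule pc perm_s1 perm_sl perm_wc)+
  have "Y 1 (Y 2 f) = \<rho> (s1 \<circ> wc) (Y1 (Psi (\<rho> s1 f)))"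
    unfolding Y_1 Y_2 unfolding Y1_def[of "\<rho> s1 _"] rho_rho[OF perm_s1 perm_wc]
    using Y1_comm[OF s1_wc] by simp
  also have "\<dots> = \<rho> ((s1 \<circ> wc) \<circ> (wc \<circ> sl)) (Psi (Psi f))"
    unfolding Y1_def Psi_Psi_s1 rho_rho[OF perm_wc perm_sl] rho_rho[OF ps(1) ps(3)] ..
  also have "(s1 \<circ> wc) \<circ> (wc \<circ> sl) = wc \<circ> wc"
    unfolding o_assoc[symmetric] wc_sl ..
  finally have l: "Y 1 (Y 2 f) = \<rho> (wc \<circ> wc) (Psi (Psi f))" .
  have "Y 2 (Y 1 f) = \<rho> s1 (\<rho> (s1 \<circ> wc) (Y1 (Psi f)))"
    unfolding Y_1 Y_2 unfolding Y1_def[of f] rho_rho[OF perm_s1 perm_wc]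
    using Y1_comm[OF s1_wc] by simp
  also have "\<dots> = \<rho> (s1 \<circ> (s1 \<circ> wc)) (Y1 (Psi f))"
    unfolding rho_rho[OF perm_s1 ps(1)] ..
  also have "\<dots> = \<rho> (wc \<circ> wc) (Psi (Psi f))"
    unfolding o_assoc s1_s1 id_comp Y1_def rho_rho[OF perm_wc perm_wc] ..
  finally show ?thesis unfolding l ..
qed

text \<open>Two-transitivity: by equivariance, a relation between distinct indices need only be
  checked for 1 and 2.\<close>

lemma ex_perm2:
  assumes "i \<in> {1..n}" "j \<in> {1..n}" "i \<noteq> j"
  obtains g where "perm g" "g 1 = i" "g 2 = j"
proof -
  define k where "k = Transposition.transpose 1 i j"
  have k: "k \<noteq> 1" "k \<in> {1..n}" using assms n2
    by (auto simp: k_def Transposition.transpose_def)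
  have p: "perm (Transposition.transpose 1 i)" "perm (Transposition.transpose 2 k)"
    using assms n2 k(2) by (auto intro!: perm_transpose)
  show thesis
  proof (rule that)
    show "perm (Transposition.transpose 1 i \<circ> Transposition.transpose 2 k)"
      using p(2) p(1) by (rule permutes_compose)
    show "(Transposition.transpose 1 i \<circ> Transposition.transpose 2 k) 1 = i"
      using k(1) by simp
    show "(Transposition.transpose 1 i \<circ> Transposition.transpose 2 k) 2 = j"
      by (simp add: k_def)
  qed
qed

lemma one_two: "1 \<in> {1..n}" "2 \<in> {1..n}" "n \<in> {1..n}"
  using n2 by auto

lemma X_commute:
  assumes "i \<in> {1..n}" "j \<in> {1..n}"
  shows "X i (X j f) = X j (X i f)"
proof (cases "i = j")
  case False
  obtain g where g: "perm g" "g 1 = i" "g 2 = j" using ex_perm2[OF assms False] .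
  define h where "h = \<rho> (inv g) f"
  have f: "f = \<rho> g h" unfolding h_def rho_inv[OF g(1)] ..
  have *: "X i (\<rho> g h) = \<rho> g (X 1 h)" "X j (\<rho> g h) = \<rho> g (X 2 h)" for h
    unfolding rho_X[OF g(1) one_two(1)] rho_X[OF g(1) one_two(2)] g by (rule refl)+
  show ?thesis unfolding f * X12 ..
qed simp

lemma Y_commute:
  assumes "i \<in> {1..n}" "j \<in> {1..n}"
  shows "Y i (Y j f) = Y j (Y i f)"
proof (cases "i = j")
  case False
  obtain g where g: "perm g" "g 1 = i" "g 2 = j" using ex_perm2[OF assms False] .
  define h where "h = \<rho> (inv g) f"
  have f: "f = \<rho> g h" unfolding h_def rho_inv[OF g(1)] ..
  have *: "Y i (\<rho> g h) = \<rho> g (Y 1 h)" "Y j (\<rho> g h) = \<rho> g (Y 2 h)" for h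
    unfolding rho_Y[OF g(1) one_two(1)] rho_Y[OF g(1) one_two(2)] g by (rule refl)+
  show ?thesis unfolding f * Y12 ..
qed simp

lemma Psi_s1_Phi:
  assumes "affsupp n f"
  shows "Psi (\<rho> s1 (Phi f)) = (\<lambda>P. Phi (\<rho> sl (Psi f)) P + c * f P)"
proof
  fix P
  have "adj 1 = s1" by (simp add: numeral_2_eq_2)
  then have T: "T 1 g = \<rho> s1 g" "T (n - 1) g = \<rho> sl g" for g
    using T_rho[of 1 g] T_rho[of "n - 1" g] n2 by (simp_all add: sl_def)
  show "Psi (\<rho> s1 (Phi f)) P = Phi (\<rho> sl (Psi f)) P + c * f P"
  proof (cases "aff n P")
    case True
    from Psi_T_Phi[OF this] show ?thesis by (simp add: T)
  next
    case False
    have "affsupp n (Psi (\<rho> s1 (Phi f)))" "affsupp n (Phi (\<rho> sl (Psi f)))"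
      using assms by (intro affsupp_Psi affsupp_Phi affsupp_rho perm_s1 perm_sl; assumption)+
    then show ?thesis using assms False by (simp add: affsupp_def)
  qed
qed

lemma Y1X2:
  assumes "affsupp n f"
  shows "Y 1 (X 2 f) = (\<lambda>P. X 2 (Y 1 f) P + c * \<rho> s1 f P)"
proof -
  have ps: "perm (wi \<circ> s1)" "perm (s1 \<circ> wc)" "perm (wi \<circ> wi)" "perm (wi \<circ> (wi \<circ> s1))"
    by (rule pc perm_s1 perm_sl perm_wc perm_wi)+
  define a where "a = \<rho> (wi \<circ> s1) f"
  have "affsupp n a" unfolding a_def by (rule affsupp_rho[OF ps(1) assms])
  note P = Psi_s1_Phi[OF this]
  have "Y 1 (X 2 f) = \<rho> wc (Psi (\<rho> s1 (Phi a)))"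
    unfolding Y_1 X_2 Y1_def X1_def a_def rho_rho[OF perm_wi perm_s1] ..
  also have "\<dots> = (\<lambda>P. \<rho> wc (Phi (\<rho> sl (Psi a))) P + c * \<rho> wc a P)"
    unfolding P rho_add[OF perm_wc] rho_scale[OF perm_wc] ..
  also have "\<rho> wc a = \<rho> s1 f"
    unfolding a_def rho_rho[OF perm_wc ps(1)] o_assoc wc_o_wi id_comp ..
  also have "\<rho> wc (Phi (\<rho> sl (Psi a))) = X 2 (Y 1 f)"
  proof -
    have Psi_eq: "Psi g = \<rho> wi (Y1 g)" for g
      unfolding Y1_def rho_rho[OF perm_wi perm_wc] wc_o_wi by simp
    have "Psi a = \<rho> (wi \<circ> (wi \<circ> s1)) (\<rho> wc (Psi f))"
      unfolding Psi_eq[of a] unfolding a_def Y1_comm[OF wi_s1, symmetric] rho_rho[OF perm_wi ps(1)]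
      unfolding Y1_def ..
    then have "\<rho> sl (Psi a) = \<rho> (wi \<circ> wi) (\<rho> wc (Psi f))"
      by (simp only: rho_rho[OF perm_sl ps(4)] sl_wi)
    also have "\<dots> = \<rho> wi (Psi f)"
      unfolding rho_rho[OF ps(3) perm_wc] o_assoc[symmetric] wc_o_wi comp_id ..
    finally have "\<rho> wc (Phi (\<rho> sl (Psi a))) = \<rho> wc (X1 (Psi f))" unfolding X1_def by simp
    also have "\<dots> = \<rho> (s1 \<circ> (s1 \<circ> wc)) (X1 (Psi f))"
      unfolding o_assoc s1_s1 id_comp ..
    also have "\<dots> = \<rho> s1 (X1 (\<rho> (s1 \<circ> wc) (Psi f)))"
      unfolding rho_comp[OF perm_s1 ps(2)] X1_comm[OF s1_wc] ..
    also have "\<dots> = X 2 (Y 1 f)"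
      unfolding X_2 Y_1 Y1_def rho_comp[OF perm_s1 perm_wc] ..
    finally show ?thesis .
  qed
  finally show ?thesis .
qed

lemma Y_X_distinct:
  assumes f: "affsupp n f" and ij: "i \<in> {1..n}" "j \<in> {1..n}" "i \<noteq> j"
  shows "Y i (X j f) = (\<lambda>P. X j (Y i f) P + c * \<rho> (Transposition.transpose i j) f P)"
proof -
  obtain g where g: "perm g" "g 1 = i" "g 2 = j" using ex_perm2[OF ij] .
  define h where "h = \<rho> (inv g) f"
  have fh: "f = \<rho> g h" unfolding h_def rho_inv[OF g(1)] ..
  have h: "affsupp n h" unfolding h_def by (intro affsupp_rho permutes_inv g f)
  have *: "Y i (\<rho> g h) = \<rho> g (Y 1 h)" "X j (\<rho> g h) = \<rho> g (X 2 h)" for h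
    unfolding rho_Y[OF g(1) one_two(1)] rho_X[OF g(1) one_two(2)] g by (rule refl)+
  have t: "\<rho> (Transposition.transpose i j) (\<rho> g h) = \<rho> g (\<rho> s1 h)"
    unfolding rho_rho[OF g(1) perm_s1] rho_rho[OF perm_transpose[OF ij(1,2)] g(1)]
    using transpose_conj[OF permutes_bij[OF g(1)], of 1 2] by (simp only: g)
  show ?thesis unfolding fh * t Y1X2[OF h] rho_add[OF g(1)] rho_scale[OF g(1)] ..
qed

text \<open>At i = 1 the cycles cancel. The Hecke relation gives U_(i+1) = s U_i s - c s, and x_i
  y_i minus c times the Jucys-Murphy sum obeys the same recursion.\<close>

lemma U_eq:
  "1 \<le> i \<Longrightarrow> i \<le> n \<Longrightarrow> affsupp n f \<Longrightarrow>
    U i f = (\<lambda>P. X i (Y i f) P - c * (\<Sum>j\<in>{1..<i}. \<rho> (Transposition.transpose i j) f P))"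
proof (induction i arbitrary: f rule: dec_induct)
  case base
  have "Phi (\<rho> wi (\<rho> wc (Psi f))) = Phi (Psi f)"
    unfolding rho_rho[OF perm_wi perm_wc] wc_o_wi by simp
  then show ?case unfolding X_1 Y_1 X1_def Y1_def Phi_Psi by simp
next
  case (step i)
  then have i: "1 \<le> i" "i < n" "i \<in> {1..n}" by auto
  have p: "perm (adj i)" using i by (intro adj_permutes) auto
  let ?s = "adj i"
  have s: "affsupp n (\<rho> ?s f)" by (rule affsupp_rho[OF p step.prems(2)])
  have ss: "\<rho> ?s (\<rho> ?s f) = f" unfolding rho_rho[OF p p] by simp
  have 1: "U (Suc i) f P = \<rho> ?s (U i (\<rho> ?s f)) P - c * \<rho> ?s f P" for P
  proof (cases "aff n P")
    case True
    from T_U[OF this, of i "\<rho> ?s f"] show ?thesis by (simp add: T_rho[OF i(1,2)] ss)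
  next
    case False
    then have "U (Suc i) f P = 0" "\<rho> ?s f P = 0"
      using step.prems(2) s by (simp_all add: U_def affsupp_def)
    moreover have "affsupp n (U i (\<rho> ?s f))" using s by (simp add: affsupp_def U_def)
    then have "\<rho> ?s (U i (\<rho> ?s f)) P = 0" using affsupp_rho[OF p] False by (simp add: affsupp_def)
    ultimately show ?thesis by simp
  qed
  have 2: "U i (\<rho> ?s f)
      = (\<lambda>P. X i (Y i (\<rho> ?s f)) P - c * (\<Sum>j\<in>{1..<i}. \<rho> (Transposition.transpose i j) (\<rho> ?s f) P))"
    by (rule step.IH) (use s i in auto)
  have 3: "\<rho> ?s (X i (Y i (\<rho> ?s f))) = X (Suc i) (Y (Suc i) f)"
    unfolding rho_X[OF p i(3)] rho_Y[OF p i(3)] ss by simp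
  have t: "\<rho> ?s (\<rho> (Transposition.transpose i j) (\<rho> ?s f)) = \<rho> (Transposition.transpose (Suc i) j) f"
    if "j \<in> {1..<i}" for j
  proof -
    have t: "perm (Transposition.transpose i j)" "perm (Transposition.transpose i j \<circ> ?s)"
      using i that by (auto intro!: perm_transpose permutes_compose p)
    have "?s \<circ> (Transposition.transpose i j \<circ> ?s) = Transposition.transpose (Suc i) j"
      using that by (auto simp: fun_eq_iff Transposition.transpose_def)
    then show ?thesis unfolding rho_rho[OF t(1) p] rho_rho[OF p t(2)] by simp
  qed
  have 4: "(\<Sum>j\<in>{1..<i}. \<rho> ?s (\<rho> (Transposition.transpose i j) (\<rho> ?s f)) P) + \<rho> ?s f P
      = (\<Sum>j\<in>{1..<Suc i}. \<rho> (Transposition.transpose (Suc i) j) f P)" for P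
  proof -
    have "(\<Sum>j\<in>{1..<i}. \<rho> ?s (\<rho> (Transposition.transpose i j) (\<rho> ?s f)) P)
        = (\<Sum>j\<in>{1..<i}. \<rho> (Transposition.transpose (Suc i) j) f P)"
      by (rule sum.cong[OF refl]) (simp only: t)
    then show ?thesis using i by (simp add: transpose_commute)
  qed
  show ?case
  proof
    fix P
    have "U (Suc i) f P = X (Suc i) (Y (Suc i) f) P
        - c * ((\<Sum>j\<in>{1..<i}. \<rho> ?s (\<rho> (Transposition.transpose i j) (\<rho> ?s f)) P) + \<rho> ?s f P)"
      unfolding 1 2 rho_comb[OF finite_atLeastLessThan p] 3 by (simp only: distrib_left diff_diff_eq)
    then show "U (Suc i) f P = X (Suc i) (Y (Suc i) f) P
        - c * (\<Sum>j\<in>{1..<Suc i}. \<rho> (Transposition.transpose (Suc i) j) f P)"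
      unfolding 4 .
  qed
qed

text \<open>\<open>Psi_Phi\<close> evaluates y_1 x_1, up to the cycle, as U_n + 1. Formula
  \<open>U_eq\<close> at n supplies x_n y_n and all transpositions (n j), and conjugation by the
  cycle carries these to x_1 y_1 and the transpositions with 1.\<close>

lemma Y1X1:
  assumes f: "affsupp n f"
  shows "Y 1 (X 1 f) = (\<lambda>P. X 1 (Y 1 f) P + f P - c * (\<Sum>j\<in>{1..n}-{1}. \<rho> (Transposition.transpose 1 j) f P))"
proof
  fix P
  define a where "a = \<rho> wi f"
  have a: "affsupp n a" unfolding a_def by (rule affsupp_rho[OF perm_wi f])
  have wa: "\<rho> wc a = f" unfolding a_def rho_rho[OF perm_wc perm_wi] wc_o_wi by simp
  have PP: "Psi (Phi a) = (\<lambda>P. U n a P + a P)"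
  proof
    fix P show "Psi (Phi a) P = U n a P + a P"
    proof (cases "aff n P")
      case False
      have "affsupp n (Psi (Phi a))" by (intro affsupp_Psi affsupp_Phi a)
      with a False show ?thesis by (simp add: affsupp_def U_def)
    qed (rule Psi_Phi)
  qed
  have XY: "\<rho> wc (X n (Y n a)) = X 1 (Y 1 f)"
    unfolding rho_X[OF perm_wc one_two(3)] rho_Y[OF perm_wc one_two(3)] wa by (simp add: wc_def)
  have t: "\<rho> wc (\<rho> (Transposition.transpose n j) a) P = \<rho> (Transposition.transpose 1 (Suc j)) f P"
    if "j \<in> {1..<n}" for j P
  proof -
    have "wc \<circ> Transposition.transpose n j = Transposition.transpose 1 (Suc j) \<circ> wc"
      using transpose_conj[OF permutes_bij[OF perm_wc], of n j] that by (simp add: wc_def Suc_eq_plus1)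
    moreover have "perm (Transposition.transpose n j)" "perm (Transposition.transpose 1 (Suc j))"
      using that by (auto intro!: perm_transpose)
    ultimately show ?thesis
      by (simp only: rho_rho perm_wc) (simp only: rho_comp perm_wc wa)
  qed
  have ts: "(\<Sum>j\<in>{1..<n}. \<rho> wc (\<rho> (Transposition.transpose n j) a) P)
      = (\<Sum>j\<in>{1..<n}. \<rho> (Transposition.transpose 1 (Suc j)) f P)"
    by (rule sum.cong[OF refl t])
  have "Y 1 (X 1 f) P = \<rho> wc (Psi (Phi a)) P"
    unfolding Y_1 X_1 Y1_def X1_def a_def ..
  also have "\<dots> = X 1 (Y 1 f) P - c * (\<Sum>j\<in>{1..<n}. \<rho> (Transposition.transpose 1 (Suc j)) f P) + f P"
    unfolding PP rho_add[OF perm_wc] wa U_eq[OF order_trans[OF one_le_numeral n2] order_refl a]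
      rho_comb[OF finite_atLeastLessThan perm_wc] XY ts by simp
  also have "(\<Sum>j\<in>{1..<n}. \<rho> (Transposition.transpose 1 (Suc j)) f P)
      = (\<Sum>j\<in>{1..n}-{1}. \<rho> (Transposition.transpose 1 j) f P)"
    by (rule sum.reindex_bij_witness[of _ "\<lambda>j. j - 1" Suc]) auto
  finally show "Y 1 (X 1 f) P
      = X 1 (Y 1 f) P + f P - c * (\<Sum>j\<in>{1..n}-{1}. \<rho> (Transposition.transpose 1 j) f P)"
    by simp
qed

lemma Y_X_same:
  assumes f: "affsupp n f" and i: "i \<in> {1..n}"
  shows "Y i (X i f) = (\<lambda>P. X i (Y i f) P + f P - c * (\<Sum>j\<in>{1..n}-{i}. \<rho> (Transposition.transpose i j) f P))"
proof -
  define g where "g = Transposition.transpose 1 i"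
  have g: "perm g" "g 1 = i" "g \<circ> g = id" unfolding g_def using i n2 by (auto intro!: perm_transpose)
  define h where "h = \<rho> g f"
  have fh: "f = \<rho> g h" unfolding h_def rho_rho[OF g(1) g(1)] g(3) by simp
  have h: "affsupp n h" unfolding h_def by (intro affsupp_rho g f)
  have *: "Y i (\<rho> g h) = \<rho> g (Y 1 h)" "X i (\<rho> g h) = \<rho> g (X 1 h)" for h
    unfolding rho_Y[OF g(1) one_two(1)] rho_X[OF g(1) one_two(1)] g by (rule refl)+
  have t: "\<rho> g (\<rho> (Transposition.transpose 1 j) h) = \<rho> (Transposition.transpose i (g j)) (\<rho> g h)"
    if "j \<in> {1..n}" for j
  proof -
    have gj: "g j \<in> {1..n}" using permutes_in_image[OF g(1)] that by simp
    have "g \<circ> Transposition.transpose 1 j = Transposition.transpose i (g j) \<circ> g"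
      using transpose_conj[OF permutes_bij[OF g(1)], of 1 j] by (simp only: g)
    then show ?thesis
      unfolding rho_rho[OF perm_transpose[OF i gj] g(1)] rho_rho[OF g(1) perm_transpose[OF one_two(1) that]]
      by simp
  qed
  have s: "(\<Sum>j\<in>{1..n}-{1}. \<rho> g (\<rho> (Transposition.transpose 1 j) h) P)
      = (\<Sum>j\<in>{1..n}-{i}. \<rho> (Transposition.transpose i j) (\<rho> g h) P)" for P
  proof (rule sum.reindex_bij_witness[of _ g g])
    have gg: "g (g x) = x" for x using fun_cong[OF g(3)] by simp
    have gi: "g i = 1" using gg[of 1] g(2) by simp
    fix a
    { assume a: "a \<in> {1..n} - {1}"
      show "g (g a) = a" by (rule gg)
      have "g a \<noteq> i" using gg[of a] gi a by auto
      then show "g a \<in> {1..n} - {i}" using permutes_in_image[OF g(1)] a by auto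
      show "\<rho> (Transposition.transpose i (g a)) (\<rho> g h) P = \<rho> g (\<rho> (Transposition.transpose 1 a) h) P"
        using t[of a] a by simp }
    { assume a: "a \<in> {1..n} - {i}"
      show "g (g a) = a" by (rule gg)
      have "g a \<noteq> 1" using gg[of a] g(2) a by auto
      then show "g a \<in> {1..n} - {1}" using permutes_in_image[OF g(1)] a by auto }
  qed
  have "\<rho> g (Y 1 (X 1 h)) = (\<lambda>P. \<rho> g (\<lambda>P. X 1 (Y 1 h) P + h P) P
      - c * (\<Sum>j\<in>{1..n}-{1}. \<rho> g (\<rho> (Transposition.transpose 1 j) h) P))"
    unfolding Y1X1[OF h] by (rule rho_comb) (use g in auto)
  then show ?thesis unfolding fh * s rho_add[OF g(1)] .
qed

end

section \<open>The crossed product and its ideal\<close>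

abbreviation FC :: "nat \<Rightarrow> (wperm \<Rightarrow>\<^sub>0 complex) set" where
  "FC n \<equiv> carrier (free_crossed n)"

definition okp :: "nat \<Rightarrow> wperm \<Rightarrow> bool" where
  "okp n p \<longleftrightarrow> letter_index ` set (wp_word p) \<subseteq> {1..n} \<and> wp_perm p permutes {1..n}"

lemma FC_iff: "h \<in> FC n \<longleftrightarrow> (\<forall>p\<in>Poly_Mapping.keys h. okp n p)"
  by (simp add: free_crossed_def okp_def)

lemma letter_index_act: "letter_index (act_letter g l) = g (letter_index l)"
  by (cases l) auto

lemma okp_plus: "okp n p \<Longrightarrow> okp n q \<Longrightarrow> okp n (p + q)"
  by (auto simp: okp_def plus_wperm_def letter_index_act image_image permutes_compose)
    (metis atLeastAtMost_iff image_subset_iff permutes_in_image)+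

lemma okp_zero: "okp n 0"
  by (simp add: okp_def zero_wperm_def permutes_id)

lemma FC_simps [simp]:
  "mult (free_crossed n) = (*)" "one (free_crossed n) = 1"
  "zero (free_crossed n) = 0" "add (free_crossed n) = (+)"
  by (simp_all add: free_crossed_def)

lemma FC_single: "okp n p \<Longrightarrow> Poly_Mapping.single p z \<in> FC n"
  by (cases "z = 0") (auto simp: FC_iff)

lemma FC_zero: "0 \<in> FC n"
  by (simp add: FC_iff)

lemma FC_one: "1 \<in> FC n"
  by (simp add: FC_iff okp_zero)

lemma FC_add: "f \<in> FC n \<Longrightarrow> g \<in> FC n \<Longrightarrow> f + g \<in> FC n"
  using Poly_Mapping.keys_add[of f g] by (auto simp: FC_iff)

lemma FC_uminus: "f \<in> FC n \<Longrightarrow> - f \<in> FC n"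
  by (simp add: FC_iff in_keys_iff)

lemma FC_diff: "f \<in> FC n \<Longrightarrow> g \<in> FC n \<Longrightarrow> f - g \<in> FC n"
  using FC_add[of f n "- g"] FC_uminus[of g n] by simp

lemma FC_mult: "f \<in> FC n \<Longrightarrow> g \<in> FC n \<Longrightarrow> f * g \<in> FC n"
  using keys_mult[of f g] okp_plus by (fastforce simp: FC_iff)

lemma FC_sum: "(\<And>i. i \<in> S \<Longrightarrow> f i \<in> FC n) \<Longrightarrow> sum f S \<in> FC n"
  by (induction S rule: infinite_finite_induct) (auto simp: FC_zero FC_add)

lemma FC_scalar: "scalar z \<in> FC n"
  by (simp add: scalar_def FC_single okp_zero)

lemma FC_gx: "i \<in> {1..n} \<Longrightarrow> gx i \<in> FC n" and FC_gy: "i \<in> {1..n} \<Longrightarrow> gy i \<in> FC n"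
  by (auto simp: gx_def gy_def okp_def permutes_id intro!: FC_single)

definition sg :: "(nat \<Rightarrow> nat) \<Rightarrow> wperm \<Rightarrow>\<^sub>0 complex" where
  "sg g = Poly_Mapping.single (WPerm [] g) 1"

lemma FC_sg: "g permutes {1..n} \<Longrightarrow> sg g \<in> FC n"
  by (auto simp: sg_def okp_def intro!: FC_single)

lemma transp_sg: "transp i j = sg (Transposition.transpose i j)"
  by (simp add: transp_def sg_def)

lemma FC_transp: "i \<in> {1..n} \<Longrightarrow> j \<in> {1..n} \<Longrightarrow> transp i j \<in> FC n"
  unfolding transp_sg by (intro FC_sg permutes_swap_id)

lemmas FC_intros = FC_add FC_diff FC_mult FC_one FC_zero FC_scalar FC_gx FC_gy FC_sg FC_transp FC_sum FC_uminus

lemma ring_FC: "ring (free_crossed n)"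
proof (rule ringI)
  show "abelian_group (free_crossed n)"
  proof (rule abelian_groupI)
    fix x assume "x \<in> FC n"
    then show "\<exists>y\<in>FC n. y \<oplus>\<^bsub>free_crossed n\<^esub> x = \<zero>\<^bsub>free_crossed n\<^esub>"
      by (intro bexI[of _ "- x"]) (auto intro: FC_uminus)
  qed (auto intro: FC_add FC_zero simp: algebra_simps)
  show "monoid (free_crossed n)"
    by (rule monoidI) (auto intro: FC_mult FC_one simp: algebra_simps)
qed (auto simp: algebra_simps)

lemma poly_mapping_sum_single:
  fixes h :: "'a \<Rightarrow>\<^sub>0 'b::comm_monoid_add"
  shows "h = (\<Sum>p\<in>Poly_Mapping.keys h. Poly_Mapping.single p (Poly_Mapping.lookup h p))"
proof (rule poly_mapping_eqI)
  fix k
  have "(\<Sum>p\<in>Poly_Mapping.keys h. Poly_Mapping.lookup h p when p = k) = Poly_Mapping.lookup h k"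
  proof (cases "k \<in> Poly_Mapping.keys h")
    case True
    then show ?thesis by (simp add: when_def)
  next
    case False
    then show ?thesis by (auto simp: when_def in_keys_iff)
  qed
  then show "Poly_Mapping.lookup h k
      = Poly_Mapping.lookup (\<Sum>p\<in>Poly_Mapping.keys h. Poly_Mapping.single p (Poly_Mapping.lookup h p)) k"
    by (simp add: lookup_sum lookup_single)
qed

lemma poly_mapping_span_induct [consumes 1, case_names zero single add]:
  fixes h :: "'a \<Rightarrow>\<^sub>0 'b::comm_monoid_add"
  assumes "\<forall>p\<in>Poly_Mapping.keys h. ok p" and "Q 0" and "\<And>p z. ok p \<Longrightarrow> Q (Poly_Mapping.single p z)"
    and "\<And>f g. Q f \<Longrightarrow> Q g \<Longrightarrow> Q (f + g)"
  shows "Q h"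
proof -
  have "Q (\<Sum>p\<in>S. Poly_Mapping.single p (Poly_Mapping.lookup h p))" if "S \<subseteq> Poly_Mapping.keys h" for S
    using finite_subset[OF that finite_keys] that
    by (induction S rule: finite_induct) (use assms in auto)
  from this[OF order_refl] show ?thesis by (simp only: poly_mapping_sum_single[symmetric])
qed

lemma single_times_eq:
  "Poly_Mapping.single p z = scalar z * Poly_Mapping.single (p::wperm) 1"
  by (simp add: scalar_def mult_single)

lemma scalar_mult_commute: "scalar z * h = h * scalar z"
proof -
  have "\<forall>p\<in>Poly_Mapping.keys h. True" by simp
  then show ?thesis
    by (induction h rule: poly_mapping_span_induct)
      (simp_all add: scalar_def mult_single algebra_simps)
qed

lemma scalar_add: "scalar (a + b) = scalar a + scalar b"
  and scalar_mult: "scalar (a * b) = scalar a * scalar b"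
  and scalar_minus: "scalar (- a) = - scalar a"
  and scalar_diff: "scalar (a - b) = scalar a - scalar b"
  and scalar_1: "scalar 1 = 1" and scalar_0: "scalar 0 = 0"
  by (simp_all add: scalar_def single_add mult_single single_uminus single_diff)

lemma sg_mult: "sg g * sg h = sg (g \<circ> h)"
  by (simp add: sg_def mult_single plus_wperm_def)

lemma sg_id: "sg id = 1"
  by (simp add: sg_def zero_wperm_def flip: single_one)

lemma sg_gx: "sg g * gx i = gx (g i) * sg g" and sg_gy: "sg g * gy i = gy (g i) * sg g"
  by (simp_all add: sg_def gx_def gy_def mult_single plus_wperm_def)

lemma cherednik_relations_FC: "cherednik_relations n c \<subseteq> FC n"
  unfolding cherednik_relations_def by (auto intro!: FC_intros)

lemma cherednik_ideal: "ideal (cherednik_ideal n c) (free_crossed n)"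
  unfolding cherednik_ideal_def by (rule ring.genideal_ideal[OF ring_FC cherednik_relations_FC])

lemma relations_ideal: "r \<in> cherednik_relations n c \<Longrightarrow> r \<in> cherednik_ideal n c"
  unfolding cherednik_ideal_def using ring.genideal_self[OF ring_FC cherednik_relations_FC] by blast

lemma ring_cherednik: "ring (cherednik n c)"
  unfolding cherednik_def by (rule ideal.quotient_is_ring[OF cherednik_ideal])

lemma ideal_FC: "h \<in> cherednik_ideal n c \<Longrightarrow> h \<in> FC n"
  using ideal.Icarr[OF cherednik_ideal] .

lemma ideal_add: "f \<in> cherednik_ideal n c \<Longrightarrow> g \<in> cherednik_ideal n c \<Longrightarrow> f + g \<in> cherednik_ideal n c"
  using additive_subgroup.a_closed[OF ideal.axioms(1)[OF cherednik_ideal]] by fastforce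

lemma ideal_lmult: "f \<in> cherednik_ideal n c \<Longrightarrow> g \<in> FC n \<Longrightarrow> g * f \<in> cherednik_ideal n c"
  using ideal.I_l_closed[OF cherednik_ideal] by fastforce

lemma ideal_rmult: "f \<in> cherednik_ideal n c \<Longrightarrow> g \<in> FC n \<Longrightarrow> f * g \<in> cherednik_ideal n c"
  using ideal.I_r_closed[OF cherednik_ideal] by fastforce

lemma class_hom: "cherednik_class n c \<in> ring_hom (free_crossed n) (cherednik n c)"
  unfolding cherednik_def cherednik_class_def using ideal.rcos_ring_hom[OF cherednik_ideal] by simp

lemma class_closed: "f \<in> FC n \<Longrightarrow> cherednik_class n c f \<in> carrier (cherednik n c)"
  using ring_hom_closed[OF class_hom] .

lemma class_mult: "f \<in> FC n \<Longrightarrow> g \<in> FC n \<Longrightarrow>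
    cherednik_class n c f \<otimes>\<^bsub>cherednik n c\<^esub> cherednik_class n c g = cherednik_class n c (f * g)"
  using ring_hom_mult[OF class_hom, of f n g c] by simp

lemma class_add: "f \<in> FC n \<Longrightarrow> g \<in> FC n \<Longrightarrow>
    cherednik_class n c f \<oplus>\<^bsub>cherednik n c\<^esub> cherednik_class n c g = cherednik_class n c (f + g)"
  using ring_hom_add[OF class_hom, of f n g c] by simp

lemma carrier_cherednik: "carrier (cherednik n c) = cherednik_class n c ` FC n"
  unfolding cherednik_def cherednik_class_def FactRing_def A_RCOSETS_def' by auto

lemma class_eqD:
  assumes "f \<in> FC n" "g \<in> FC n" "cherednik_class n c f = cherednik_class n c g"
  shows "f - g \<in> cherednik_ideal n c"
proof -
  interpret ideal "cherednik_ideal n c" "free_crossed n" by (rule cherednik_ideal)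
  have "f \<in> cherednik_ideal n c +>\<^bsub>free_crossed n\<^esub> g"
    using a_rcos_self[OF assms(1)] assms(3) unfolding cherednik_class_def by simp
  then obtain h where "h \<in> cherednik_ideal n c" "f = h + g"
    by (auto simp: a_r_coset_def')
  then show ?thesis by simp
qed

context affine_model
begin

section \<open>The representation of the crossed product on functions\<close>

fun opl :: "letter \<Rightarrow> affine_fun \<Rightarrow> affine_fun" where
  "opl (LX i) = X i"
| "opl (LY i) = Y i"

definition actp :: "wperm \<Rightarrow> affine_fun \<Rightarrow> affine_fun" where
  "actp p f = foldr opl (wp_word p) (\<rho> (wp_perm p) f)"

definition act :: "(wperm \<Rightarrow>\<^sub>0 complex) \<Rightarrow> affine_fun \<Rightarrow> affine_fun" where
  "act h f P = (\<Sum>p\<in>Poly_Mapping.keys h. Poly_Mapping.lookup h p * actp p f P)"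

lemma rho_opl: "perm g \<Longrightarrow> letter_index l \<in> {1..n} \<Longrightarrow> \<rho> g (opl l f) = opl (act_letter g l) (\<rho> g f)"
  by (cases l) (simp_all add: rho_X rho_Y)

lemma rho_foldr:
  "perm g \<Longrightarrow> letter_index ` set w \<subseteq> {1..n} \<Longrightarrow>
    \<rho> g (foldr opl w f) = foldr opl (map (act_letter g) w) (\<rho> g f)"
  by (induction w) (simp_all add: rho_opl)

lemma actp_plus: "okp n p \<Longrightarrow> okp n q \<Longrightarrow> actp (p + q) f = actp p (actp q f)"
  by (simp add: okp_def actp_def plus_wperm_def rho_foldr rho_comp)

lemma fam_linear:
  assumes "\<And>a b. Z (\<lambda>P. a P + b P) = (\<lambda>P. Z a P + Z b P)" "\<And>z a. Z (\<lambda>P. z * a P) = (\<lambda>P. z * Z a P)"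
    and "i \<in> {1..n}"
  shows "fam Z i (\<lambda>P. a P + b P) = (\<lambda>P. fam Z i a P + fam Z i b P)"
    "fam Z i (\<lambda>P. z * a P) = (\<lambda>P. z * fam Z i a P)"
  unfolding fam_def using rho_add rho_scale perm_transpose[OF one_two(1) assms(3)] assms(1,2) by simp_all

lemma opl_linear:
  assumes "letter_index l \<in> {1..n}"
  shows "opl l (\<lambda>P. a P + b P) = (\<lambda>P. opl l a P + opl l b P)"
    "opl l (\<lambda>P. z * a P) = (\<lambda>P. z * opl l a P)"
proof -
  have X: "X1 (\<lambda>P. a P + b P) = (\<lambda>P. X1 a P + X1 b P)" "X1 (\<lambda>P. z * a P) = (\<lambda>P. z * X1 a P)" for a b z
    by (simp_all add: X1_def rho_add[OF perm_wi] rho_scale[OF perm_wi] Phi_def fun_eq_iff)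
  have PP: "Psi (\<lambda>P. a P + b P) = (\<lambda>P. Psi a P + Psi b P)" "Psi (\<lambda>P. z * a P) = (\<lambda>P. z * Psi a P)" for a b z
    by (simp_all add: Psi_def fun_eq_iff distrib_left)
  have Y: "Y1 (\<lambda>P. a P + b P) = (\<lambda>P. Y1 a P + Y1 b P)" "Y1 (\<lambda>P. z * a P) = (\<lambda>P. z * Y1 a P)" for a b z
    by (simp_all add: Y1_def PP rho_add[OF perm_wc] rho_scale[OF perm_wc])
  show "opl l (\<lambda>P. a P + b P) = (\<lambda>P. opl l a P + opl l b P)"
    "opl l (\<lambda>P. z * a P) = (\<lambda>P. z * opl l a P)"
    using assms by (cases l; simp add: X_def Y_def fam_linear[OF X] fam_linear[OF Y])+
qed

lemma actp_linear:
  assumes "okp n p"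
  shows "actp p (\<lambda>P. a P + b P) = (\<lambda>P. actp p a P + actp p b P)"
    "actp p (\<lambda>P. z * a P) = (\<lambda>P. z * actp p a P)"
proof -
  have "foldr opl w (\<lambda>P. a P + b P) = (\<lambda>P. foldr opl w a P + foldr opl w b P)"
    "foldr opl w (\<lambda>P. z * a P) = (\<lambda>P. z * foldr opl w a P)"
    if "letter_index ` set w \<subseteq> {1..n}" for w a b
    using that by (induction w) (simp_all add: opl_linear)
  then show "actp p (\<lambda>P. a P + b P) = (\<lambda>P. actp p a P + actp p b P)"
    "actp p (\<lambda>P. z * a P) = (\<lambda>P. z * actp p a P)"
    using assms by (simp_all add: actp_def okp_def rho_add rho_scale)
qed

lemma act_superset:
  assumes "finite S" "Poly_Mapping.keys h \<subseteq> S"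
  shows "act h f P = (\<Sum>p\<in>S. Poly_Mapping.lookup h p * actp p f P)"
  unfolding act_def by (rule sum.mono_neutral_left[OF assms]) (auto simp: in_keys_iff)

lemma act_zero [simp]: "act 0 f = (\<lambda>P. 0)"
  by (simp add: act_def fun_eq_iff)

lemma act_add: "act (h + k) f = (\<lambda>P. act h f P + act k f P)"
proof
  fix P
  let ?S = "Poly_Mapping.keys h \<union> Poly_Mapping.keys k"
  have f: "finite ?S" by simp
  show "act (h + k) f P = act h f P + act k f P"
    unfolding act_superset[OF f keys_add] act_superset[OF f Un_upper1] act_superset[OF f Un_upper2]
    by (simp add: lookup_add distrib_right sum.distrib)
qed

lemma act_single: "act (Poly_Mapping.single p z) f = (\<lambda>P. z * actp p f P)"
  by (cases "z = 0") (simp_all add: act_def fun_eq_iff)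

lemma act_uminus: "act (- h) f = (\<lambda>P. - act h f P)"
  using act_add[of h "- h" f] by (simp add: fun_eq_iff add_eq_0_iff)

lemma act_diff: "act (h - k) f = (\<lambda>P. act h f P - act k f P)"
  using act_add[of h "- k" f] act_uminus[of k f] by simp

lemma act_sum: "act (sum h S) f = (\<lambda>P. \<Sum>i\<in>S. act (h i) f P)"
  by (induction S rule: infinite_finite_induct) (simp_all add: act_add)

lemma act_one [simp]: "act 1 f = f"
  using act_single[of 0 1 f, unfolded single_one] by (simp add: actp_def zero_wperm_def)

lemma act_mult:
  assumes "h \<in> FC n" "k \<in> FC n"
  shows "act (h * k) f = act h (act k f)"
proof -
  have h: "\<forall>p\<in>Poly_Mapping.keys h. okp n p" and k: "\<forall>p\<in>Poly_Mapping.keys k. okp n p"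
    using assms by (simp_all add: FC_iff)
  from h show ?thesis
  proof (induction h rule: poly_mapping_span_induct)
    case (single p z)
    from k show ?case
    proof (induction k rule: poly_mapping_span_induct)
      case zero
      then show ?case using actp_linear(2)[OF single, of 0] by (simp add: act_single fun_eq_iff)
    next
      case (single q w)
      then show ?case using \<open>okp n p\<close>
        by (simp add: mult_single act_single actp_plus actp_linear mult.assoc)
    next
      case (add f' g')
      then show ?case
        by (simp add: distrib_left act_add act_single actp_linear[OF \<open>okp n p\<close>])
    qed
  next
    case (add f' g')
    then show ?case by (simp add: distrib_right act_add)
  qed simp
qed

lemma act_linear:
  assumes "h \<in> FC n"
  shows "act h (\<lambda>P. a P + b P) = (\<lambda>P. act h a P + act h b P)"
    "act h (\<lambda>P. z * a P) = (\<lambda>P. z * act h a P)"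
  using assms unfolding FC_iff
  by (auto simp: act_def fun_eq_iff actp_linear distrib_left sum.distrib sum_distrib_left mult.left_commute
      intro!: sum.cong)

lemma act_scalar: "act (scalar z) f = (\<lambda>P. z * f P)"
  by (simp add: scalar_def act_single actp_def zero_wperm_def)

lemma act_scalar_mult: "h \<in> FC n \<Longrightarrow> act (scalar z * h) f = (\<lambda>P. z * act h f P)"
  by (simp add: act_mult FC_scalar act_scalar)

lemma act_gx: "act (gx i) f = X i f" and act_gy: "act (gy i) f = Y i f"
  by (simp_all add: gx_def gy_def act_single actp_def)

lemma act_sg: "act (sg g) f = \<rho> g f"
  by (simp add: sg_def act_single actp_def)

lemma affsupp_opl: "letter_index l \<in> {1..n} \<Longrightarrow> affsupp n f \<Longrightarrow> affsupp n (opl l f)"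
  by (cases l) (auto simp: X_def Y_def fam_def X1_def Y1_def
      intro!: affsupp_rho affsupp_Phi affsupp_Psi perm_transpose perm_wi perm_wc one_two)

lemma affsupp_act:
  assumes "h \<in> FC n" "affsupp n f" shows "affsupp n (act h f)"
proof -
  have "affsupp n (foldr opl w g)" if "letter_index ` set w \<subseteq> {1..n}" "affsupp n g" for w g
    using that by (induction w) (auto intro: affsupp_opl)
  then have "affsupp n (actp p f)" if "okp n p" for p
    using that assms(2) by (auto simp: actp_def okp_def intro: affsupp_rho)
  then show ?thesis using assms(1) by (auto simp: affsupp_def act_def FC_iff)
qed

lemma relations_act:
  assumes "r \<in> cherednik_relations n c" "affsupp n f"
  shows "act r f = (\<lambda>P. 0)"
proof -
  note s = act_diff act_add act_mult act_gx act_gy act_scalar_mult act_sum transp_sg act_sg FC_intros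
    perm_transpose
  have "r \<in> FC n" using assms cherednik_relations_FC by blast
  from assms(1) consider
    (1) i j where "i \<in> {1..n}" "j \<in> {1..n}" "r = gx i * gx j - gx j * gx i"
  | (2) i j where "i \<in> {1..n}" "j \<in> {1..n}" "r = gy i * gy j - gy j * gy i"
  | (3) i j where "i \<in> {1..n}" "j \<in> {1..n}" "i \<noteq> j"
      "r = gy i * gx j - gx j * gy i - scalar c * transp i j"
  | (4) i where "i \<in> {1..n}"
      "r = gy i * gx i - gx i * gy i - (1 - scalar c * (\<Sum>j \<in> {1..n} - {i}. transp i j))"
    unfolding cherednik_relations_def by blast
  then show ?thesis
  proof cases
    case 1
    then show ?thesis by (simp add: s X_commute[of i j])
  next
    case 2
    then show ?thesis by (simp add: s Y_commute[of i j])
  next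
    case 3
    then show ?thesis by (simp add: s act_scalar Y_X_distinct[OF assms(2)])
  next
    case 4
    have "(\<Sum>j \<in> {1..n} - {i}. transp i j) \<in> FC n"
      using 4 by (intro FC_sum FC_transp) auto
    then have "act (scalar c * (\<Sum>j \<in> {1..n} - {i}. transp i j)) f
      = (\<lambda>P. c * (\<Sum>j\<in>{1..n}-{i}. \<rho> (Transposition.transpose i j) f P))"
      by (simp only: act_scalar_mult act_sum transp_sg act_sg)
    then show ?thesis using 4
      by (simp add: act_diff act_mult FC_gx FC_gy act_gx act_gy Y_X_same[OF assms(2)])
  qed
qed

text \<open>The elements killing every function supported on affine permutations form a two-sided
  ideal; closure under right multiplication holds because the algebra preserves this
  support.\<close>

lemma ideal_act:
  assumes "h \<in> cherednik_ideal n c" "affsupp n f"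
  shows "act h f = (\<lambda>P. 0)"
proof -
  let ?A = "{h \<in> FC n. \<forall>f. affsupp n f \<longrightarrow> act h f = (\<lambda>P. 0)}"
  interpret ring "free_crossed n" by (rule ring_FC)
  have act0: "act h (\<lambda>P. 0) = (\<lambda>P. 0)" if "h \<in> FC n" for h
    using act_linear(2)[OF that, of 0] by simp
  have "ideal ?A (free_crossed n)"
  proof (rule idealI[OF ring_FC])
    show "subgroup ?A (add_monoid (free_crossed n))"
    proof (rule group.subgroupI)
      show "group (add_monoid (free_crossed n))" by (rule a_group)
      show "?A \<noteq> {}" using FC_zero by auto
      fix a assume a: "a \<in> ?A"
      have "m_inv (add_monoid (free_crossed n)) a = - a"
        using a minus_equality[of "- a" a] FC_uminus by (simp add: a_inv_def)
      then show "m_inv (add_monoid (free_crossed n)) a \<in> ?A"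
        using a by (simp add: FC_uminus act_uminus)
      fix b assume "b \<in> ?A"
      then show "a \<otimes>\<^bsub>add_monoid (free_crossed n)\<^esub> b \<in> ?A"
        using a by (simp add: FC_add act_add)
    qed auto
  qed (auto simp: FC_mult act_mult act0 affsupp_act)
  moreover have "cherednik_relations n c \<subseteq> ?A"
    using relations_act cherednik_relations_FC by blast
  ultimately have "cherednik_ideal n c \<subseteq> ?A"
    unfolding cherednik_ideal_def by (rule genideal_minimal)
  then show ?thesis using assms by blast
qed

end

section \<open>The support region of the simple module\<close>

locale hook_model = affine_model n m for n m +
  fixes l :: nat
  assumes m0: "0 < m" and cop: "coprime m n" and ln: "l < n - 1"
begin

text \<open>The inverse of \<open>P\<close> records positions: the conditions say that the position of \<open>m a\<close> increases
  with \<open>a\<close> along the arm of the hook, up to the first step around the cylinder, that it increases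
  along the leg, and that the corner box sits at a positive position.\<close>

definition J :: "(int \<Rightarrow> int) \<Rightarrow> bool" where
  "J P \<longleftrightarrow> aff n P \<and> (\<forall>i. P i = 0 \<longrightarrow> 1 \<le> i) \<and>
     (\<forall>i j a. 0 \<le> a \<and> a < int n - int l \<and> P i = int m * a \<and> P j = int m * (a + 1) \<longrightarrow> i < j) \<and>
     (\<forall>i j a. - int l \<le> a \<and> a < 0 \<and> P i = int m * a \<and> P j = int m * (a + 1) \<longrightarrow> j < i)"

lemma J_aff: "J P \<Longrightarrow> aff n P"
  by (simp add: J_def)

lemma tau_crossing:
  assumes "b < a" "\<not> tau n i b < tau n i a"
  shows "a = b + 1" "int n dvd b - i"
proof -
  have ne: "tau n i a \<noteq> tau n i b" using assms(1) tau_invol[OF n2, of i a] tau_invol[OF n2, of i b] by auto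
  have r: "z - 1 \<le> tau n i z" "tau n i z \<le> z + 1" for z by (auto simp: tau_def)
  show a: "a = b + 1" using assms ne r[of a] r[of b] by linarith
  show "int n dvd b - i"
  proof (rule ccontr)
    assume "\<not> int n dvd b - i"
    then have "tau n i b \<le> b" by (auto simp: tau_def)
    then show False using assms ne r[of a] a by linarith
  qed
qed

text \<open>Leaving J breaks one of its inequalities, so the step swaps the two neighbouring
  positions compared there, which carry m a and m (a + 1). The corner condition cannot break: only
  the affine reflection 0 swaps positions 0 and 1, and 1 <= i < n excludes it.\<close>

lemma J_tau_exit:
  assumes P: "aff n P" "\<not> J P" and Q: "J (\<lambda>z. P (tau n (int i) z))" and i: "1 \<le> i" "i < n"
  shows "\<bar>P (int i + 1) - P (int i)\<bar> = int m"
proof -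
  let ?t = "tau n (int i)"
  have Q0: "P (?t (?t z)) = P z" for z by (simp add: tau_invol[OF n2])
  \<comment> \<open>The crossing may happen in another period; periodicity moves its difference to
    the positions i and i + 1.\<close>
  have diff: "P (b + 1) - P b = P (int i + 1) - P (int i)" if d: "int n dvd b - int i" for b
  proof -
    obtain r where b: "b = int i + r * int n" using dvd_diffE[OF d] .
    have per: "P (z + r * int n) = P z + r * int n" for z r
    proof (induction r rule: int_induct[where k = 0])
      case (step1 r)
      then show ?case using aff_per[OF P(1), of "z + r * int n"] by (simp add: algebra_simps)
    next
      case (step2 r)
      then show ?case using aff_per'[OF P(1), of "z + r * int n"] by (simp add: algebra_simps)
    qed simp
    show ?thesis using per[of "int i" r] per[of "int i + 1" r] by (simp add: b algebra_simps)
  qed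
  have "1 \<le> z" if "P z = 0" for z
  proof (rule ccontr)
    assume z: "\<not> 1 \<le> z"
    have "1 \<le> x" if "P (?t x) = 0" for x using Q that unfolding J_def by blast
    then have "1 \<le> ?t z" using that Q0[of z] by simp
    then have "z = 0" "?t z = 1" using z by (auto simp: tau_def split: if_splits)
    then have "int n dvd - int i" by (auto simp: tau_def split: if_splits)
    then show False using small_dvd[of "- int i"] i by auto
  qed
  note corner = this
  have arm: "i < j" if "J R" "0 \<le> a" "a < int n - int l" "R i = int m * a" "R j = int m * (a + 1)" for R i j a
    using that unfolding J_def by blast
  have leg: "j < i" if "J R" "- int l \<le> a" "a < 0" "R i = int m * a" "R j = int m * (a + 1)" for R i j a
    using that unfolding J_def by blast
  consider a b k where "0 \<le> k" "k < int n - int l" "P a = int m * k" "P b = int m * (k + 1)" "\<not> a < b"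
    | a b k where "- int l \<le> k" "k < 0" "P a = int m * k" "P b = int m * (k + 1)" "\<not> b < a"
  proof (rule ccontr)
    note r1 = that(1) and r2 = that(2)
    assume *: "\<not> thesis"
    have "J P"
      unfolding J_def
    proof (intro conjI allI impI)
      show "aff n P" by (rule P)
      show "1 \<le> i" if "P i = 0" for i using corner that .
      show "i < j" if "0 \<le> a \<and> a < int n - int l \<and> P i = int m * a \<and> P j = int m * (a + 1)" for i j a
        using * r1[of a i j] that by blast
      show "j < i" if "- int l \<le> a \<and> a < 0 \<and> P i = int m * a \<and> P j = int m * (a + 1)" for i j a
        using * r2[of a i j] that by blast
    qed
    then show False using P by blast
  qed
  then show ?thesis
  proof cases
    case 1
    have "?t a < ?t b" by (rule arm[OF Q 1(1,2)]) (simp_all add: Q0 1)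
    moreover have "b < a" using 1 calculation by (cases "a = b") auto
    ultimately have "a = b + 1" "int n dvd b - int i" using tau_crossing[of b a "int i"] by auto
    then have "P (int i + 1) - P (int i) = int m * k - int m * (k + 1)" using diff[of b] 1 by simp
    then show ?thesis by (simp add: algebra_simps)
  next
    case 2
    have "?t b < ?t a" by (rule leg[OF Q 2(1,2)]) (simp_all add: Q0 2)
    moreover have "a < b" using 2 calculation by (cases "a = b") auto
    ultimately have "b = a + 1" "int n dvd a - int i" using tau_crossing[of a b "int i"] by auto
    then have "P (int i + 1) - P (int i) = int m * (k + 1) - int m * k" using diff[of a] 2 by simp
    then show ?thesis by (simp add: algebra_simps)
  qed
qed

lemma csq_m: "\<bar>d\<bar> = int m \<Longrightarrow> csq m d = 0"
proof -
  assume "\<bar>d\<bar> = int m"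
  then have "d = int m \<or> d = - int m" by linarith
  then have "(of_nat m / of_int d :: complex) * (of_nat m / of_int d) = 1" using m0 by auto
  then show ?thesis by (simp add: csq_def)
qed

lemma J_shift_up: "J P \<Longrightarrow> J (\<lambda>z. P (z - 1))"
proof -
  assume P: "J P"
  have "aff n (\<lambda>z. P (z - 1))" using J_aff[OF P] aff_shift_diff[of n P 1] by blast
  moreover have "1 \<le> i" if "P (i - 1) = 0" for i
  proof -
    have "1 \<le> i - 1" using P that unfolding J_def by blast
    then show ?thesis by simp
  qed
  moreover have "i < j" if "0 \<le> a \<and> a < int n - int l \<and> P (i - 1) = int m * a \<and> P (j - 1) = int m * (a + 1)" for i j a
  proof -
    have "i - 1 < j - 1" using P that unfolding J_def by blast
    then show ?thesis by simp
  qed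
  moreover have "j < i" if "- int l \<le> a \<and> a < 0 \<and> P (i - 1) = int m * a \<and> P (j - 1) = int m * (a + 1)" for i j a
  proof -
    have "j - 1 < i - 1" using P that unfolding J_def by blast
    then show ?thesis by simp
  qed
  ultimately show ?thesis unfolding J_def by blast
qed

text \<open>The only obstruction is the value 0 at position 1, and exactly there the factor of
  \<open>Psi\<close> vanishes; hence \<open>W_Psi\<close>.\<close>

lemma J_shift_down: "J P \<Longrightarrow> P 1 \<noteq> 0 \<Longrightarrow> J (\<lambda>z. P (z + 1))"
proof -
  assume P: "J P" and P1: "P 1 \<noteq> 0"
  have "aff n (\<lambda>z. P (z + 1))" using J_aff[OF P] aff_shift[of n P 1] by blast
  moreover have "1 \<le> i" if "P (i + 1) = 0" for i
  proof -
    have "1 \<le> i + 1" using P that unfolding J_def by blast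
    moreover have "i \<noteq> 0" using that P1 by auto
    ultimately show ?thesis by linarith
  qed
  moreover have "i < j" if "0 \<le> a \<and> a < int n - int l \<and> P (i + 1) = int m * a \<and> P (j + 1) = int m * (a + 1)" for i j a
  proof -
    have "i + 1 < j + 1" using P that unfolding J_def by blast
    then show ?thesis by simp
  qed
  moreover have "j < i" if "- int l \<le> a \<and> a < 0 \<and> P (i + 1) = int m * a \<and> P (j + 1) = int m * (a + 1)" for i j a
  proof -
    have "j + 1 < i + 1" using P that unfolding J_def by blast
    then show ?thesis by simp
  qed
  ultimately show ?thesis unfolding J_def by blast
qed

section \<open>The module of finitely supported functions on J\<close>

definition W :: "affine_fun \<Rightarrow> bool" where
  "W f \<longleftrightarrow> (\<forall>P. f P \<noteq> 0 \<longrightarrow> J P) \<and> finite {P. f P \<noteq> 0}"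

lemma W_affsupp: "W f \<Longrightarrow> affsupp n f"
  unfolding W_def affsupp_def using J_aff by blast

lemma W_T:
  assumes "W f" "1 \<le> i" "i < n" shows "W (T i f)"
proof -
  let ?t = "tau n (int i)"
  have *: "f P \<noteq> 0 \<or> f (\<lambda>z. P (?t z)) \<noteq> 0" if "T i f P \<noteq> 0" for P
    using that by (cases "aff n P") (auto simp: T_at)
  have "{P. T i f P \<noteq> 0} \<subseteq> {P. f P \<noteq> 0} \<union> (\<lambda>P z. P (?t z)) ` {P. f P \<noteq> 0}"
  proof
    fix P assume "P \<in> {P. T i f P \<noteq> 0}"
    then have "f P \<noteq> 0 \<or> f (\<lambda>z. P (?t z)) \<noteq> 0" using * by simp
    then show "P \<in> {P. f P \<noteq> 0} \<union> (\<lambda>P z. P (?t z)) ` {P. f P \<noteq> 0}"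
    proof
      assume "f (\<lambda>z. P (?t z)) \<noteq> 0"
      then show ?thesis
        by (intro UnI2 image_eqI[of _ _ "\<lambda>z. P (?t z)"]) (simp_all add: tau_invol[OF n2])
    qed simp
  qed
  moreover have "J P" if nz: "T i f P \<noteq> 0" for P
  proof (rule ccontr)
    assume nJ: "\<not> J P"
    then have f0: "f P = 0" using assms(1) unfolding W_def by blast
    then have a: "aff n P" using nz by (cases "aff n P") (auto simp: T_at)
    have "f (\<lambda>z. P (?t z)) \<noteq> 0" using * nz f0 by blast
    then have "J (\<lambda>z. P (?t z))" using assms(1) unfolding W_def by blast
    from J_tau_exit[OF a nJ this assms(2,3)] have "csq m (P (int i + 1) - P (int i)) = 0" by (rule csq_m)
    then show False using nz f0 by (simp add: T_at(1)[OF a])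
  qed
  ultimately show ?thesis using assms(1) finite_subset unfolding W_def by blast
qed

lemma W_Phi: "W f \<Longrightarrow> W (Phi f)"
proof -
  assume f: "W f"
  have "{P. Phi f P \<noteq> 0} \<subseteq> (\<lambda>P z. P (z - 1)) ` {P. f P \<noteq> 0}"
  proof
    fix P assume "P \<in> {P. Phi f P \<noteq> 0}"
    then show "P \<in> (\<lambda>P z. P (z - 1)) ` {P. f P \<noteq> 0}"
      by (intro image_eqI[of _ _ "\<lambda>z. P (z + 1)"]) (simp_all add: Phi_def)
  qed
  moreover have "J P" if "Phi f P \<noteq> 0" for P
    using J_shift_up[of "\<lambda>z. P (z + 1)"] f that by (simp add: W_def Phi_def)
  ultimately show ?thesis using f finite_subset unfolding W_def by blast
qed

lemma W_Psi: "W f \<Longrightarrow> W (Psi f)"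
proof -
  assume f: "W f"
  have "{P. Psi f P \<noteq> 0} \<subseteq> (\<lambda>P z. P (z + 1)) ` {P. f P \<noteq> 0}"
  proof
    fix P assume "P \<in> {P. Psi f P \<noteq> 0}"
    then show "P \<in> (\<lambda>P z. P (z + 1)) ` {P. f P \<noteq> 0}"
      by (intro image_eqI[of _ _ "\<lambda>z. P (z - 1)"]) (simp_all add: Psi_def)
  qed
  moreover have "J P" if "Psi f P \<noteq> 0" for P
    using J_shift_down[of "\<lambda>z. P (z - 1)"] f that by (simp add: W_def Psi_def)
  ultimately show ?thesis using f finite_subset unfolding W_def by blast
qed

lemma W_zero: "W (\<lambda>P. 0)"
  by (simp add: W_def)

lemma W_add: "W f \<Longrightarrow> W g \<Longrightarrow> W (\<lambda>P. f P + g P)"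
proof -
  assume f: "W f" "W g"
  have "{P. f P + g P \<noteq> 0} \<subseteq> {P. f P \<noteq> 0} \<union> {P. g P \<noteq> 0}" by auto
  moreover have "f P \<noteq> 0 \<or> g P \<noteq> 0" if "f P + g P \<noteq> 0" for P using that by auto
  ultimately show ?thesis using f finite_subset unfolding W_def by blast
qed

lemma W_scale: "W f \<Longrightarrow> W (\<lambda>P. z * f P)"
  unfolding W_def by (cases "z = 0") auto

lemma W_rho: "perm g \<Longrightarrow> W f \<Longrightarrow> W (\<rho> g f)"
proof (induction g rule: adjacent_induct)
  case (adj i g)
  then have i: "1 \<le> i" "i < n" by auto
  show ?case unfolding rho_adj_comp[OF i adj(3)] using adj i by (intro W_T) auto
qed simp

lemma W_opl: "letter_index x \<in> {1..n} \<Longrightarrow> W f \<Longrightarrow> W (opl x f)"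
  by (cases x) (auto simp: X_def Y_def fam_def X1_def Y1_def
      intro!: W_rho W_Phi W_Psi perm_transpose perm_wi perm_wc one_two)

lemma W_act:
  assumes "h \<in> FC n" "W f" shows "W (act h f)"
proof -
  have *: "W (foldr opl w g)" if "letter_index ` set w \<subseteq> {1..n}" "W g" for w g
    using that by (induction w) (auto intro: W_opl)
  have "W (actp p f)" if "okp n p" for p
    using that assms(2) unfolding actp_def okp_def by (auto intro!: * W_rho)
  then have a: "\<And>p. p \<in> Poly_Mapping.keys h \<Longrightarrow> W (actp p f)" using assms(1) unfolding FC_iff by blast
  have s: "W (\<lambda>P. \<Sum>p\<in>S. z p * b p P)" if "finite S" "\<And>p. p \<in> S \<Longrightarrow> W (b p)" for S :: "wperm set" and z b
    using that by (induction S rule: finite_induct) (simp_all add: W_zero W_add W_scale)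
  have "W (\<lambda>P. \<Sum>p\<in>Poly_Mapping.keys h. Poly_Mapping.lookup h p * actp p f P)"
    by (rule s[OF finite_keys a])
  then show ?thesis unfolding act_def[abs_def] .
qed

section \<open>The highest weight and its indicator function\<close>

text \<open>Contents in the tableau filled row by row: the labels up to n - l run along the arm, the
  others down the leg. With exponents 0 this tableau gives \<open>P0\<close>.\<close>

definition ct0 :: "nat \<Rightarrow> int" where
  "ct0 i = (if i \<le> n - l then int i - 1 else int n - int l - int i)"

definition P0 :: "int \<Rightarrow> int" where
  "P0 z = int m * ct0 (nat ((z - 1) mod int n + 1)) + int n * ((z - 1) div int n)"

definition e0 :: affine_fun where "e0 P = (if P = P0 then 1 else 0)"

lemma ct0_range: "1 \<le> i \<Longrightarrow> i \<le> n \<Longrightarrow> - int l \<le> ct0 i \<and> ct0 i < int n - int l"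
  using ln by (auto simp: ct0_def)

lemma ct0_inj: "1 \<le> i \<Longrightarrow> i \<le> n \<Longrightarrow> 1 \<le> j \<Longrightarrow> j \<le> n \<Longrightarrow> ct0 i = ct0 j \<Longrightarrow> i = j"
  using ln by (auto simp: ct0_def split: if_splits)

lemma P0_at: "1 \<le> i \<Longrightarrow> i \<le> n \<Longrightarrow> P0 (int i + int n * r) = int m * ct0 i + int n * r"
proof -
  assume i: "1 \<le> i" "i \<le> n"
  have "int i + int n * r - 1 = (int i - 1) + int n * r" by simp
  moreover have "(int i - 1 + int n * r) mod int n = int i - 1" "(int i - 1 + int n * r) div int n = r"
    using i by auto
  ultimately show ?thesis unfolding P0_def by (simp only:) simp
qed

lemma P0_at': "1 \<le> i \<Longrightarrow> i \<le> n \<Longrightarrow> P0 (int i) = int m * ct0 i"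
  using P0_at[of i 0] by simp

lemma int_rep: obtains i r where "1 \<le> i" "i \<le> n" "z = int i + int n * r"
proof (rule that[of "nat ((z - 1) mod int n + 1)" "(z - 1) div int n"])
  have "0 \<le> (z - 1) mod int n" "(z - 1) mod int n < int n" using n2 by auto
  then show "1 \<le> nat ((z - 1) mod int n + 1)" "nat ((z - 1) mod int n + 1) \<le> n" by linarith+
  show "z = int (nat ((z - 1) mod int n + 1)) + int n * ((z - 1) div int n)"
    using \<open>0 \<le> (z - 1) mod int n\<close> div_mult_mod_eq[of "z - 1" "int n"] by (simp add: mult.commute)
qed

lemma dvd_m: "int n dvd int m * a \<Longrightarrow> int n dvd a"
proof -
  assume "int n dvd int m * a"
  moreover have "coprime (int n) (int m)" using cop by (simp add: coprime_commute)
  ultimately show ?thesis by (simp add: coprime_dvd_mult_right_iff)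
qed

text \<open>Here coprimality enters: the contents are n consecutive integers, so multiplication by m
  keeps them distinct modulo n.\<close>

lemma content_unique:
  assumes "- int l \<le> a" "a < int n - int l" "- int l \<le> b" "b < int n - int l"
    and "int n dvd int m * a - int m * b"
  shows "a = b"
proof -
  have "int n dvd int m * (a - b)" using assms(5) by (simp add: algebra_simps)
  then have "int n dvd a - b" by (rule dvd_m)
  moreover have "\<bar>a - b\<bar> < int n" using assms by linarith
  ultimately show ?thesis using small_dvd[of "a - b"] by simp
qed

lemma content_exists:
  obtains a r where "- int l \<le> a" "a < int n - int l" "x = int m * a + int n * r"
proof -
  have "gcd (int m) (int n) = 1" using cop by simp
  then obtain u v where "u * int m + v * int n = 1" using bezout_int[of "int m" "int n"] by auto
  then have "int m * u - 1 = int n * (- v)" by (simp add: algebra_simps)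
  then have u: "int n dvd int m * u - 1" by (metis dvd_triv_left)
  \<comment> \<open>u inverts m modulo n; the residue of x u is moved into the interval of contents,
    which starts at - l.\<close>
  define a where "a = (x * u + int l) mod int n - int l"
  have a: "- int l \<le> a" "a < int n - int l" using n2 by (auto simp: a_def)
  have "int n dvd (x * u + int l) mod int n - (x * u + int l)"
    by (simp add: mod_eq_dvd_iff[symmetric])
  then have "int n dvd a - x * u" by (simp add: a_def algebra_simps)
  then have "int n dvd int m * (a - x * u) + x * (int m * u - 1)"
    using u by (intro dvd_add dvd_mult)
  then have "int n dvd int m * a - x" by (simp add: algebra_simps)
  then have "int n dvd x - int m * a" by (simp add: dvd_diff_commute)
  then obtain r where "x - int m * a = int n * r" by (auto simp: dvd_def)
  then have "x = int m * a + int n * r" by simp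
  then show thesis by (rule that[OF a])
qed

lemma ct0_surj:
  assumes "- int l \<le> a" "a < int n - int l"
  obtains i where "1 \<le> i" "i \<le> n" "ct0 i = a"
proof (cases "0 \<le> a")
  case True
  show thesis by (rule that[of "nat a + 1"]) (use True assms in \<open>auto simp: ct0_def\<close>)
next
  case False
  show thesis by (rule that[of "nat (int n - int l - a)"]) (use False assms ln in \<open>auto simp: ct0_def\<close>)
qed

lemma aff_P0: "aff n P0"
  unfolding aff_def
proof (intro conjI allI)
  fix z
  obtain i r where i: "1 \<le> i" "i \<le> n" and z: "z = int i + int n * r" by (rule int_rep)
  have "z + int n = int i + int n * (r + 1)" by (simp add: z algebra_simps)
  then have "P0 (z + int n) = int m * ct0 i + int n * (r + 1)" by (simp only: P0_at[OF i])
  moreover have "P0 z = int m * ct0 i + int n * r" by (simp only: z P0_at[OF i])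
  ultimately show "P0 (z + int n) = P0 z + int n" by (simp add: algebra_simps)
next
  show "bij P0"
  proof (rule bijI)
    show "inj P0"
    proof (rule injI)
      fix x y assume eq: "P0 x = P0 y"
      obtain i r where i: "1 \<le> i" "i \<le> n" and x: "x = int i + int n * r" by (rule int_rep)
      obtain j s where j: "1 \<le> j" "j \<le> n" and y: "y = int j + int n * s" by (rule int_rep)
      have e: "int m * ct0 i + int n * r = int m * ct0 j + int n * s"
        using eq by (simp only: x y P0_at[OF i] P0_at[OF j])
      then have "int m * ct0 i - int m * ct0 j = int n * (s - r)" by (simp add: algebra_simps)
      then have "int n dvd int m * ct0 i - int m * ct0 j" by simp
      then have "ct0 i = ct0 j" using ct0_range[OF i] ct0_range[OF j] by (intro content_unique) auto
      then have "i = j" using ct0_inj i j by blast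
      moreover from this have "r = s" using e n2 by simp
      ultimately show "x = y" by (simp add: x y)
    qed
    show "surj P0"
      unfolding surj_def
    proof
      fix x
      obtain a r where a: "- int l \<le> a" "a < int n - int l" and x: "x = int m * a + int n * r"
        by (rule content_exists)
      obtain i where i: "1 \<le> i" "i \<le> n" "ct0 i = a" using ct0_surj[OF a] .
      show "\<exists>z. x = P0 z" using P0_at[OF i(1,2), of r] i(3) x by metis
    qed
  qed
qed

abbreviation pos :: "(int \<Rightarrow> int) \<Rightarrow> int \<Rightarrow> int" where "pos P \<equiv> inv P"

lemma pos_iff: "aff n P \<Longrightarrow> pos P x = i \<longleftrightarrow> P i = x"
  unfolding aff_def by (metis bij_inv_eq_iff)

lemma P_pos: "aff n P \<Longrightarrow> P (pos P x) = x"
  using pos_iff by blast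

lemma pos_per: "aff n P \<Longrightarrow> pos P (x + int n) = pos P x + int n"
  by (simp add: pos_iff aff_per P_pos)

lemma pos_per_mult: "aff n P \<Longrightarrow> pos P (x + int n * r) = pos P x + int n * r"
proof (induction r rule: int_induct[where k = 0])
  case (step1 r)
  then show ?case using pos_per[of P "x + int n * r"] by (simp add: algebra_simps)
next
  case (step2 r)
  then show ?case using pos_per[of P "x + int n * (r - 1)"] by (simp add: algebra_simps)
qed simp

lemma J_pos: "J P \<longleftrightarrow> aff n P \<and> 1 \<le> pos P 0 \<and>
     (\<forall>a. 0 \<le> a \<and> a < int n - int l \<longrightarrow> pos P (int m * a) < pos P (int m * (a + 1))) \<and>
     (\<forall>a. - int l \<le> a \<and> a < 0 \<longrightarrow> pos P (int m * (a + 1)) < pos P (int m * a))"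
proof (cases "aff n P")
  case True
  have e: "P i = x \<longleftrightarrow> i = pos P x" for i x using pos_iff[OF True, of x i] by auto
  show ?thesis unfolding J_def e by auto
qed (simp add: J_def)

lemma J_arm: "J P \<Longrightarrow> 0 \<le> a \<Longrightarrow> a < int n - int l \<Longrightarrow> pos P (int m * a) < pos P (int m * (a + 1))"
  and J_leg: "J P \<Longrightarrow> - int l \<le> a \<Longrightarrow> a < 0 \<Longrightarrow> pos P (int m * (a + 1)) < pos P (int m * a)"
  and J_corner: "J P \<Longrightarrow> 1 \<le> pos P 0"
  unfolding J_pos by blast+

lemma ct0_1: "ct0 1 = 0"
  using ln by (auto simp: ct0_def)

lemma pos_P0: "1 \<le> i \<Longrightarrow> i \<le> n \<Longrightarrow> pos P0 (int m * ct0 i) = int i"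
  by (simp add: pos_iff[OF aff_P0] P0_at')

lemma J_P0: "J P0"
  unfolding J_pos
proof (intro conjI allI impI)
  show "aff n P0" by (rule aff_P0)
  show "1 \<le> pos P0 0" using pos_P0[of 1] n2 by (simp add: ct0_1)
  have arm: "pos P0 (int m * b) = b + 1" if b: "0 \<le> b" "b < int n - int l" for b
  proof -
    have i: "nat b + 1 \<le> n - l" using b by linarith
    then have "ct0 (nat b + 1) = b" using b by (simp add: ct0_def)
    then show ?thesis using pos_P0[of "nat b + 1"] i b by simp
  qed
  have leg: "pos P0 (int m * b) = int n - int l - b" if b: "- int l \<le> b" "b < 0" for b
  proof -
    have i: "\<not> nat (int n - int l - b) \<le> n - l" "1 \<le> nat (int n - int l - b)" "nat (int n - int l - b) \<le> n"
      using b ln by linarith+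
    then have "ct0 (nat (int n - int l - b)) = b" using b ln by (simp add: ct0_def)
    then show ?thesis using pos_P0[OF i(2,3)] b ln by simp
  qed
  fix a
  { assume a: "0 \<le> a \<and> a < int n - int l"
    have p: "pos P0 (int m * a) = a + 1"
      using arm a by blast
    show "pos P0 (int m * a) < pos P0 (int m * (a + 1))"
    proof (cases "a + 1 < int n - int l")
      case True
      then show ?thesis using p arm[of "a + 1"] a by simp
    next
      case False
      then have "a + 1 = int n - int l" using a by linarith
      \<comment> \<open>Beyond the end of the arm comes the end of the leg, moved by m
        periods.\<close>
      then have "int m * (a + 1) = int m * (- int l) + int n * int m" by (simp only:) (simp add: algebra_simps)
      then have "pos P0 (int m * (a + 1)) = pos P0 (int m * (- int l)) + int n * int m"
        by (simp only: pos_per_mult[OF aff_P0])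
      moreover have "1 \<le> pos P0 (int m * (- int l))"
      proof (cases "l = 0")
        case True
        then have "int m * (- int l) = int m * ct0 1" unfolding ct0_1 by simp
        then show ?thesis using pos_P0[of 1] n2 by simp
      next
        case False
        then show ?thesis using leg[of "- int l"] ln by simp
      qed
      moreover have "int n * 1 \<le> int n * int m" using m0 by (intro mult_left_mono) auto
      ultimately show ?thesis using p a by linarith
    qed }
  { assume a: "- int l \<le> a \<and> a < 0"
    have p: "pos P0 (int m * a) = int n - int l - a"
      using leg a by blast
    show "pos P0 (int m * (a + 1)) < pos P0 (int m * a)"
    proof (cases "a = -1")
      case True
      then show ?thesis using p pos_P0[of 1] n2 ln by (simp add: ct0_1)
    next
      case False
      then show ?thesis using p leg[of "a + 1"] a by simp
    qed }
qed

text \<open>The inequalities of J chain outwards from the corner, along the arm and along the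
  leg.\<close>

lemma pos_corner_least:
  assumes "J P" "- int l \<le> a" "a < int n - int l" "a \<noteq> 0"
  shows "pos P 0 < pos P (int m * a)"
proof (cases "0 \<le> a")
  case True
  then have "0 < a" using assms by simp
  then show ?thesis using assms(3)
  proof (induction a rule: int_gr_induct)
    case base
    then show ?case using J_arm[OF assms(1), of 0] by simp
  next
    case (step i)
    then have "pos P (int m * i) < pos P (int m * (i + 1))" using J_arm[OF assms(1), of i] by auto
    then show ?case using step by simp
  qed
next
  case False
  then have "a < 0" by simp
  then show ?thesis using assms(2)
  proof (induction a rule: int_less_induct)
    case base
    then show ?case using J_leg[OF assms(1), of "-1"] by simp
  next
    case (step i)
    then have "pos P (int m * (i - 1 + 1)) < pos P (int m * (i - 1))"
      using J_leg[OF assms(1), of "i - 1"] by auto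
    moreover have "i - 1 + 1 = i" by simp
    ultimately show ?case using step by simp
  qed
qed

lemma W_e0: "W e0"
  using J_P0 by (simp add: W_def e0_def)

text \<open>At distance m the off-diagonal coefficient is zero, so the reflection preserves the line
  of \<open>e0\<close> and acts on it by a sign.\<close>

lemma T_e0:
  assumes i: "1 \<le> i" "i < n" and d: "\<bar>P0 (int i + 1) - P0 (int i)\<bar> = int m"
  shows "T i e0 = (\<lambda>P. of_nat m / of_int (P0 (int i + 1) - P0 (int i)) * e0 P)"
proof
  fix P
  let ?t = "tau n (int i)"
  show "T i e0 P = of_nat m / of_int (P0 (int i + 1) - P0 (int i)) * e0 P"
  proof (cases "aff n P")
    case True
    have 1: "csq m (P (int i + 1) - P (int i)) * e0 (\<lambda>z. P (?t z)) = 0"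
    proof (cases "(\<lambda>z. P (?t z)) = P0")
      case True
      then have "P0 (int i + 1) = P (int i)" "P0 (int i) = P (int i + 1)"
        using fun_cong[OF True, of "int i + 1"] fun_cong[OF True, of "int i"] by (simp_all add: tau_next[OF n2])
      then have "\<bar>P (int i + 1) - P (int i)\<bar> = int m" using d by simp
      then show ?thesis by (simp add: csq_m)
    qed (simp add: e0_def)
    show ?thesis unfolding T_at(1)[OF True] 1 by (simp add: e0_def)
  next
    case False
    then have "P \<noteq> P0" using aff_P0 by blast
    then show ?thesis by (simp add: T_at(2)[OF False] e0_def)
  qed
qed

lemma rho_row_e0: "g permutes {1..n - l} \<Longrightarrow> \<rho> g e0 = e0"
proof (induction g rule: adjacent_induct)
  case (adj i g)
  then have i: "1 \<le> i" "i < n" "Suc i \<le> n - l" by auto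
  have g: "perm g" using adj(3) by (rule permutes_subset) auto
  have "P0 (int i + 1) - P0 (int i) = int m"
    using P0_at'[of i] P0_at'[of "Suc i"] i by (simp add: ct0_def algebra_simps)
  then have "T i e0 = e0" using T_e0[OF i(1,2)] m0 by simp
  then show ?case unfolding rho_adj_comp[OF i(1,2) g] adj(4) .
qed simp

lemma rho_leg_e0: "g permutes {n - l + 1..n} \<Longrightarrow> \<rho> g e0 = (\<lambda>P. of_int (sign g) * e0 P)"
proof (induction g rule: adjacent_induct)
  case id
  then show ?case by (simp add: sign_id[unfolded id_def] sign_id)
next
  case (adj i g)
  then have i: "1 \<le> i" "i < n" "n - l + 1 \<le> i" by auto
  have g: "perm g" using adj(3) by (rule permutes_subset) auto
  have "P0 (int i + 1) - P0 (int i) = - int m"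
    using P0_at'[of i] P0_at'[of "Suc i"] i ln by (simp add: ct0_def algebra_simps)
  then have T: "T i e0 = (\<lambda>P. (-1) * e0 P)" using T_e0[OF i(1,2)] m0 by simp
  have s: "sign (adj i \<circ> g) = - sign g"
  proof -
    have "permutation (adj i)" "permutation g"
      using permutes_imp_permutation[OF finite_atLeastAtMost g] by (simp_all add: permutation_swap_id)
    then show ?thesis by (simp add: sign_compose sign_swap_id)
  qed
  show ?case unfolding rho_adj_comp[OF i(1,2) g] adj(4) T_scale T s by simp
qed

text \<open>Support on weights with exponent vector 0, which plays the part of polynomial degree
  zero.\<close>

definition deg0 :: "affine_fun \<Rightarrow> bool" where
  "deg0 f \<longleftrightarrow> (\<forall>P. f P \<noteq> 0 \<longrightarrow> J P \<and> (\<forall>z\<in>{1..int n}. \<exists>a. - int l \<le> a \<and> a < int n - int l \<and> P z = int m * a))"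

lemma deg0_rho_e0: "perm g \<Longrightarrow> deg0 (\<rho> g e0)"
proof (induction g rule: adjacent_induct)
  case id
  have "\<exists>a. - int l \<le> a \<and> a < int n - int l \<and> P0 z = int m * a" if "z \<in> {1..int n}" for z
    using P0_at'[of "nat z"] ct0_range[of "nat z"] that by (intro exI[of _ "ct0 (nat z)"]) auto
  then show ?case by (simp add: deg0_def e0_def J_P0)
next
  case (adj i g)
  then have i: "1 \<le> i" "i < n" by auto
  have W: "W (T i (\<rho> g e0))" by (intro W_T W_rho W_e0 adj(3) i)
  show ?case unfolding rho_adj_comp[OF i adj(3)] deg0_def
  proof (intro allI impI conjI)
    fix P assume nz: "T i (\<rho> g e0) P \<noteq> 0"
    then show "J P" using W unfolding W_def by blast
    then have a: "aff n P" by (rule J_aff)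
    have "\<rho> g e0 P \<noteq> 0 \<or> \<rho> g e0 (\<lambda>z. P (tau n (int i) z)) \<noteq> 0" using nz by (auto simp: T_at(1)[OF a])
    then show "\<forall>z\<in>{1..int n}. \<exists>a. - int l \<le> a \<and> a < int n - int l \<and> P z = int m * a"
    proof
      assume "\<rho> g e0 P \<noteq> 0"
      then show ?thesis using adj(4) unfolding deg0_def by blast
    next
      assume "\<rho> g e0 (\<lambda>z. P (tau n (int i) z)) \<noteq> 0"
      then have *: "\<forall>z\<in>{1..int n}. \<exists>a. - int l \<le> a \<and> a < int n - int l \<and> P (tau n (int i) z) = int m * a"
        using adj(4) unfolding deg0_def by blast
      show ?thesis
      proof
        fix z assume z: "z \<in> {1..int n}"
        have "tau n (int i) z \<in> {1..int n}"
        proof (cases n "int i" z rule: tau_cases)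
          case 1
          have "z \<noteq> int n" using 1(1) small_dvd[of "int n - int i"] i by auto
          then show ?thesis using z 1 by auto
        next
          case 2
          have "z \<noteq> 1" using 2(2) small_dvd[of "1 - int i - 1"] i by auto
          then show ?thesis using z 2 by auto
        qed (use z in auto)
        then show "\<exists>a. - int l \<le> a \<and> a < int n - int l \<and> P z = int m * a"
          using * tau_invol[OF n2, of "int i" z] by metis
      qed
    qed
  qed
qed

text \<open>The factor of \<open>Psi\<close> is the value of the shifted permutation at position 1,
  which is m times a content. The corner has the least position among the contents and that position
  is at least 1, so the content is 0 and the factor vanishes.\<close>

lemma Psi_deg0: "deg0 f \<Longrightarrow> Psi f = (\<lambda>P. 0)"
proof
  fix P assume f: "deg0 f"
  show "Psi f P = 0"
  proof (cases "f (\<lambda>z. P (z - 1)) = 0")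
    case False
    define Q where "Q = (\<lambda>z. P (z - 1))"
    have Q: "J Q" "\<forall>z\<in>{1..int n}. \<exists>a. - int l \<le> a \<and> a < int n - int l \<and> Q z = int m * a"
      using f False unfolding deg0_def Q_def by blast+
    obtain a where a: "- int l \<le> a" "a < int n - int l" "Q 1 = int m * a" using Q(2) n2 by force
    have "a = 0"
    proof (rule ccontr)
      assume "a \<noteq> 0"
      from pos_corner_least[OF Q(1) a(1,2) this] have "pos Q 0 < 1"
        using pos_iff[OF J_aff[OF Q(1)], of "int m * a" 1] a(3) by simp
      then show False using Q(1) unfolding J_pos by linarith
    qed
    then have "P 0 = 0" using a(3) by (simp add: Q_def)
    then show ?thesis by (simp add: Psi_def)
  qed (simp add: Psi_def)
qed

lemma Y_e0: "i \<in> {1..n} \<Longrightarrow> Y i e0 = (\<lambda>P. 0)"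
  unfolding Y_def fam_def Y1_def
  by (simp add: Psi_deg0[OF deg0_rho_e0] perm_transpose[OF one_two(1)] rho_zero perm_wc)

lemma X_zero: "i \<in> {1..n} \<Longrightarrow> X i (\<lambda>P. 0) = (\<lambda>P. 0)"
  using opl_linear(2)[of "LX i" 0] by simp

lemma c_nonzero: "c \<noteq> 0"
  using m0 n2 by (simp add: c_def)

text \<open>Read off from u_i: since y_i kills \<open>e0\<close>, u_i reduces to - c times the
  Jucys-Murphy sum, while its eigenvalue is - c times the content, and c is nonzero.\<close>

lemma JM_e0:
  assumes "1 \<le> i" "i \<le> n"
  shows "(\<Sum>j\<in>{1..<i}. \<rho> (Transposition.transpose i j) e0 P) = of_int (ct0 i) * e0 P"
proof -
  have "U i e0 P = - c * of_int (ct0 i) * e0 P"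
    using P0_at'[OF assms] by (simp add: U_def e0_def c_def)
  moreover have "U i e0 P = - c * (\<Sum>j\<in>{1..<i}. \<rho> (Transposition.transpose i j) e0 P)"
    using assms by (simp add: U_eq[OF assms W_affsupp[OF W_e0]] Y_e0 X_zero)
  ultimately show ?thesis using c_nonzero by simp
qed

end

section \<open>Young symmetrizers of hooks\<close>

lemma eq_neg_self:
  fixes x :: "wperm \<Rightarrow>\<^sub>0 complex" assumes "x = - x" shows "x = 0"
proof (rule poly_mapping_eqI)
  fix p
  have "Poly_Mapping.lookup x p = - Poly_Mapping.lookup x p"
    by (metis assms lookup_uminus)
  then show "Poly_Mapping.lookup x p = Poly_Mapping.lookup 0 p" by simp
qed

definition CS :: "nat \<Rightarrow> (wperm \<Rightarrow>\<^sub>0 complex) set" where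
  "CS n = {s. \<forall>p\<in>Poly_Mapping.keys s. wp_word p = [] \<and> wp_perm p permutes {1..n}}"

lemma CS_FC: "s \<in> CS n \<Longrightarrow> s \<in> FC n"
  by (auto simp: CS_def FC_iff okp_def)

lemma CS_add: "s \<in> CS n \<Longrightarrow> t \<in> CS n \<Longrightarrow> s + t \<in> CS n"
  using Poly_Mapping.keys_add[of s t] by (auto simp: CS_def)

lemma CS_zero: "0 \<in> CS n"
  by (simp add: CS_def)

lemma CS_mult: "s \<in> CS n \<Longrightarrow> t \<in> CS n \<Longrightarrow> s * t \<in> CS n"
  using keys_mult[of s t] by (fastforce simp: CS_def plus_wperm_def permutes_compose)

lemma CS_sum: "(\<And>i. i \<in> S \<Longrightarrow> f i \<in> CS n) \<Longrightarrow> sum f S \<in> CS n"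
  by (induction S rule: infinite_finite_induct) (auto simp: CS_zero CS_add)

lemma CS_sg: "g permutes {1..n} \<Longrightarrow> sg g \<in> CS n"
  by (auto simp: sg_def CS_def)

lemma CS_scalar: "scalar z \<in> CS n"
  by (cases "z = 0") (auto simp: scalar_def CS_def zero_wperm_def permutes_id)

lemma CS_uminus: "s \<in> CS n \<Longrightarrow> - s \<in> CS n"
  by (simp add: CS_def in_keys_iff)

lemma CS_diff: "s \<in> CS n \<Longrightarrow> t \<in> CS n \<Longrightarrow> s - t \<in> CS n"
  using CS_add[of s n "- t"] CS_uminus[of t n] by simp

lemma CS_induct [consumes 1, case_names zero single add]:
  assumes "s \<in> CS n" "Q 0" "\<And>g z. g permutes {1..n} \<Longrightarrow> Q (scalar z * sg g)"
    "\<And>s t. Q s \<Longrightarrow> Q t \<Longrightarrow> Q (s + t)"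
  shows "Q s"
proof -
  have "\<forall>p\<in>Poly_Mapping.keys s. wp_word p = [] \<and> wp_perm p permutes {1..n}"
    using assms(1) by (simp add: CS_def)
  then show ?thesis
  proof (induction s rule: poly_mapping_span_induct)
    case (single p z)
    have "p = WPerm [] (wp_perm p)" using single by (cases p) simp
    then have "Poly_Mapping.single p z = scalar z * sg (wp_perm p)"
      using single_times_eq[of p z] by (simp add: sg_def)
    then show ?case using assms(3) single by simp
  qed (use assms in auto)
qed

context hook_model
begin

section \<open>Row sum and signed column sum of the hook\<close>

abbreviation (input) k :: nat where "k \<equiv> n - l"

lemma k_bounds: "1 \<le> k" "k \<le> n" "2 \<le> k"
  using ln by auto

definition colset :: "nat set" where "colset = insert 1 {n - l + 1..n}"

definition ra :: "wperm \<Rightarrow>\<^sub>0 complex" where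
  "ra = (\<Sum>g\<in>{g. g permutes {1..n - l}}. sg g)"

definition rb :: "wperm \<Rightarrow>\<^sub>0 complex" where
  "rb = (\<Sum>g\<in>{g. g permutes colset}. scalar (of_int (sign g)) * sg g)"

definition JM :: "nat \<Rightarrow> wperm \<Rightarrow>\<^sub>0 complex" where
  "JM i = (\<Sum>j\<in>{1..<i}. transp i j)"

lemma colset_sub: "colset \<subseteq> {1..n}" "finite colset"
  using ln by (auto simp: colset_def)

lemma perm_row: "g permutes {1..n - l} \<Longrightarrow> perm g"
  by (erule permutes_subset) auto

lemma perm_col: "g permutes colset \<Longrightarrow> perm g"
  by (erule permutes_subset) (rule colset_sub)

lemma CS_ra: "ra \<in> CS n"
  unfolding ra_def by (auto intro!: CS_sum CS_sg perm_row)

lemma CS_rb: "rb \<in> CS n"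
  unfolding rb_def by (auto intro!: CS_sum CS_mult CS_scalar CS_sg perm_col)

lemma ra_mult: "h permutes {1..n - l} \<Longrightarrow> ra * sg h = ra"
  unfolding ra_def sum_distrib_right sg_mult by (rule sum_permutations_compose_right[symmetric])

lemma mult_ra: "h permutes {1..n - l} \<Longrightarrow> sg h * ra = ra"
  unfolding ra_def sum_distrib_left sg_mult by (rule setum_permutations_compose_left[symmetric])

lemma scalar_sg_left: "sg h * (scalar z * x) = scalar z * (sg h * x)"
  by (metis mult.assoc scalar_mult_commute)

lemma mult_rb: "h permutes colset \<Longrightarrow> sg h * rb = scalar (of_int (sign h)) * rb"
proof -
  assume h: "h permutes colset"
  have p: "permutation g" if "g permutes colset" for g
    using that permutes_imp_permutation[OF colset_sub(2)] by blast
  have "scalar (of_int (sign h)) * rb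
      = (\<Sum>g\<in>{g. g permutes colset}. scalar (of_int (sign h)) * (scalar (of_int (sign (h \<circ> g))) * sg (h \<circ> g)))"
    unfolding rb_def sum_distrib_left
    using setum_permutations_compose_left[OF h, of "\<lambda>g. scalar (of_int (sign h)) * (scalar (of_int (sign g)) * sg g)"] .
  also have "\<dots> = (\<Sum>g\<in>{g. g permutes colset}. sg h * (scalar (of_int (sign g)) * sg g))"
  proof (rule sum.cong[OF refl])
    fix g assume g: "g \<in> {g. g permutes colset}"
    have "sign h * sign (h \<circ> g) = sign g"
      using g h p by (simp add: sign_compose mult.assoc[symmetric])
    then have "scalar (of_int (sign h)) * scalar (of_int (sign (h \<circ> g))) = scalar (of_int (sign g))"
      by (metis of_int_mult scalar_mult)
    then show "scalar (of_int (sign h)) * (scalar (of_int (sign (h \<circ> g))) * sg (h \<circ> g))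
        = sg h * (scalar (of_int (sign g)) * sg g)"
      by (simp add: mult.assoc[symmetric]) (simp add: mult.assoc sg_mult scalar_sg_left)
  qed
  finally show ?thesis by (simp add: rb_def sum_distrib_left)
qed

lemma transp_rb:
  assumes "i \<in> colset" "j \<in> colset" "i \<noteq> j" shows "transp i j * rb = - rb"
  using mult_rb[OF permutes_swap_id[OF assms(1,2)]] assms(3)
  by (simp add: transp_sg sign_swap_id scalar_minus scalar_1)

text \<open>A transposition of the row group, absorbed by \<open>ra\<close>, becomes one of the
  column group when moved past g, and \<open>rb\<close> absorbs that with sign -1; the product is
  its own negative.\<close>

lemma vanish:
  assumes "perm g" "p \<in> colset" "q \<in> colset" "p \<noteq> q" "g p \<in> {1..n - l}" "g q \<in> {1..n - l}"
  shows "ra * sg g * rb = 0"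
proof -
  let ?t = "Transposition.transpose (g p) (g q)"
  have t: "?t permutes {1..n - l}" by (rule permutes_swap_id[OF assms(5,6)])
  have tg: "?t \<circ> g = g \<circ> Transposition.transpose p q"
    using transpose_conj[OF permutes_bij[OF assms(1)], of p q] by simp
  have "ra * sg g * rb = ra * sg ?t * sg g * rb" by (simp add: ra_mult[OF t])
  also have "\<dots> = ra * sg (?t \<circ> g) * rb" by (simp add: mult.assoc sg_mult)
  also have "\<dots> = ra * sg g * (transp p q * rb)"
    unfolding tg transp_sg by (simp add: mult.assoc sg_mult flip: sg_mult)
  also have "\<dots> = - (ra * sg g * rb)" by (simp add: transp_rb[OF assms(2-4)])
  finally show ?thesis by (rule eq_neg_self)
qed

text \<open>The classical dichotomy for Young symmetrizers. If no two column entries land in the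
  row, exactly one does, because the column has one entry more than the leg. Corrected on both
  sides, the permutation preserves leg and row and factors through the two stabilizers.\<close>

lemma ra_sg_rb:
  assumes g: "perm g"
  shows "\<exists>z. ra * sg g * rb = scalar z * (ra * rb)"
proof (cases "\<exists>p\<in>colset. \<exists>q\<in>colset. p \<noteq> q \<and> g p \<in> {1..n - l} \<and> g q \<in> {1..n - l}")
  case True
  then have "ra * sg g * rb = 0" using vanish[OF g] by blast
  then show ?thesis by (intro exI[of _ 0]) (simp add: scalar_0)
next
  case False
  have in_n: "g x \<in> {1..n}" if "x \<in> {1..n}" for x using permutes_in_image[OF g] that by simp
  have ginj: "inj g" using g by (rule permutes_inj)
  have "\<exists>p\<in>colset. g p \<in> {1..n - l}"
  proof (rule ccontr)
    assume *: "\<not> ?thesis"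
    have "g ` colset \<subseteq> {n - l + 1..n}"
    proof
      fix y assume "y \<in> g ` colset"
      then obtain x where x: "x \<in> colset" "y = g x" by blast
      then have "g x \<in> {1..n}" "g x \<notin> {1..n - l}" using in_n colset_sub(1) * by blast+
      then show "y \<in> {n - l + 1..n}" using x by auto
    qed
    then have "card (g ` colset) \<le> card {n - l + 1..n}" by (intro card_mono) auto
    moreover have "card (g ` colset) = card colset"
      by (rule card_image) (rule inj_on_subset[OF ginj], simp)
    moreover have "card colset = Suc (card {n - l + 1..n})"
      unfolding colset_def using k_bounds by (subst card_insert_disjoint) auto
    ultimately show False by simp
  qed
  then obtain p where p: "p \<in> colset" "g p \<in> {1..n - l}" by blast
  \<comment> \<open>\<open>t2\<close> takes 1 to p and \<open>t1\<close> takes \<open>g p\<close>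
    back to 1; the rest of the column then has to go to the leg.\<close>
  define t1 where "t1 = Transposition.transpose 1 (g p)"
  define t2 where "t2 = Transposition.transpose 1 p"
  have one: "1 \<in> colset" "1 \<in> {1..n - l}" using k_bounds by (auto simp: colset_def)
  have t1: "t1 permutes {1..n - l}" unfolding t1_def by (rule permutes_swap_id[OF one(2) p(2)])
  have t2: "t2 permutes colset" unfolding t2_def by (rule permutes_swap_id[OF one(1) p(1)])
  define h where "h = t1 \<circ> g \<circ> t2"
  have h: "perm h" unfolding h_def
    by (intro permutes_compose g perm_row[OF t1] perm_col[OF t2])
  have hinj: "inj h" using h by (rule permutes_inj)
  have leg: "h x \<in> {n - l + 1..n}" if x: "x \<in> {n - l + 1..n}" for x
  proof -
    have x1: "x \<in> colset" "x \<noteq> 1" using x k_bounds by (auto simp: colset_def)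
    have "t2 x \<in> colset" using permutes_in_image[OF t2] x1 by blast
    moreover have "t2 x \<noteq> p" using x1(2) unfolding t2_def Transposition.transpose_def by auto
    ultimately have "g (t2 x) \<notin> {1..n - l}" using False p by metis
    then have "t1 (g (t2 x)) = g (t2 x)" using t1 by (simp add: permutes_def)
    moreover have "g (t2 x) \<in> {1..n}" using in_n \<open>t2 x \<in> colset\<close> colset_sub(1) by blast
    ultimately show ?thesis using \<open>g (t2 x) \<notin> {1..n - l}\<close> by (auto simp: h_def)
  qed
  have img: "h ` {n - l + 1..n} = {n - l + 1..n}"
    by (rule endo_inj_surj) (use leg inj_on_subset[OF hinj, of "{n - l + 1..n}"] in auto)
  have row: "h x \<in> {1..n - l}" if x: "x \<in> {1..n - l}" for x
  proof (rule ccontr)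
    assume "h x \<notin> {1..n - l}"
    moreover have "x \<in> {1..n}" using x by auto
    then have "h x \<in> {1..n}" using permutes_in_image[OF h, of x] by blast
    ultimately have "h x \<in> h ` {n - l + 1..n}" using img by auto
    then have "x \<in> {n - l + 1..n}" using hinj by (auto simp: inj_image_mem_iff inj_eq)
    then show False using x by auto
  qed
  define r where "r x = (if x \<in> {1..n - l} then h x else x)" for x
  define q where "q x = (if x \<in> {n - l + 1..n} then h x else x)" for x
  have r: "r permutes {1..n - l}"
  proof (rule inj_imp_permutes)
    show "inj_on r {1..n - l}" by (auto simp: r_def inj_on_def inj_eq[OF hinj])
    show "r x \<in> {1..n - l}" if "x \<in> {1..n - l}" for x
      unfolding r_def if_P[OF that] by (rule row[OF that])
  qed (auto simp: r_def)
  have q: "q permutes colset"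
  proof -
    have "q permutes {n - l + 1..n}"
    proof (rule inj_imp_permutes)
      show "inj_on q {n - l + 1..n}" by (auto simp: q_def inj_on_def inj_eq[OF hinj])
      show "q x \<in> {n - l + 1..n}" if "x \<in> {n - l + 1..n}" for x
        unfolding q_def if_P[OF that] by (rule leg[OF that])
    qed (auto simp: q_def)
    then show ?thesis by (rule permutes_subset) (auto simp: colset_def)
  qed
  have hrq: "h = r \<circ> q"
  proof
    fix x
    consider "x \<in> {1..n - l}" | "x \<in> {n - l + 1..n}" | "x \<notin> {1..n}" by fastforce
    then show "h x = (r \<circ> q) x"
    proof cases
      case 1 then show ?thesis by (auto simp: r_def q_def)
    next
      case 2
      then show ?thesis using leg[OF 2] by (auto simp: r_def q_def)
    next
      case 3
      then have "h x = x" using h by (simp add: permutes_def)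
      then show ?thesis using 3 by (auto simp: r_def q_def)
    qed
  qed
  have "t1 \<circ> t1 = id" "t2 \<circ> t2 = id" by (simp_all add: t1_def t2_def)
  then have gh: "g = (t1 \<circ> r) \<circ> (q \<circ> t2)"
    using hrq unfolding h_def by (metis comp_assoc comp_id id_comp)
  have "ra * sg g * rb = (ra * sg (t1 \<circ> r)) * (sg (q \<circ> t2) * rb)"
    by (simp only: gh sg_mult[symmetric] mult.assoc)
  also have "\<dots> = scalar (of_int (sign (q \<circ> t2))) * (ra * rb)"
    unfolding ra_mult[OF permutes_compose[OF r t1]] mult_rb[OF permutes_compose[OF t2 q]]
    by (metis mult.assoc scalar_mult_commute)
  finally show ?thesis by blast
qed

lemma ra_CS_rb: "s \<in> CS n \<Longrightarrow> \<exists>z. ra * s * rb = scalar z * (ra * rb)"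
proof (induction s rule: CS_induct)
  case zero
  show ?case by (intro exI[of _ 0]) (simp add: scalar_0)
next
  case (single g z)
  obtain y where "ra * sg g * rb = scalar y * (ra * rb)" using ra_sg_rb[OF single] by blast
  moreover have "ra * (scalar z * sg g) * rb = scalar z * (ra * sg g * rb)"
    by (metis mult.assoc scalar_mult_commute)
  ultimately have "ra * (scalar z * sg g) * rb = scalar (z * y) * (ra * rb)"
    by (simp add: scalar_mult mult.assoc)
  then show ?case by blast
next
  case (add s t)
  then obtain y z where "ra * s * rb = scalar y * (ra * rb)" "ra * t * rb = scalar z * (ra * rb)" by blast
  then have "ra * (s + t) * rb = scalar (y + z) * (ra * rb)"
    by (simp add: distrib_left distrib_right scalar_add)
  then show ?case by blast
qed

lemma sum_neg_one: "finite S \<Longrightarrow> (\<Sum>j\<in>S. - x) = scalar (- of_nat (card S)) * (x :: wperm \<Rightarrow>\<^sub>0 complex)"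
  by (induction S rule: finite_induct)
    (simp_all add: scalar_0 scalar_minus scalar_add scalar_diff scalar_1 algebra_simps del: sum_constant)

lemma sum_one: "finite S \<Longrightarrow> (\<Sum>j\<in>S. x) = scalar (of_nat (card S)) * (x :: wperm \<Rightarrow>\<^sub>0 complex)"
  by (induction S rule: finite_induct)
    (simp_all add: scalar_0 scalar_add scalar_1 algebra_simps del: sum_constant)

text \<open>For i in the row every transposition is absorbed by \<open>ra\<close>. For i in the leg,
  the sum of the transpositions with row entries commutes with \<open>ra\<close>; between
  \<open>ra\<close> and \<open>rb\<close> only (i 1) survives, with sign -1, and each earlier leg
  entry contributes another -1. The total is the content.\<close>

lemma JM_young:
  assumes i: "1 \<le> i" "i \<le> n"
  shows "JM i * (ra * rb) = scalar (of_int (ct0 i)) * (ra * rb)"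
proof (cases "i \<le> n - l")
  case True
  have "transp i j * ra = ra" if "j \<in> {1..<i}" for j
    unfolding transp_sg using that True i by (intro mult_ra permutes_swap_id) auto
  then have "JM i * ra = (\<Sum>j\<in>{1..<i}. ra)" by (simp add: JM_def sum_distrib_right)
  also have "\<dots> = scalar (of_nat (card {1..<i})) * ra" by (rule sum_one) simp
  also have "of_nat (card {1..<i}) = (of_int (ct0 i) :: complex)" using True i by (simp add: ct0_def of_nat_diff)
  finally show ?thesis by (simp add: mult.assoc[symmetric])
next
  case False
  define D where "D = (\<Sum>j\<in>{1..n - l}. transp i j)"
  have ic: "i \<in> colset" using False i by (auto simp: colset_def)
  have gi: "g i = i" if "g permutes {1..n - l}" for g using that False by (auto simp: permutes_def)
  have Dg: "D * sg g = sg g * D" if g: "g permutes {1..n - l}" for g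
  proof -
    have "sg g * D = (\<Sum>j\<in>{1..n - l}. transp i (g j) * sg g)"
      unfolding D_def sum_distrib_left transp_sg sg_mult
        transpose_conj[OF permutes_bij[OF g]] gi[OF g] ..
    also have "\<dots> = (\<Sum>j\<in>{1..n - l}. transp i j * sg g)"
      by (rule sum.reindex_bij_betw[OF permutes_imp_bij[OF g], where g = "\<lambda>j. transp i j * sg g"])
    finally show ?thesis by (simp add: D_def sum_distrib_right)
  qed
  have Dra: "D * ra = ra * D"
    unfolding ra_def sum_distrib_left sum_distrib_right by (rule sum.cong) (use Dg in auto)
  have legs: "transp i j * ra = ra * transp i j" if j: "j \<in> {n - l + 1..<i}" for j
  proof -
    have "transp i j * sg g = sg g * transp i j" if g: "g permutes {1..n - l}" for g
    proof -
      have "g j = j" using g j by (auto simp: permutes_def)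
      then show ?thesis using transpose_conj[OF permutes_bij[OF g], of i j] gi[OF g]
        by (simp add: transp_sg sg_mult)
    qed
    then show ?thesis
      unfolding ra_def sum_distrib_left sum_distrib_right by (intro sum.cong) auto
  qed
  have set_split: "{1..<i} = {1..n - l} \<union> {n - l + 1..<i}" using False k_bounds by auto
  have "JM i = D + (\<Sum>j\<in>{n - l + 1..<i}. transp i j)"
    unfolding JM_def D_def set_split by (rule sum.union_disjoint) auto
  then have "JM i * (ra * rb) = D * ra * rb + (\<Sum>j\<in>{n - l + 1..<i}. transp i j * ra * rb)"
    by (simp add: distrib_right sum_distrib_right mult.assoc)
  also have "(\<Sum>j\<in>{n - l + 1..<i}. transp i j * ra * rb) = (\<Sum>j\<in>{n - l + 1..<i}. - (ra * rb))"
  proof (rule sum.cong[OF refl])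
    fix j assume j: "j \<in> {n - l + 1..<i}"
    then have "j \<in> colset" "i \<noteq> j" using i by (auto simp: colset_def)
    then show "transp i j * ra * rb = - (ra * rb)"
      using transp_rb[OF ic, of j] by (simp add: legs[OF j] mult.assoc)
  qed
  also have "\<dots> = scalar (- of_nat (i - (n - l + 1))) * (ra * rb)" using sum_neg_one[of "{n - l + 1..<i}"] by simp
  also have "D * ra * rb = (\<Sum>j\<in>{1..n - l}. ra * transp i j * rb)"
    unfolding Dra by (simp add: D_def sum_distrib_left sum_distrib_right)
  also have "\<dots> = ra * transp i 1 * rb + (\<Sum>j\<in>{1..n - l} - {1}. ra * transp i j * rb)"
    using k_bounds by (subst sum.remove[of _ 1]) auto
  also have "(\<Sum>j\<in>{1..n - l} - {1}. ra * transp i j * rb) = 0"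
  proof (rule sum.neutral, rule ballI)
    fix j assume j: "j \<in> {1..n - l} - {1}"
    \<comment> \<open>This transposition fixes 1 and sends i to j, so two column entries land in the
      row.\<close>
    show "ra * transp i j * rb = 0" unfolding transp_sg
    proof (rule vanish[of _ 1 i])
      show "perm (Transposition.transpose i j)" using i j by (intro perm_transpose) auto
      have "Transposition.transpose i j 1 = 1" using j i False k_bounds by (intro transpose_apply_other) auto
      then show "Transposition.transpose i j 1 \<in> {1..n - l}" using k_bounds by auto
    qed (use j ic False k_bounds in \<open>auto simp: colset_def\<close>)
  qed
  also have "ra * transp i 1 * rb = - (ra * rb)"
    using transp_rb[OF ic, of 1] False k_bounds by (simp add: mult.assoc colset_def)
  also have "- (ra * rb) + 0 + scalar (- of_nat (i - (n - l + 1))) * (ra * rb)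
      = scalar (- 1 + (- of_nat (i - (n - l + 1)))) * (ra * rb)"
    by (simp only: scalar_add scalar_minus scalar_1 distrib_right) simp
  also have "- 1 + (- of_nat (i - (n - l + 1))) = (of_int (ct0 i) :: complex)"
  proof -
    have "- 1 + (- int (i - (n - l + 1))) = ct0 i" using False ln by (simp add: ct0_def of_nat_diff)
    then show ?thesis by (metis of_int_add of_int_minus of_int_1 of_int_of_nat_eq)
  qed
  finally show ?thesis .
qed

text \<open>The product n l! (n - l - 1)! of the hook lengths, in the form in which the computation
  delivers it.\<close>

definition youngL :: complex where
  "youngL = of_nat (fact l) * (of_nat (fact (n - l)) * (1 + of_nat l / of_nat (n - l)))"

lemma youngL_nonzero: "youngL \<noteq> 0"
proof -
  have "(of_nat (n - l) :: complex) \<noteq> 0" using k_bounds by simp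
  moreover have "(of_nat (n - l) :: complex) + of_nat l \<noteq> 0"
    using k_bounds by (simp only: of_nat_add[symmetric] of_nat_eq_0_iff)
  ultimately have "1 + of_nat l / of_nat (n - l) \<noteq> (0 :: complex)" by (simp add: field_simps)
  then show ?thesis by (simp add: youngL_def)
qed

lemma act_ra: "act ra f P = (\<Sum>g\<in>{g. g permutes {1..n - l}}. \<rho> g f P)"
  by (simp add: ra_def act_sum act_sg)

lemma act_ra_e0: "act ra e0 P = of_nat (fact (n - l)) * e0 P"
  by (simp add: act_ra rho_row_e0 card_permutations)

text \<open>The transpositions of b with row entries are conjugate under the row group, which fixes
  \<open>e0\<close>, so after \<open>ra\<close> they all give the same vector. Their sum on
  \<open>e0\<close> is the content of b minus the contributions -1 of the earlier leg entries, that
  is, -1; division by n - l gives the constant.\<close>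

lemma act_ra_transp_e0:
  assumes b: "b \<in> {n - l + 1..n}"
  shows "act ra (\<rho> (Transposition.transpose 1 b) e0) P = - (of_nat (fact (n - l)) / of_nat (n - l)) * e0 P"
proof -
  let ?v = "act ra (\<rho> (Transposition.transpose 1 b) e0) P"
  have bn: "b \<in> {1..n}" using b by auto
  have 1: "act ra (\<rho> (Transposition.transpose b i) e0) P = ?v" if i: "i \<in> {1..n - l}" for i
  proof -
    let ?t = "Transposition.transpose 1 i"
    have t: "?t permutes {1..n - l}" using i k_bounds by (intro permutes_swap_id) auto
    have "?t \<circ> Transposition.transpose 1 b = Transposition.transpose b i \<circ> ?t"
      using transpose_conj[of ?t 1 b] b i by (auto simp: transpose_commute)
    then have "\<rho> (Transposition.transpose b i) e0 = \<rho> ?t (\<rho> (Transposition.transpose 1 b) e0)"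
      using rho_comp[OF perm_row[OF t] perm_transpose[OF one_two(1) bn]] rho_row_e0[OF t] i
        rho_comp[OF perm_transpose[OF bn, of i] perm_row[OF t], of e0] by auto
    then have "act ra (\<rho> (Transposition.transpose b i) e0) = act (ra * sg ?t) (\<rho> (Transposition.transpose 1 b) e0)"
      by (simp add: act_mult CS_FC[OF CS_ra] FC_sg[OF perm_row[OF t]] act_sg)
    then show ?thesis by (simp add: ra_mult[OF t])
  qed
  have split: "{1..<b} = {1..n - l} \<union> {n - l + 1..<b}" using b k_bounds by auto
  have leg: "(\<Sum>i\<in>{n - l + 1..<b}. \<rho> (Transposition.transpose b i) e0 P) = - of_nat (b - (n - l + 1)) * e0 P" for P
  proof -
    have "\<rho> (Transposition.transpose b i) e0 P = - e0 P" if "i \<in> {n - l + 1..<b}" for i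
    proof -
      have "Transposition.transpose b i permutes {n - l + 1..n}" using that b by (intro permutes_swap_id) auto
      from rho_leg_e0[OF this] show ?thesis using that by (simp add: sign_swap_id)
    qed
    then show ?thesis by simp
  qed
  have disj: "{1..n - l} \<inter> {n - l + 1..<b} = {}" by auto
  have "(\<Sum>i\<in>{1..n - l}. \<rho> (Transposition.transpose b i) e0 P) = - e0 P" for P
  proof -
    have "of_int (ct0 b) * e0 P = (\<Sum>i\<in>{1..n - l}. \<rho> (Transposition.transpose b i) e0 P)
        + (\<Sum>i\<in>{n - l + 1..<b}. \<rho> (Transposition.transpose b i) e0 P)"
      using JM_e0[of b P] b unfolding split
        sum.union_disjoint[OF finite_atLeastAtMost finite_atLeastLessThan disj] by simp
    then have "(\<Sum>i\<in>{1..n - l}. \<rho> (Transposition.transpose b i) e0 P)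
        = (of_int (ct0 b) + of_nat (b - (n - l + 1))) * e0 P"
      unfolding leg by (simp add: algebra_simps)
    also have "of_int (ct0 b) + of_nat (b - (n - l + 1)) = (- 1 :: complex)"
    proof -
      have "\<not> b \<le> n - l" using b by auto
      then have "ct0 b + int (b - (n - l + 1)) = - 1" using b ln by (simp add: ct0_def of_nat_diff)
      then show ?thesis by (metis of_int_add of_int_minus of_int_1 of_int_of_nat_eq)
    qed
    finally show ?thesis by simp
  qed
  then have "(\<lambda>P. \<Sum>i\<in>{1..n - l}. \<rho> (Transposition.transpose b i) e0 P) = (\<lambda>P. (-1) * e0 P)" by auto
  then have "act ra (\<lambda>P. \<Sum>i\<in>{1..n - l}. \<rho> (Transposition.transpose b i) e0 P) P = - of_nat (fact (n - l)) * e0 P"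
    using act_linear(2)[OF CS_FC[OF CS_ra], of "-1" e0] act_ra_e0[of P] by simp
  moreover have "act ra (\<lambda>P. \<Sum>i\<in>S. h i P) P = (\<Sum>i\<in>S. act ra (h i) P)" if "finite S" for S :: "nat set" and h
    using that by (induction S rule: finite_induct)
      (use act_linear[OF CS_FC[OF CS_ra]] act_linear(2)[OF CS_FC[OF CS_ra], of 0] in simp_all)
  ultimately have "(\<Sum>i\<in>{1..n - l}. act ra (\<rho> (Transposition.transpose b i) e0) P) = - of_nat (fact (n - l)) * e0 P"
    by simp
  then have "of_nat (n - l) * ?v = - of_nat (fact (n - l)) * e0 P" using 1 by simp
  then show ?thesis using k_bounds by (simp add: field_simps)
qed

text \<open>The column group is decomposed into cosets of the leg group, on which \<open>e0\<close>
  is alternating; the representatives are the identity and the transpositions (1 b).\<close>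

lemma act_rb_e0:
  "act rb e0 = (\<lambda>P. of_nat (fact l) * (e0 P - 1 * (\<Sum>b\<in>{n - l + 1..n}. \<rho> (Transposition.transpose 1 b) e0 P)))"
proof
  fix P
  let ?S = "{n - l + 1..n}"
  have 1: "1 \<notin> ?S" using k_bounds by auto
  let ?F = "\<lambda>g. of_int (sign g) * \<rho> g e0 P"
  have F: "?F (Transposition.transpose 1 b \<circ> q) = of_int (sign (Transposition.transpose 1 b)) * \<rho> (Transposition.transpose 1 b) e0 P"
    if b: "b \<in> insert 1 ?S" and q: "q permutes ?S" for b q
  proof -
    have pb: "perm (Transposition.transpose 1 b)" using b n2 by (intro perm_transpose) auto
    have pq: "perm q" using q by (rule permutes_subset) auto
    have s: "sign (Transposition.transpose 1 b \<circ> q) = sign (Transposition.transpose 1 b) * sign q"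
      using permutes_imp_permutation[OF finite_atLeastAtMost pq] by (intro sign_compose permutation_swap_id)
    have "\<rho> (Transposition.transpose 1 b \<circ> q) e0 P = of_int (sign q) * \<rho> (Transposition.transpose 1 b) e0 P"
      unfolding rho_comp[OF pb pq] rho_leg_e0[OF q] rho_scale[OF pb] ..
    moreover have "(of_int (sign q) :: complex) * of_int (sign q) = 1"
      by (simp flip: of_int_mult)
    ultimately show ?thesis unfolding s by (simp add: mult_ac)
  qed
  have "act rb e0 P = (\<Sum>g\<in>{g. g permutes insert 1 ?S}. ?F g)"
    unfolding rb_def colset_def[symmetric] act_sum
    by (rule sum.cong) (simp_all add: act_scalar_mult[OF FC_sg[OF perm_col]] act_sg)
  also have "\<dots> = (\<Sum>b\<in>insert 1 ?S. \<Sum>q\<in>{q. q permutes ?S}. ?F (Transposition.transpose 1 b \<circ> q))"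
    by (rule sum_over_permutations_insert[OF finite_atLeastAtMost 1])
  also have "\<dots> = (\<Sum>b\<in>insert 1 ?S. of_nat (fact l) * (of_int (sign (Transposition.transpose 1 b)) * \<rho> (Transposition.transpose 1 b) e0 P))"
  proof (rule sum.cong[OF refl])
    fix b assume b: "b \<in> insert 1 ?S"
    have "card {q. q permutes ?S} = fact l" using ln by (subst card_permutations[of _ l]) auto
    then show "(\<Sum>q\<in>{q. q permutes ?S}. ?F (Transposition.transpose 1 b \<circ> q))
        = of_nat (fact l) * (of_int (sign (Transposition.transpose 1 b)) * \<rho> (Transposition.transpose 1 b) e0 P)"
      using F[OF b] by simp
  qed
  also have "\<dots> = of_nat (fact l) * (e0 P + (\<Sum>b\<in>?S. of_int (sign (Transposition.transpose 1 b)) * \<rho> (Transposition.transpose 1 b) e0 P))"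
    using 1 by (simp add: sum_distrib_left distrib_left)
  also have "(\<Sum>b\<in>?S. of_int (sign (Transposition.transpose 1 b)) * \<rho> (Transposition.transpose 1 b) e0 P)
      = (\<Sum>b\<in>?S. - \<rho> (Transposition.transpose 1 b) e0 P)"
    by (rule sum.cong) (use 1 in \<open>auto simp: sign_swap_id\<close>)
  finally show "act rb e0 P = of_nat (fact l) * (e0 P - 1 * (\<Sum>b\<in>{n - l + 1..n}. \<rho> (Transposition.transpose 1 b) e0 P))"
    by (simp add: sum_negf)
qed

lemma act_young: "act (ra * rb) e0 = (\<lambda>P. youngL * e0 P)"
proof
  fix P
  let ?S = "{n - l + 1..n}"
  note lin = act_linear[OF CS_FC[OF CS_ra]]
  have sum: "act ra (\<lambda>P. \<Sum>i\<in>S. h i P) = (\<lambda>P. \<Sum>i\<in>S. act ra (h i) P)" if "finite S" for S :: "nat set" and h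
    using that by (induction S rule: finite_induct) (use lin lin(2)[of 0] in simp_all)
  let ?G = "\<lambda>P. \<Sum>b\<in>?S. \<rho> (Transposition.transpose 1 b) e0 P"
  have "act (ra * rb) e0 P = of_nat (fact l) * act ra (\<lambda>P. e0 P + (-1) * ?G P) P"
    unfolding act_mult[OF CS_FC[OF CS_ra] CS_FC[OF CS_rb]] act_rb_e0 lin(2) by simp
  also have "act ra (\<lambda>P. e0 P + (-1) * ?G P) P = act ra e0 P - (\<Sum>b\<in>?S. act ra (\<rho> (Transposition.transpose 1 b) e0) P)"
    unfolding lin(1)[of e0 "\<lambda>P. (-1) * ?G P"] lin(2)[of "-1" ?G] sum[OF finite_atLeastAtMost] by simp
  also have "\<dots> = of_nat (fact (n - l)) * e0 P + of_nat l * (of_nat (fact (n - l)) / of_nat (n - l) * e0 P)"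
    using ln by (simp add: act_ra_e0 act_ra_transp_e0)
  finally show "act (ra * rb) e0 P = youngL * e0 P"
    by (simp add: youngL_def algebra_simps)
qed

end

section \<open>Intertwiners modulo a left ideal\<close>

context hook_model
begin

definition u :: "nat \<Rightarrow> wperm \<Rightarrow>\<^sub>0 complex" where
  "u i = gx i * gy i - scalar c * JM i"

definition phi :: "wperm \<Rightarrow>\<^sub>0 complex" where "phi = gx 1 * sg wc"
definition psi :: "wperm \<Rightarrow>\<^sub>0 complex" where "psi = sg wi * gy 1"

lemma CS_JM: "i \<in> {1..n} \<Longrightarrow> JM i \<in> CS n"
  unfolding JM_def transp_sg by (intro CS_sum CS_sg perm_transpose) auto

lemma FC_JM: "i \<in> {1..n} \<Longrightarrow> JM i \<in> FC n"
  by (intro CS_FC CS_JM)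

lemma FC_u: "i \<in> {1..n} \<Longrightarrow> u i \<in> FC n"
  unfolding u_def by (intro FC_intros FC_JM) auto

lemma FC_phi: "phi \<in> FC n" and FC_psi: "psi \<in> FC n"
  unfolding phi_def psi_def using one_two perm_wc perm_wi by (auto intro!: FC_intros)

lemma scalar_left: "x * (scalar z * y) = scalar z * (x * y)"
  by (metis mult.assoc scalar_mult_commute)

lemma sg_JM_conj:
  assumes g: "bij g" and i: "g i = i'" and b: "bij_betw g {1..<i} S"
  shows "sg g * JM i = (\<Sum>j\<in>S. transp i' j) * sg g"
proof -
  have "sg g * JM i = (\<Sum>j\<in>{1..<i}. transp i' (g j) * sg g)"
    unfolding JM_def sum_distrib_left transp_sg sg_mult transpose_conj[OF g] i ..
  also have "\<dots> = (\<Sum>j\<in>S. transp i' j * sg g)"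
    by (rule sum.reindex_bij_betw[OF b, of "\<lambda>j. transp i' j * sg g"])
  finally show ?thesis by (simp add: sum_distrib_right)
qed

lemma sg_xy: "sg g * (gx i * gy i) = gx (g i) * gy (g i) * sg g"
  by (metis mult.assoc sg_gx sg_gy)

lemma sg_u:
  assumes "bij g" "g i = i'" "bij_betw g {1..<i} S"
  shows "sg g * u i = (gx i' * gy i' - scalar c * (\<Sum>j\<in>S. transp i' j)) * sg g"
  unfolding u_def right_diff_distrib sg_xy scalar_left sg_JM_conj[OF assms] assms(2)
  by (simp add: algebra_simps)

lemma JM_Suc: "1 \<le> i \<Longrightarrow> JM (Suc i) = (\<Sum>j\<in>{1..<i}. transp (Suc i) j) + sg (adj i)"
  by (simp add: JM_def transp_sg transpose_commute)

lemma s_u: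
  assumes "1 \<le> i" "i < n"
  shows "sg (adj i) * u i = u (Suc i) * sg (adj i) + scalar c"
proof -
  have "bij_betw (adj i) {1..<i} {1..<i}"
    by (rule bij_betw_cong[THEN iffD1, OF _ bij_betw_id]) (auto simp: Transposition.transpose_def)
  then have "sg (adj i) * u i = (gx (Suc i) * gy (Suc i) - scalar c * (\<Sum>j\<in>{1..<i}. transp (Suc i) j)) * sg (adj i)"
    by (intro sg_u) auto
  moreover have "u (Suc i) * sg (adj i) = (gx (Suc i) * gy (Suc i) - scalar c * (\<Sum>j\<in>{1..<i}. transp (Suc i) j)) * sg (adj i)
      - scalar c * (sg (adj i) * sg (adj i))"
    unfolding u_def JM_Suc[OF assms(1)] by (simp add: algebra_simps)
  moreover have "sg (adj i) * sg (adj i) = 1" by (simp add: sg_mult sg_id)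
  ultimately show ?thesis by simp
qed

lemma s_u_other:
  assumes "1 \<le> i" "i < n" "1 \<le> j" "j \<le> n" "j \<noteq> i" "j \<noteq> Suc i"
  shows "sg (adj i) * u j = u j * sg (adj i)"
proof -
  have "bij_betw (adj i) {1..<j} {1..<j}"
    by (rule bij_betw_byWitness[where f' = "adj i"]) (use assms in \<open>auto simp: Transposition.transpose_def\<close>)
  moreover have "adj i j = j" using assms by simp
  ultimately show ?thesis using sg_u[of "adj i" j j] by (simp add: u_def JM_def)
qed

text \<open>The Jucys-Murphy sum of i + 1 without the transposition with 1. It commutes with x_1 and
  y_1, and the omitted term is what their commutators with y_(i+1) and x_(i+1) provide.\<close>

definition Dsum :: "nat \<Rightarrow> wperm \<Rightarrow>\<^sub>0 complex" where "Dsum i = (\<Sum>j\<in>{2..i}. transp (Suc i) j)"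
definition Esum :: "wperm \<Rightarrow>\<^sub>0 complex" where "Esum = (\<Sum>j\<in>{1..n} - {1}. transp 1 j)"

lemma wc_u:
  assumes "1 \<le> i" "i < n"
  shows "sg wc * u i = (gx (Suc i) * gy (Suc i) - scalar c * Dsum i) * sg wc"
  unfolding Dsum_def
proof (rule sg_u)
  show "bij wc" by (rule permutes_bij[OF perm_wc])
  show "wc i = Suc i" using assms by (simp add: wc_def)
  show "bij_betw wc {1..<i} {2..i}"
    by (rule bij_betw_byWitness[where f' = wi]) (use assms in \<open>auto simp: wc_def wi_def\<close>)
qed

lemma wc_u_last: "sg wc * u n = (gx 1 * gy 1 - scalar c * Esum) * sg wc"
  unfolding Esum_def
proof (rule sg_u)
  show "bij wc" by (rule permutes_bij[OF perm_wc])
  show "wc n = 1" by (simp add: wc_def)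
  show "bij_betw wc {1..<n} ({1..n} - {1})"
    by (rule bij_betw_byWitness[where f' = wi]) (use n2 in \<open>auto simp: wc_def wi_def\<close>)
qed

lemma sg_w: "sg wc * sg wi = 1" "sg wi * sg wc = 1"
  by (simp_all only: sg_mult wc_o_wi sg_id)

lemma from_wc:
  assumes "sg wc * a = b * sg wc" shows "a * sg wi = sg wi * b"
proof -
  have "sg wi * (sg wc * a) * sg wi = sg wi * (b * sg wc) * sg wi" using assms by simp
  then have "(sg wi * sg wc) * a * sg wi = sg wi * b * (sg wc * sg wi)" by (simp only: mult.assoc)
  then show ?thesis by (simp only: sg_w mult_1_left mult_1_right)
qed

lemma u_wi: "1 \<le> i \<Longrightarrow> i < n \<Longrightarrow> u i * sg wi = sg wi * (gx (Suc i) * gy (Suc i) - scalar c * Dsum i)"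
  and u_wi_last: "u n * sg wi = sg wi * (gx 1 * gy 1 - scalar c * Esum)"
  by (simp_all only: from_wc[OF wc_u] from_wc[OF wc_u_last])

lemma Dsum_commute:
  assumes "1 \<le> i" "i < n"
  shows "Dsum i * gx 1 = gx 1 * Dsum i" "Dsum i * gy 1 = gy 1 * Dsum i"
proof -
  have "transp (Suc i) j * gx 1 = gx 1 * transp (Suc i) j" "transp (Suc i) j * gy 1 = gy 1 * transp (Suc i) j"
    if "j \<in> {2..i}" for j
    unfolding transp_sg sg_gx sg_gy using that assms by (simp_all add: transpose_apply_other)
  then show "Dsum i * gx 1 = gx 1 * Dsum i" "Dsum i * gy 1 = gy 1 * Dsum i"
    unfolding Dsum_def sum_distrib_left sum_distrib_right by (auto intro: sum.cong)
qed

lemma JM_Suc': "1 \<le> i \<Longrightarrow> JM (Suc i) = transp (Suc i) 1 + Dsum i"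
proof -
  assume "1 \<le> i"
  then have "{1..<Suc i} = insert 1 {2..i}" by auto
  then show ?thesis by (simp add: JM_def Dsum_def)
qed

lemma rel_xx: "i \<in> {1..n} \<Longrightarrow> j \<in> {1..n} \<Longrightarrow> gx i * gx j - gx j * gx i \<in> cherednik_ideal n c"
  and rel_yy: "i \<in> {1..n} \<Longrightarrow> j \<in> {1..n} \<Longrightarrow> gy i * gy j - gy j * gy i \<in> cherednik_ideal n c"
  and rel_yx: "i \<in> {1..n} \<Longrightarrow> j \<in> {1..n} \<Longrightarrow> i \<noteq> j \<Longrightarrow>
      gy i * gx j - gx j * gy i - scalar c * transp i j \<in> cherednik_ideal n c"
  and rel_yx_same: "i \<in> {1..n} \<Longrightarrow>
      gy i * gx i - gx i * gy i - (1 - scalar c * (\<Sum>j \<in> {1..n} - {i}. transp i j)) \<in> cherednik_ideal n c"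
  by (rule relations_ideal, unfold cherednik_relations_def, blast)+

lemmas ideal_intros = ideal_add ideal_lmult ideal_rmult FC_gx FC_gy FC_sg perm_wc perm_wi one_two

lemma ideal_uminus: "a \<in> cherednik_ideal n c \<Longrightarrow> - a \<in> cherednik_ideal n c"
  using ideal_lmult[of a n c "- 1"] FC_uminus[OF FC_one] by simp

lemma ideal_diff: "a \<in> cherednik_ideal n c \<Longrightarrow> b \<in> cherednik_ideal n c \<Longrightarrow> a - b \<in> cherednik_ideal n c"
  using ideal_add[of a n c "- b"] ideal_uminus by simp

text \<open>Conjugation by the cycle yields the Jucys-Murphy sum of i + 1 without its term (i+1, 1);
  that term is made up by the commutator of y_(i+1) with x_1.\<close>

lemma phi_u:
  assumes i: "1 \<le> i" "i < n"
  shows "phi * u i - u (Suc i) * phi \<in> cherednik_ideal n c"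
proof -
  have i': "Suc i \<in> {1..n}" "Suc i \<noteq> 1" using i by auto
  have t: "transp (Suc i) 1 * gx 1 = gx (Suc i) * transp (Suc i) 1"
    unfolding transp_sg sg_gx by simp
  have l: "phi * u i = gx 1 * (gx (Suc i) * gy (Suc i)) * sg wc - scalar c * (gx 1 * Dsum i) * sg wc"
    unfolding phi_def mult.assoc[of "gx 1"] wc_u[OF i]
    by (simp only: right_diff_distrib left_diff_distrib scalar_left mult.assoc)
  have r: "u (Suc i) * phi = gx (Suc i) * gy (Suc i) * gx 1 * sg wc
      - scalar c * (gx (Suc i) * transp (Suc i) 1) * sg wc - scalar c * (gx 1 * Dsum i) * sg wc"
    unfolding u_def phi_def JM_Suc'[OF i(1)] t[symmetric] Dsum_commute[OF i, symmetric]
    by (simp add: algebra_simps)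
  have "phi * u i - u (Suc i) * phi = ((gx 1 * gx (Suc i) - gx (Suc i) * gx 1) * gy (Suc i)
      - gx (Suc i) * (gy (Suc i) * gx 1 - gx 1 * gy (Suc i) - scalar c * transp (Suc i) 1)) * sg wc"
    unfolding l r by (simp add: algebra_simps scalar_left)
  also have "\<dots> \<in> cherednik_ideal n c"
    by (intro ideal_intros ideal_diff rel_xx rel_yx i')
  finally show ?thesis .
qed

lemma psi_u:
  assumes i: "1 \<le> i" "i < n"
  shows "psi * u (Suc i) - u i * psi \<in> cherednik_ideal n c"
proof -
  have i': "Suc i \<in> {1..n}" "1 \<noteq> Suc i" using i by auto
  have t: "gy 1 * transp (Suc i) 1 = transp 1 (Suc i) * gy (Suc i)"
    unfolding transp_sg sg_gy by (simp add: transpose_commute)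
  have l: "psi * u (Suc i) = sg wi * (gy 1 * (gx (Suc i) * gy (Suc i))
      - scalar c * (transp 1 (Suc i) * gy (Suc i)) - scalar c * (gy 1 * Dsum i))"
    unfolding psi_def u_def JM_Suc'[OF i(1)] t[symmetric]
    by (simp add: algebra_simps scalar_left)
  have r: "u i * psi = sg wi * (gx (Suc i) * gy (Suc i) * gy 1 - scalar c * (gy 1 * Dsum i))"
    unfolding psi_def mult.assoc[symmetric] u_wi[OF i]
    by (simp only: mult.assoc left_diff_distrib Dsum_commute[OF i])
  have "psi * u (Suc i) - u i * psi = sg wi * ((gy 1 * gx (Suc i) - gx (Suc i) * gy 1 - scalar c * transp 1 (Suc i)) * gy (Suc i)
      + gx (Suc i) * (gy 1 * gy (Suc i) - gy (Suc i) * gy 1))"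
    unfolding l r by (simp add: algebra_simps)
  also have "\<dots> \<in> cherednik_ideal n c"
    by (intro ideal_intros ideal_diff rel_yy rel_yx i')
  finally show ?thesis .
qed

lemma rel_11: "gy 1 * gx 1 - gx 1 * gy 1 - (1 - scalar c * Esum) \<in> cherednik_ideal n c"
  unfolding Esum_def by (rule rel_yx_same[OF one_two(1)])

lemma JM_1: "JM 1 = 0"
  by (simp add: JM_def)

lemma u_1: "u 1 = gx 1 * gy 1"
  by (simp add: u_def JM_1)

text \<open>At the last index the cycle produces all transpositions (1 j), which the relation for
  y_1 and x_1 trades for a commutator and a unit; the unit is the shift of the eigenvalue by
  one.\<close>

lemma phi_u_last: "phi * u n - (u 1 - 1) * phi \<in> cherednik_ideal n c"
proof -
  have "phi * u n - (u 1 - 1) * phi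
      = (- gx 1) * (gy 1 * gx 1 - gx 1 * gy 1 - (1 - scalar c * Esum)) * sg wc"
    unfolding phi_def mult.assoc[of "gx 1" _ "u n"] wc_u_last u_1 by (simp add: algebra_simps)
  also have "\<dots> \<in> cherednik_ideal n c"
    by (intro ideal_intros FC_uminus rel_11)
  finally show ?thesis .
qed

lemma psi_u_first: "psi * u 1 - (u n + 1) * psi \<in> cherednik_ideal n c"
proof -
  have r: "u n * psi = sg wi * (gx 1 * gy 1 - scalar c * Esum) * gy 1"
    unfolding psi_def mult.assoc[symmetric] u_wi_last ..
  have "psi * u 1 - (u n + 1) * psi
      = sg wi * (gy 1 * gx 1 - gx 1 * gy 1 - (1 - scalar c * Esum)) * gy 1"
    unfolding distrib_right r unfolding psi_def u_1 by (simp add: algebra_simps)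
  also have "\<dots> \<in> cherednik_ideal n c"
    by (intro ideal_intros rel_11)
  finally show ?thesis .
qed

lemma psi_phi: "psi * phi - (u n + 1) \<in> cherednik_ideal n c"
proof -
  have "sg wi * (gx 1 * gy 1 - scalar c * Esum) * sg wc = u n * (sg wi * sg wc)"
    by (simp only: mult.assoc[symmetric] u_wi_last)
  then have r: "u n = sg wi * (gx 1 * gy 1 - scalar c * Esum) * sg wc" by (simp add: sg_w)
  have o: "(1::wperm \<Rightarrow>\<^sub>0 complex) = sg wi * 1 * sg wc" by (simp add: sg_w)
  have "psi * phi - (u n + 1)
      = sg wi * (gy 1 * gx 1 - gx 1 * gy 1 - (1 - scalar c * Esum)) * sg wc"
    unfolding r unfolding psi_def phi_def by (subst o) (simp add: algebra_simps)
  also have "\<dots> \<in> cherednik_ideal n c"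
    by (intro ideal_intros rel_11)
  finally show ?thesis .
qed

lemma phi_psi: "phi * psi = u 1"
proof -
  have "phi * psi = gx 1 * (sg wc * sg wi) * gy 1" unfolding phi_def psi_def by (simp only: mult.assoc)
  then show ?thesis by (simp add: sg_w u_1)
qed

text \<open>The eigenvalues of the operators \<open>U i\<close> on the indicator of P.\<close>

definition wt :: "(int \<Rightarrow> int) \<Rightarrow> nat \<Rightarrow> complex" where
  "wt P i = - of_int (P (int i)) / of_nat n"

end

section \<open>Weight spaces modulo a left ideal\<close>

text \<open>Vectors of the cyclic module FC / K are handled through representatives in the algebra.
  Congruence modulo K is preserved by left multiplication; multiplying on the right is possible for
  the two-sided ideal of relations, as in \<open>eqv_ideal\<close>.\<close>

locale left_ideal = hook_model +
  fixes K :: "(wperm \<Rightarrow>\<^sub>0 complex) set"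
  assumes K_FC: "h \<in> K \<Longrightarrow> h \<in> FC n"
    and K_add: "a \<in> K \<Longrightarrow> b \<in> K \<Longrightarrow> a + b \<in> K"
    and K_mult: "g \<in> FC n \<Longrightarrow> a \<in> K \<Longrightarrow> g * a \<in> K"
    and K_ideal: "a \<in> cherednik_ideal n c \<Longrightarrow> a \<in> K"
begin

lemma K_zero: "0 \<in> K"
  using K_ideal ideal_uminus relations_ideal additive_subgroup.zero_closed[OF ideal.axioms(1)[OF cherednik_ideal]]
  by fastforce

lemma K_uminus: "a \<in> K \<Longrightarrow> - a \<in> K"
  using K_mult[of "- 1" a] FC_uminus[OF FC_one] by simp

lemma K_diff: "a \<in> K \<Longrightarrow> b \<in> K \<Longrightarrow> a - b \<in> K"
  using K_add[of a "- b"] K_uminus by simp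

definition eqv :: "(wperm \<Rightarrow>\<^sub>0 complex) \<Rightarrow> (wperm \<Rightarrow>\<^sub>0 complex) \<Rightarrow> bool" (infix \<open>\<approx>\<close> 50) where
  "a \<approx> b \<longleftrightarrow> a - b \<in> K"

lemma eqv_refl [simp]: "a \<approx> a"
  by (simp add: eqv_def K_zero)

lemma eqv_sym: "a \<approx> b \<Longrightarrow> b \<approx> a"
  using K_uminus[of "a - b"] by (simp add: eqv_def)

lemma eqv_trans [trans]: "a \<approx> b \<Longrightarrow> b \<approx> d \<Longrightarrow> a \<approx> d"
  using K_add[of "a - b" "b - d"] by (simp add: eqv_def)

lemma eqv_add: "a \<approx> b \<Longrightarrow> a' \<approx> b' \<Longrightarrow> a + a' \<approx> b + b'"
  using K_add[of "a - b" "a' - b'"] by (simp add: eqv_def algebra_simps)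

lemma eqv_diff: "a \<approx> b \<Longrightarrow> a' \<approx> b' \<Longrightarrow> a - a' \<approx> b - b'"
  using K_diff[of "a - b" "a' - b'"] by (simp add: eqv_def algebra_simps)

lemma eqv_mult: "g \<in> FC n \<Longrightarrow> a \<approx> b \<Longrightarrow> g * a \<approx> g * b"
  using K_mult[of g "a - b"] by (simp add: eqv_def algebra_simps)

lemma eqv_sum: "(\<And>i. i \<in> S \<Longrightarrow> f i \<approx> g i) \<Longrightarrow> sum f S \<approx> sum g S"
  by (induction S rule: infinite_finite_induct) (auto intro: eqv_add)

lemma eqv_ideal: "a - b \<in> cherednik_ideal n c \<Longrightarrow> h \<in> FC n \<Longrightarrow> a * h \<approx> b * h"
  using K_ideal[OF ideal_rmult[of "a - b" n c h]] by (simp add: eqv_def algebra_simps)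

lemma eqv_zero_iff: "a \<approx> 0 \<longleftrightarrow> a \<in> K"
  by (simp add: eqv_def)

lemma eqv_K: "a \<approx> b \<Longrightarrow> a \<in> K \<longleftrightarrow> b \<in> K"
  using eqv_zero_iff eqv_trans eqv_sym by metis

lemma scalar_K: "z \<noteq> 0 \<Longrightarrow> scalar z * a \<in> K \<Longrightarrow> a \<in> K"
proof -
  assume z: "z \<noteq> 0" "scalar z * a \<in> K"
  from K_mult[OF FC_scalar z(2), of "1 / z"] have "scalar (1 / z) * (scalar z * a) \<in> K" .
  moreover have "scalar (1 / z) * (scalar z * a) = a"
    using z by (simp add: mult.assoc[symmetric] scalar_mult[symmetric] scalar_1)
  ultimately show ?thesis by (simp only:)
qed

text \<open>The preimage in the algebra of a simultaneous eigenspace of FC / K. It contains K, so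
  membership does not say that the vector is nonzero.\<close>

definition Wt :: "(nat \<Rightarrow> complex) \<Rightarrow> (wperm \<Rightarrow>\<^sub>0 complex) set" where
  "Wt w = {h \<in> FC n. \<forall>i\<in>{1..n}. u i * h \<approx> scalar (w i) * h}"

lemma WtD: "h \<in> Wt w \<Longrightarrow> h \<in> FC n" "h \<in> Wt w \<Longrightarrow> 1 \<le> i \<Longrightarrow> i \<le> n \<Longrightarrow> u i * h \<approx> scalar (w i) * h"
  by (auto simp: Wt_def)

lemma Wt_pass:
  assumes h: "h \<in> FC n" "a \<in> FC n" and "v' * (a * h) \<approx> a * (v * h)" and "v * h \<approx> scalar z * h"
  shows "v' * (a * h) \<approx> scalar z * (a * h)"
proof -
  note assms(3)
  also have "a * (v * h) \<approx> a * (scalar z * h)" by (rule eqv_mult[OF h(2) assms(4)])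
  finally show ?thesis by (simp only: scalar_left)
qed

lemma index_cases: "1 \<le> j \<Longrightarrow> j \<le> n \<Longrightarrow> j = 1 \<or> (\<exists>i. 1 \<le> i \<and> i < n \<and> j = Suc i)"
  by (cases j) auto

lemma phi_Wt:
  assumes h: "h \<in> Wt w"
    and w': "w' 1 = w n + 1" "\<And>i. 1 \<le> i \<Longrightarrow> i < n \<Longrightarrow> w' (Suc i) = w i"
  shows "phi * h \<in> Wt w'" "psi * (phi * h) \<approx> scalar (w n + 1) * h"
proof -
  note hF = WtD(1)[OF h]
  have n1: "1 \<le> n" using n2 by simp
  have un: "(u n + 1) * h \<approx> scalar (w n + 1) * h"
    using eqv_add[OF WtD(2)[OF h n1 order_refl] eqv_refl[of h]] by (simp add: distrib_right scalar_add scalar_1)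
  have "u j * (phi * h) \<approx> scalar (w' j) * (phi * h)" if j: "j \<in> {1..n}" for j
  proof -
    from j index_cases consider "j = 1" | i where "1 \<le> i" "i < n" "j = Suc i" by auto
    then show ?thesis
    proof cases
      case 1
      have "u 1 * (phi * h) - phi * h \<approx> phi * (u n * h)"
        using eqv_sym[OF eqv_ideal[OF phi_u_last hF]] by (simp add: algebra_simps)
      from eqv_add[OF this eqv_refl[of "phi * h"]] have "u 1 * (phi * h) \<approx> phi * ((u n + 1) * h)"
        by (simp add: algebra_simps)
      from Wt_pass[OF hF FC_phi this un] show ?thesis by (simp add: 1 w')
    next
      case 2
      have "u (Suc i) * (phi * h) \<approx> phi * (u i * h)"
        using eqv_sym[OF eqv_ideal[OF phi_u[OF 2(1,2)] hF]] by (simp add: mult.assoc)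
      from Wt_pass[OF hF FC_phi this WtD(2)[OF h 2(1)]] show ?thesis using 2 w' by simp
    qed
  qed
  then show "phi * h \<in> Wt w'" unfolding Wt_def using hF FC_phi FC_mult by blast
  show "psi * (phi * h) \<approx> scalar (w n + 1) * h"
    using eqv_trans[OF eqv_ideal[OF psi_phi hF] un] by (simp add: mult.assoc)
qed

lemma psi_Wt:
  assumes h: "h \<in> Wt w'"
    and w': "w' 1 = w n + 1" "\<And>i. 1 \<le> i \<Longrightarrow> i < n \<Longrightarrow> w' (Suc i) = w i"
  shows "psi * h \<in> Wt w" "phi * (psi * h) \<approx> scalar (w n + 1) * h"
proof -
  note hF = WtD(1)[OF h]
  have n1: "1 \<le> n" using n2 by simp
  have u1: "u 1 * h \<approx> scalar (w n + 1) * h" using WtD(2)[OF h order_refl n1] w' by simp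
  have "u j * (psi * h) \<approx> scalar (w j) * (psi * h)" if j: "j \<in> {1..n}" for j
  proof (cases "j = n")
    case True
    have "(u n + 1) * (psi * h) \<approx> psi * (u 1 * h)"
      using eqv_sym[OF eqv_ideal[OF psi_u_first hF]] by (simp add: mult.assoc)
    from eqv_diff[OF Wt_pass[OF hF FC_psi this u1] eqv_refl[of "psi * h"]]
    show ?thesis by (simp add: True algebra_simps scalar_add scalar_1)
  next
    case False
    then have j': "1 \<le> j" "j < n" using j by auto
    have "u j * (psi * h) \<approx> psi * (u (Suc j) * h)"
      using eqv_sym[OF eqv_ideal[OF psi_u[OF j'] hF]] by (simp add: mult.assoc)
    from Wt_pass[OF hF FC_psi this WtD(2)[OF h]] show ?thesis using j' w' by simp
  qed
  then show "psi * h \<in> Wt w" unfolding Wt_def using hF FC_psi FC_mult by blast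
  show "phi * (psi * h) \<approx> scalar (w n + 1) * h"
    using u1 by (simp add: mult.assoc[symmetric] phi_psi)
qed

text \<open>From s u_i = u_(i+1) s + c, the summand - \<kappa> is exactly what turns s into a map
  between the two eigenspaces. For the way back the weights are exchanged, so the sign of \<kappa>
  changes, and the composite is s^2 - \<kappa>^2.\<close>

lemma sigma_Wt:
  assumes h: "h \<in> Wt w" and i: "1 \<le> i" "i < n" and ne: "w i \<noteq> w (Suc i)"
    and w': "w' i = w (Suc i)" "w' (Suc i) = w i" "\<And>j. j \<in> {1..n} \<Longrightarrow> j \<noteq> i \<Longrightarrow> j \<noteq> Suc i \<Longrightarrow> w' j = w j"
    and k: "\<kappa> = c / (w i - w (Suc i))"
  shows "(sg (adj i) - scalar \<kappa>) * h \<in> Wt w'"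
    "(sg (adj i) + scalar \<kappa>) * ((sg (adj i) - scalar \<kappa>) * h) \<approx> scalar (1 - \<kappa> * \<kappa>) * h"
proof -
  let ?s = "sg (adj i)"
  note hF = WtD(1)[OF h]
  have p: "perm (adj i)" using i by (intro adj_permutes) auto
  have sF: "?s \<in> FC n" by (rule FC_sg[OF p])
  have ss: "?s * ?s = 1" by (simp add: sg_mult sg_id)
  have kk: "\<kappa> * (w i - w (Suc i)) = c" using ne k by simp
  have u1: "u i * h \<approx> scalar (w i) * h" and u2: "u (Suc i) * h \<approx> scalar (w (Suc i)) * h"
    using WtD(2)[OF h] i by auto
  have us2: "u (Suc i) * (?s * h) \<approx> scalar (w i) * (?s * h) - scalar c * h"
  proof -
    have "u (Suc i) * (?s * h) = ?s * (u i * h) - scalar c * h"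
    proof -
      have "?s * u i * h = (u (Suc i) * ?s + scalar c) * h" by (simp only: s_u[OF i])
      then show ?thesis by (simp add: mult.assoc distrib_right)
    qed
    moreover have "?s * (u i * h) \<approx> scalar (w i) * (?s * h)"
      using eqv_mult[OF sF u1] by (simp only: scalar_left)
    ultimately show ?thesis by (simp add: eqv_diff)
  qed
  have us1: "u i * (?s * h) \<approx> scalar (w (Suc i)) * (?s * h) + scalar c * h"
  proof -
    have "?s * (?s * u i) * ?s = ?s * (u (Suc i) * ?s + scalar c) * ?s" using s_u[OF i] by simp
    moreover have "?s * (?s * u i) * ?s = u i * ?s"
      by (simp only: mult.assoc[symmetric] ss mult_1_left)
    moreover have "?s * (u (Suc i) * ?s + scalar c) * ?s = ?s * u (Suc i) * (?s * ?s) + scalar c * (?s * ?s)"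
      by (simp only: distrib_left distrib_right mult.assoc scalar_left)
    ultimately have "u i * ?s = ?s * u (Suc i) + scalar c" by (simp add: ss)
    then have "u i * (?s * h) = ?s * (u (Suc i) * h) + scalar c * h"
      by (simp add: mult.assoc[symmetric] distrib_right)
    moreover have "?s * (u (Suc i) * h) \<approx> scalar (w (Suc i)) * (?s * h)"
      using eqv_mult[OF sF u2] by (simp only: scalar_left)
    ultimately show ?thesis by (simp add: eqv_add)
  qed
  let ?g = "(?s - scalar \<kappa>) * h"
  have gF: "?g \<in> FC n" using sF hF by (simp add: FC_mult FC_diff FC_scalar)
  have eu: "u j * ?g = u j * (?s * h) - scalar \<kappa> * (u j * h)" for j
    by (simp add: left_diff_distrib right_diff_distrib scalar_left)
  have ks: "scalar \<kappa> * (v * h) \<approx> scalar (\<kappa> * z) * h" if "v * h \<approx> scalar z * h" for v z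
    using eqv_mult[OF FC_scalar that] by (simp add: scalar_mult mult.assoc)
  have "u j * ?g \<approx> scalar (w' j) * ?g" if j: "j \<in> {1..n}" for j
  proof -
    consider "j = i" | "j = Suc i" | "j \<noteq> i" "j \<noteq> Suc i" by blast
    then show ?thesis
    proof cases
      case 1
      have "u i * ?g \<approx> (scalar (w (Suc i)) * (?s * h) + scalar c * h) - scalar (\<kappa> * w i) * h"
        unfolding eu by (rule eqv_diff[OF us1 ks[OF u1]])
      also have "(scalar (w (Suc i)) * (?s * h) + scalar c * h) - scalar (\<kappa> * w i) * h
          = scalar (w (Suc i)) * (?s * h) - scalar (\<kappa> * w (Suc i)) * h"
        unfolding kk[symmetric] by (simp add: right_diff_distrib scalar_diff left_diff_distrib)
      also have "\<dots> = scalar (w' i) * ?g"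
        by (simp only: w' left_diff_distrib right_diff_distrib mult.commute[of \<kappa>] scalar_mult mult.assoc)
      finally show ?thesis by (simp add: 1)
    next
      case 2
      have "u (Suc i) * ?g \<approx> (scalar (w i) * (?s * h) - scalar c * h) - scalar (\<kappa> * w (Suc i)) * h"
        unfolding eu by (rule eqv_diff[OF us2 ks[OF u2]])
      also have "(scalar (w i) * (?s * h) - scalar c * h) - scalar (\<kappa> * w (Suc i)) * h
          = scalar (w i) * (?s * h) - scalar (\<kappa> * w i) * h"
        unfolding kk[symmetric] by (simp add: right_diff_distrib scalar_diff left_diff_distrib)
      also have "\<dots> = scalar (w' (Suc i)) * ?g"
        by (simp only: w' left_diff_distrib right_diff_distrib mult.commute[of \<kappa>] scalar_mult mult.assoc)
      finally show ?thesis by (simp add: 2)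
    next
      case 3
      have j': "1 \<le> j" "j \<le> n" using j by auto
      have com: "u j * (?s - scalar \<kappa>) = (?s - scalar \<kappa>) * u j"
        using s_u_other[OF i j' 3] by (simp add: left_diff_distrib right_diff_distrib scalar_mult_commute)
      have "u j * ((?s - scalar \<kappa>) * h) \<approx> (?s - scalar \<kappa>) * (u j * h)"
        by (simp only: mult.assoc[symmetric] com eqv_refl)
      from Wt_pass[OF hF _ this WtD(2)[OF h j']] show ?thesis
        using w'(3)[OF j 3] sF by (simp add: FC_diff FC_scalar)
    qed
  qed
  then show "?g \<in> Wt w'" unfolding Wt_def using gF by blast
  have "(?s + scalar \<kappa>) * (?s - scalar \<kappa>) = ?s * ?s - scalar (\<kappa> * \<kappa>)"
    by (simp add: distrib_right right_diff_distrib scalar_mult scalar_mult_commute[of \<kappa> ?s])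
  then show "(?s + scalar \<kappa>) * ?g \<approx> scalar (1 - \<kappa> * \<kappa>) * h"
    unfolding mult.assoc[symmetric] by (simp add: ss scalar_diff scalar_1)
qed

text \<open>The scalars are existential and may depend on h: being nonzero is all that matters, and
  transitivity then multiplies them without tracking their values.\<close>

definition linked :: "(int \<Rightarrow> int) \<Rightarrow> (int \<Rightarrow> int) \<Rightarrow> bool" where
  "linked P Q \<longleftrightarrow> (\<exists>\<alpha>\<in>FC n. \<exists>\<beta>\<in>FC n.
     (\<forall>h\<in>Wt (wt P). \<alpha> * h \<in> Wt (wt Q) \<and> (\<exists>z. z \<noteq> 0 \<and> \<beta> * (\<alpha> * h) \<approx> scalar z * h)) \<and>
     (\<forall>h\<in>Wt (wt Q). \<beta> * h \<in> Wt (wt P) \<and> (\<exists>z. z \<noteq> 0 \<and> \<alpha> * (\<beta> * h) \<approx> scalar z * h)))"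

lemma linked_refl: "linked P P"
  unfolding linked_def
  by (intro bexI[of _ 1] conjI ballI exI[of _ 1]) (auto simp: scalar_1 FC_one)

lemma linked_sym: "linked P Q \<Longrightarrow> linked Q P"
  unfolding linked_def by blast

lemma linked_trans:
  assumes "linked P Q" "linked Q R" shows "linked P R"
proof -
  obtain a b where ab: "a \<in> FC n" "b \<in> FC n"
    "\<And>h. h \<in> Wt (wt P) \<Longrightarrow> a * h \<in> Wt (wt Q) \<and> (\<exists>z. z \<noteq> 0 \<and> b * (a * h) \<approx> scalar z * h)"
    "\<And>h. h \<in> Wt (wt Q) \<Longrightarrow> b * h \<in> Wt (wt P) \<and> (\<exists>z. z \<noteq> 0 \<and> a * (b * h) \<approx> scalar z * h)"
    using assms(1) unfolding linked_def by blast
  obtain a' b' where ab': "a' \<in> FC n" "b' \<in> FC n"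
    "\<And>h. h \<in> Wt (wt Q) \<Longrightarrow> a' * h \<in> Wt (wt R) \<and> (\<exists>z. z \<noteq> 0 \<and> b' * (a' * h) \<approx> scalar z * h)"
    "\<And>h. h \<in> Wt (wt R) \<Longrightarrow> b' * h \<in> Wt (wt Q) \<and> (\<exists>z. z \<noteq> 0 \<and> a' * (b' * h) \<approx> scalar z * h)"
    using assms(2) unfolding linked_def by blast
  have comb: "\<exists>z. z \<noteq> 0 \<and> (b * b') * ((a' * a) * h) \<approx> scalar z * h"
    if "b \<in> FC n" "y \<noteq> 0" "z \<noteq> 0" "b * (a * h) \<approx> scalar y * h" "b' * (a' * (a * h)) \<approx> scalar z * (a * h)"
    for a a' b b' h y z
  proof -
    have "b * (b' * (a' * (a * h))) \<approx> scalar z * (b * (a * h))"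
      using eqv_mult[OF that(1,5)] by (simp only: scalar_left)
    also have "\<dots> \<approx> scalar z * (scalar y * h)" by (rule eqv_mult[OF FC_scalar that(4)])
    finally have "(b * b') * ((a' * a) * h) \<approx> scalar (z * y) * h" by (simp only: mult.assoc scalar_mult)
    then show ?thesis using that(2,3) by (intro exI[of _ "z * y"]) simp
  qed
  show ?thesis unfolding linked_def
  proof (rule bexI[of _ "a' * a"], rule bexI[of _ "b * b'"], intro conjI ballI)
    fix h assume h: "h \<in> Wt (wt P)"
    show "a' * a * h \<in> Wt (wt R)" using ab(3)[OF h] ab'(3) by (simp add: mult.assoc)
    show "\<exists>z. z \<noteq> 0 \<and> b * b' * (a' * a * h) \<approx> scalar z * h"
      using ab(3)[OF h] ab'(3)[of "a * h"] comb[OF ab(2), of _ _ a h b' a'] by blast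
  next
    fix h assume h: "h \<in> Wt (wt R)"
    show "b * b' * h \<in> Wt (wt P)" using ab'(4)[OF h] ab(4) by (simp add: mult.assoc)
    show "\<exists>z. z \<noteq> 0 \<and> a' * a * (b * b' * h) \<approx> scalar z * h"
      using ab'(4)[OF h] ab(4)[of "b' * h"] comb[OF ab'(1), of _ _ b' h a b] by blast
  qed (use ab ab' FC_mult in auto)
qed

text \<open>The two composites of \<open>phi\<close> and \<open>psi\<close> are the eigenvalue w_n +
  1 of u_n + 1, which equals - P 0 / n.\<close>

lemma linked_shift:
  assumes P: "aff n P" "P 0 \<noteq> 0"
  shows "linked P (\<lambda>z. P (z - 1))"
proof -
  let ?Q = "\<lambda>z. P (z - 1)"
  have nz: "(of_nat n :: complex) \<noteq> 0" using n2 by simp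
  have "P (int n) = P 0 + int n" using aff_per[OF P(1), of 0] by simp
  then have z: "wt P n + 1 = - of_int (P 0) / of_nat n" using nz by (simp add: wt_def field_simps)
  then have nz': "wt P n + 1 \<noteq> 0" using P(2) nz by simp
  have w: "wt ?Q 1 = wt P n + 1" "\<And>i. 1 \<le> i \<Longrightarrow> i < n \<Longrightarrow> wt ?Q (Suc i) = wt P i"
    unfolding z by (simp_all add: wt_def)
  show ?thesis unfolding linked_def
  proof (rule bexI[OF _ FC_phi], rule bexI[OF _ FC_psi], intro conjI ballI)
    fix h assume h: "h \<in> Wt (wt P)"
    show "phi * h \<in> Wt (wt ?Q)" "\<exists>z. z \<noteq> 0 \<and> psi * (phi * h) \<approx> scalar z * h"
      using phi_Wt[OF h w] nz' by blast+
  next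
    fix h assume h: "h \<in> Wt (wt ?Q)"
    show "psi * h \<in> Wt (wt P)" "\<exists>z. z \<noteq> 0 \<and> phi * (psi * h) \<approx> scalar z * h"
      using psi_Wt[OF h w] nz' by blast+
  qed
qed

text \<open>Here \<kappa> = m/d for the difference d of the swapped values, so the composite 1 -
  \<kappa>^2 vanishes only for d = m and d = -m.\<close>

lemma linked_swap:
  assumes P: "aff n P" and i: "1 \<le> i" "i < n" and d: "\<bar>P (int i + 1) - P (int i)\<bar> \<noteq> int m"
  shows "linked P (\<lambda>z. P (tau n (int i) z))"
proof -
  let ?Q = "\<lambda>z. P (tau n (int i) z)"
  have nz: "(of_nat n :: complex) \<noteq> 0" using n2 by simp
  let ?d = "of_int (P (int i + 1) - P (int i)) :: complex"
  have dn: "wt P i - wt P (Suc i) = ?d / of_nat n"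
    by (simp add: wt_def int_Suc diff_divide_distrib del: of_nat_Suc)
  have d0: "?d \<noteq> 0" using aff_eq[OF P, of "int i + 1" "int i"] by (simp only: of_int_eq_0_iff) simp
  then have ne: "wt P i \<noteq> wt P (Suc i)" using dn nz by (metis divide_eq_0_iff eq_iff_diff_eq_0)
  define \<kappa> where "\<kappa> = c / (wt P i - wt P (Suc i))"
  have k: "\<kappa> = of_nat m / ?d" unfolding \<kappa>_def dn c_def using nz d0 by simp
  have k1: "1 - \<kappa> * \<kappa> \<noteq> 0"
  proof
    assume "1 - \<kappa> * \<kappa> = 0"
    then have "of_nat m * of_nat m = ?d * ?d" using d0 unfolding k by (simp add: field_simps del: of_int_diff)
    then have "(of_int (int m * int m) :: complex) = of_int ((P (int i + 1) - P (int i)) * (P (int i + 1) - P (int i)))"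
      by (simp only: of_int_mult of_int_of_nat_eq)
    then have "int m * int m = (P (int i + 1) - P (int i)) * (P (int i + 1) - P (int i))"
      by (simp only: of_int_eq_iff)
    then have "\<bar>P (int i + 1) - P (int i)\<bar> * \<bar>P (int i + 1) - P (int i)\<bar> = int m * int m" by (simp only: abs_mult_self_eq)
    then show False using d by (metis abs_ge_zero of_nat_0_le_iff power2_eq_iff_nonneg power2_eq_square)
  qed
  have w: "wt ?Q i = wt P (Suc i)" "wt ?Q (Suc i) = wt P i"
    by (simp_all add: wt_def int_Suc tau_next[OF n2] del: of_nat_Suc)
  have w3: "wt ?Q j = wt P j" if "j \<in> {1..n}" "j \<noteq> i" "j \<noteq> Suc i" for j
  proof -
    have "tau n (int i) (int j) = int j"
      by (rule tau_other) (use small_dvd[of "int j - int i"] small_dvd[of "int j - int i - 1"] that i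
          in \<open>auto simp: abs_less_iff\<close>)
    then show ?thesis by (simp add: wt_def)
  qed
  have p: "perm (adj i)" using i by (intro adj_permutes) auto
  have F: "sg (adj i) - scalar \<kappa> \<in> FC n" "sg (adj i) + scalar \<kappa> \<in> FC n"
    using FC_sg[OF p] by (auto intro: FC_intros)
  have 1: "(sg (adj i) - scalar \<kappa>) * h \<in> Wt (wt ?Q)"
    "(sg (adj i) + scalar \<kappa>) * ((sg (adj i) - scalar \<kappa>) * h) \<approx> scalar (1 - \<kappa> * \<kappa>) * h"
    if "h \<in> Wt (wt P)" for h
    using sigma_Wt[OF that i ne w w3 \<kappa>_def] by blast+
  have k': "- \<kappa> = c / (wt ?Q i - wt ?Q (Suc i))"
    unfolding w \<kappa>_def by (metis minus_diff_eq minus_divide_right)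
  have ne': "wt ?Q i \<noteq> wt ?Q (Suc i)" unfolding w using ne by simp
  have 2: "(sg (adj i) + scalar \<kappa>) * h \<in> Wt (wt P)"
    "(sg (adj i) - scalar \<kappa>) * ((sg (adj i) + scalar \<kappa>) * h) \<approx> scalar (1 - \<kappa> * \<kappa>) * h"
    if "h \<in> Wt (wt ?Q)" for h
    using sigma_Wt[OF that i ne' w(2)[symmetric] w(1)[symmetric] w3[symmetric] k']
    by (simp_all add: scalar_minus)
  show ?thesis unfolding linked_def
    by (rule bexI[OF _ F(1)], rule bexI[OF _ F(2)]) (use 1 2 k1 in blast)
qed

end

section \<open>Connectedness of the support region\<close>

context hook_model
begin

lemma pos_tau: "aff n P \<Longrightarrow> pos (\<lambda>z. P (tau n i z)) x = tau n i (pos P x)"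
  by (rule pos_iff[THEN iffD2]) (simp_all add: aff_tauI[OF n2] tau_invol[OF n2] P_pos)

lemma pos_shift: "aff n P \<Longrightarrow> pos (\<lambda>z. P (z + a)) x = pos P x - a"
  by (rule pos_iff[THEN iffD2]) (simp_all add: P_pos)

lemma pos_P: "aff n P \<Longrightarrow> pos P (P i) = i"
  by (simp add: pos_iff)

lemma aff_per_mult: "aff n P \<Longrightarrow> P (z + int n * r) = P z + int n * r"
proof (induction r rule: int_induct[where k = 0])
  case (step1 r)
  then show ?case using aff_per[of n P "z + int n * r"] by (simp add: algebra_simps)
next
  case (step2 r)
  then show ?case using aff_per'[of n P "z + int n * r"] by (simp add: algebra_simps)
qed simp

text \<open>Neighbouring values differing by m are, up to a period, consecutive multiples of m whose
  order J prescribes. For an arm pair the swapped permutation breaks the inequality, for a leg pair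
  P itself does.\<close>

lemma J_swap_not_m:
  assumes P: "J P" and Q: "J (\<lambda>z. P (tau n i z))"
  shows "P (i + 1) - P i \<noteq> int m"
proof
  assume d: "P (i + 1) - P i = int m"
  note a = J_aff[OF P] and b = J_aff[OF Q]
  obtain k r where k: "- int l \<le> k" "k < int n - int l" and x: "P i = int m * k + int n * r"
    by (rule content_exists)
  have p1: "pos P (int m * k) = i - int n * r"
    using aff_per_mult[OF a, of i "- r"] x by (simp add: pos_iff[OF a])
  have "P (i + 1) = int m * (k + 1) + int n * r" using d x by (simp add: algebra_simps)
  then have p2: "pos P (int m * (k + 1)) = i + 1 - int n * r"
    using aff_per_mult[OF a, of "i + 1" "- r"] by (simp add: pos_iff[OF a])
  have t: "tau n i (i - int n * r) = i + 1 - int n * r" "tau n i (i + 1 - int n * r) = i - int n * r"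
    using tau_mult_periodic[of n i i "- r"] tau_mult_periodic[of n i "i + 1" "- r"] tau_next[OF n2, of i]
    by (simp_all add: algebra_simps)
  show False
  proof (cases "0 \<le> k")
    case True
    have "pos (\<lambda>z. P (tau n i z)) (int m * k) < pos (\<lambda>z. P (tau n i z)) (int m * (k + 1))"
      using J_arm[OF Q True k(2)] .
    then show False unfolding pos_tau[OF a] p1 p2 t by simp
  next
    case False
    then have "pos P (int m * (k + 1)) < pos P (int m * k)" using J_leg[OF P k(1)] by simp
    then show False unfolding p1 p2 by simp
  qed
qed

lemma J_swap_gap:
  assumes P: "J P" and Q: "J (\<lambda>z. P (tau n i z))"
  shows "\<bar>P (i + 1) - P i\<bar> \<noteq> int m"
proof -
  have "J (\<lambda>z. (\<lambda>z. P (tau n i z)) (tau n i z))" using P by (simp add: tau_invol[OF n2])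
  from J_swap_not_m[OF Q this] have "P i - P (i + 1) \<noteq> int m" by (simp add: tau_next[OF n2])
  then show ?thesis using J_swap_not_m[OF P Q] by linarith
qed

text \<open>Squared distance to \<open>P0\<close>. For affine P the displacement depends only on the
  residue of z, so one period is enough.\<close>

definition meas :: "(int \<Rightarrow> int) \<Rightarrow> nat" where
  "meas P = nat (\<Sum>z\<in>{0..<int n}. (pos P z - pos P0 z)\<^sup>2)"

text \<open>A swap repairing a descent relative to \<open>P0\<close> keeps every order relation that
  P and \<open>P0\<close> share, in particular the arm and leg inequalities. The corner condition
  compares with a fixed position and needs its own argument.\<close>

lemma descent_J:
  assumes P: "J P" and desc: "pos P0 (P (i + 1)) < pos P0 (P i)"
  shows "J (\<lambda>z. P (tau n i z))"
proof -
  note a = J_aff[OF P]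
  let ?Q = "\<lambda>z. P (tau n i z)"
  have ord: "pos ?Q s < pos ?Q t" if "pos P s < pos P t" "pos P0 s < pos P0 t" for s t
  proof (rule ccontr)
    assume n: "\<not> ?thesis"
    have c: "pos P t = pos P s + 1" "int n dvd pos P s - i"
      by (rule tau_crossing[OF that(1)], use n in \<open>simp add: pos_tau[OF a]\<close>)+
    obtain r where "pos P s = i + r * int n" using dvd_diffE[OF c(2)] .
    then have "s = P (i + int n * r)" "t = P (i + 1 + int n * r)"
      using c(1) pos_iff[OF a, of s "i + int n * r"] pos_iff[OF a, of t "i + 1 + int n * r"]
      by (simp_all add: algebra_simps)
    then have "pos P0 s = pos P0 (P i) + int n * r" "pos P0 t = pos P0 (P (i + 1)) + int n * r"
      by (simp_all only: aff_per_mult[OF a] pos_per_mult[OF aff_P0])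
    then show False using that(2) desc by simp
  qed
  \<comment> \<open>Only a swap of positions 0 and 1 could break it, so i is a multiple of n and
    \<open>P 1 = 0\<close>. Write \<open>P 0\<close> as m k + n s. Then k is nonzero and, the corner
    being least, s is negative; thus \<open>P0\<close> puts the value \<open>P 0\<close> at a
    position at most 0, before the value 0, against the descent.\<close>
  have corner: "1 \<le> pos ?Q 0"
  proof (rule ccontr)
    assume "\<not> ?thesis"
    then have t: "tau n i (pos P 0) < 1" by (simp add: pos_tau[OF a])
    moreover have "1 \<le> pos P 0" by (rule J_corner[OF P])
    ultimately have p: "pos P 0 = 1" and "int n dvd pos P 0 - i - 1" by (auto simp: tau_def split: if_splits)
    then have "int n dvd - i" by simp
    then have "int n dvd i" by simp
    then obtain r where i: "i = int n * r" by (rule dvdE)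
    have P1: "P 1 = 0" using p pos_iff[OF a] by blast
    have "P (i + 1) = P 1 + int n * r" "P i = P 0 + int n * r"
      using aff_per_mult[OF a, of 1 r] aff_per_mult[OF a, of 0 r] by (simp_all add: i add.commute)
    then have "pos P0 0 < pos P0 (P 0)" using desc pos_per_mult[OF aff_P0, of 0 r] pos_per_mult[OF aff_P0, of "P 0" r] P1 by simp
    moreover obtain k s where k: "- int l \<le> k" "k < int n - int l" and x: "P 0 = int m * k + int n * s"
      by (rule content_exists)
    have pk: "pos P (int m * k) = - int n * s"
      using aff_per_mult[OF a, of 0 "- s"] x by (simp add: pos_iff[OF a])
    have "k \<noteq> 0"
    proof
      assume "k = 0"
      then have "int n dvd 1" using pk p by (metis dvd_minus_iff dvd_triv_left mult_minus_left mult_zero_right)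
      then show False using n2 by simp
    qed
    from pos_corner_least[OF P k this] have "1 < - int n * s" using p pk by simp
    then have "s < 0" using n2 by (simp add: mult_less_0_iff zero_less_mult_iff) (smt (verit) mult_nonneg_nonneg of_nat_0_le_iff)
    obtain j where j: "1 \<le> j" "j \<le> n" "ct0 j = k" using ct0_surj[OF k] .
    have "pos P0 (P 0) = int j + int n * s"
      using pos_P0[OF j(1,2)] j(3) by (simp add: x pos_per_mult[OF aff_P0])
    moreover have "int n * s \<le> int n * (-1)" using \<open>s < 0\<close> by (intro mult_left_mono) auto
    moreover have "1 \<le> pos P0 0" by (rule J_corner[OF J_P0])
    ultimately show False using j(2) by linarith
  qed
  show ?thesis unfolding J_pos
  proof (intro conjI allI impI)
    show "aff n ?Q" by (rule aff_tauI[OF n2 a])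
    show "1 \<le> pos ?Q 0" by (rule corner)
    show "pos ?Q (int m * k) < pos ?Q (int m * (k + 1))" if "0 \<le> k \<and> k < int n - int l" for k
      using that by (intro ord J_arm P J_P0) auto
    show "pos ?Q (int m * (k + 1)) < pos ?Q (int m * k)" if "- int l \<le> k \<and> k < 0" for k
      using that by (intro ord J_leg P J_P0) auto
  qed
qed

text \<open>Two displacements change by one in opposite directions, so the sum of squares changes by
  twice \<open>pos P0 (P (i + 1)) - pos P0 (P i)\<close>, which is negative.\<close>

lemma descent_meas:
  assumes a: "aff n P" and desc: "pos P0 (P (i + 1)) < pos P0 (P i)"
  shows "meas (\<lambda>z. P (tau n i z)) < meas P"
proof -
  define d where "d z = pos P z - pos P0 z" for z
  define x where "x = P (i + 1) mod int n"
  define y where "y = P i mod int n"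
  have per: "d (z mod int n) = d z" for z
  proof -
    have "d (z + int n * k) = d z" for k
      unfolding d_def pos_per_mult[OF a] pos_per_mult[OF aff_P0] by simp
    moreover have "z mod int n = z + int n * (- (z div int n))" by (simp add: minus_div_mult_eq_mod[symmetric] mult.commute)
    ultimately show ?thesis by metis
  qed
  have dx: "d x = i + 1 - pos P0 (P (i + 1))" "d y = i - pos P0 (P i)"
    unfolding x_def y_def per by (simp_all add: d_def pos_P[OF a])
  have xy: "x \<in> {0..<int n}" "y \<in> {0..<int n}" using n2 by (auto simp: x_def y_def)
  have res: "int n dvd pos P z - j \<longleftrightarrow> z = P j mod int n" if "z \<in> {0..<int n}" for z j
  proof
    assume "int n dvd pos P z - j"
    then obtain r where "pos P z = j + r * int n" by (rule dvd_diffE)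
    then have "z = P j + int n * r" using pos_iff[OF a, of z] aff_per_mult[OF a, of j r] by (metis mult.commute)
    then have "z mod int n = P j mod int n" by simp
    then show "z = P j mod int n" using that by simp
  next
    assume z: "z = P j mod int n"
    then have "z = P j + int n * (- (P j div int n))" by (simp add: minus_div_mult_eq_mod[symmetric] mult.commute)
    then have "pos P z = j + int n * (- (P j div int n))" by (simp only: pos_per_mult[OF a] pos_P[OF a])
    then show "int n dvd pos P z - j" by simp
  qed
  have xney: "x \<noteq> y"
  proof
    assume "x = y"
    then have "int n dvd pos P x - (i + 1)" "int n dvd pos P x - i"
      using res[OF xy(1)] by (auto simp: x_def y_def)
    then show False using not_dvd_both[OF n2, of "pos P x - (i + 1)" "pos P x - i"] by simp
  qed
  have e: "pos (\<lambda>z. P (tau n i z)) z - pos P0 z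
      = d z + ((if z = y then 1 else 0) - (if z = x then 1 else 0))" if z: "z \<in> {0..<int n}" for z
  proof -
    have "int n dvd pos P z - i - 1 \<longleftrightarrow> z = x" using res[OF z, of "i + 1"] by (simp add: x_def algebra_simps)
    moreover have "int n dvd pos P z - i \<longleftrightarrow> z = y" using res[OF z, of i] by (simp add: y_def)
    ultimately show ?thesis unfolding pos_tau[OF a] d_def using xney by (auto simp: tau_def)
  qed
  have "(\<Sum>z\<in>{0..<int n}. (pos (\<lambda>z. P (tau n i z)) z - pos P0 z)\<^sup>2)
      = (\<Sum>z\<in>{0..<int n}. (d z)\<^sup>2 + ((if z = y then 2 * d y + 1 else 0) + (if z = x then - 2 * d x + 1 else 0)))"
    by (rule sum.cong[OF refl], subst e) (use xney in \<open>auto simp: power2_eq_square algebra_simps\<close>)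
  also have "\<dots> = (\<Sum>z\<in>{0..<int n}. (d z)\<^sup>2) + (2 * d y + 1) + (- 2 * d x + 1)"
    using xy by (simp add: sum.distrib)
  also have "\<dots> < (\<Sum>z\<in>{0..<int n}. (d z)\<^sup>2)" using dx desc by simp
  finally have "(\<Sum>z\<in>{0..<int n}. (pos (\<lambda>z. P (tau n i z)) z - pos P0 z)\<^sup>2) < (\<Sum>z\<in>{0..<int n}. (d z)\<^sup>2)" .
  moreover have "0 \<le> (\<Sum>z\<in>{0..<int n}. (pos (\<lambda>z. P (tau n i z)) z - pos P0 z)\<^sup>2)" by (rule sum_nonneg) simp
  ultimately show ?thesis unfolding meas_def d_def by (subst nat_less_eq_zless) auto
qed

text \<open>The integer sequence \<open>pos P0 (P i)\<close> is strictly increasing and gains n over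
  every n steps, so each step is exactly one and the sequence is a translation.\<close>

lemma no_descent:
  assumes a: "aff n P" and nd: "\<And>i. \<not> pos P0 (P (i + 1)) < pos P0 (P i)"
  obtains t where "\<And>i. P i = P0 (i + t)"
proof -
  define s where "s i = pos P0 (P i)" for i
  have inj: "s i \<noteq> s (i + 1)" for i
  proof
    assume "s i = s (i + 1)"
    then have "P i = P (i + 1)" unfolding s_def using P_pos[OF aff_P0] by metis
    then show False using aff_eq[OF a] by simp
  qed
  have up: "s i + 1 \<le> s (i + 1)" for i using nd[of i] inj[of i] unfolding s_def by linarith
  have ups: "s i + int k \<le> s (i + int k)" for i k
  proof (induction k)
    case (Suc k)
    then show ?case using up[of "i + int k"] by (simp add: algebra_simps)
  qed simp
  have per: "s (i + int n) = s i + int n" for i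
    by (simp add: s_def aff_per[OF a] pos_per[OF aff_P0])
  have eq: "s (i + 1) = s i + 1" for i
    using ups[of "i + 1" "n - 1"] per[of i] up[of i] n2 by (simp add: of_nat_diff)
  have st: "s i = i + s 0" for i
  proof (induction i rule: int_induct[where k = 0])
    case (step1 i)
    then show ?case using eq[of i] by simp
  next
    case (step2 i)
    then show ?case using eq[of "i - 1"] by simp
  qed simp
  have "P0 (s i) = P i" for i by (simp add: s_def P_pos[OF aff_P0])
  then have "P i = P0 (i + s 0)" for i using st[of i] by metis
  then show thesis by (rule that)
qed

end

context left_ideal
begin

lemma linked_swap_inner:
  assumes P: "J P" and Q: "J (\<lambda>z. P (tau n (int i) z))" and i: "1 \<le> i" "i < n"
  shows "linked P (\<lambda>z. P (tau n (int i) z))"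
  by (rule linked_swap[OF J_aff[OF P] i J_swap_gap[OF P Q]])

lemma J_zero: "J P \<Longrightarrow> P 0 \<noteq> 0"
  unfolding J_def by fastforce

text \<open>The affine reflection 0 has no intertwiner of its own in the algebra; a shift carries it
  to the reflection 1. The shift is available because J forbids the value 0 at position 0.\<close>

lemma linked_swap_any:
  assumes P: "J P" and Q: "J (\<lambda>z. P (tau n i z))"
  shows "linked P (\<lambda>z. P (tau n i z))"
proof -
  obtain j r where j: "1 \<le> j" "j \<le> n" and i: "i = int j + int n * r" by (rule int_rep)
  have "tau n (i' + int n * r) z = tau n i' z" for i' r z
  proof (induction r rule: int_induct[where k = 0])
    case (step1 r)
    then show ?case using tau_index_periodic[of n "i' + int n * r" z] by (simp add: algebra_simps)
  next
    case (step2 r)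
    then show ?case using tau_index_periodic[of n "i' + int n * (r - 1)" z] by (simp add: algebra_simps)
  qed simp
  then have t: "tau n i z = tau n (int j) z" for z by (simp add: i)
  show ?thesis
  proof (cases "j < n")
    case True
    then show ?thesis using linked_swap_inner[OF P, of j] Q j by (simp add: t)
  next
    case False
    then have jn: "j = n" using j by simp
    define R where "R z = P (z - 1)" for z
    have t0: "tau n i (z - 1) = tau n 1 z - 1" for z
      using tau_index_periodic[of n 0 "z - 1"] tau_shift'[of n 0 z] by (simp add: t jn)
    have QR: "(\<lambda>z. (\<lambda>z. P (tau n i z)) (z - 1)) = (\<lambda>z. R (tau n (int 1) z))"
      by (simp add: R_def t0)
    have JR: "J R" unfolding R_def by (rule J_shift_up[OF P])
    have JQ: "J (\<lambda>z. R (tau n (int 1) z))" using J_shift_up[OF Q] unfolding QR .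
    have "linked P R" unfolding R_def by (rule linked_shift[OF J_aff[OF P] J_zero[OF P]])
    moreover have "linked R (\<lambda>z. R (tau n (int 1) z))"
      using linked_swap_inner[OF JR JQ] n2 by simp
    moreover have "linked (\<lambda>z. P (tau n i z)) (\<lambda>z. R (tau n (int 1) z))"
      using linked_shift[OF J_aff[OF Q] J_zero[OF Q]] unfolding QR .
    ultimately show ?thesis using linked_trans linked_sym by blast
  qed
qed

text \<open>Descent on \<open>meas\<close>. Without descents P is \<open>P0\<close> translated by
  some t; the corner condition forces t <= 0, and for t < 0 one shift down lowers every displacement
  from - t to - t - 1.\<close>

lemma linked_P0: "J P \<Longrightarrow> linked P P0"
proof (induction "meas P" arbitrary: P rule: less_induct)
  case less
  note a = J_aff[OF less.prems]
  show ?case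
  proof (cases "\<exists>i. pos P0 (P (i + 1)) < pos P0 (P i)")
    case True
    then obtain i where i: "pos P0 (P (i + 1)) < pos P0 (P i)" by blast
    have Q: "J (\<lambda>z. P (tau n i z))" by (rule descent_J[OF less.prems i])
    have "linked (\<lambda>z. P (tau n i z)) P0" by (rule less.hyps[OF descent_meas[OF a i] Q])
    with linked_swap_any[OF less.prems Q] show ?thesis by (rule linked_trans)
  next
    case False
    then obtain t where t: "\<And>i. P i = P0 (i + t)" using no_descent[OF a] by blast
    have Pt: "P = (\<lambda>z. P0 (z + t))" using t by blast
    have d: "pos P x = pos P0 x - t" for x unfolding Pt by (rule pos_shift[OF aff_P0])
    have p0: "pos P0 0 = 1" using pos_P0[of 1] n2 by (simp add: ct0_1)
    have "t \<le> 0" using J_corner[OF less.prems] unfolding d p0 by simp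
    show ?thesis
    proof (cases "t = 0")
      case True
      then show ?thesis using Pt linked_refl by simp
    next
      case False
      then have t0: "t < 0" using \<open>t \<le> 0\<close> by simp
      have P1: "P 1 \<noteq> 0" using d[of 0] p0 t0 pos_iff[OF a, of 0 1] by simp
      let ?Q = "\<lambda>z. P (z + 1)"
      have Q: "J ?Q" by (rule J_shift_down[OF less.prems P1])
      have "linked ?Q (\<lambda>z. ?Q (z - 1))" by (rule linked_shift[OF J_aff[OF Q]]) (use P1 in simp)
      then have l: "linked P ?Q" using linked_sym by simp
      have e: "pos ?Q x - pos P0 x = - (t + 1)" for x using pos_shift[OF a, of 1 x] d[of x] by simp
      have "(\<Sum>z\<in>{0..<int n}. (pos ?Q z - pos P0 z)\<^sup>2) = (\<Sum>z\<in>{0..<int n}. (t + 1)\<^sup>2)"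
        by (simp only: e power2_minus)
      moreover have "(\<Sum>z\<in>{0..<int n}. (pos P z - pos P0 z)\<^sup>2) = (\<Sum>z\<in>{0..<int n}. t\<^sup>2)"
        by (intro sum.cong) (auto simp: d power2_eq_square)
      moreover have "(t + 1)\<^sup>2 < t\<^sup>2" using t0 by (simp add: power2_eq_square algebra_simps)
      then have "int n * (t + 1)\<^sup>2 < int n * t\<^sup>2" using n2 by simp
      ultimately have "meas ?Q < meas P" unfolding meas_def using n2 t0 by (simp add: nat_less_eq_zless nat_mult_distrib)
      from less.hyps[OF this Q] l show ?thesis using linked_trans by blast
    qed
  qed
qed

end

section \<open>The grading by the Euler element\<close>

context hook_model
begin

definition E :: "wperm \<Rightarrow>\<^sub>0 complex" where "E = (\<Sum>i\<in>{1..n}. u i)"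

definition \<epsilon> :: complex where "\<epsilon> = (\<Sum>i\<in>{1..n}. wt P0 i)"

lemma FC_E: "E \<in> FC n"
  unfolding E_def by (intro FC_sum FC_u) auto

text \<open>The constants c in the relations of s with u_i and u_(i+1) cancel in the sum.\<close>

lemma s_E: "1 \<le> i \<Longrightarrow> i < n \<Longrightarrow> sg (adj i) * E = E * sg (adj i)"
proof -
  assume i: "1 \<le> i" "i < n"
  let ?s = "sg (adj i)" and ?R = "{1..n} - {i} - {Suc i}"
  have Es: "E = u i + (u (Suc i) + sum u ?R)"
    unfolding E_def using i by (simp add: sum.remove[of "{1..n}" i] sum.remove[of "{1..n} - {i}" "Suc i"])
  have ss: "?s * ?s = 1" by (simp add: sg_mult sg_id)
  have "?s * (?s * u i) * ?s = ?s * (u (Suc i) * ?s + scalar c) * ?s" by (simp only: s_u[OF i])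
  moreover have "?s * (?s * u i) * ?s = u i * ?s" by (simp only: mult.assoc[symmetric] ss mult_1_left)
  moreover have "?s * (u (Suc i) * ?s + scalar c) * ?s = ?s * u (Suc i) * (?s * ?s) + scalar c * (?s * ?s)"
    by (simp only: distrib_left distrib_right mult.assoc scalar_left)
  ultimately have us: "u i * ?s = ?s * u (Suc i) + scalar c" by (simp add: ss)
  have "?s * sum u ?R = sum u ?R * ?s"
    unfolding sum_distrib_left sum_distrib_right by (rule sum.cong[OF refl], rule s_u_other) (use i in auto)
  then show ?thesis unfolding Es distrib_left distrib_right s_u[OF i] us by simp
qed

lemma sg_E: "perm g \<Longrightarrow> sg g * E = E * sg g"
proof (induction g rule: adjacent_induct)
  case id
  then show ?case by (simp add: sg_id[unfolded id_def] sg_id)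
next
  case (adj i g)
  then have "sg (adj i) * (sg g * E) = sg (adj i) * E * sg g" by (simp add: mult.assoc)
  also have "sg (adj i) * E = E * sg (adj i)" using adj by (intro s_E) auto
  finally show ?case by (simp only: sg_mult[symmetric] mult.assoc)
qed

lemma phi_E: "phi * E - (E - 1) * phi \<in> cherednik_ideal n c"
proof -
  have n: "{1..n} = insert n {1..<n}" using n2 by auto
  have 1: "E = u n + (\<Sum>i\<in>{1..<n}. u i)" unfolding E_def n by simp
  have eq: "{1..n} = insert 1 (Suc ` {1..<n})" using n2 by (auto simp: image_iff)
  have "sum u (insert 1 (Suc ` {1..<n})) = u 1 + sum u (Suc ` {1..<n})" by (rule sum.insert) auto
  moreover have "sum u (Suc ` {1..<n}) = sum (u \<circ> Suc) {1..<n}" by (rule sum.reindex) simp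
  ultimately have 2: "E = u 1 + (\<Sum>i\<in>{1..<n}. u (Suc i))"
    unfolding E_def eq by (simp add: o_def)
  have "phi * E - (E - 1) * phi = (phi * u n - (u 1 - 1) * phi) + (\<Sum>i\<in>{1..<n}. phi * u i - u (Suc i) * phi)"
    by (subst 1, subst 2) (simp add: sum_subtractf sum_distrib_left sum_distrib_right algebra_simps)
  moreover have "(\<Sum>i\<in>S. phi * u i - u (Suc i) * phi) \<in> cherednik_ideal n c" if "S \<subseteq> {1..<n}" for S
    using finite_subset[OF that finite_atLeastLessThan] that
  proof (induction S rule: finite_induct)
    case empty
    have "0 * (phi * u n - (u 1 - 1) * phi) \<in> cherednik_ideal n c"
      by (rule ideal_lmult[OF phi_u_last FC_zero])
    then show ?case by simp
  next
    case (insert x S)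
    then show ?case by (simp add: ideal_add phi_u)
  qed
  ultimately show ?thesis using phi_u_last by (simp add: ideal_add)
qed

text \<open>\<open>phi\<close> permutes the u_i cyclically with a shift by one at the last index, so
  it raises E by one. x_1 differs from \<open>phi\<close> by a permutation, which commutes with E,
  and conjugation gives the other x_i.\<close>

lemma E_x:
  assumes i: "i \<in> {1..n}"
  shows "E * gx i - gx i * (E + 1) \<in> cherednik_ideal n c"
proof -
  let ?t = "sg (Transposition.transpose 1 i)"
  have p: "perm (Transposition.transpose 1 i)" by (rule perm_transpose[OF one_two(1) i])
  have x1: "gx 1 = phi * sg wi" by (simp add: phi_def mult.assoc sg_w)
  have "E * gx 1 - gx 1 * (E + 1) = (- 1) * ((phi * E - (E - 1) * phi) * sg wi)"
    unfolding x1 using sg_E[OF perm_wi] by (simp add: algebra_simps)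
  then have 1: "E * gx 1 - gx 1 * (E + 1) \<in> cherednik_ideal n c"
    using ideal_lmult[OF ideal_rmult[OF phi_E FC_sg[OF perm_wi]] FC_uminus[OF FC_one]] by simp
  have tt: "?t * ?t = 1" by (simp add: sg_mult sg_id)
  have xi: "gx i = ?t * gx 1 * ?t"
  proof -
    have "?t * gx 1 = gx i * ?t" by (simp add: sg_gx)
    then show ?thesis by (simp add: mult.assoc tt)
  qed
  have l: "E * gx i = ?t * E * gx 1 * ?t"
    unfolding xi by (simp only: mult.assoc[symmetric] sg_E[OF p])
  have r: "gx i * E = ?t * gx 1 * (E * ?t)"
    unfolding xi by (simp only: mult.assoc sg_E[OF p])
  have "?t * (E * gx 1 - gx 1 * (E + 1)) * ?t = ?t * E * gx 1 * ?t - ?t * gx 1 * (E * ?t) - ?t * gx 1 * ?t"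
    by (simp add: algebra_simps)
  also have "\<dots> = E * gx i - gx i * (E + 1)"
    unfolding l[symmetric] r[symmetric] xi[symmetric] by (simp add: algebra_simps)
  finally show ?thesis
    using ideal_rmult[OF ideal_lmult[OF 1 FC_sg[OF p]] FC_sg[OF p]] by simp
qed

end

section \<open>Homogeneous elements and the projection to degree zero\<close>

locale highest_weight_ideal = left_ideal +
  assumes K_y: "i \<in> {1..n} \<Longrightarrow> gy i \<in> K"
    and K_JM: "i \<in> {1..n} \<Longrightarrow> JM i - scalar (of_int (ct0 i)) \<in> K"
begin

lemma one_Wt: "1 \<in> Wt (wt P0)"
proof -
  have "u i * 1 \<approx> scalar (wt P0 i) * 1" if i: "i \<in> {1..n}" for i
  proof -
    have "wt P0 i = - c * of_int (ct0 i)" using i by (simp add: wt_def P0_at' c_def)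
    then have "u i - scalar (wt P0 i) = gx i * gy i - scalar c * (JM i - scalar (of_int (ct0 i)))"
      by (simp add: u_def algebra_simps scalar_mult scalar_minus)
    also have "\<dots> \<in> K" using i by (intro K_diff K_mult K_y K_JM FC_gx FC_scalar)
    finally show ?thesis by (simp add: eqv_def)
  qed
  then show ?thesis by (simp add: Wt_def FC_one)
qed

lemma Wt_E: "h \<in> Wt w \<Longrightarrow> E * h \<approx> scalar (\<Sum>i\<in>{1..n}. w i) * h"
proof -
  assume h: "h \<in> Wt w"
  have s: "scalar (sum f S) = (\<Sum>i\<in>S. scalar (f i))" if "finite S" for f and S :: "nat set"
    using that by (induction S rule: finite_induct) (simp_all add: scalar_0 scalar_add)
  show ?thesis unfolding E_def s[OF finite_atLeastAtMost] sum_distrib_right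
    by (rule eqv_sum) (use WtD(2)[OF h] in auto)
qed

text \<open>Homogeneous of degree d modulo K: words of length d in the x_i applied to the group
  algebra. K is put into every degree so that the predicate respects congruence.\<close>

inductive D :: "nat \<Rightarrow> (wperm \<Rightarrow>\<^sub>0 complex) \<Rightarrow> bool" where
  D_K: "h \<in> K \<Longrightarrow> D d h"
| D_g: "perm g \<Longrightarrow> D 0 (scalar z * sg g)"
| D_x: "D d h \<Longrightarrow> i \<in> {1..n} \<Longrightarrow> D (Suc d) (gx i * h)"
| D_add: "D d h \<Longrightarrow> D d h' \<Longrightarrow> D d (h + h')"

lemma D_FC: "D d h \<Longrightarrow> h \<in> FC n"
proof (induction rule: D.induct)
  case (D_x d h i)
  show ?case by (rule FC_mult[OF FC_gx[OF D_x(2)] D_x(3)])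
qed (auto intro: K_FC FC_mult FC_scalar FC_sg FC_add)

lemma D_E: "D d h \<Longrightarrow> E * h \<approx> scalar (\<epsilon> + of_nat d) * h"
proof (induction rule: D.induct)
  case (D_K h d)
  then have "E * h \<in> K" "scalar (\<epsilon> + of_nat d) * h \<in> K" by (auto intro: K_mult FC_E FC_scalar)
  then show ?case unfolding eqv_def by (rule K_diff)
next
  case (D_g g z)
  have "E * (scalar z * sg g) = scalar z * (sg g * E)" by (simp only: scalar_left sg_E[OF D_g])
  moreover have "scalar z * sg g * (E * 1) \<approx> scalar z * sg g * (scalar \<epsilon> * 1)"
    unfolding \<epsilon>_def by (intro eqv_mult FC_mult FC_scalar FC_sg D_g Wt_E one_Wt)
  moreover have "scalar z * sg g * (E * 1) = scalar z * (sg g * E)"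
    by (simp only: mult.assoc mult_1_right)
  moreover have "scalar z * sg g * (scalar \<epsilon> * 1) = scalar \<epsilon> * (scalar z * sg g)"
    using scalar_left[of "scalar z * sg g" \<epsilon> 1] by (simp only: mult_1_right)
  ultimately show ?case by simp
next
  case (D_x d h i)
  note hF = D_FC[OF D_x(1)]
  have "E * (gx i * h) \<approx> gx i * (E * h) + gx i * h"
    using eqv_ideal[OF E_x[OF D_x(2)] hF] by (simp add: mult.assoc distrib_left distrib_right)
  also have "gx i * (E * h) + gx i * h \<approx> gx i * (scalar (\<epsilon> + of_nat d) * h) + gx i * h"
    by (intro eqv_add eqv_mult FC_gx D_x eqv_refl)
  also have "\<dots> = (scalar (\<epsilon> + of_nat d) + 1) * (gx i * h)"
    by (simp only: scalar_left[of "gx i"] distrib_right mult_1_left)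
  also have "scalar (\<epsilon> + of_nat d) + 1 = scalar (\<epsilon> + of_nat (Suc d))"
    by (simp add: scalar_add scalar_1 algebra_simps)
  finally show ?case .
next
  case (D_add d h h')
  then show ?case using eqv_add by (simp add: distrib_left)
qed

lemma D_sg: "D d h \<Longrightarrow> perm g \<Longrightarrow> D d (sg g * h)"
proof (induction rule: D.induct)
  case (D_K h d)
  then show ?case by (intro D.D_K K_mult FC_sg)
next
  case (D_g g' z)
  have "sg g * (scalar z * sg g') = scalar z * sg (g \<circ> g')" by (simp only: scalar_left sg_mult)
  then show ?case using D.D_g[OF permutes_compose[OF D_g(1,2)]] by simp
next
  case (D_x d h i)
  have "sg g * (gx i * h) = gx (g i) * (sg g * h)" by (metis mult.assoc sg_gx)
  moreover have "g i \<in> {1..n}" using permutes_in_image[OF D_x(4)] D_x(2) by simp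
  ultimately show ?case using D.D_x[OF D_x(3)[OF D_x(4)]] by simp
next
  case (D_add d h h')
  then show ?case by (simp add: distrib_left D.D_add)
qed

lemma D_scalar: "D d h \<Longrightarrow> D d (scalar z * h)"
proof (induction rule: D.induct)
  case (D_K h d)
  then show ?case by (intro D.D_K K_mult FC_scalar)
next
  case (D_g g' y)
  have "scalar z * (scalar y * sg g') = scalar (z * y) * sg g'" by (simp add: scalar_mult mult.assoc)
  then show ?case using D.D_g[OF D_g] by simp
next
  case (D_x d h i)
  then show ?case using D.D_x[OF D_x(3,2)] by (simp only: scalar_left)
next
  case (D_add d h h')
  then show ?case by (simp add: distrib_left D.D_add)
qed

lemma D_eqv: "D d h \<Longrightarrow> h' \<approx> h \<Longrightarrow> D d h'"
  using D_add[of d h "h' - h"] D_K[of "h' - h" d] by (simp add: eqv_def)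

lemma D_diff: "D d h \<Longrightarrow> D d h' \<Longrightarrow> D d (h - h')"
  using D_add[of d h "scalar (-1) * h'"] D_scalar[of d h' "-1"] by (simp add: scalar_minus scalar_1)

lemma D_sum: "(\<And>j. j \<in> S \<Longrightarrow> D d (f j)) \<Longrightarrow> D d (sum f S)"
  by (induction S rule: infinite_finite_induct) (auto intro: D_add D_K K_zero)

text \<open>Moving y_i to the right past an x_j leaves only group elements behind; at the right end
  it passes the group algebra and falls into K.\<close>

lemma D_y: "D d h \<Longrightarrow> i \<in> {1..n} \<Longrightarrow> (if d = 0 then gy i * h \<in> K else D (d - 1) (gy i * h))"
proof (induction arbitrary: i rule: D.induct)
  case (D_K h d)
  have "gy i * h \<in> K" by (rule K_mult[OF FC_gy[OF D_K(2)] D_K(1)])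
  then show ?case by (simp add: D.D_K)
next
  case (D_g g z)
  have "gy i * sg g = sg g * gy (inv g i)"
    using sg_gy[of g "inv g i"] permutes_inverses(1)[OF D_g(1)] by simp
  moreover have "inv g i \<in> {1..n}" using permutes_in_image[OF permutes_inv[OF D_g(1)]] D_g(2) by simp
  ultimately have "gy i * (scalar z * sg g) \<in> K"
    using K_mult[OF FC_mult[OF FC_scalar FC_sg[OF D_g(1)]] K_y] by (simp add: scalar_left mult.assoc)
  then show ?case by simp
next
  case (D_x d h j)
  note hF = D_FC[OF D_x(1)]
  have xy: "D d (gx j * (gy i * h))"
  proof (cases "d = 0")
    case True
    then have "gy i * h \<in> K" using D_x(3)[OF D_x(4)] by simp
    from D.D_K[OF K_mult[OF FC_gx[OF D_x(2)] this]] show ?thesis .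
  next
    case False
    then have "D (d - 1) (gy i * h)" using D_x(3)[OF D_x(4)] by simp
    from D.D_x[OF this D_x(2)] False show ?thesis by simp
  qed
  have tD: "D d (transp i k * h)" if "k \<in> {1..n}" for k
    unfolding transp_sg by (intro D_sg D_x(1) perm_transpose D_x(4) that)
  have "D d (gy i * (gx j * h))"
  proof (cases "i = j")
    case False
    have "gy i * gx j * h \<approx> (gx j * gy i + scalar c * transp i j) * h"
      by (rule eqv_ideal[OF _ hF]) (use rel_yx[OF D_x(4,2) False] in \<open>simp add: algebra_simps\<close>)
    moreover have "D d ((gx j * gy i + scalar c * transp i j) * h)"
      using D_add[OF xy D_scalar[OF tD[OF D_x(2)], of c]] by (simp add: distrib_right mult.assoc)
    ultimately show ?thesis using D_eqv by (simp add: mult.assoc)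
  next
    case True
    let ?S = "\<Sum>k \<in> {1..n} - {i}. transp i k"
    have "gy i * gx i * h \<approx> (gx i * gy i + (1 - scalar c * ?S)) * h"
      by (rule eqv_ideal[OF _ hF]) (use rel_yx_same[OF D_x(4)] in \<open>simp add: algebra_simps\<close>)
    moreover have "D d (?S * h)" unfolding sum_distrib_right by (rule D_sum) (use tD in auto)
    then have "D d ((gx i * gy i + (1 - scalar c * ?S)) * h)"
      using D_add[OF xy D_diff[OF D_x(1) D_scalar[of d "?S * h" c]]] True
      by (simp add: distrib_right left_diff_distrib mult.assoc)
    ultimately show ?thesis using D_eqv True by (simp add: mult.assoc)
  qed
  then show ?case by simp
next
  case (D_add d h h')
  then show ?case using D.D_add K_add by (auto simp: distrib_left split: if_splits)
qed

inductive M :: "(wperm \<Rightarrow>\<^sub>0 complex) \<Rightarrow> bool" where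
  M_D: "D d h \<Longrightarrow> M h"
| M_add: "M h \<Longrightarrow> M h' \<Longrightarrow> M (h + h')"

lemma M_x: "M h \<Longrightarrow> i \<in> {1..n} \<Longrightarrow> M (gx i * h)"
proof (induction rule: M.induct)
  case (M_D d h)
  show ?case by (rule M.M_D[OF D_x[OF M_D]])
qed (auto simp: distrib_left intro: M_add)

lemma M_y: "M h \<Longrightarrow> i \<in> {1..n} \<Longrightarrow> M (gy i * h)"
proof (induction rule: M.induct)
  case (M_D d h)
  then show ?case using D_y[of d h i] D_K M.M_D by (auto split: if_splits)
qed (auto simp: distrib_left intro: M_add)

lemma M_word: "letter_index ` set w \<subseteq> {1..n} \<Longrightarrow> perm g \<Longrightarrow> M (Poly_Mapping.single (WPerm w g) z)"
proof (induction w)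
  case Nil
  have "Poly_Mapping.single (WPerm [] g) z = scalar z * sg g"
    using single_times_eq[of "WPerm [] g" z] by (simp add: sg_def)
  then show ?case using M_D[OF D_g[OF Nil(2)]] by simp
next
  case (Cons a w)
  have id: "map (act_letter id) w = w"
    by (rule map_idI) (metis act_letter.simps id_apply letter_index.cases)
  have "Poly_Mapping.single (WPerm (a # w) g) z
      = Poly_Mapping.single (WPerm [a] id) 1 * Poly_Mapping.single (WPerm w g) z"
    by (simp only: mult_single plus_wperm_def wperm.sel id id_comp mult_1_left append.simps)
  moreover have "M (Poly_Mapping.single (WPerm [a] id) 1 * Poly_Mapping.single (WPerm w g) z)"
    using Cons M_x M_y by (cases a) (auto simp: gx_def[symmetric] gy_def[symmetric])
  ultimately show ?case by simp
qed

text \<open>The spanning half of the triangular decomposition: modulo K every element is a sum of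
  polynomials in the x_i times group elements.\<close>

lemma M_all: "h \<in> FC n \<Longrightarrow> M h"
proof -
  assume "h \<in> FC n"
  then have "\<forall>p\<in>Poly_Mapping.keys h. okp n p" by (simp add: FC_iff)
  then show ?thesis
  proof (induction h rule: poly_mapping_span_induct)
    case zero
    show ?case by (rule M_D[OF D_K[OF K_zero, of 0]])
  next
    case (single p z)
    then show ?case using M_word[of "wp_word p" "wp_perm p" z] by (simp add: okp_def)
  qed (rule M_add)
qed

text \<open>\<open>pr N\<close> is a Lagrange polynomial in the Euler element: it annihilates the degrees \<open>1, \<dots>, N\<close> and
  fixes degree \<open>0\<close>.\<close>

fun pr :: "nat \<Rightarrow> wperm \<Rightarrow>\<^sub>0 complex" where
  "pr 0 = 1"
| "pr (Suc N) = scalar (- 1 / of_nat (Suc N)) * (E - scalar (\<epsilon> + of_nat (Suc N))) * pr N"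

lemma FC_pr: "pr N \<in> FC n"
  by (induction N) (auto intro!: FC_one FC_mult FC_scalar FC_diff FC_E)

text \<open>On degree d the factor with index j contributes 1 - d / j, which is 0 for j = d and 1
  for d = 0.\<close>

lemma pr_eigen:
  assumes "h \<in> FC n" "E * h \<approx> scalar (\<epsilon> + of_nat d) * h"
  shows "pr N * h \<approx> scalar (\<Prod>j\<in>{1..N}. 1 - of_nat d / of_nat j) * h"
proof (induction N)
  case 0
  then show ?case by (simp add: scalar_1)
next
  case (Suc N)
  let ?z = "\<Prod>j\<in>{1..N}. 1 - of_nat d / (of_nat j :: complex)" and ?e = "\<epsilon> + of_nat (Suc N)"
  let ?A = "scalar (- 1 / of_nat (Suc N)) * (E - scalar ?e)"
  have A: "?A \<in> FC n" by (intro FC_mult FC_diff FC_E FC_scalar)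
  have "pr (Suc N) * h = ?A * (pr N * h)" by (simp only: pr.simps mult.assoc)
  also have "\<dots> \<approx> ?A * (scalar ?z * h)" by (rule eqv_mult[OF A Suc])
  also have "\<dots> = scalar (- 1 / of_nat (Suc N)) * (scalar ?z * (E * h - scalar ?e * h))"
    by (simp only: mult.assoc scalar_left[of "E - scalar ?e"] left_diff_distrib[symmetric])
  also have "\<dots> \<approx> scalar (- 1 / of_nat (Suc N)) * (scalar ?z * (scalar (\<epsilon> + of_nat d) * h - scalar ?e * h))"
    by (intro eqv_mult FC_scalar eqv_diff assms eqv_refl)
  also have "\<dots> = scalar (- 1 / of_nat (Suc N) * (?z * (\<epsilon> + of_nat d - ?e))) * h"
    by (simp only: scalar_mult scalar_diff mult.assoc left_diff_distrib)
  also have "- 1 / of_nat (Suc N) * (?z * (\<epsilon> + of_nat d - ?e)) = (\<Prod>j\<in>{1..Suc N}. 1 - of_nat d / of_nat j)"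
  proof -
    have "(of_nat (Suc N) :: complex) \<noteq> 0" by (simp del: of_nat_Suc)
    then have "- 1 / of_nat (Suc N) * (\<epsilon> + of_nat d - ?e) = 1 - of_nat d / (of_nat (Suc N) :: complex)"
      by (simp add: field_simps del: of_nat_Suc)
    moreover have "(\<Prod>j\<in>{1..Suc N}. 1 - of_nat d / (of_nat j :: complex)) = ?z * (1 - of_nat d / of_nat (Suc N))"
      by simp
    moreover have "- 1 / of_nat (Suc N) * (?z * (\<epsilon> + of_nat d - ?e)) = ?z * (- 1 / of_nat (Suc N) * (\<epsilon> + of_nat d - ?e))"
      by (rule mult.left_commute)
    ultimately show ?thesis by (simp only:)
  qed
  finally show ?case .
qed

lemma pr_zero: "D d h \<Longrightarrow> 0 < d \<Longrightarrow> d \<le> N \<Longrightarrow> pr N * h \<in> K"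
proof -
  assume h: "D d h" "0 < d" "d \<le> N"
  have "(\<Prod>j\<in>{1..N}. 1 - of_nat d / of_nat j) = (0 :: complex)"
    using h by (intro prod_zero bexI[of _ d]) auto
  with pr_eigen[OF D_FC[OF h(1)] D_E[OF h(1)], of N] show ?thesis
    by (simp add: scalar_0 eqv_zero_iff)
qed

lemma pr_fix: "h \<in> FC n \<Longrightarrow> E * h \<approx> scalar \<epsilon> * h \<Longrightarrow> pr N * h \<approx> h"
  using pr_eigen[of h 0 N] by (simp add: scalar_1)

lemma D0_CS: "D d h \<Longrightarrow> d = 0 \<Longrightarrow> \<exists>s\<in>CS n. h \<approx> s"
proof (induction rule: D.induct)
  case (D_K h d)
  then show ?case using eqv_zero_iff CS_zero by blast
next
  case (D_g g z)
  then show ?case by (intro bexI[of _ "scalar z * sg g"] CS_mult CS_scalar CS_sg) auto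
next
  case (D_add d h h')
  then obtain s s' where "s \<in> CS n" "s' \<in> CS n" "h \<approx> s" "h' \<approx> s'" by blast
  then show ?case using eqv_add CS_add by blast
qed simp

text \<open>The bound is uniform in all larger N' so that the bounds of two summands can be
  merged.\<close>

lemma M_proj: "M h \<Longrightarrow> \<exists>s\<in>CS n. \<exists>N. \<forall>N'\<ge>N. pr N' * h \<approx> s"
proof (induction rule: M.induct)
  case (M_D d h)
  show ?case
  proof (cases "d = 0")
    case True
    then obtain s where s: "s \<in> CS n" "h \<approx> s" using D0_CS[OF M_D] by blast
    have "E * h \<approx> scalar \<epsilon> * h" using D_E[OF M_D] True by simp
    then have "pr N * h \<approx> s" for N using pr_fix[OF D_FC[OF M_D]] s eqv_trans by blast
    then show ?thesis using s by blast
  next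
    case False
    then have "\<forall>N'\<ge>d. pr N' * h \<approx> 0" using pr_zero[OF M_D] eqv_zero_iff by simp
    then show ?thesis using CS_zero by blast
  qed
next
  case (M_add h h')
  then obtain s s' N N' where s: "s \<in> CS n" "s' \<in> CS n"
    "\<forall>M\<ge>N. pr M * h \<approx> s" "\<forall>M\<ge>N'. pr M * h' \<approx> s'" by blast
  have "\<forall>M\<ge>max N N'. pr M * (h + h') \<approx> s + s'"
    using s(3,4) eqv_add by (simp add: distrib_left)
  then show ?case using CS_add[OF s(1,2)] by blast
qed

lemma degree_zero_part:
  assumes "h \<in> FC n"
  obtains s N where "s \<in> CS n" "pr N * h \<approx> s"
  using M_proj[OF M_all[OF assms]] by blast

text \<open>The sum over S_j factors as the product of the 1 + JM_i with i <= j. On an eigenvector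
  with the row contents the factor for i is 1 + (i - 1) = i, which produces the factorial.\<close>

lemma row_sum_eigen:
  assumes s: "s \<in> FC n" and JM: "\<And>i. i \<in> {1..n - l} \<Longrightarrow> JM i * s \<approx> scalar (of_int (ct0 i)) * s"
  shows "ra * s \<approx> scalar (of_nat (fact (n - l))) * s"
proof -
  have "j \<le> n - l \<Longrightarrow> (\<Sum>g\<in>{g. g permutes {1..j}}. sg g) * s \<approx> scalar (of_nat (fact j)) * s" for j
  proof (induction j)
    case 0
    have "{g. g permutes {1..0::nat}} = {id}" by (auto simp: permutes_empty)
    then show ?case by (simp add: sg_id[unfolded id_def] sg_id scalar_1)
  next
    case (Suc j)
    let ?A = "\<lambda>j. \<Sum>g\<in>{g. g permutes {1..j}}. sg g"
    have 1: "{1..Suc j} = insert (Suc j) {1..j}" by auto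
    have JS: "JM (Suc j) = (\<Sum>b\<in>{1..j}. transp (Suc j) b)" by (simp add: JM_def atLeastLessThanSuc_atLeastAtMost)
    have "?A (Suc j) = (\<Sum>b\<in>insert (Suc j) {1..j}. \<Sum>q\<in>{q. q permutes {1..j}}. sg (Transposition.transpose (Suc j) b \<circ> q))"
      unfolding 1 by (rule sum_over_permutations_insert) auto
    also have "\<dots> = (\<Sum>b\<in>insert (Suc j) {1..j}. transp (Suc j) b * ?A j)"
      by (simp add: sum_distrib_left sg_mult transp_sg)
    also have "\<dots> = transp (Suc j) (Suc j) * ?A j + JM (Suc j) * ?A j"
      by (simp add: JS sum_distrib_right)
    also have "transp (Suc j) (Suc j) = 1" by (simp add: transp_sg sg_id[unfolded id_def] sg_id)
    finally have "?A (Suc j) * s = (1 + JM (Suc j)) * (?A j * s)"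
      by (simp add: distrib_right mult.assoc)
    also have "\<dots> \<approx> (1 + JM (Suc j)) * (scalar (of_nat (fact j)) * s)"
      by (intro eqv_mult FC_add FC_one FC_JM Suc.IH) (use Suc.prems in auto)
    also have "\<dots> = scalar (of_nat (fact j)) * (s + JM (Suc j) * s)"
      unfolding scalar_left by (simp add: distrib_right)
    also have "\<dots> \<approx> scalar (of_nat (fact j)) * (s + scalar (of_int (ct0 (Suc j))) * s)"
      by (intro eqv_mult FC_scalar eqv_add eqv_refl JM) (use Suc.prems in auto)
    also have "\<dots> = scalar (of_nat (fact j)) * (scalar (of_nat (Suc j)) * s)"
      using Suc.prems by (simp add: ct0_def scalar_add scalar_1 distrib_right)
    also have "\<dots> = scalar (of_nat (fact (Suc j))) * s"
    proof -
      have "(of_nat (fact (Suc j)) :: complex) = of_nat (fact j) * of_nat (Suc j)" by (simp add: algebra_simps)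
      then show ?thesis by (simp only: scalar_mult mult.assoc)
    qed
    finally show ?case .
  qed
  then show ?thesis unfolding ra_def by simp
qed

end

section \<open>The weight space of the highest weight\<close>

locale standard_ideal = highest_weight_ideal +
  assumes K_young: "s \<in> CS n \<Longrightarrow> s * (ra * rb) = 0 \<Longrightarrow> s \<in> K"
    and K_act: "h \<in> K \<Longrightarrow> act h e0 = (\<lambda>P. 0)"
begin

text \<open>By \<open>ra_CS_rb\<close>, a s a b is a scalar multiple of a b, so a s minus that
  scalar annihilates a b and lies in K.\<close>

lemma ra_CS: "s \<in> CS n \<Longrightarrow> \<exists>z. ra * s \<approx> scalar z"
proof -
  assume s: "s \<in> CS n"
  obtain z where z: "ra * (s * ra) * rb = scalar z * (ra * rb)" using ra_CS_rb[OF CS_mult[OF s CS_ra]] by blast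
  have "(ra * s - scalar z) * (ra * rb) = 0" using z by (simp add: left_diff_distrib mult.assoc)
  then have "ra * s - scalar z \<in> K" by (intro K_young CS_diff CS_mult CS_ra s CS_scalar)
  then show ?thesis by (auto simp: eqv_def)
qed

lemma act_eqv: "a \<approx> b \<Longrightarrow> act a e0 = act b e0"
  using K_act[of "a - b"] by (simp add: eqv_def act_diff fun_eq_iff)

text \<open>The projection to degree 0 does not change h modulo K, so h is congruent to some s in
  the group algebra. Then a s is congruent both to (n - l)! s, by the row contents, and to a scalar,
  by \<open>ra_CS\<close>.\<close>

lemma Wt_top_scalar:
  assumes h: "h \<in> Wt (wt P0)"
  shows "\<exists>z. h \<approx> scalar z"
proof -
  note hF = WtD(1)[OF h]
  obtain s N where s: "s \<in> CS n" "pr N * h \<approx> s" by (rule degree_zero_part[OF hF])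
  have "pr N * h \<approx> h" using pr_fix[OF hF] Wt_E[OF h] unfolding \<epsilon>_def by blast
  then have hs: "h \<approx> s" using s(2) eqv_sym eqv_trans by blast
  have sF: "s \<in> FC n" by (rule CS_FC[OF s(1)])
  have "JM i * s \<approx> scalar (of_int (ct0 i)) * s" if i: "i \<in> {1..n - l}" for i
  proof -
    have i': "i \<in> {1..n}" using i by auto
    have "u i * s \<approx> u i * h" by (rule eqv_mult[OF FC_u[OF i'] eqv_sym[OF hs]])
    also have "\<dots> \<approx> scalar (wt P0 i) * h" using WtD(2)[OF h] i' by auto
    also have "\<dots> \<approx> scalar (wt P0 i) * s" by (rule eqv_mult[OF FC_scalar hs])
    finally have 1: "u i * s \<approx> scalar (wt P0 i) * s" .
    \<comment> \<open>Degree 0 elements are sent into K by the y_i, so on s the element u_i reduces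
      to - c times the Jucys-Murphy element.\<close>
    have D0: "D 0 s" using s(1)
    proof (induction s rule: CS_induct)
      case zero
      show ?case by (rule D_K[OF K_zero])
    qed (auto intro: D_g D_add)
    then have "gy i * s \<in> K" using D_y[OF D0 i'] by simp
    then have "gx i * (gy i * s) \<in> K" by (rule K_mult[OF FC_gx[OF i']])
    then have 2: "gx i * (gy i * s) - u i * s \<approx> 0 - scalar (wt P0 i) * s"
      by (intro eqv_diff 1) (simp add: eqv_zero_iff)
    have "gx i * (gy i * s) - u i * s = scalar c * (JM i * s)"
      by (simp add: u_def left_diff_distrib mult.assoc)
    moreover have "- wt P0 i = c * of_int (ct0 i)" using i' by (simp add: wt_def P0_at' c_def)
    then have "0 - scalar (wt P0 i) * s = scalar c * (scalar (of_int (ct0 i)) * s)"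
      by (metis diff_0 minus_mult_left mult.assoc scalar_minus scalar_mult)
    ultimately have "scalar c * (JM i * s - scalar (of_int (ct0 i)) * s) \<in> K"
      using 2 by (simp add: eqv_def right_diff_distrib)
    then show ?thesis unfolding eqv_def by (rule scalar_K[OF c_nonzero])
  qed
  from row_sum_eigen[OF sF this] have r: "ra * s \<approx> scalar (of_nat (fact (n - l))) * s" .
  obtain z where "ra * s \<approx> scalar z" using ra_CS[OF s(1)] by blast
  then have "scalar (of_nat (fact (n - l))) * s \<approx> scalar z" using r eqv_sym eqv_trans by blast
  from eqv_mult[OF FC_scalar this, of "1 / of_nat (fact (n - l))"]
  have "s \<approx> scalar (z / of_nat (fact (n - l)))"
    by (simp add: mult.assoc[symmetric] scalar_mult[symmetric] scalar_1)
  then show ?thesis using hs eqv_trans by blast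
qed

text \<open>Transported to \<open>P0\<close> the vector becomes a scalar, which its action on
  \<open>e0\<close> shows to be 0; the way back only divides by a nonzero scalar.\<close>

lemma Wt_J_faithful:
  assumes P: "J P" and h: "h \<in> Wt (wt P)" and "act h e0 = (\<lambda>P. 0)"
  shows "h \<in> K"
proof -
  obtain a b z where a: "a \<in> FC n" "a * h \<in> Wt (wt P0)" and b: "b \<in> FC n" and z: "z \<noteq> 0" "b * (a * h) \<approx> scalar z * h"
    using linked_P0[OF P] h unfolding linked_def by blast
  obtain y where y: "a * h \<approx> scalar y" using Wt_top_scalar[OF a(2)] by blast
  have "act (a * h) e0 = act a (\<lambda>P. 0 * (0::complex))" using act_mult[OF a(1) WtD(1)[OF h]] assms(3) by simp
  then have "act (a * h) e0 = (\<lambda>P. 0)" using act_linear(2)[OF a(1), of 0 "\<lambda>_. 0"] by simp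
  then have "act (scalar y) e0 P0 = 0" using act_eqv[OF y] by simp
  then have "y = 0" by (simp add: act_scalar e0_def)
  then have "a * h \<in> K" using y by (simp add: scalar_0 eqv_zero_iff)
  then have "scalar z * h \<in> K" using eqv_K[OF z(2)] K_mult[OF b] by blast
  then show ?thesis by (rule scalar_K[OF z(1)])
qed

end

section \<open>The annihilator of the highest weight function\<close>

context hook_model
begin

definition Ann :: "(wperm \<Rightarrow>\<^sub>0 complex) set" where
  "Ann = {h \<in> FC n. act h e0 = (\<lambda>P. 0)}"

lemma Ann_iff: "h \<in> Ann \<longleftrightarrow> h \<in> FC n \<and> (\<forall>Q. act h e0 Q = 0)"
  by (auto simp: Ann_def)

lemma act_zero_fun: "h \<in> FC n \<Longrightarrow> act h (\<lambda>P. 0) = (\<lambda>P. 0)"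
  using act_linear(2)[of h 0 "\<lambda>P. 0"] by simp

lemma act_JM_e0: "i \<in> {1..n} \<Longrightarrow> act (JM i) e0 = (\<lambda>P. of_int (ct0 i) * e0 P)"
  using JM_e0[of i] by (simp add: JM_def act_sum transp_sg act_sg)

lemma Ann_ideal: "highest_weight_ideal n m l Ann"
proof unfold_locales
  show "h \<in> Ann \<Longrightarrow> h \<in> FC n" for h by (simp add: Ann_def)
  show "a \<in> Ann \<Longrightarrow> b \<in> Ann \<Longrightarrow> a + b \<in> Ann" for a b
    by (simp add: Ann_def FC_add act_add)
  show "g \<in> FC n \<Longrightarrow> a \<in> Ann \<Longrightarrow> g * a \<in> Ann" for g a
    by (simp add: Ann_def FC_mult act_mult act_zero_fun)
  show "a \<in> cherednik_ideal n c \<Longrightarrow> a \<in> Ann" for a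
    by (simp add: Ann_def ideal_FC ideal_act W_affsupp[OF W_e0])
  show "gy i \<in> Ann" if "i \<in> {1..n}" for i
    using that by (simp add: Ann_def FC_gy act_gy Y_e0 del: atLeastAtMost_iff)
  show "JM i - scalar (of_int (ct0 i)) \<in> Ann" if "i \<in> {1..n}" for i
    using that by (simp add: Ann_def FC_diff FC_JM FC_scalar act_diff act_JM_e0 act_scalar del: atLeastAtMost_iff)
qed

text \<open>FC / Ann is the submodule of functions generated by \<open>e0\<close>; this instance
  makes the intertwiners available inside it.\<close>

sublocale ann: highest_weight_ideal n m l Ann
  by (rule Ann_ideal)

lemma act_u: "W f \<Longrightarrow> i \<in> {1..n} \<Longrightarrow> act (u i) f = U i f"
proof -
  assume f: "W f" and i: "i \<in> {1..n}"
  have F: "gx i * gy i \<in> FC n" by (intro FC_mult FC_gx FC_gy i)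
  have "act (u i) f = (\<lambda>P. act (gx i * gy i) f P - c * act (JM i) f P)"
    unfolding u_def act_diff act_scalar_mult[OF FC_JM[OF i]] ..
  also have "act (gx i * gy i) f = X i (Y i f)"
    by (simp add: act_mult[OF FC_gx[OF i] FC_gy[OF i]] act_gx act_gy)
  also have "act (JM i) f = (\<lambda>P. \<Sum>j\<in>{1..<i}. \<rho> (Transposition.transpose i j) f P)"
    by (simp add: JM_def act_sum transp_sg act_sg)
  finally show ?thesis using U_eq[of i f] i W_affsupp[OF f] by simp
qed

lemma aff_determined:
  assumes "aff n P" "aff n Q" "\<And>i. i \<in> {1..n} \<Longrightarrow> P (int i) = Q (int i)"
  shows "P = Q"
proof
  fix z
  obtain i r where i: "1 \<le> i" "i \<le> n" and z: "z = int i + int n * r" by (rule int_rep)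
  show "P z = Q z"
    unfolding z aff_per_mult[OF assms(1)] aff_per_mult[OF assms(2)] using assms(3) i by simp
qed

lemma wt_eqD:
  assumes "aff n P" "aff n Q" "\<And>i. i \<in> {1..n} \<Longrightarrow> wt P i = wt Q i"
  shows "P = Q"
proof (rule aff_determined[OF assms(1,2)])
  fix i assume "i \<in> {1..n}"
  from assms(3)[OF this] show "P (int i) = Q (int i)" using n2 by (simp add: wt_def)
qed

lemma W_act_e0: "h \<in> FC n \<Longrightarrow> W (act h e0)"
  by (rule W_act[OF _ W_e0])

lemma act_u_mult: "h \<in> FC n \<Longrightarrow> i \<in> {1..n} \<Longrightarrow> act (u i * h) e0 Q = wt Q i * act h e0 Q"
  by (simp add: act_mult FC_u act_u W_act_e0 U_def wt_def del: atLeastAtMost_iff)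

text \<open>An affine permutation is determined by its values at 1 to n, so the eigenvalues of the
  u_i separate the points of J.\<close>

lemma ann_Wt_iff:
  assumes P: "aff n P" and h: "h \<in> FC n"
  shows "h \<in> ann.Wt (wt P) \<longleftrightarrow> (\<forall>Q. act h e0 Q \<noteq> 0 \<longrightarrow> Q = P)"
proof -
  have "ann.eqv (u i * h) (scalar (wt P i) * h) \<longleftrightarrow> (\<forall>Q. (wt Q i - wt P i) * act h e0 Q = 0)"
    if i: "i \<in> {1..n}" for i
    unfolding ann.eqv_def Ann_iff using i h
    by (simp add: FC_diff FC_mult FC_u FC_scalar act_diff act_u_mult
        act_scalar_mult left_diff_distrib del: atLeastAtMost_iff mult_eq_0_iff)
  then have "h \<in> ann.Wt (wt P) \<longleftrightarrow> (\<forall>i\<in>{1..n}. \<forall>Q. (wt Q i - wt P i) * act h e0 Q = 0)"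
    using h unfolding ann.Wt_def by auto
  also have "\<dots> \<longleftrightarrow> (\<forall>Q. act h e0 Q \<noteq> 0 \<longrightarrow> Q = P)"
  proof (intro iffI allI impI)
    fix Q assume *: "\<forall>i\<in>{1..n}. \<forall>Q. (wt Q i - wt P i) * act h e0 Q = 0" and nz: "act h e0 Q \<noteq> 0"
    have "J Q" using W_act_e0[OF h] nz unfolding W_def by blast
    then show "Q = P" using * nz by (intro wt_eqD[OF J_aff P]) auto
  qed auto
  finally show ?thesis .
qed

definition ind :: "(int \<Rightarrow> int) \<Rightarrow> affine_fun" where
  "ind P Q = (if Q = P then 1 else 0)"

lemma ann_Wt_act:
  assumes "aff n P" "h \<in> ann.Wt (wt P)"
  shows "act h e0 = (\<lambda>Q. act h e0 P * ind P Q)"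
proof
  fix Q show "act h e0 Q = act h e0 P * ind P Q"
    using ann_Wt_iff[OF assms(1) ann.WtD(1)[OF assms(2)]] assms(2) by (cases "Q = P") (auto simp: ind_def)
qed

lemma ann_move:
  assumes "ann.linked P Q" "h \<in> ann.Wt (wt P)" "h \<notin> Ann"
  obtains a where "a \<in> FC n" "a * h \<in> ann.Wt (wt Q)" "a * h \<notin> Ann"
proof -
  obtain a b z where a: "a \<in> FC n" "a * h \<in> ann.Wt (wt Q)" and b: "b \<in> FC n"
    and z: "z \<noteq> 0" "ann.eqv (b * (a * h)) (scalar z * h)"
    using assms(1,2) unfolding ann.linked_def by blast
  have "a * h \<notin> Ann"
  proof
    assume "a * h \<in> Ann"
    then have "scalar z * h \<in> Ann" using ann.eqv_K[OF z(2)] ann.K_mult[OF b] by blast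
    then show False using ann.scalar_K[OF z(1)] assms(3) by blast
  qed
  then show thesis using that a by blast
qed

lemma one_not_Ann: "1 \<notin> Ann"
  by (auto simp: Ann_def e0_def fun_eq_iff)

text \<open>Invertible intertwiners carry \<open>e0\<close> to a nonzero multiple of the indicator
  of P. Since functions in \<open>W\<close> have finite support in J, \<open>e0\<close> generates
  all of \<open>W\<close>.\<close>

lemma ind_reached:
  assumes P: "J P"
  obtains h where "h \<in> FC n" "act h e0 = ind P"
proof -
  have "ann.linked P0 P" by (rule ann.linked_sym[OF ann.linked_P0[OF P]])
  from ann_move[OF this ann.one_Wt one_not_Ann]
  obtain b where "b \<in> FC n" "b * 1 \<in> ann.Wt (wt P)" "b * 1 \<notin> Ann" .
  then obtain a where a: "a \<in> FC n" "a \<in> ann.Wt (wt P)" "a \<notin> Ann" by simp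
  have e: "act a e0 = (\<lambda>Q. act a e0 P * ind P Q)" by (rule ann_Wt_act[OF J_aff[OF P] a(2)])
  have nz: "act a e0 P \<noteq> 0"
  proof
    assume z: "act a e0 P = 0"
    have "act a e0 Q = 0" for Q using fun_cong[OF e, of Q] unfolding z by simp
    then show False using a(1,3) unfolding Ann_iff by blast
  qed
  have "act (scalar (1 / act a e0 P) * a) e0 = ind P"
    unfolding act_scalar_mult[OF a(1)] by (subst e) (use nz in simp)
  then show thesis using that FC_mult[OF FC_scalar a(1)] by blast
qed

text \<open>Induction on the size of the support: u_i minus its eigenvalue at Q removes the point Q
  and, for a suitable i, keeps P.\<close>

lemma isolate:
  assumes N: "\<And>a b. a \<in> N \<Longrightarrow> b \<in> N \<Longrightarrow> a + b \<in> N" "\<And>g a. g \<in> FC n \<Longrightarrow> a \<in> N \<Longrightarrow> g * a \<in> N" "N \<subseteq> FC n"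
    and h: "h \<in> N" "act h e0 \<noteq> (\<lambda>P. 0)"
  shows "\<exists>h1\<in>N. \<exists>P. J P \<and> h1 \<in> ann.Wt (wt P) \<and> h1 \<notin> Ann"
  using h
proof (induction "card {P. act h e0 P \<noteq> 0}" arbitrary: h rule: less_induct)
  case less
  have hF: "h \<in> FC n" using N(3) less by blast
  have W: "W (act h e0)" by (rule W_act_e0[OF hF])
  obtain P where P: "act h e0 P \<noteq> 0" using less.prems(2) by (auto simp: fun_eq_iff)
  have JP: "J P" using W P unfolding W_def by blast
  show ?case
  proof (cases "\<exists>Q. act h e0 Q \<noteq> 0 \<and> Q \<noteq> P")
    case False
    then have "h \<in> ann.Wt (wt P)" using ann_Wt_iff[OF J_aff[OF JP] hF] by blast
    moreover have "h \<notin> Ann" using less.prems(2) by (simp add: Ann_def)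
    ultimately show ?thesis using JP less.prems(1) by blast
  next
    case True
    then obtain Q where Q: "act h e0 Q \<noteq> 0" "Q \<noteq> P" by blast
    have JQ: "J Q" using W Q unfolding W_def by blast
    obtain i where i: "i \<in> {1..n}" "wt P i \<noteq> wt Q i"
      using wt_eqD[OF J_aff[OF JP] J_aff[OF JQ]] Q(2) by metis
    let ?g = "u i - scalar (wt Q i)"
    have g: "?g \<in> FC n" by (intro FC_diff FC_u FC_scalar i)
    have e: "act (?g * h) e0 R = (wt R i - wt Q i) * act h e0 R" for R
      using act_u_mult[OF hF i(1)] act_scalar_mult[OF hF] by (simp add: left_diff_distrib act_diff)
    have fin: "finite {P. act h e0 P \<noteq> 0}" using W unfolding W_def by blast
    have "{R. act (?g * h) e0 R \<noteq> 0} \<subset> {R. act h e0 R \<noteq> 0}"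
      unfolding e using Q(1) by auto
    then have "card {R. act (?g * h) e0 R \<noteq> 0} < card {R. act h e0 R \<noteq> 0}"
      by (rule psubset_card_mono[OF fin])
    moreover have "act (?g * h) e0 \<noteq> (\<lambda>P. 0)"
    proof
      assume "act (?g * h) e0 = (\<lambda>P. 0)"
      from fun_cong[OF this, of P] show False using e[of P] P i(2) by simp
    qed
    ultimately show ?thesis using less.hyps[OF _ N(2)[OF g less.prems(1)]] by blast
  qed
qed

end

context standard_ideal
begin

lemma Wt_subset_ann: "h \<in> Wt w \<Longrightarrow> h \<in> ann.Wt w"
  unfolding Wt_def ann.Wt_def eqv_def ann.eqv_def using K_act K_FC by (auto simp: Ann_def)

text \<open>The image of \<open>e0\<close> would be a multiple of the indicator of P, but it is
  supported on J.\<close>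

lemma Wt_outside:
  assumes P: "aff n P" "\<not> J P" and h: "h \<in> Wt (wt P)"
  shows "act h e0 = (\<lambda>P. 0)"
proof -
  have "act h e0 P = 0" using W_act_e0[OF WtD(1)[OF h]] P(2) unfolding W_def by blast
  then show ?thesis using ann_Wt_act[OF P(1) Wt_subset_ann[OF h]] by simp
qed

text \<open>The isolated and transported element g has weight \<open>P0\<close> modulo Ann, but
  perhaps not modulo K, so \<open>Wt_top_scalar\<close> does not apply to it. Instead the projection
  to degree 0 followed by \<open>ra\<close> makes it a scalar modulo K, and evaluation on
  \<open>e0\<close> shows that this scalar is nonzero.\<close>

lemma ideal_generates:
  assumes N: "\<And>a b. a \<in> N \<Longrightarrow> b \<in> N \<Longrightarrow> a + b \<in> N" "\<And>g a. g \<in> FC n \<Longrightarrow> a \<in> N \<Longrightarrow> g * a \<in> N" "N \<subseteq> FC n"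
    and K: "K \<subseteq> N" and h: "h \<in> N" "act h e0 \<noteq> (\<lambda>P. 0)"
  shows "1 \<in> N"
proof -
  have N_eqv: "b \<in> N" if "a \<in> N" "a \<approx> b" for a b
  proof -
    have "b - a \<in> N" using eqv_sym[OF that(2)] K unfolding eqv_def by blast
    from N(1)[OF this that(1)] show ?thesis by simp
  qed
  obtain h1 P where h1: "h1 \<in> N" "J P" "h1 \<in> ann.Wt (wt P)" "h1 \<notin> Ann"
    using isolate[OF N h] by blast
  obtain a where a: "a \<in> FC n" "a * h1 \<in> ann.Wt (wt P0)" "a * h1 \<notin> Ann"
    using ann_move[OF ann.linked_P0[OF h1(2)] h1(3,4)] .
  define g where "g = a * h1"
  have g: "g \<in> N" "g \<in> FC n" unfolding g_def using N a(1) h1(1) by blast+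
  define z where "z = act g e0 P0"
  have ge: "act g e0 = (\<lambda>Q. z * e0 Q)"
    using ann_Wt_act[OF aff_P0 a(2)] unfolding g_def[symmetric] z_def
    by (simp add: ind_def[abs_def] e0_def[abs_def])
  have z0: "z \<noteq> 0" using ge a(3) g(2) unfolding g_def[symmetric] by (auto simp: Ann_def)
  obtain s M where s: "s \<in> CS n" "pr M * g \<approx> s" by (rule degree_zero_part[OF g(2)])
  have prN: "pr M * g \<in> N" by (rule N(2)[OF FC_pr g(1)])
  have sN: "s \<in> N" by (rule N_eqv[OF prN s(2)])
  \<comment> \<open>The projection fixes 1 modulo K, hence also \<open>e0\<close>, so it preserves
    the value z.\<close>
  have "pr M * 1 \<approx> 1" using Wt_E[OF one_Wt] unfolding \<epsilon>_def[symmetric] by (intro pr_fix FC_one) simp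
  then have "act (pr M) e0 = e0" using act_eqv by fastforce
  then have "act (pr M * g) e0 = (\<lambda>Q. z * e0 Q)"
    by (simp add: act_mult[OF FC_pr g(2)] ge act_linear(2)[OF FC_pr])
  then have se: "act s e0 = (\<lambda>Q. z * e0 Q)" using act_eqv[OF s(2)] by simp
  obtain y where y: "ra * s \<approx> scalar y" using ra_CS[OF s(1)] by blast
  have "act (ra * s) e0 P0 = z * of_nat (fact (n - l))"
    unfolding act_mult[OF CS_FC[OF CS_ra] CS_FC[OF s(1)]] se act_linear(2)[OF CS_FC[OF CS_ra]] act_ra_e0
    by (simp add: e0_def)
  then have "y = z * of_nat (fact (n - l))" using act_eqv[OF y] by (simp add: act_scalar e0_def)
  then have y0: "y \<noteq> 0" using z0 by simp
  have "scalar y \<in> N" by (rule N_eqv[OF N(2)[OF CS_FC[OF CS_ra] sN] y])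
  from N(2)[OF FC_scalar this, of "1 / y"] show ?thesis
    using y0 by (simp add: scalar_mult[symmetric] scalar_1)
qed

end

section \<open>Abelian groups with operators and their quotients\<close>

text \<open>Before the relations are divided out, the tensor construction is no module: its
  operation is additive in the vector but not in the ring element. This weaker structure passes to
  quotients.\<close>

locale operator_group = abelian_group M for M :: "('r, 'a) module" (structure) +
  fixes A :: "'r set"
  assumes op_closed: "r \<in> A \<Longrightarrow> x \<in> carrier M \<Longrightarrow> r \<odot> x \<in> carrier M"
    and op_add: "r \<in> A \<Longrightarrow> x \<in> carrier M \<Longrightarrow> y \<in> carrier M \<Longrightarrow> r \<odot> (x \<oplus> y) = r \<odot> x \<oplus> r \<odot> y"
begin

lemma op_zero: "r \<in> A \<Longrightarrow> r \<odot> \<zero> = \<zero>"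
proof -
  assume r: "r \<in> A"
  have "r \<odot> \<zero> \<oplus> r \<odot> \<zero> = r \<odot> \<zero> \<oplus> \<zero>" using op_add[OF r zero_closed zero_closed] op_closed[OF r zero_closed] by simp
  then have "\<ominus> (r \<odot> \<zero>) \<oplus> (r \<odot> \<zero> \<oplus> r \<odot> \<zero>) = \<ominus> (r \<odot> \<zero>) \<oplus> (r \<odot> \<zero> \<oplus> \<zero>)" by simp
  then show ?thesis using op_closed[OF r zero_closed] by (simp add: a_assoc[symmetric] l_neg)
qed

end

locale operator_quotient = operator_group M A for M :: "('r, 'a) module" (structure) and A +
  fixes N :: "'a set"
  assumes sub: "additive_subgroup N M"
    and stable: "r \<in> A \<Longrightarrow> x \<in> N \<Longrightarrow> r \<odot> x \<in> N"
begin

sublocale abelian_subgroup N M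
  by (rule abelian_subgroupI3[OF sub]) (rule abelian_group_axioms)

abbreviation Q where "Q \<equiv> quotient_module M N"
abbreviation q where "q x \<equiv> N +> x"

lemma Q_carrier: "carrier Q = q ` carrier M"
  by (auto simp: quotient_module_def A_RCOSETS_def')

lemma Q_zero: "\<zero>\<^bsub>Q\<^esub> = N"
  by (simp add: quotient_module_def)

lemma q_eq_iff:
  assumes "x \<in> carrier M" "y \<in> carrier M"
  shows "q x = q y \<longleftrightarrow> x \<ominus> y \<in> N"
proof
  assume "q x = q y"
  then have "x \<in> q y" using a_rcos_self[OF assms(1)] by simp
  then show "x \<ominus> y \<in> N" using a_rcos_module[OF assms(2,1)] by (simp add: minus_eq)
next
  assume "x \<ominus> y \<in> N"
  then have "x \<in> q y" using a_rcos_module[OF assms(2,1)] by (simp add: minus_eq)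
  then show "q x = q y" using a_repr_independence'[OF _ assms(2)] by simp
qed

lemma q_zero_iff: "x \<in> carrier M \<Longrightarrow> q x = N \<longleftrightarrow> x \<in> N"
  using a_rcos_const a_rcos_self by blast

lemma q_add: "x \<in> carrier M \<Longrightarrow> y \<in> carrier M \<Longrightarrow> q x \<oplus>\<^bsub>Q\<^esub> q y = q (x \<oplus> y)"
  using a_rcos_sum by (simp add: quotient_module_def)

text \<open>The quotient operation is defined as a union over all representatives; stability of N
  makes all the cosets in that union equal.\<close>

lemma q_smult:
  assumes r: "r \<in> A" and x: "x \<in> carrier M"
  shows "r \<odot>\<^bsub>Q\<^esub> q x = q (r \<odot> x)"
proof -
  have "q (r \<odot> y) = q (r \<odot> x)" if y: "y \<in> q x" for y
  proof -
    obtain h where h: "h \<in> N" "y = h \<oplus> x" using y by (auto simp: a_r_coset_def')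
    have "r \<odot> y = r \<odot> h \<oplus> r \<odot> x" using op_add[OF r a_Hcarr[OF h(1)] x] h(2) by simp
    then have "r \<odot> y \<in> q (r \<odot> x)" using stable[OF r h(1)] by (auto simp: a_r_coset_def')
    then show ?thesis using a_repr_independence'[OF _ op_closed[OF r x]] by simp
  qed
  moreover have "x \<in> q x" by (rule a_rcos_self[OF x])
  ultimately have "(\<Union>y\<in>q x. q (r \<odot> y)) = q (r \<odot> x)" by blast
  then show ?thesis by (simp add: quotient_module_def)
qed

lemma Q_operator_group: "operator_group Q A"
proof -
  have rep: "\<exists>x'\<in>carrier M. x = q x'" if "x \<in> carrier Q" for x using that unfolding Q_carrier by blast
  interpret Q: abelian_group Q
  proof (rule abelian_groupI)
    show "\<zero>\<^bsub>Q\<^esub> \<in> carrier Q" using q_zero_iff[of \<zero>] zero_closed unfolding Q_carrier Q_zero by force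
    fix x assume "x \<in> carrier Q"
    then obtain x' where x: "x' \<in> carrier M" "x = q x'" using rep by blast
    have z: "\<zero>\<^bsub>Q\<^esub> = q \<zero>" using q_zero_iff[of \<zero>] zero_closed by (simp add: Q_zero)
    show "\<zero>\<^bsub>Q\<^esub> \<oplus>\<^bsub>Q\<^esub> x = x" unfolding z using x by (simp add: q_add)
    have "q (\<ominus> x') \<oplus>\<^bsub>Q\<^esub> x = \<zero>\<^bsub>Q\<^esub>" unfolding z using x by (simp add: q_add l_neg)
    then show "\<exists>y\<in>carrier Q. y \<oplus>\<^bsub>Q\<^esub> x = \<zero>\<^bsub>Q\<^esub>" using x(1) unfolding Q_carrier by blast
    fix y assume "y \<in> carrier Q"
    then obtain y' where y: "y' \<in> carrier M" "y = q y'" using rep by blast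
    show "x \<oplus>\<^bsub>Q\<^esub> y \<in> carrier Q" using x y by (simp add: q_add Q_carrier)
    show "x \<oplus>\<^bsub>Q\<^esub> y = y \<oplus>\<^bsub>Q\<^esub> x" using x y by (simp add: q_add a_comm)
    fix w assume "w \<in> carrier Q"
    then obtain w' where w: "w' \<in> carrier M" "w = q w'" using rep by blast
    show "x \<oplus>\<^bsub>Q\<^esub> y \<oplus>\<^bsub>Q\<^esub> w = x \<oplus>\<^bsub>Q\<^esub> (y \<oplus>\<^bsub>Q\<^esub> w)" using x y w by (simp add: q_add a_assoc)
  qed
  show ?thesis
  proof unfold_locales
    fix r x assume r: "r \<in> A" and "x \<in> carrier Q"
    then obtain x' where x: "x' \<in> carrier M" "x = q x'" unfolding Q_carrier by blast
    show "r \<odot>\<^bsub>Q\<^esub> x \<in> carrier Q" unfolding x(2) q_smult[OF r x(1)] Q_carrier using op_closed[OF r x(1)] by blast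
    fix y assume "y \<in> carrier Q"
    then obtain y' where y: "y' \<in> carrier M" "y = q y'" unfolding Q_carrier by blast
    show "r \<odot>\<^bsub>Q\<^esub> (x \<oplus>\<^bsub>Q\<^esub> y) = r \<odot>\<^bsub>Q\<^esub> x \<oplus>\<^bsub>Q\<^esub> r \<odot>\<^bsub>Q\<^esub> y"
      using x y r by (simp add: q_add q_smult op_closed op_add)
  qed
qed

end

section \<open>Cyclic modules presented by a left ideal\<close>

text \<open>Isolates what the argument uses about the standard module, namely a presentation as FC /
  K, from its construction as a tensor product.\<close>

locale cyclic_module = standard_ideal +
  fixes \<Delta> :: "(cherednik_elem, 'v) module" and gen :: "(wperm \<Rightarrow>\<^sub>0 complex) \<Rightarrow> 'v"
  assumes Delta_op: "operator_group \<Delta> (carrier (cherednik n c))"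
    and gen_image: "carrier \<Delta> = gen ` FC n"
    and gen_add: "f \<in> FC n \<Longrightarrow> g \<in> FC n \<Longrightarrow> gen (f + g) = gen f \<oplus>\<^bsub>\<Delta>\<^esub> gen g"
    and gen_smult: "f \<in> FC n \<Longrightarrow> g \<in> FC n \<Longrightarrow> cherednik_class n c f \<odot>\<^bsub>\<Delta>\<^esub> gen g = gen (f * g)"
    and gen_zero_iff: "f \<in> FC n \<Longrightarrow> gen f = \<zero>\<^bsub>\<Delta>\<^esub> \<longleftrightarrow> f \<in> K"
begin

sublocale Dl: operator_group \<Delta> "carrier (cherednik n c)"
  by (rule Delta_op)

abbreviation R where "R \<equiv> cherednik n c"

lemma gen_closed: "f \<in> FC n \<Longrightarrow> gen f \<in> carrier \<Delta>"
  using gen_image by blast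

lemma gen_diff:
  assumes f: "f \<in> FC n" and g: "g \<in> FC n"
  shows "gen (f - g) = gen f \<ominus>\<^bsub>\<Delta>\<^esub> gen g"
proof -
  have "gen (f - g) \<oplus>\<^bsub>\<Delta>\<^esub> gen g = gen f" using gen_add[OF FC_diff[OF f g] g] by simp
  moreover have "(gen f \<ominus>\<^bsub>\<Delta>\<^esub> gen g) \<oplus>\<^bsub>\<Delta>\<^esub> gen g = gen f"
    using gen_closed[OF f] gen_closed[OF g] by (simp add: a_minus_def Dl.a_assoc Dl.l_neg)
  ultimately show ?thesis
    using Dl.add.right_cancel[of "gen g" "gen (f - g)" "gen f \<ominus>\<^bsub>\<Delta>\<^esub> gen g"]
      gen_closed[OF f] gen_closed[OF g] gen_closed[OF FC_diff[OF f g]] by simp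
qed

lemma gen_eq_iff:
  assumes f: "f \<in> FC n" and g: "g \<in> FC n"
  shows "gen f = gen g \<longleftrightarrow> f - g \<in> K"
proof -
  have c: "gen g \<in> carrier \<Delta>" "gen (f - g) \<in> carrier \<Delta>" using gen_closed FC_diff f g by blast+
  have "gen f = gen (f - g) \<oplus>\<^bsub>\<Delta>\<^esub> gen g" using gen_add[OF FC_diff[OF f g] g] by simp
  then have "gen f = gen g \<longleftrightarrow> gen (f - g) \<oplus>\<^bsub>\<Delta>\<^esub> gen g = \<zero>\<^bsub>\<Delta>\<^esub> \<oplus>\<^bsub>\<Delta>\<^esub> gen g" using c by simp
  also have "\<dots> \<longleftrightarrow> gen (f - g) = \<zero>\<^bsub>\<Delta>\<^esub>" using Dl.add.right_cancel[of "gen g" "gen (f - g)" "\<zero>\<^bsub>\<Delta>\<^esub>"] c by simp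
  finally show ?thesis using gen_zero_iff[OF FC_diff[OF f g]] by simp
qed

definition Imax :: "'v set" where "Imax = gen ` Ann"

lemma Ann_FC: "h \<in> Ann \<Longrightarrow> h \<in> FC n"
  by (simp add: Ann_def)

lemma gen_Imax: "h \<in> FC n \<Longrightarrow> gen h \<in> Imax \<longleftrightarrow> h \<in> Ann"
proof
  assume h: "h \<in> FC n" and "gen h \<in> Imax"
  then obtain h' where h': "h' \<in> Ann" "gen h = gen h'" unfolding Imax_def by blast
  have "h - h' \<in> K" using h' gen_eq_iff[OF h Ann_FC[OF h'(1)]] by simp
  then have "h - h' \<in> Ann" using K_act K_FC by (simp add: Ann_def)
  from ann.K_add[OF this h'(1)] show "h \<in> Ann" by simp
qed (simp add: Imax_def)

lemma submodule_iff:
  "submodule S R \<Delta> \<longleftrightarrow> additive_subgroup S \<Delta> \<and> (\<forall>r\<in>carrier R. \<forall>x\<in>S. r \<odot>\<^bsub>\<Delta>\<^esub> x \<in> S)"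
  unfolding submodule_def submodule_axioms_def additive_subgroup_def by auto

lemma submoduleI':
  assumes "S \<subseteq> carrier \<Delta>" "\<zero>\<^bsub>\<Delta>\<^esub> \<in> S" "\<And>a b. a \<in> S \<Longrightarrow> b \<in> S \<Longrightarrow> a \<oplus>\<^bsub>\<Delta>\<^esub> b \<in> S"
    "\<And>h x. h \<in> FC n \<Longrightarrow> x \<in> S \<Longrightarrow> cherednik_class n c h \<odot>\<^bsub>\<Delta>\<^esub> x \<in> S"
  shows "submodule S R \<Delta>"
  unfolding submodule_iff
proof (intro conjI ballI)
  show "r \<odot>\<^bsub>\<Delta>\<^esub> x \<in> S" if "r \<in> carrier R" "x \<in> S" for r x
    using that assms(4) unfolding carrier_cherednik by blast
  have "\<ominus>\<^bsub>\<Delta>\<^esub> x \<in> S" if x: "x \<in> S" for x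
  proof -
    obtain f where f: "f \<in> FC n" "x = gen f" using x assms(1) gen_image by blast
    have m: "- 1 \<in> FC n" by (rule FC_uminus[OF FC_one])
    have "gen (- f) \<oplus>\<^bsub>\<Delta>\<^esub> gen f = \<zero>\<^bsub>\<Delta>\<^esub>"
      using gen_add[OF FC_uminus[OF f(1)] f(1)] gen_zero_iff[OF FC_zero] K_zero by simp
    then have "gen (- f) = \<ominus>\<^bsub>\<Delta>\<^esub> x"
      using f gen_closed[OF f(1)] gen_closed[OF FC_uminus[OF f(1)]] by (metis Dl.minus_equality)
    moreover have "gen (- f) = cherednik_class n c (- 1) \<odot>\<^bsub>\<Delta>\<^esub> x" using gen_smult[OF m f(1)] f(2) by simp
    ultimately show ?thesis using assms(4)[OF m x] by simp
  qed
  then show "additive_subgroup S \<Delta>"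
    using assms(1-3) by (intro additive_subgroup.intro group.subgroupI[OF Dl.a_group])
      (auto simp: a_inv_def[symmetric])
qed

lemma submodule_ideal:
  assumes S: "submodule S R \<Delta>"
  shows "S \<subseteq> carrier \<Delta>" "\<zero>\<^bsub>\<Delta>\<^esub> \<in> S" "a \<in> S \<Longrightarrow> b \<in> S \<Longrightarrow> a \<oplus>\<^bsub>\<Delta>\<^esub> b \<in> S"
    "h \<in> FC n \<Longrightarrow> x \<in> S \<Longrightarrow> cherednik_class n c h \<odot>\<^bsub>\<Delta>\<^esub> x \<in> S"
proof -
  interpret additive_subgroup S \<Delta> using S submodule_iff by blast
  show "S \<subseteq> carrier \<Delta>" "\<zero>\<^bsub>\<Delta>\<^esub> \<in> S" "a \<in> S \<Longrightarrow> b \<in> S \<Longrightarrow> a \<oplus>\<^bsub>\<Delta>\<^esub> b \<in> S"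
    by (simp_all add: a_subset)
  show "h \<in> FC n \<Longrightarrow> x \<in> S \<Longrightarrow> cherednik_class n c h \<odot>\<^bsub>\<Delta>\<^esub> x \<in> S"
    using S class_closed unfolding submodule_iff by blast
qed

lemma Imax_submodule: "submodule Imax R \<Delta>"
proof (rule submoduleI')
  show "Imax \<subseteq> carrier \<Delta>" unfolding Imax_def gen_image using Ann_FC by blast
  have "gen 0 = \<zero>\<^bsub>\<Delta>\<^esub>" using gen_zero_iff[OF FC_zero] K_zero by simp
  then show "\<zero>\<^bsub>\<Delta>\<^esub> \<in> Imax" using ann.K_zero unfolding Imax_def by (metis image_eqI)
  show "a \<oplus>\<^bsub>\<Delta>\<^esub> b \<in> Imax" if ab: "a \<in> Imax" "b \<in> Imax" for a b
  proof -
    obtain f g where "f \<in> Ann" "a = gen f" "g \<in> Ann" "b = gen g" using ab unfolding Imax_def by blast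
    then show ?thesis using gen_add[OF Ann_FC Ann_FC] ann.K_add unfolding Imax_def by (metis image_eqI)
  qed
  show "cherednik_class n c h \<odot>\<^bsub>\<Delta>\<^esub> x \<in> Imax" if hx: "h \<in> FC n" "x \<in> Imax" for h x
  proof -
    obtain f where "f \<in> Ann" "x = gen f" using hx unfolding Imax_def by blast
    then show ?thesis using gen_smult[OF hx(1) Ann_FC] ann.K_mult[OF hx(1)] unfolding Imax_def by (metis image_eqI)
  qed
qed

lemma gen_one_not_Imax: "gen 1 \<notin> Imax"
  using gen_Imax[OF FC_one] one_not_Ann by simp

lemma Imax_proper: "Imax \<noteq> carrier \<Delta>"
  using gen_one_not_Imax gen_closed[OF FC_one] by blast

lemma submodule_gen_one:
  assumes S: "submodule S R \<Delta>" and "gen 1 \<in> S"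
  shows "S = carrier \<Delta>"
proof
  show "carrier \<Delta> \<subseteq> S"
  proof
    fix x assume "x \<in> carrier \<Delta>"
    then obtain f where f: "f \<in> FC n" "x = gen f" using gen_image by blast
    then show "x \<in> S" using submodule_ideal(4)[OF S f(1) assms(2)] gen_smult[OF f(1) FC_one] by simp
  qed
qed (rule submodule_ideal(1)[OF S])

text \<open>Pulled back along \<open>gen\<close>, a submodule becomes a left ideal containing K. If
  it met an element not killing \<open>e0\<close>, then \<open>ideal_generates\<close> would put 1
  into it.\<close>

lemma proper_submodule:
  assumes S: "submodule S R \<Delta>" "S \<noteq> carrier \<Delta>"
  shows "S \<subseteq> Imax"
proof
  fix x assume x: "x \<in> S"
  then obtain f where f: "f \<in> FC n" "x = gen f" using submodule_ideal(1)[OF S(1)] gen_image by blast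
  note si = submodule_ideal[OF S(1)]
  let ?N = "{h \<in> FC n. gen h \<in> S}"
  show "x \<in> Imax"
  proof (rule ccontr)
    assume "x \<notin> Imax"
    then have "act f e0 \<noteq> (\<lambda>P. 0)" using f gen_Imax[OF f(1)] by (auto simp: Ann_def)
    moreover have "K \<subseteq> ?N"
    proof
      fix h assume h: "h \<in> K"
      then have "gen h = \<zero>\<^bsub>\<Delta>\<^esub>" using gen_zero_iff[OF K_FC[OF h]] by simp
      then show "h \<in> ?N" using K_FC[OF h] si(2) by simp
    qed
    moreover have "a + b \<in> ?N" if "a \<in> ?N" "b \<in> ?N" for a b
      using that si(3) by (simp add: FC_add gen_add)
    moreover have "g * a \<in> ?N" if "g \<in> FC n" "a \<in> ?N" for g a
      using that si(4) by (simp add: FC_mult flip: gen_smult)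
    ultimately have "1 \<in> ?N" using f x by (intro ideal_generates[of ?N f]) auto
    then have "S = carrier \<Delta>" by (intro submodule_gen_one[OF S(1)]) simp
    then show False using S(2) by simp
  qed
qed

lemma the_maximal: "the_maximal_submodule R \<Delta> = Imax"
  unfolding the_maximal_submodule_def
proof (rule the_equality)
  show "maximal_submodule R \<Delta> Imax"
    unfolding maximal_submodule_def using Imax_submodule Imax_proper proper_submodule by blast
  show "S = Imax" if "maximal_submodule R \<Delta> S" for S
    using that Imax_submodule Imax_proper proper_submodule unfolding maximal_submodule_def by blast
qed

lemma quotient_of_submodule:
  assumes "submodule S R \<Delta>" shows "operator_quotient \<Delta> (carrier R) S"
  using assms unfolding submodule_iff
  by (intro operator_quotient.intro operator_quotient_axioms.intro Delta_op) auto

lemma quotient_submodule_iff: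
  assumes S: "submodule S R \<Delta>"
  shows "submodule TT R (quotient_module \<Delta> S) \<longleftrightarrow>
    (\<exists>S'. submodule S' R \<Delta> \<and> S \<subseteq> S' \<and> TT = (\<lambda>x. S +>\<^bsub>\<Delta>\<^esub> x) ` S')"
proof -
  interpret Qt: operator_quotient \<Delta> "carrier R" S by (rule quotient_of_submodule[OF S])
  interpret QQ: operator_group Qt.Q "carrier R" by (rule Qt.Q_operator_group)
  show ?thesis
  proof
    assume TT: "submodule TT R Qt.Q"
    then have Ts: "subgroup TT (add_monoid Qt.Q)" "\<And>r x. r \<in> carrier R \<Longrightarrow> x \<in> TT \<Longrightarrow> r \<odot>\<^bsub>Qt.Q\<^esub> x \<in> TT"
      unfolding submodule_def submodule_axioms_def by auto
    have Tc: "TT \<subseteq> carrier Qt.Q" using subgroup.subset[OF Ts(1)] by simp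
    have Ta: "a \<oplus>\<^bsub>Qt.Q\<^esub> b \<in> TT" if "a \<in> TT" "b \<in> TT" for a b using subgroup.m_closed[OF Ts(1)] that by simp
    have Tz: "S \<in> TT" using subgroup.one_closed[OF Ts(1)] by (simp add: Qt.Q_zero)
    let ?S' = "{x \<in> carrier \<Delta>. Qt.q x \<in> TT}"
    have "submodule ?S' R \<Delta>"
    proof (rule submoduleI')
      show "\<zero>\<^bsub>\<Delta>\<^esub> \<in> ?S'" using Tz Qt.q_zero_iff[of "\<zero>\<^bsub>\<Delta>\<^esub>"] Qt.zero_closed by simp
      show "a \<oplus>\<^bsub>\<Delta>\<^esub> b \<in> ?S'" if "a \<in> ?S'" "b \<in> ?S'" for a b
        using that Ta Qt.q_add by (metis (mono_tags, lifting) Dl.add.m_closed mem_Collect_eq)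
      show "cherednik_class n c h \<odot>\<^bsub>\<Delta>\<^esub> x \<in> ?S'" if "h \<in> FC n" "x \<in> ?S'" for h x
        using that Ts(2) Qt.q_smult class_closed Dl.op_closed by (metis (mono_tags, lifting) mem_Collect_eq)
    qed auto
    moreover have "S \<subseteq> ?S'"
    proof
      fix x assume x: "x \<in> S"
      then have "Qt.q x = S" by (rule Qt.a_rcos_const)
      then show "x \<in> ?S'" using Tz x submodule_ideal(1)[OF S] by auto
    qed
    moreover have "TT = Qt.q ` ?S'" using Tc unfolding Qt.Q_carrier by auto
    ultimately show "\<exists>S'. submodule S' R \<Delta> \<and> S \<subseteq> S' \<and> TT = Qt.q ` S'" by blast
  next
    assume "\<exists>S'. submodule S' R \<Delta> \<and> S \<subseteq> S' \<and> TT = Qt.q ` S'"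
    then obtain S' where S': "submodule S' R \<Delta>" "S \<subseteq> S'" and TT: "TT = Qt.q ` S'" by blast
    note si = submodule_ideal[OF S'(1)]
    interpret s': additive_subgroup S' \<Delta> using S'(1) submodule_iff by blast
    have sc: "x \<in> carrier \<Delta>" if "x \<in> S'" for x using si(1) that by blast
    have "subgroup TT (add_monoid Qt.Q)"
    proof (rule group.subgroupI[OF QQ.a_group])
      show "TT \<subseteq> carrier (add_monoid Qt.Q)" using sc by (auto simp: TT Qt.Q_carrier)
      show "TT \<noteq> {}" unfolding TT using s'.zero_closed by blast
      fix a assume "a \<in> TT"
      then obtain x where x: "x \<in> S'" "a = Qt.q x" unfolding TT by blast
      have "Qt.q (\<ominus>\<^bsub>\<Delta>\<^esub> x) \<oplus>\<^bsub>Qt.Q\<^esub> Qt.q x = \<zero>\<^bsub>Qt.Q\<^esub>"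
        using sc[OF x(1)] Qt.q_zero_iff[of "\<zero>\<^bsub>\<Delta>\<^esub>"] Qt.zero_closed by (simp add: Qt.q_add Dl.l_neg Qt.Q_zero)
      then have "\<ominus>\<^bsub>Qt.Q\<^esub> a = Qt.q (\<ominus>\<^bsub>\<Delta>\<^esub> x)"
        using sc[OF x(1)] x(2) by (intro QQ.minus_equality) (auto simp: Qt.Q_carrier)
      then show "m_inv (add_monoid Qt.Q) a \<in> TT" using s'.a_inv_closed[OF x(1)] by (simp add: a_inv_def TT)
      fix b assume "b \<in> TT"
      then obtain y where y: "y \<in> S'" "b = Qt.q y" unfolding TT by blast
      show "a \<otimes>\<^bsub>add_monoid Qt.Q\<^esub> b \<in> TT"
        using x y si(3) sc by (simp add: TT Qt.q_add)
    qed
    moreover have "r \<odot>\<^bsub>Qt.Q\<^esub> x \<in> TT" if rx: "r \<in> carrier R" "x \<in> TT" for r x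
    proof -
      obtain y where y: "y \<in> S'" "x = Qt.q y" using rx unfolding TT by blast
      then show ?thesis using rx(1) Qt.q_smult[OF rx(1) sc[OF y(1)]] S'(1) unfolding TT submodule_iff by simp
    qed
    ultimately show "submodule TT R Qt.Q" unfolding submodule_def submodule_axioms_def by simp
  qed
qed

text \<open>The correspondence of submodules reduces irreducibility to maximality. The resulting
  uniqueness is what gives the definite description in \<open>irreducible_quotient\<close> its
  meaning.\<close>

lemma irreducible_quotient_iff:
  assumes S: "submodule S R \<Delta>"
  shows "irreducible_module R (quotient_module \<Delta> S) \<longleftrightarrow> S = Imax"
proof -
  interpret Qt: operator_quotient \<Delta> "carrier R" S by (rule quotient_of_submodule[OF S])
  have triv: "Qt.q ` S' = {S} \<longleftrightarrow> S' = S" if "submodule S' R \<Delta>" "S \<subseteq> S'" for S'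
  proof
    assume "Qt.q ` S' = {S}"
    then have "Qt.q x = S" if "x \<in> S'" for x using that by blast
    then have "x \<in> S" if "x \<in> S'" for x
      using Qt.q_zero_iff[of x] submodule_ideal(1)[OF \<open>submodule S' R \<Delta>\<close>] that by blast
    then show "S' = S" using that(2) by blast
  next
    assume "S' = S"
    moreover have "Qt.q x = S" if "x \<in> S" for x by (rule Qt.a_rcos_const[OF that])
    moreover have "S \<noteq> {}" using Qt.zero_closed by blast
    ultimately show "Qt.q ` S' = {S}" by auto
  qed
  have full: "Qt.q ` S' = carrier Qt.Q \<longleftrightarrow> S' = carrier \<Delta>" if S': "submodule S' R \<Delta>" "S \<subseteq> S'" for S'
  proof
    assume "Qt.q ` S' = carrier Qt.Q"
    show "S' = carrier \<Delta>"
    proof (rule antisym[OF submodule_ideal(1)[OF S'(1)] subsetI])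
      fix x assume x: "x \<in> carrier \<Delta>"
      then obtain y where y: "y \<in> S'" "Qt.q x = Qt.q y"
        using \<open>Qt.q ` S' = carrier Qt.Q\<close> unfolding Qt.Q_carrier by (metis imageE image_eqI)
      have yc: "y \<in> carrier \<Delta>" using submodule_ideal(1)[OF S'(1)] y by blast
      have "x \<ominus>\<^bsub>\<Delta>\<^esub> y \<in> S'" using Qt.q_eq_iff[OF x yc] y S'(2) by blast
      from submodule_ideal(3)[OF S'(1) this y(1)] show "x \<in> S'"
        using x yc by (simp add: a_minus_def Dl.a_assoc Dl.l_neg)
    qed
  qed (simp add: Qt.Q_carrier)
  have whole: "submodule (carrier \<Delta>) R \<Delta>"
    by (rule submoduleI') (auto simp: class_closed Dl.op_closed)
  have Sc: "S \<subseteq> carrier \<Delta>" by (rule submodule_ideal(1)[OF S])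
  have ne: "carrier Qt.Q \<noteq> {\<zero>\<^bsub>Qt.Q\<^esub>} \<longleftrightarrow> S \<noteq> carrier \<Delta>"
    using triv[OF whole Sc] unfolding Qt.Q_carrier Qt.Q_zero by auto
  show ?thesis
  proof
    assume irr: "irreducible_module R Qt.Q"
    then have S1: "S \<noteq> carrier \<Delta>" using ne unfolding irreducible_module_def by blast
    have sI: "S \<subseteq> Imax" by (rule proper_submodule[OF S S1])
    have "submodule (Qt.q ` Imax) R Qt.Q" using quotient_submodule_iff[OF S] Imax_submodule sI by blast
    then have "Qt.q ` Imax = {S} \<or> Qt.q ` Imax = carrier Qt.Q"
      using irr unfolding irreducible_module_def Qt.Q_zero by blast
    then show "S = Imax" using triv[OF Imax_submodule sI] full[OF Imax_submodule sI] Imax_proper by auto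
  next
    assume SI: "S = Imax"
    show "irreducible_module R Qt.Q"
      unfolding irreducible_module_def
    proof (intro conjI allI impI)
      show "carrier Qt.Q \<noteq> {\<zero>\<^bsub>Qt.Q\<^esub>}" using ne Imax_proper SI by simp
      fix TT assume TT: "submodule TT R Qt.Q"
      obtain S' where S': "submodule S' R \<Delta>" "S \<subseteq> S'" "TT = Qt.q ` S'"
        using iffD1[OF quotient_submodule_iff[OF S] TT] by (elim exE conjE)
      have "S' = S \<or> S' = carrier \<Delta>" using proper_submodule[OF S'(1)] S'(2) SI by blast
      then show "TT = {\<zero>\<^bsub>Qt.Q\<^esub>} \<or> TT = carrier Qt.Q"
        using triv[OF S'(1,2)] full[OF S'(1,2)] S'(3) Qt.Q_zero by auto
    qed
  qed
qed

lemma irreducible_quotient_eq: "irreducible_quotient R \<Delta> = quotient_module \<Delta> Imax"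
proof -
  have "(THE S. submodule S R \<Delta> \<and> irreducible_module R (quotient_module \<Delta> S)) = Imax"
    by (rule the_equality) (use irreducible_quotient_iff Imax_submodule in blast)+
  then show ?thesis by (simp add: irreducible_quotient_def)
qed

lemma u_elem_eq: "u_elem n c i = cherednik_class n c (u i)"
  by (simp add: u_elem_def u_def JM_def)

lemma weight_vector_Wt:
  assumes w: "\<And>i. i \<in> {1..n} \<Longrightarrow> w i = wt P i" and v: "weight_vector n c \<Delta> w v"
  obtains h where "h \<in> Wt (wt P)" "v = gen h" "h \<notin> K"
proof -
  obtain h where h: "h \<in> FC n" "v = gen h" using v gen_image unfolding weight_vector_def by blast
  have "u i * h \<approx> scalar (wt P i) * h" if i: "i \<in> {1..n}" for i
  proof -
    have "u_elem n c i \<odot>\<^bsub>\<Delta>\<^esub> v = cherednik_class n c (scalar (w i)) \<odot>\<^bsub>\<Delta>\<^esub> v"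
      using v i unfolding weight_vector_def by blast
    then have "gen (u i * h) = gen (scalar (wt P i) * h)"
      using h i by (simp add: u_elem_eq gen_smult FC_u FC_scalar w del: atLeastAtMost_iff)
    then show ?thesis using gen_eq_iff[OF FC_mult[OF FC_u[OF i] h(1)] FC_mult[OF FC_scalar h(1)]]
      unfolding eqv_def by simp
  qed
  then have "h \<in> Wt (wt P)" using h by (simp add: Wt_def)
  moreover have "h \<notin> K" using v h gen_zero_iff unfolding weight_vector_def by blast
  ultimately show thesis using that h by blast
qed

text \<open>For a weight in J a nonzero vector cannot kill \<open>e0\<close>, by faithfulness; for a
  weight outside J it must, by the support of the functions.\<close>

lemma weight_vector_in_Imax:
  assumes P: "aff n P" and w: "\<And>i. i \<in> {1..n} \<Longrightarrow> w i = wt P i" and v: "weight_vector n c \<Delta> w v"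
  shows "v \<in> Imax \<longleftrightarrow> \<not> J P"
proof -
  obtain h where h: "h \<in> Wt (wt P)" "v = gen h" "h \<notin> K" by (rule weight_vector_Wt[OF w v])
  have "v \<in> Imax \<longleftrightarrow> act h e0 = (\<lambda>P. 0)"
    using gen_Imax[OF WtD(1)[OF h(1)]] h(2) WtD(1)[OF h(1)] by (simp add: Ann_def)
  then show ?thesis using Wt_J_faithful[OF _ h(1)] Wt_outside[OF P _ h(1)] h(3) by blast
qed

section \<open>The weight basis of the simple quotient\<close>

definition ind_preimage :: "(int \<Rightarrow> int) \<Rightarrow> wperm \<Rightarrow>\<^sub>0 complex" where
  "ind_preimage P = (SOME h. h \<in> FC n \<and> act h e0 = ind P)"

lemma ind_preimage: "J P \<Longrightarrow> ind_preimage P \<in> FC n" "J P \<Longrightarrow> act (ind_preimage P) e0 = ind P"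
proof -
  assume "J P"
  then have "\<exists>h. h \<in> FC n \<and> act h e0 = ind P" using ind_reached by metis
  then have "ind_preimage P \<in> FC n \<and> act (ind_preimage P) e0 = ind P" unfolding ind_preimage_def by (rule someI_ex)
  then show "ind_preimage P \<in> FC n" "act (ind_preimage P) e0 = ind P" by auto
qed

sublocale Im: operator_quotient \<Delta> "carrier R" Imax
  by (rule quotient_of_submodule[OF Imax_submodule])

sublocale QI: operator_group Im.Q "carrier R"
  by (rule Im.Q_operator_group)

text \<open>Identifies the quotient with a space of functions, by letting representatives act on
  \<open>e0\<close>; later equalities in the quotient are checked there.\<close>

lemma q_gen_eq_iff:
  assumes "f \<in> FC n" "g \<in> FC n"
  shows "Im.q (gen f) = Im.q (gen g) \<longleftrightarrow> act f e0 = act g e0"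
proof -
  have "Im.q (gen f) = Im.q (gen g) \<longleftrightarrow> gen (f - g) \<in> Imax"
    using Im.q_eq_iff[OF gen_closed gen_closed] assms gen_diff by simp
  also have "\<dots> \<longleftrightarrow> f - g \<in> Ann" by (rule gen_Imax[OF FC_diff[OF assms]])
  finally show ?thesis using assms by (auto simp: Ann_def FC_diff act_diff fun_eq_iff)
qed

lemma q_gen_smult:
  assumes "f \<in> FC n" "g \<in> FC n"
  shows "cherednik_class n c f \<odot>\<^bsub>Im.Q\<^esub> Im.q (gen g) = Im.q (gen (f * g))"
  using Im.q_smult[OF class_closed[OF assms(1)] gen_closed[OF assms(2)]] gen_smult[OF assms] by simp

definition basis_vec :: "(int \<Rightarrow> int) \<Rightarrow> 'v set" where
  "basis_vec P = Im.q (gen (ind_preimage P))"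

lemma basis_vec_closed: "J P \<Longrightarrow> basis_vec P \<in> carrier Im.Q"
  unfolding basis_vec_def Im.Q_carrier using gen_closed[OF ind_preimage(1)] by blast

lemma basis_vec_weight:
  assumes P: "J P" and w: "\<And>i. i \<in> {1..n} \<Longrightarrow> w i = wt P i"
  shows "weight_vector n c Im.Q w (basis_vec P)"
  unfolding weight_vector_def
proof (intro conjI ballI)
  show "basis_vec P \<in> carrier Im.Q" by (rule basis_vec_closed[OF P])
  have "ind_preimage P \<notin> Ann"
  proof
    assume "ind_preimage P \<in> Ann"
    then have "ind P P = 0" using ind_preimage(2)[OF P] unfolding Ann_iff by metis
    then show False by (simp add: ind_def)
  qed
  then show "basis_vec P \<noteq> \<zero>\<^bsub>Im.Q\<^esub>"
    unfolding basis_vec_def Im.Q_zero using Im.q_zero_iff[OF gen_closed] gen_Imax ind_preimage(1)[OF P] by blast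
  fix i assume i: "i \<in> {1..n}"
  have "act (u i * ind_preimage P) e0 = act (scalar (w i) * ind_preimage P) e0"
    by (rule ext) (simp add: act_u_mult[OF ind_preimage(1)[OF P] i] act_scalar_mult[OF ind_preimage(1)[OF P]] ind_preimage(2)[OF P] ind_def w[OF i])
  then show "u_elem n c i \<odot>\<^bsub>Im.Q\<^esub> basis_vec P = cherednik_class n c (scalar (w i)) \<odot>\<^bsub>Im.Q\<^esub> basis_vec P"
    unfolding basis_vec_def u_elem_eq q_gen_smult[OF FC_u[OF i] ind_preimage(1)[OF P]] q_gen_smult[OF FC_scalar ind_preimage(1)[OF P]]
    by (subst q_gen_eq_iff) (use i in \<open>auto intro!: FC_mult FC_u FC_scalar ind_preimage(1)[OF P]\<close>)
qed

lemma finsum_basis: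
  assumes "finite F" "\<And>s. s \<in> F \<Longrightarrow> J (PP s)"
  shows "(\<Oplus>\<^bsub>Im.Q\<^esub>s\<in>F. cherednik_class n c (scalar (z s)) \<odot>\<^bsub>Im.Q\<^esub> basis_vec (PP s))
      = Im.q (gen (\<Sum>s\<in>F. scalar (z s) * ind_preimage (PP s)))"
  using assms
proof (induction F rule: finite_induct)
  case empty
  have "gen 0 = \<zero>\<^bsub>\<Delta>\<^esub>" using gen_zero_iff[OF FC_zero] K_zero by simp
  then show ?case using Im.q_zero_iff[of "\<zero>\<^bsub>\<Delta>\<^esub>"] Im.zero_closed by (simp add: Im.Q_zero)
next
  case (insert s F)
  have e: "cherednik_class n c (scalar (z s)) \<odot>\<^bsub>Im.Q\<^esub> basis_vec (PP s) = Im.q (gen (scalar (z s) * ind_preimage (PP s)))"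
    if "s \<in> insert s F" "J (PP s)" for s
    unfolding basis_vec_def using q_gen_smult[OF FC_scalar ind_preimage(1)[OF that(2)]] .
  have FCs: "scalar (z s) * ind_preimage (PP s) \<in> FC n" "(\<Sum>s\<in>F. scalar (z s) * ind_preimage (PP s)) \<in> FC n"
    using insert.prems by (auto intro!: FC_sum FC_mult FC_scalar ind_preimage(1))
  have "(\<Oplus>\<^bsub>Im.Q\<^esub>s\<in>insert s F. cherednik_class n c (scalar (z s)) \<odot>\<^bsub>Im.Q\<^esub> basis_vec (PP s))
      = cherednik_class n c (scalar (z s)) \<odot>\<^bsub>Im.Q\<^esub> basis_vec (PP s)
        \<oplus>\<^bsub>Im.Q\<^esub> (\<Oplus>\<^bsub>Im.Q\<^esub>s\<in>F. cherednik_class n c (scalar (z s)) \<odot>\<^bsub>Im.Q\<^esub> basis_vec (PP s))"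
    by (rule QI.finsum_insert) (use insert in \<open>auto intro!: QI.op_closed class_closed FC_scalar basis_vec_closed\<close>)
  also have "\<dots> = Im.q (gen (scalar (z s) * ind_preimage (PP s))) \<oplus>\<^bsub>Im.Q\<^esub> Im.q (gen (\<Sum>s\<in>F. scalar (z s) * ind_preimage (PP s)))"
    using e[of s] insert by simp
  also have "\<dots> = Im.q (gen (scalar (z s) * ind_preimage (PP s) + (\<Sum>s\<in>F. scalar (z s) * ind_preimage (PP s))))"
    unfolding Im.q_add[OF gen_closed[OF FCs(1)] gen_closed[OF FCs(2)]] gen_add[OF FCs] ..
  finally show ?case using insert by simp
qed

text \<open>Among functions the basis vectors are the indicators of the points of J, so the
  coordinate at s is the value at \<open>PP s\<close>, and finitely many coordinates occur because
  the support is finite.\<close>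

lemma basis:
  fixes PP :: "'i \<Rightarrow> int \<Rightarrow> int" and S :: "'i set"
  assumes bij: "bij_betw PP S {P. J P}"
  shows "is_basis n c Im.Q S (\<lambda>s. basis_vec (PP s))"
  unfolding is_basis_def
proof (intro conjI ballI)
  have JP: "J (PP s)" if "s \<in> S" for s using bij_betwE[OF bij] that by blast
  show "(\<lambda>s. basis_vec (PP s)) ` S \<subseteq> carrier Im.Q" using JP basis_vec_closed by blast
  fix v assume "v \<in> carrier Im.Q"
  then obtain h where h: "h \<in> FC n" "v = Im.q (gen h)" unfolding Im.Q_carrier gen_image by blast
  have W: "W (act h e0)" by (rule W_act_e0[OF h(1)])
  have comb: "act (\<Sum>s\<in>F. scalar (z s) * ind_preimage (PP s)) e0 Q = (\<Sum>s\<in>F. z s * ind (PP s) Q)"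
    if "F \<subseteq> S" for F z Q
    unfolding act_sum
    by (rule sum.cong[OF refl]) (use that JP in \<open>auto simp: act_scalar_mult[OF ind_preimage(1)] ind_preimage(2)\<close>)
  have eval: "(\<Sum>s\<in>F. z s * ind (PP s) (PP t)) = (if t \<in> F then z t else 0)"
    if "F \<subseteq> S" "t \<in> S" "finite F" for F z t
  proof -
    have "ind (PP s) (PP t) = (if s = t then 1 else 0)" if "s \<in> F" for s
      using that \<open>F \<subseteq> S\<close> \<open>t \<in> S\<close> bij_betw_imp_inj_on[OF bij] by (auto simp: ind_def inj_on_def)
    then have "(\<Sum>s\<in>F. z s * ind (PP s) (PP t)) = (\<Sum>s\<in>F. if s = t then z s else 0)"
      by (intro sum.cong) auto
    also have "\<dots> = (if t \<in> F then z t else 0)" using \<open>finite F\<close> by simp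
    finally show ?thesis .
  qed
  have iff: "v = (\<Oplus>\<^bsub>Im.Q\<^esub>s\<in>Poly_Mapping.keys f. cherednik_class n c (scalar (Poly_Mapping.lookup f s)) \<odot>\<^bsub>Im.Q\<^esub> basis_vec (PP s))
      \<longleftrightarrow> (\<forall>s\<in>S. Poly_Mapping.lookup f s = act h e0 (PP s))" if f: "Poly_Mapping.keys f \<subseteq> S" for f :: "'i \<Rightarrow>\<^sub>0 complex"
  proof -
    let ?g = "\<Sum>s\<in>Poly_Mapping.keys f. scalar (Poly_Mapping.lookup f s) * ind_preimage (PP s)"
    have g: "?g \<in> FC n" using f JP by (intro FC_sum FC_mult FC_scalar ind_preimage(1)) auto
    have gv: "act ?g e0 (PP s) = Poly_Mapping.lookup f s" if "s \<in> S" for s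
      using comb[OF f] eval[OF f that finite_keys] by (simp add: in_keys_iff)
    have Wg: "W (act ?g e0)" by (rule W_act_e0[OF g])
    have "v = (\<Oplus>\<^bsub>Im.Q\<^esub>s\<in>Poly_Mapping.keys f. cherednik_class n c (scalar (Poly_Mapping.lookup f s)) \<odot>\<^bsub>Im.Q\<^esub> basis_vec (PP s))
      \<longleftrightarrow> Im.q (gen h) = Im.q (gen ?g)"
    proof -
      have "J (PP s)" if "s \<in> Poly_Mapping.keys f" for s using f JP that by blast
      then show ?thesis
        unfolding h(2) by (subst finsum_basis[OF finite_keys]) (assumption, rule refl)
    qed
    also have "\<dots> \<longleftrightarrow> act h e0 = act ?g e0" by (rule q_gen_eq_iff[OF h(1) g])
    also have "\<dots> \<longleftrightarrow> (\<forall>s\<in>S. act ?g e0 (PP s) = act h e0 (PP s))"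
    proof (intro iffI ballI ext)
      fix Q assume *: "\<forall>s\<in>S. act ?g e0 (PP s) = act h e0 (PP s)"
      show "act h e0 Q = act ?g e0 Q"
      proof (cases "J Q")
        case True
        then obtain s where "s \<in> S" "Q = PP s" using bij unfolding bij_betw_def by blast
        then show ?thesis using * by simp
      next
        case False
        then have "act h e0 Q = 0" "act ?g e0 Q = 0" using W Wg unfolding W_def by blast+
        then show ?thesis by simp
      qed
    qed simp
    finally show ?thesis using gv by simp
  qed
  \<comment> \<open>The value 0 off S keeps the support finite and inside S, as
    \<open>Abs_poly_mapping\<close> and the basis condition require.\<close>
  define F where "F s = (if s \<in> S then act h e0 (PP s) else 0)" for s
  have "PP ` {s. F s \<noteq> 0} \<subseteq> {P. act h e0 P \<noteq> 0}" by (auto simp: F_def split: if_splits)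
  moreover have "inj_on PP {s. F s \<noteq> 0}"
    by (rule inj_on_subset[OF bij_betw_imp_inj_on[OF bij]]) (auto simp: F_def split: if_splits)
  ultimately have fin: "finite {s. F s \<noteq> 0}" using W finite_subset finite_imageD unfolding W_def by metis
  define f where "f = Abs_poly_mapping F"
  have lf: "Poly_Mapping.lookup f = F" unfolding f_def using fin by simp
  show "\<exists>!f :: 'i \<Rightarrow>\<^sub>0 complex. Poly_Mapping.keys f \<subseteq> S \<and>
      v = (\<Oplus>\<^bsub>Im.Q\<^esub>s\<in>Poly_Mapping.keys f. cherednik_class n c (scalar (Poly_Mapping.lookup f s)) \<odot>\<^bsub>Im.Q\<^esub> basis_vec (PP s))"
  proof (rule ex1I[of _ f])
    have kf: "Poly_Mapping.keys f \<subseteq> S" unfolding keys.rep_eq lf by (auto simp: F_def split: if_splits)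
    then show "Poly_Mapping.keys f \<subseteq> S \<and>
      v = (\<Oplus>\<^bsub>Im.Q\<^esub>s\<in>Poly_Mapping.keys f. cherednik_class n c (scalar (Poly_Mapping.lookup f s)) \<odot>\<^bsub>Im.Q\<^esub> basis_vec (PP s))"
      using iff[OF kf] lf by (simp add: F_def)
    fix g :: "'i \<Rightarrow>\<^sub>0 complex"
    assume g: "Poly_Mapping.keys g \<subseteq> S \<and>
      v = (\<Oplus>\<^bsub>Im.Q\<^esub>s\<in>Poly_Mapping.keys g. cherednik_class n c (scalar (Poly_Mapping.lookup g s)) \<odot>\<^bsub>Im.Q\<^esub> basis_vec (PP s))"
    show "g = f"
    proof (rule poly_mapping_eqI)
      fix s
      show "Poly_Mapping.lookup g s = Poly_Mapping.lookup f s"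
      proof (cases "s \<in> S")
        case True
        then show ?thesis using iff g lf by (auto simp: F_def)
      next
        case False
        then have "s \<notin> Poly_Mapping.keys g" using g by blast
        then show ?thesis using False lf by (simp add: F_def in_keys_iff)
      qed
    qed
  qed
qed

end

section \<open>Induced modules\<close>

locale induction_data = ring R + V: abelian_group V
  for R :: "('r, 's) ring_scheme" (structure) and V :: "('b, 'v) module" +
  fixes B :: "('b, 't) ring_scheme" and \<phi> :: "'b \<Rightarrow> 'r"
  assumes phi_closed: "b \<in> carrier B \<Longrightarrow> \<phi> b \<in> carrier R"
    and V_op_closed: "b \<in> carrier B \<Longrightarrow> v \<in> carrier V \<Longrightarrow> b \<odot>\<^bsub>V\<^esub> v \<in> carrier V"
begin

abbreviation F where "F \<equiv> free_tensor R V"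
abbreviation pure :: "'r \<Rightarrow> 'v \<Rightarrow> ('r \<times> 'v) \<Rightarrow>\<^sub>0 int" where "pure r v \<equiv> Poly_Mapping.single (r, v) 1"
abbreviation Rel where "Rel \<equiv> tensor_relations R B \<phi> V"

definition N where "N = generate (add_monoid F) Rel"

lemma F_carrier: "z \<in> carrier F \<longleftrightarrow> (\<forall>p\<in>Poly_Mapping.keys z. p \<in> carrier R \<times> carrier V)"
  by (auto simp: free_tensor_def)

lemma F_simps [simp]: "zero F = 0" "add F = (+)"
  by (simp_all add: free_tensor_def)

lemma F_smult_superset:
  assumes "finite S" "Poly_Mapping.keys z \<subseteq> S"
  shows "r \<odot>\<^bsub>F\<^esub> z = (\<Sum>p\<in>S. Poly_Mapping.single (r \<otimes> fst p, snd p) (Poly_Mapping.lookup z p))"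
proof -
  have "r \<odot>\<^bsub>F\<^esub> z = (\<Sum>p\<in>Poly_Mapping.keys z. Poly_Mapping.single (r \<otimes> fst p, snd p) (Poly_Mapping.lookup z p))"
    by (simp add: free_tensor_def case_prod_unfold)
  also have "\<dots> = (\<Sum>p\<in>S. Poly_Mapping.single (r \<otimes> fst p, snd p) (Poly_Mapping.lookup z p))"
    by (rule sum.mono_neutral_left[OF assms]) (simp add: in_keys_iff)
  finally show ?thesis .
qed

lemma F_smult_single: "r \<odot>\<^bsub>F\<^esub> Poly_Mapping.single (s, v) k = Poly_Mapping.single (r \<otimes> s, v) k"
  by (subst F_smult_superset[of "{(s, v)}"]) (auto simp: lookup_single)

lemma F_smult_add: "r \<odot>\<^bsub>F\<^esub> (z + w) = r \<odot>\<^bsub>F\<^esub> z + r \<odot>\<^bsub>F\<^esub> w"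
proof -
  let ?S = "Poly_Mapping.keys z \<union> Poly_Mapping.keys w"
  have f: "finite ?S" by simp
  show ?thesis
    unfolding F_smult_superset[OF f keys_add] F_smult_superset[OF f Un_upper1] F_smult_superset[OF f Un_upper2]
    by (simp add: lookup_add single_add sum.distrib)
qed

lemma F_smult_zero: "r \<odot>\<^bsub>F\<^esub> 0 = 0"
  using F_smult_add[of r 0 0] by simp

lemma F_smult_diff: "r \<odot>\<^bsub>F\<^esub> (z - w) = r \<odot>\<^bsub>F\<^esub> z - r \<odot>\<^bsub>F\<^esub> w"
  using F_smult_add[of r "z - w" w] by simp

lemma F_add_closed: "z \<in> carrier F \<Longrightarrow> w \<in> carrier F \<Longrightarrow> z + w \<in> carrier F"
  unfolding F_carrier using keys_add[of z w] by blast

lemma F_uminus_closed: "z \<in> carrier F \<Longrightarrow> - z \<in> carrier F"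
  by (simp add: F_carrier in_keys_iff)

lemma F_diff_closed: "z \<in> carrier F \<Longrightarrow> w \<in> carrier F \<Longrightarrow> z - w \<in> carrier F"
  using F_add_closed[OF _ F_uminus_closed, of z w] by simp

lemma F_zero_closed: "0 \<in> carrier F"
  by (simp add: F_carrier)

lemma F_single_closed: "r \<in> carrier R \<Longrightarrow> v \<in> carrier V \<Longrightarrow> Poly_Mapping.single (r, v) k \<in> carrier F"
  by (simp add: F_carrier)

lemma F_smult_closed: "r \<in> carrier R \<Longrightarrow> z \<in> carrier F \<Longrightarrow> r \<odot>\<^bsub>F\<^esub> z \<in> carrier F"
proof -
  assume r: "r \<in> carrier R" and z: "z \<in> carrier F"
  then have "\<forall>p\<in>Poly_Mapping.keys z. p \<in> carrier R \<times> carrier V" by (simp add: F_carrier)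
  then show "r \<odot>\<^bsub>F\<^esub> z \<in> carrier F"
  proof (induction z rule: poly_mapping_span_induct)
    case (single p k)
    then show ?case using r by (cases p) (auto simp: F_smult_single intro: F_single_closed)
  qed (simp_all add: F_smult_zero F_smult_add F_zero_closed F_add_closed)
qed

lemma F_group: "abelian_group F"
proof (rule abelian_groupI)
  show "\<exists>w\<in>carrier F. w \<oplus>\<^bsub>F\<^esub> z = \<zero>\<^bsub>F\<^esub>" if "z \<in> carrier F" for z
    using F_uminus_closed[OF that] by (intro bexI[of _ "- z"]) auto
qed (auto simp: F_zero_closed F_add_closed algebra_simps)

lemma F_operator_group: "operator_group F (carrier R)"
  by (intro operator_group.intro operator_group_axioms.intro F_group F_smult_closed)
    (simp_all add: F_smult_add)

lemma relE:
  assumes "z \<in> Rel"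
  obtains (left) r s v where "z = pure (r \<oplus> s) v - pure r v - pure s v"
      "r \<in> carrier R" "s \<in> carrier R" "v \<in> carrier V"
  | (right) r v w where "z = pure r (v \<oplus>\<^bsub>V\<^esub> w) - pure r v - pure r w"
      "r \<in> carrier R" "v \<in> carrier V" "w \<in> carrier V"
  | (balanced) r b v where "z = pure (r \<otimes> \<phi> b) v - pure r (b \<odot>\<^bsub>V\<^esub> v)"
      "r \<in> carrier R" "b \<in> carrier B" "v \<in> carrier V"
  using assms unfolding tensor_relations_def Let_def by blast

lemma rel_left: "r \<in> carrier R \<Longrightarrow> s \<in> carrier R \<Longrightarrow> v \<in> carrier V \<Longrightarrow>
    pure (r \<oplus> s) v - pure r v - pure s v \<in> Rel"
  and rel_right: "r \<in> carrier R \<Longrightarrow> v \<in> carrier V \<Longrightarrow> w \<in> carrier V \<Longrightarrow>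
    pure r (v \<oplus>\<^bsub>V\<^esub> w) - pure r v - pure r w \<in> Rel"
  and rel_balanced: "r \<in> carrier R \<Longrightarrow> b \<in> carrier B \<Longrightarrow> v \<in> carrier V \<Longrightarrow>
    pure (r \<otimes> \<phi> b) v - pure r (b \<odot>\<^bsub>V\<^esub> v) \<in> Rel"
  unfolding tensor_relations_def Let_def by blast+

lemma Rel_closed: "Rel \<subseteq> carrier F"
proof
  fix z assume "z \<in> Rel"
  then show "z \<in> carrier F"
    by (cases rule: relE) (auto intro!: F_diff_closed F_single_closed phi_closed V_op_closed)
qed

lemma Rel_stable: "r \<in> carrier R \<Longrightarrow> z \<in> Rel \<Longrightarrow> r \<odot>\<^bsub>F\<^esub> z \<in> Rel"
proof -
  assume r: "r \<in> carrier R" and "z \<in> Rel"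
  from this(2) show ?thesis
  proof (cases rule: relE)
    case (left r' s v)
    then show ?thesis using rel_left[of "r \<otimes> r'" "r \<otimes> s" v] r
      by (simp add: F_smult_diff F_smult_single r_distr)
  next
    case (right r' v w)
    then show ?thesis using rel_right[of "r \<otimes> r'" v w] r by (simp add: F_smult_diff F_smult_single)
  next
    case (balanced r' b v)
    then show ?thesis using rel_balanced[of "r \<otimes> r'" b v] r phi_closed
      by (simp add: F_smult_diff F_smult_single m_assoc)
  qed
qed

sublocale F: operator_group F "carrier R"
  by (rule F_operator_group)

lemma F_minus: "z \<in> carrier F \<Longrightarrow> \<ominus>\<^bsub>F\<^esub> z = - z"
  by (rule F.minus_equality) (auto simp: F_uminus_closed)

lemma N_subgroup: "additive_subgroup N F"
  unfolding N_def using F.add.generate_is_subgroup Rel_closed by (intro additive_subgroup.intro) simp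

lemma N_stable: "r \<in> carrier R \<Longrightarrow> z \<in> N \<Longrightarrow> r \<odot>\<^bsub>F\<^esub> z \<in> N"
proof -
  assume r: "r \<in> carrier R" and "z \<in> N"
  interpret additive_subgroup N F by (rule N_subgroup)
  have incl: "z \<in> N" if "z \<in> Rel" for z unfolding N_def using that by (rule generate.incl)
  from \<open>z \<in> N\<close> show "r \<odot>\<^bsub>F\<^esub> z \<in> N"
    unfolding N_def[abs_def]
  proof (induction rule: generate.induct)
    case one
    then show ?case using zero_closed by (simp add: F_smult_zero N_def)
  next
    case (incl h)
    then show ?case using \<open>\<And>z. z \<in> Rel \<Longrightarrow> z \<in> N\<close> Rel_stable r by (simp add: N_def)
  next
    case (inv h)
    have h: "h \<in> carrier F" using inv Rel_closed by blast
    have "m_inv (add_monoid F) h = 0 - h" using F_minus[OF h] by (simp add: a_inv_def)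
    moreover have "- (r \<odot>\<^bsub>F\<^esub> h) \<in> N"
      using a_inv_closed[OF incl[OF Rel_stable[OF r inv]]] F_minus[OF F_smult_closed[OF r h]] by simp
    ultimately show ?case by (simp only: F_smult_diff F_smult_zero) (simp add: N_def)
  next
    case (eng h1 h2)
    then show ?case using a_closed by (simp add: F_smult_add N_def)
  qed
qed

sublocale Ind: operator_quotient F "carrier R" N
  by (intro operator_quotient.intro operator_quotient_axioms.intro F_operator_group N_subgroup N_stable)

sublocale IndQ: operator_group Ind.Q "carrier R"
  by (rule Ind.Q_operator_group)

lemma induced_module_eq: "induced_module R B \<phi> V = Ind.Q"
  by (simp add: induced_module_def N_def)

definition ten :: "'r \<Rightarrow> 'v \<Rightarrow> ('r \<times> 'v \<Rightarrow>\<^sub>0 int) set" where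
  "ten r v = Ind.q (pure r v)"

lemma ten_closed: "r \<in> carrier R \<Longrightarrow> v \<in> carrier V \<Longrightarrow> ten r v \<in> carrier Ind.Q"
  unfolding ten_def Ind.Q_carrier using F_single_closed by blast

lemma F_a_minus: "z \<in> carrier F \<Longrightarrow> w \<in> carrier F \<Longrightarrow> z \<ominus>\<^bsub>F\<^esub> w = z - w"
  by (simp add: a_minus_def F_minus)

lemma Rel_N: "z \<in> Rel \<Longrightarrow> z \<in> N"
  unfolding N_def by (rule generate.incl)

lemma ten_add_left:
  assumes "r \<in> carrier R" "s \<in> carrier R" "v \<in> carrier V"
  shows "ten (r \<oplus> s) v = ten r v \<oplus>\<^bsub>Ind.Q\<^esub> ten s v"
proof -
  have c: "pure (r \<oplus> s) v \<in> carrier F" "pure r v \<in> carrier F" "pure s v \<in> carrier F"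
    using assms by (simp_all add: F_single_closed)
  have "Ind.q (pure (r \<oplus> s) v) = Ind.q (pure r v + pure s v)"
    using Rel_N[OF rel_left[OF assms]] Ind.q_eq_iff[OF c(1) F_add_closed[OF c(2,3)]]
      F_a_minus[OF c(1) F_add_closed[OF c(2,3)]] by (simp add: diff_diff_add)
  then show ?thesis unfolding ten_def Ind.q_add[OF c(2,3)] by simp
qed

lemma ten_add_right:
  assumes "r \<in> carrier R" "v \<in> carrier V" "w \<in> carrier V"
  shows "ten r (v \<oplus>\<^bsub>V\<^esub> w) = ten r v \<oplus>\<^bsub>Ind.Q\<^esub> ten r w"
proof -
  have c: "pure r (v \<oplus>\<^bsub>V\<^esub> w) \<in> carrier F" "pure r v \<in> carrier F" "pure r w \<in> carrier F"
    using assms by (simp_all add: F_single_closed)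
  have "Ind.q (pure r (v \<oplus>\<^bsub>V\<^esub> w)) = Ind.q (pure r v + pure r w)"
    using Rel_N[OF rel_right[OF assms]] Ind.q_eq_iff[OF c(1) F_add_closed[OF c(2,3)]]
      F_a_minus[OF c(1) F_add_closed[OF c(2,3)]] by (simp add: diff_diff_add)
  then show ?thesis unfolding ten_def Ind.q_add[OF c(2,3)] by simp
qed

lemma ten_balanced:
  assumes "r \<in> carrier R" "b \<in> carrier B" "v \<in> carrier V"
  shows "ten (r \<otimes> \<phi> b) v = ten r (b \<odot>\<^bsub>V\<^esub> v)"
proof -
  have c: "pure (r \<otimes> \<phi> b) v \<in> carrier F" "pure r (b \<odot>\<^bsub>V\<^esub> v) \<in> carrier F"
    using assms by (simp_all add: F_single_closed phi_closed V_op_closed)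
  show ?thesis
    using Rel_N[OF rel_balanced[OF assms]] Ind.q_eq_iff[OF c] F_a_minus[OF c] by (simp add: ten_def)
qed

lemma ten_smult:
  assumes "r \<in> carrier R" "s \<in> carrier R" "v \<in> carrier V"
  shows "r \<odot>\<^bsub>Ind.Q\<^esub> ten s v = ten (r \<otimes> s) v"
  unfolding ten_def using Ind.q_smult[OF assms(1) F_single_closed[OF assms(2,3)]] by (simp add: F_smult_single)

text \<open>The free group has integer coefficients while S is only closed under addition, so a
  negative multiple of a tensor is rewritten as a positive multiple with the first factor
  negated.\<close>

lemma ten_span:
  assumes x: "x \<in> carrier Ind.Q" and ten: "\<And>r v. r \<in> carrier R \<Longrightarrow> v \<in> carrier V \<Longrightarrow> ten r v \<in> S"
    and zero: "\<zero>\<^bsub>Ind.Q\<^esub> \<in> S" and add: "\<And>x y. x \<in> S \<Longrightarrow> y \<in> S \<Longrightarrow> x \<oplus>\<^bsub>Ind.Q\<^esub> y \<in> S"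
    and S: "S \<subseteq> carrier Ind.Q"
  shows "x \<in> S"
proof -
  obtain z where z: "z \<in> carrier F" "x = Ind.q z" using x unfolding Ind.Q_carrier by blast
  have q0: "Ind.q 0 = \<zero>\<^bsub>Ind.Q\<^esub>"
    using Ind.q_zero_iff[OF F_zero_closed] Ind.zero_closed by (simp add: Ind.Q_zero)
  have nat: "Ind.q (Poly_Mapping.single (r, v) (int k)) \<in> S" if rv: "r \<in> carrier R" "v \<in> carrier V" for r v k
  proof (induction k)
    case (Suc k)
    have "Poly_Mapping.single (r, v) (int (Suc k)) = pure r v + Poly_Mapping.single (r, v) (int k)"
      by (simp add: single_add)
    then show ?case using Ind.q_add[OF F_single_closed[OF rv] F_single_closed[OF rv]] add[OF ten[OF rv] Suc]
      by (simp add: ten_def)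
  qed (use q0 zero in simp)
  have "\<forall>p\<in>Poly_Mapping.keys z. p \<in> carrier R \<times> carrier V" using z(1) by (simp add: F_carrier)
  then have "z \<in> carrier F \<and> Ind.q z \<in> S"
  proof (induction z rule: poly_mapping_span_induct)
    case zero
    show ?case using q0 \<open>\<zero>\<^bsub>Ind.Q\<^esub> \<in> S\<close> F_zero_closed by simp
  next
    case (single p k)
    then obtain r v where p: "p = (r, v)" "r \<in> carrier R" "v \<in> carrier V" by auto
    show ?case
    proof (cases "0 \<le> k")
      case True
      then show ?thesis using nat[OF p(2,3), of "nat k"] F_single_closed p by simp
    next
      case False
      have neg: "\<ominus> r \<in> carrier R" using p by simp
      have "ten (\<ominus> r) v \<oplus>\<^bsub>Ind.Q\<^esub> ten r v = ten \<zero> v" using ten_add_left[OF neg p(2,3)] p by (simp add: l_neg)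
      moreover have "ten \<zero> v \<oplus>\<^bsub>Ind.Q\<^esub> ten \<zero> v = ten \<zero> v" using ten_add_left[of \<zero> \<zero> v] p by simp
      then have "ten \<zero> v = \<zero>\<^bsub>Ind.Q\<^esub>" using ten_closed[of \<zero> v] p IndQ.add.l_cancel_one' by simp
      ultimately have m: "Ind.q (pure (\<ominus> r) v) \<oplus>\<^bsub>Ind.Q\<^esub> Ind.q (pure r v) = \<zero>\<^bsub>Ind.Q\<^esub>" by (simp add: ten_def)
      have "Ind.q (Poly_Mapping.single (\<ominus> r, v) (int j)) = Ind.q (Poly_Mapping.single (r, v) (- int j))" for j
      proof -
        have "Poly_Mapping.single (\<ominus> r, v) (int j) - Poly_Mapping.single (r, v) (- int j) \<in> N"
        proof (induction j)
          case 0
          show ?case using Ind.zero_closed by simp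
        next
          case (Suc j)
          have cl: "pure (\<ominus> r) v \<in> carrier F" "pure r v \<in> carrier F" using neg p by (simp_all add: F_single_closed)
          have "pure (\<ominus> r) v + pure r v \<in> N"
            using m Ind.q_zero_iff[OF F_add_closed[OF cl]] unfolding Ind.q_add[OF cl] Ind.Q_zero by simp
          from Ind.a_closed[OF this Suc] show ?case
            by (simp add: single_add single_diff single_uminus algebra_simps)
        qed
        then show ?thesis
          using Ind.q_eq_iff F_single_closed neg p(2,3) F_a_minus by simp
      qed
      from this[of "nat (- k)"] show ?thesis
        using nat[OF neg p(3), of "nat (- k)"] False F_single_closed p by simp
    qed
  next
    case (add f g)
    then show ?case using assms(4)[of "Ind.q f" "Ind.q g"] Ind.q_add[of f g] by (simp add: F_add_closed)
  qed
  then show ?thesis using z by simp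
qed

text \<open>A balanced biadditive map extends to the free group and kills all relations, hence the
  subgroup they generate. This is the means of bounding the kernel of the standard module from
  above.\<close>

lemma ten_zeroD:
  fixes \<beta> :: "'r \<Rightarrow> 'v \<Rightarrow> complex"
  assumes left: "\<And>r s v. r \<in> carrier R \<Longrightarrow> s \<in> carrier R \<Longrightarrow> v \<in> carrier V \<Longrightarrow> \<beta> (r \<oplus> s) v = \<beta> r v + \<beta> s v"
    and right: "\<And>r v w. r \<in> carrier R \<Longrightarrow> v \<in> carrier V \<Longrightarrow> w \<in> carrier V \<Longrightarrow> \<beta> r (v \<oplus>\<^bsub>V\<^esub> w) = \<beta> r v + \<beta> r w"
    and balanced: "\<And>r b v. r \<in> carrier R \<Longrightarrow> b \<in> carrier B \<Longrightarrow> v \<in> carrier V \<Longrightarrow> \<beta> (r \<otimes> \<phi> b) v = \<beta> r (b \<odot>\<^bsub>V\<^esub> v)"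
    and rv: "r \<in> carrier R" "v \<in> carrier V" and zero: "ten r v = \<zero>\<^bsub>Ind.Q\<^esub>"
  shows "\<beta> r v = 0"
proof -
  define \<theta> where "\<theta> z = (\<Sum>p\<in>Poly_Mapping.keys z. of_int (Poly_Mapping.lookup z p) * \<beta> (fst p) (snd p))"
    for z :: "'r \<times> 'v \<Rightarrow>\<^sub>0 int"
  have sup: "\<theta> z = (\<Sum>p\<in>S. of_int (Poly_Mapping.lookup z p) * \<beta> (fst p) (snd p))"
    if "finite S" "Poly_Mapping.keys z \<subseteq> S" for z S
    unfolding \<theta>_def by (rule sum.mono_neutral_left[OF that]) (simp add: in_keys_iff)
  have add: "\<theta> (z + w) = \<theta> z + \<theta> w" for z w
  proof -
    let ?S = "Poly_Mapping.keys z \<union> Poly_Mapping.keys w"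
    have f: "finite ?S" by simp
    show ?thesis unfolding sup[OF f keys_add] sup[OF f Un_upper1] sup[OF f Un_upper2]
      by (simp add: lookup_add ring_distribs sum.distrib)
  qed
  have z0: "\<theta> 0 = 0" by (simp add: \<theta>_def)
  have diff: "\<theta> (z - w) = \<theta> z - \<theta> w" for z w using add[of "z - w" w] by simp
  have single: "\<theta> (pure r v) = \<beta> r v" for r v by (simp add: \<theta>_def)
  have Rel0: "\<theta> z = 0" if "z \<in> Rel" for z
    using that by (cases rule: relE) (simp_all add: diff single left right balanced)
  have "\<theta> z = 0" if "z \<in> N" for z
    using that unfolding N_def
  proof (induction rule: generate.induct)
    case (inv h)
    have h: "h \<in> carrier F" using inv Rel_closed by blast
    have "m_inv (add_monoid F) h = 0 - h" using F_minus[OF h] by (simp add: a_inv_def)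
    then show ?case using diff[of 0 h] Rel0[OF inv] z0 by (simp only: diff_zero)
  qed (simp_all add: z0 Rel0 add)
  moreover have "pure r v \<in> N"
    using zero Ind.q_zero_iff[OF F_single_closed[OF rv]] unfolding ten_def Ind.Q_zero by simp
  ultimately show ?thesis using single by metis
qed

end

section \<open>The standard module of a hook\<close>

definition pushforward :: "('a \<Rightarrow> 'b) \<Rightarrow> ('a \<Rightarrow>\<^sub>0 complex) \<Rightarrow> 'b \<Rightarrow>\<^sub>0 complex" where
  "pushforward f h = (\<Sum>p\<in>Poly_Mapping.keys h. Poly_Mapping.single (f p) (Poly_Mapping.lookup h p))"

lemma pushforward_superset:
  assumes "finite S" "Poly_Mapping.keys h \<subseteq> S"
  shows "pushforward f h = (\<Sum>p\<in>S. Poly_Mapping.single (f p) (Poly_Mapping.lookup h p))"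
  unfolding pushforward_def by (rule sum.mono_neutral_left[OF assms]) (simp add: in_keys_iff)

lemma pushforward_add: "pushforward f (g + h) = pushforward f g + pushforward f h"
proof -
  let ?S = "Poly_Mapping.keys g \<union> Poly_Mapping.keys h"
  have f: "finite ?S" by simp
  show ?thesis
    unfolding pushforward_superset[OF f keys_add] pushforward_superset[OF f Un_upper1]
      pushforward_superset[OF f Un_upper2] by (simp add: lookup_add single_add sum.distrib)
qed

lemma pushforward_single: "pushforward f (Poly_Mapping.single p z) = Poly_Mapping.single (f p) z"
  by (cases "z = 0") (simp_all add: pushforward_def)

lemma pushforward_zero: "pushforward f 0 = 0"
  by (simp add: pushforward_def)

lemma pushforward_sum: "pushforward f (sum g S) = (\<Sum>i\<in>S. pushforward f (g i))"
  by (induction S rule: infinite_finite_induct) (simp_all add: pushforward_zero pushforward_add)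

lemma y_to_zero_superset:
  assumes "finite S" "Poly_Mapping.keys b \<subseteq> S"
  shows "y_to_zero b = (\<Sum>p\<in>S. if yp_mon p = {#} then Poly_Mapping.single p (Poly_Mapping.lookup b p) else 0)"
proof -
  have "y_to_zero b = (\<Sum>p\<in>Poly_Mapping.keys b. if yp_mon p = {#} then Poly_Mapping.single p (Poly_Mapping.lookup b p) else 0)"
    by (simp add: y_to_zero_def sum.inter_filter)
  also have "\<dots> = (\<Sum>p\<in>S. if yp_mon p = {#} then Poly_Mapping.single p (Poly_Mapping.lookup b p) else 0)"
    by (rule sum.mono_neutral_left[OF assms]) (simp add: in_keys_iff)
  finally show ?thesis .
qed

lemma y_to_zero_add: "y_to_zero (b + d) = y_to_zero b + y_to_zero d"
proof -
  let ?S = "Poly_Mapping.keys b \<union> Poly_Mapping.keys d"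
  have f: "finite ?S" by simp
  show ?thesis
    unfolding y_to_zero_superset[OF f keys_add] y_to_zero_superset[OF f Un_upper1]
      y_to_zero_superset[OF f Un_upper2]
    by (simp add: lookup_add single_add sum.distrib[symmetric] if_distrib cong: if_cong)
qed

lemma y_to_zero_single: "y_to_zero (Poly_Mapping.single p z) = (if yp_mon p = {#} then Poly_Mapping.single p z else 0)"
  by (subst y_to_zero_superset[of "{p}"]) auto

lemma y_to_zero_zero: "y_to_zero 0 = 0"
  by (simp add: y_to_zero_def)

abbreviation YC :: "nat \<Rightarrow> (yperm \<Rightarrow>\<^sub>0 complex) set" where "YC n \<equiv> carrier (y_crossed n)"

lemma YC_iff: "b \<in> YC n \<longleftrightarrow> (\<forall>p\<in>Poly_Mapping.keys b. set_mset (yp_mon p) \<subseteq> {1..n} \<and> yp_perm p permutes {1..n})"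
  by (simp add: y_crossed_def)

lemma GA_YC: "s \<in> group_algebra n \<Longrightarrow> s \<in> YC n"
  by (auto simp: group_algebra_def YC_iff)

lemma GA_add: "s \<in> group_algebra n \<Longrightarrow> t \<in> group_algebra n \<Longrightarrow> s + t \<in> group_algebra n"
  using keys_add[of s t] by (auto simp: group_algebra_def)

lemma GA_uminus: "s \<in> group_algebra n \<Longrightarrow> - s \<in> group_algebra n"
  by (simp add: group_algebra_def in_keys_iff)

lemma GA_zero: "0 \<in> group_algebra n"
  by (simp add: group_algebra_def)

lemma GA_one: "1 \<in> group_algebra n"
  by (auto simp: group_algebra_def zero_yperm_def permutes_id)

lemma GA_mult: "s \<in> group_algebra n \<Longrightarrow> t \<in> group_algebra n \<Longrightarrow> s * t \<in> group_algebra n"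
  using keys_mult[of s t] by (fastforce simp: group_algebra_def plus_yperm_def permutes_compose)

lemma GA_sum: "(\<And>i. i \<in> S \<Longrightarrow> f i \<in> group_algebra n) \<Longrightarrow> sum f S \<in> group_algebra n"
  by (induction S rule: infinite_finite_induct) (auto simp: GA_zero GA_add)

lemma GA_single: "g permutes {1..n} \<Longrightarrow> Poly_Mapping.single (YPerm {#} g) z \<in> group_algebra n"
  by (simp add: group_algebra_def)

lemma GA_induct [consumes 1, case_names zero single add]:
  assumes "s \<in> group_algebra n" "Q 0"
    "\<And>g z. g permutes {1..n} \<Longrightarrow> Q (Poly_Mapping.single (YPerm {#} g) z)"
    "\<And>s t. Q s \<Longrightarrow> Q t \<Longrightarrow> Q (s + t)"
  shows "Q s"
proof -
  have "\<forall>p\<in>Poly_Mapping.keys s. yp_mon p = {#} \<and> yp_perm p permutes {1..n}"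
    using assms(1) by (simp add: group_algebra_def)
  then show ?thesis
  proof (induction s rule: poly_mapping_span_induct)
    case (single p z)
    then show ?case using assms(3)[of "yp_perm p" z] by (cases p) simp
  qed (use assms in auto)
qed

lemma y_to_zero_GA: "b \<in> YC n \<Longrightarrow> y_to_zero b \<in> group_algebra n"
proof -
  assume "b \<in> YC n"
  then have "\<forall>p\<in>Poly_Mapping.keys b. set_mset (yp_mon p) \<subseteq> {1..n} \<and> yp_perm p permutes {1..n}" by (simp add: YC_iff)
  then show ?thesis
  proof (induction b rule: poly_mapping_span_induct)
    case (single p z)
    then show ?case using GA_single[of "yp_perm p" n z] by (cases p) (auto simp: y_to_zero_single GA_zero)
  qed (simp_all add: y_to_zero_zero y_to_zero_add GA_zero GA_add)
qed

lemma y_to_zero_id: "s \<in> group_algebra n \<Longrightarrow> y_to_zero s = s"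
  by (induction rule: GA_induct) (simp_all add: y_to_zero_zero y_to_zero_add y_to_zero_single)

definition enc :: "yperm \<Rightarrow> wperm" where
  "enc p = WPerm (map LY (sorted_list_of_multiset (yp_mon p))) (yp_perm p)"

text \<open>The lift underlying \<open>y_to_cherednik\<close>. It is multiplicative on the group
  algebra, while on monomials in the y_i it depends on the sorting.\<close>

definition lift :: "(yperm \<Rightarrow>\<^sub>0 complex) \<Rightarrow> wperm \<Rightarrow>\<^sub>0 complex" where
  "lift = pushforward enc"

text \<open>Forgets the word; on elements whose words are all empty this inverts
  \<open>lift\<close>.\<close>

definition unlift :: "(wperm \<Rightarrow>\<^sub>0 complex) \<Rightarrow> yperm \<Rightarrow>\<^sub>0 complex" where
  "unlift = pushforward (\<lambda>p. YPerm {#} (wp_perm p))"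

lemma y_to_cherednik_lift: "y_to_cherednik n c b = cherednik_class n c (lift b)"
  by (simp add: y_to_cherednik_def lift_def pushforward_def enc_def)

lemma lift_add: "lift (b + d) = lift b + lift d" and lift_zero: "lift 0 = 0"
  by (simp_all add: lift_def pushforward_add pushforward_zero)

lemma lift_sum: "lift (sum f S) = (\<Sum>i\<in>S. lift (f i))"
  by (simp add: lift_def pushforward_sum)

lemma lift_single: "lift (Poly_Mapping.single (YPerm {#} g) z) = scalar z * sg g"
  unfolding lift_def pushforward_single using single_times_eq[of "WPerm [] g" z] by (simp add: enc_def sg_def)

lemma enc_single: "lift (Poly_Mapping.single p z) = Poly_Mapping.single (enc p) z"
  by (simp add: lift_def pushforward_single)

lemma lift_CS: "s \<in> group_algebra n \<Longrightarrow> lift s \<in> CS n"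
  by (induction rule: GA_induct) (auto simp: lift_zero lift_add lift_single intro: CS_zero CS_add CS_mult CS_scalar CS_sg)

lemma lift_FC: "b \<in> YC n \<Longrightarrow> lift b \<in> FC n"
proof -
  assume "b \<in> YC n"
  then have "\<forall>p\<in>Poly_Mapping.keys b. set_mset (yp_mon p) \<subseteq> {1..n} \<and> yp_perm p permutes {1..n}" by (simp add: YC_iff)
  then show ?thesis
  proof (induction b rule: poly_mapping_span_induct)
    case (single p z)
    then have "okp n (enc p)" by (auto simp: okp_def enc_def)
    then show ?case by (simp add: enc_single FC_single)
  qed (simp_all add: lift_zero lift_add FC_zero FC_add)
qed

lemma lift_mult: "s \<in> group_algebra n \<Longrightarrow> t \<in> group_algebra n \<Longrightarrow> lift (s * t) = lift s * lift t"
proof (induction s rule: GA_induct)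
  case (single g z)
  from single(2) show ?case
  proof (induction t rule: GA_induct)
    case (single h w)
    have "lift (Poly_Mapping.single (YPerm {#} g) z * Poly_Mapping.single (YPerm {#} h) w) = scalar (z * w) * sg (g \<circ> h)"
      by (simp only: mult_single plus_yperm_def yperm.sel image_mset_empty add_0 lift_single)
    also have "\<dots> = scalar z * (scalar w * (sg g * sg h))"
      by (simp only: scalar_mult sg_mult mult.assoc)
    also have "\<dots> = scalar z * (sg g * (scalar w * sg h))"
      by (simp only: mult.assoc[symmetric] scalar_mult_commute[of w "sg g"])
    finally show ?case by (simp only: lift_single mult.assoc)
  qed (simp_all add: lift_zero lift_add distrib_left)
qed (simp_all add: lift_zero lift_add distrib_right)

lemma unlift_lift: "s \<in> group_algebra n \<Longrightarrow> unlift (lift s) = s"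
proof (induction rule: GA_induct)
  case (single g z)
  then show ?case by (simp only: enc_single) (simp add: unlift_def pushforward_single enc_def)
qed (simp_all add: lift_zero lift_add unlift_def pushforward_zero pushforward_add)

lemma unlift_single: "unlift (scalar z * sg g) = Poly_Mapping.single (YPerm {#} g) z"
  using single_times_eq[of "WPerm [] g" z] by (simp add: unlift_def sg_def pushforward_single flip: single_times_eq)

lemma unlift_CS: "t \<in> CS n \<Longrightarrow> unlift t \<in> group_algebra n \<and> lift (unlift t) = t"
proof (induction rule: CS_induct)
  case zero
  show ?case by (simp add: unlift_def pushforward_zero GA_zero lift_zero)
next
  case (single g z)
  then show ?case by (simp add: unlift_single GA_single lift_single)
next
  case (add s t)
  then show ?case by (simp add: unlift_def pushforward_add GA_add lift_add)
qed

context hook_model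
begin

section \<open>The stabilizers and the irreducible module of a hook\<close>

abbreviation V where "V \<equiv> irrep (hook n l)"
abbreviation ab where "ab \<equiv> young_symmetrizer (hook n l)"

lemma sum_list_hook: "sum_list (hook n l) = n"
  using ln by (simp add: hook_def sum_list_replicate)

lemma mem_boxes: "(r, j) \<in> boxes (hook n l) \<longleftrightarrow> r = 0 \<and> j < n - l \<or> 1 \<le> r \<and> r \<le> l \<and> j = 0"
  by (cases r) (auto simp: boxes_def hook_def)

lemma row_filling_row: "row_filling (hook n l) (0, j) = j + 1"
  by (simp add: row_filling_def)

lemma row_filling_leg: "1 \<le> r \<Longrightarrow> r \<le> l \<Longrightarrow> row_filling (hook n l) (r, 0) = n - l + r"
  by (cases r) (simp_all add: row_filling_def hook_def sum_list_replicate)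

lemma row_0: "row_filling (hook n l) ` {b \<in> boxes (hook n l). fst b = 0} = {1..n - l}"
proof -
  have "{b \<in> boxes (hook n l). fst b = 0} = (\<lambda>j. (0, j)) ` {..<n - l}"
    by (rule Set.set_eqI) (auto simp: split_paired_all mem_boxes image_iff)
  then have "row_filling (hook n l) ` {b \<in> boxes (hook n l). fst b = 0} = (\<lambda>j. j + 1) ` {..<n - l}"
    by (simp add: image_image row_filling_row)
  also have "\<dots> = {1..n - l}" by (simp only: lessThan_atLeast0 image_add_atLeastLessThan') auto
  finally show ?thesis .
qed

lemma row_Suc: "1 \<le> r \<Longrightarrow> r \<le> l \<Longrightarrow> row_filling (hook n l) ` {b \<in> boxes (hook n l). fst b = r} = {n - l + r}"
proof -
  assume r: "1 \<le> r" "r \<le> l"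
  have "{b \<in> boxes (hook n l). fst b = r} = {(r, 0)}"
    by (rule Set.set_eqI) (use r in \<open>auto simp: split_paired_all mem_boxes\<close>)
  then show ?thesis using row_filling_leg[OF r] by simp
qed

lemma row_beyond: "l < r \<Longrightarrow> {b \<in> boxes (hook n l). fst b = r} = {}"
  by (rule Set.set_eqI) (simp add: split_paired_all mem_boxes)

lemma column_0: "row_filling (hook n l) ` {b \<in> boxes (hook n l). snd b = 0} = colset"
proof -
  have "{b \<in> boxes (hook n l). snd b = 0} = insert (0, 0) ((\<lambda>r. (r, 0)) ` {1..l})"
    by (rule Set.set_eqI) (use ln in \<open>auto simp: split_paired_all mem_boxes image_iff\<close>)
  then have "row_filling (hook n l) ` {b \<in> boxes (hook n l). snd b = 0} = insert 1 ((\<lambda>r. n - l + r) ` {1..l})"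
    by (simp add: image_image row_filling_row row_filling_leg cong: image_cong_simp)
  also have "\<dots> = colset" using ln by (simp only: colset_def image_add_atLeastAtMost) (simp add: add.commute)
  finally show ?thesis .
qed

lemma column_Suc: "1 \<le> j \<Longrightarrow> j < n - l \<Longrightarrow> row_filling (hook n l) ` {b \<in> boxes (hook n l). snd b = j} = {j + 1}"
proof -
  assume j: "1 \<le> j" "j < n - l"
  have "{b \<in> boxes (hook n l). snd b = j} = {(0, j)}"
    by (rule Set.set_eqI) (use j in \<open>auto simp: split_paired_all mem_boxes\<close>)
  then show ?thesis using row_filling_row by simp
qed

lemma column_beyond: "1 \<le> j \<Longrightarrow> n - l \<le> j \<Longrightarrow> {b \<in> boxes (hook n l). snd b = j} = {}"
  by (rule Set.set_eqI) (simp add: split_paired_all mem_boxes)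

lemma permutes_fix_outside:
  assumes f: "perm f" and S: "S \<subseteq> {1..n}" "\<And>i. i \<in> {1..n} - S \<Longrightarrow> f i = i"
  shows "f permutes S"
  using permutes_superset[OF f, of S] S(2) f by (metis Diff_iff permutes_not_in)

lemma row_stabilizer_hook: "row_stabilizer (hook n l) = {g. g permutes {1..n - l}}"
proof (intro equalityI subsetI)
  fix f assume "f \<in> row_stabilizer (hook n l)"
  then have f: "perm f" "\<And>r. f ` (row_filling (hook n l) ` {b \<in> boxes (hook n l). fst b = r}) = row_filling (hook n l) ` {b \<in> boxes (hook n l). fst b = r}"
    unfolding row_stabilizer_def sum_list_hook by blast+
  have "f i = i" if "i \<in> {1..n} - {1..n - l}" for i
    using f(2)[of "i - (n - l)"] row_Suc[of "i - (n - l)"] that by auto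
  then show "f \<in> {g. g permutes {1..n - l}}" using permutes_fix_outside[OF f(1), of "{1..n - l}"] by auto
next
  fix f assume f: "f \<in> {g. g permutes {1..n - l}}"
  have "f ` (row_filling (hook n l) ` {b \<in> boxes (hook n l). fst b = r}) = row_filling (hook n l) ` {b \<in> boxes (hook n l). fst b = r}" for r
  proof -
    consider "r = 0" | "1 \<le> r" "r \<le> l" | "l < r" by linarith
    then show ?thesis
    proof cases
      case 1
      then show ?thesis using row_0 permutes_image[of f "{1..n - l}"] f by simp
    next
      case 2
      have "f (n - l + r) = n - l + r" using f 2 by (intro permutes_not_in[of f "{1..n - l}"]) auto
      then show ?thesis using row_Suc[OF 2] by simp
    next
      case 3
      show ?thesis unfolding row_beyond[OF 3] by simp
    qed
  qed
  then show "f \<in> row_stabilizer (hook n l)" unfolding row_stabilizer_def sum_list_hook using f perm_row by blast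
qed

lemma column_stabilizer_hook: "column_stabilizer (hook n l) = {g. g permutes colset}"
proof (intro equalityI subsetI)
  fix f assume "f \<in> column_stabilizer (hook n l)"
  then have f: "perm f" "\<And>r. f ` (row_filling (hook n l) ` {b \<in> boxes (hook n l). snd b = r}) = row_filling (hook n l) ` {b \<in> boxes (hook n l). snd b = r}"
    unfolding column_stabilizer_def sum_list_hook by blast+
  have "f i = i" if "i \<in> {1..n} - colset" for i
  proof -
    have i: "1 \<le> i - 1" "i - 1 < n - l" "i - 1 + 1 = i" using that by (auto simp: colset_def)
    show ?thesis using f(2)[of "i - 1"] column_Suc[OF i(1,2)] i(3) by simp
  qed
  then show "f \<in> {g. g permutes colset}" using permutes_fix_outside[OF f(1) colset_sub(1)] by auto
next
  fix f assume f: "f \<in> {g. g permutes colset}"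
  have "f ` (row_filling (hook n l) ` {b \<in> boxes (hook n l). snd b = r}) = row_filling (hook n l) ` {b \<in> boxes (hook n l). snd b = r}" for r
  proof -
    consider "r = 0" | "1 \<le> r" "r < n - l" | "1 \<le> r" "n - l \<le> r" by linarith
    then show ?thesis
    proof cases
      case 1
      then show ?thesis using column_0 permutes_image[of f colset] f by simp
    next
      case 2
      have "f (r + 1) = r + 1" using f 2 by (intro permutes_not_in[of f colset]) (auto simp: colset_def)
      then show ?thesis using column_Suc[OF 2] by simp
    next
      case 3
      show ?thesis unfolding column_beyond[OF 3] by simp
    qed
  qed
  then show "f \<in> column_stabilizer (hook n l)" unfolding column_stabilizer_def sum_list_hook using f perm_col by blast
qed

lemma ab_parts:
  "(\<Sum>f\<in>row_stabilizer (hook n l). Poly_Mapping.single (YPerm {#} f) 1) \<in> group_algebra n"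
  "(\<Sum>f\<in>column_stabilizer (hook n l). Poly_Mapping.single (YPerm {#} f) (of_int (sign f))) \<in> group_algebra n"
  unfolding row_stabilizer_hook column_stabilizer_hook using perm_row perm_col by (auto intro!: GA_sum GA_single)

lemma GA_ab: "ab \<in> group_algebra n"
  unfolding young_symmetrizer_def by (intro GA_mult ab_parts)

lemma lift_ab: "lift ab = ra * rb"
  unfolding young_symmetrizer_def lift_mult[OF ab_parts]
  unfolding row_stabilizer_hook column_stabilizer_hook lift_sum lift_single ra_def rb_def scalar_1 by simp

lemma V_carrier: "carrier V = {s * ab | s. s \<in> group_algebra n}"
  by (simp add: irrep_def sum_list_hook)

lemma V_simps [simp]: "zero V = 0" "add V = (+)" "b \<odot>\<^bsub>V\<^esub> v = y_to_zero b * v"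
  by (simp_all add: irrep_def)

lemma V_GA: "v \<in> carrier V \<Longrightarrow> v \<in> group_algebra n"
  unfolding V_carrier using GA_mult GA_ab by blast

lemma V_mem: "s \<in> group_algebra n \<Longrightarrow> s * ab \<in> carrier V"
  unfolding V_carrier by blast

lemma V_add: "v \<in> carrier V \<Longrightarrow> w \<in> carrier V \<Longrightarrow> v + w \<in> carrier V"
  unfolding V_carrier by (smt (verit) GA_add distrib_right mem_Collect_eq)

lemma V_group: "abelian_group V"
proof (rule abelian_groupI)
  show "\<zero>\<^bsub>V\<^esub> \<in> carrier V" using V_mem[OF GA_zero] by simp
  fix v assume "v \<in> carrier V"
  then obtain s where s: "s \<in> group_algebra n" "v = s * ab" unfolding V_carrier by blast
  show "\<exists>w\<in>carrier V. w \<oplus>\<^bsub>V\<^esub> v = \<zero>\<^bsub>V\<^esub>"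
    using V_mem[OF GA_uminus[OF s(1)]] s(2) by (intro bexI[of _ "- s * ab"]) simp_all
qed (auto simp: V_add algebra_simps)

sublocale ID: induction_data "cherednik n c" V "y_crossed n" "y_to_cherednik n c"
proof (intro induction_data.intro induction_data_axioms.intro ring_cherednik V_group)
  show "y_to_cherednik n c b \<in> carrier (cherednik n c)" if "b \<in> YC n" for b
    unfolding y_to_cherednik_lift by (rule class_closed[OF lift_FC[OF that]])
  show "b \<odot>\<^bsub>V\<^esub> v \<in> carrier V" if b: "b \<in> YC n" and v: "v \<in> carrier V" for b v
  proof -
    obtain s where s: "s \<in> group_algebra n" "v = s * ab" using v unfolding V_carrier by blast
    show ?thesis using V_mem[OF GA_mult[OF y_to_zero_GA[OF b] s(1)]] s(2) by (simp add: mult.assoc)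
  qed
qed

end

context hook_model
begin

section \<open>The standard module as a cyclic module\<close>

abbreviation \<Delta> where "\<Delta> \<equiv> ID.Ind.Q"

definition gen :: "(wperm \<Rightarrow>\<^sub>0 complex) \<Rightarrow> standard_elem" where
  "gen h = ID.ten (cherednik_class n c h) ab"

definition gen_kernel :: "(wperm \<Rightarrow>\<^sub>0 complex) set" where
  "gen_kernel = {h \<in> FC n. gen h = \<zero>\<^bsub>\<Delta>\<^esub>}"

lemma standard_module_eq: "standard_module c (hook n l) = \<Delta>"
  unfolding standard_module_def sum_list_hook Let_def ID.induced_module_eq ..

lemma ab_closed: "ab \<in> carrier V"
  using V_mem[OF GA_one] by simp

lemma gen_closed: "f \<in> FC n \<Longrightarrow> gen f \<in> carrier \<Delta>"
  unfolding gen_def by (intro ID.ten_closed class_closed ab_closed)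

lemma gen_add: "f \<in> FC n \<Longrightarrow> g \<in> FC n \<Longrightarrow> gen (f + g) = gen f \<oplus>\<^bsub>\<Delta>\<^esub> gen g"
  unfolding gen_def using ID.ten_add_left[OF class_closed class_closed ab_closed] by (simp add: class_add)

lemma gen_smult: "f \<in> FC n \<Longrightarrow> g \<in> FC n \<Longrightarrow> cherednik_class n c f \<odot>\<^bsub>\<Delta>\<^esub> gen g = gen (f * g)"
  unfolding gen_def using ID.ten_smult[OF class_closed class_closed ab_closed] by (simp add: class_mult)

lemma class_ideal: "h \<in> cherednik_ideal n c \<Longrightarrow> cherednik_class n c h = cherednik_class n c 0"
proof -
  interpret ideal "cherednik_ideal n c" "free_crossed n" by (rule cherednik_ideal)
  assume "h \<in> cherednik_ideal n c"
  then show ?thesis using a_rcos_const[of h] a_rcos_const[of 0] additive_subgroup.zero_closed[OF is_additive_subgroup] by (simp add: cherednik_class_def)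
qed

lemma gen_zero: "gen 0 = \<zero>\<^bsub>\<Delta>\<^esub>"
proof -
  have "gen 0 \<oplus>\<^bsub>\<Delta>\<^esub> gen 0 = gen 0" using gen_add[OF FC_zero FC_zero] by simp
  then show ?thesis using gen_closed[OF FC_zero] ID.IndQ.add.l_cancel_one' by simp
qed

text \<open>Moves elements of the smaller algebra across the tensor sign. Read one way it shows that
  a single vector generates, read the other way it yields the relations satisfied by that
  vector.\<close>

lemma ten_lift:
  assumes h: "h \<in> FC n" and b: "b \<in> YC n"
  shows "gen (h * lift b) = ID.ten (cherednik_class n c h) (y_to_zero b * ab)"
  unfolding gen_def using ID.ten_balanced[OF class_closed[OF h] b ab_closed]
  by (simp add: y_to_cherednik_lift class_mult[OF h lift_FC[OF b]])

lemma ten_zero_right: "h \<in> FC n \<Longrightarrow> ID.ten (cherednik_class n c h) 0 = \<zero>\<^bsub>\<Delta>\<^esub>"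
proof -
  assume h: "h \<in> FC n"
  have z: "0 \<in> carrier V" using V_mem[OF GA_zero] by simp
  show ?thesis
    using ID.ten_add_right[OF class_closed[OF h] z z] ID.ten_closed[OF class_closed[OF h] z]
      ID.IndQ.add.l_cancel_one' by simp
qed

lemma gen_image: "carrier \<Delta> = gen ` FC n"
proof (intro equalityI subsetI)
  fix x assume "x \<in> carrier \<Delta>"
  then show "x \<in> gen ` FC n"
  proof (rule ID.ten_span)
    fix r v assume "r \<in> carrier (cherednik n c)" and v: "v \<in> carrier V"
    then obtain h where h: "h \<in> FC n" "r = cherednik_class n c h" unfolding carrier_cherednik by blast
    obtain s where s: "s \<in> group_algebra n" "v = s * ab" using v unfolding V_carrier by blast
    have "ID.ten r v = gen (h * lift s)"
      using ten_lift[OF h(1) GA_YC[OF s(1)]] y_to_zero_id[OF s(1)] h(2) s(2) by simp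
    then show "ID.ten r v \<in> gen ` FC n" using FC_mult[OF h(1) lift_FC[OF GA_YC[OF s(1)]]] by blast
  next
    show "\<zero>\<^bsub>\<Delta>\<^esub> \<in> gen ` FC n" using gen_zero FC_zero by (metis image_eqI)
    show "x \<oplus>\<^bsub>\<Delta>\<^esub> y \<in> gen ` FC n" if xy: "x \<in> gen ` FC n" "y \<in> gen ` FC n" for x y
    proof -
      obtain f g where "f \<in> FC n" "x = gen f" "g \<in> FC n" "y = gen g" using xy by blast
      then show ?thesis using imageI[OF FC_add[of f n g], of gen] gen_add[of f g] by simp
    qed
  qed (use gen_closed in blast)
qed (use gen_closed in blast)

lemma gen_kernel_y: "i \<in> {1..n} \<Longrightarrow> gy i \<in> gen_kernel"
proof -
  assume i: "i \<in> {1..n}"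
  let ?b = "Poly_Mapping.single (YPerm {#i#} id) 1"
  have b: "?b \<in> YC n" using i by (simp add: YC_iff permutes_id)
  have "lift ?b = gy i" unfolding enc_single by (simp add: enc_def gy_def)
  moreover have "y_to_zero ?b = 0" by (simp add: y_to_zero_single)
  ultimately have "gen (gy i) = \<zero>\<^bsub>\<Delta>\<^esub>"
    using ten_lift[OF FC_one b] ten_zero_right[OF FC_one] by simp
  then show ?thesis using FC_gy[OF i] by (simp add: gen_kernel_def)
qed

lemma gen_kernel_young: "s \<in> CS n \<Longrightarrow> s * (ra * rb) = 0 \<Longrightarrow> s \<in> gen_kernel"
proof -
  assume s: "s \<in> CS n" and z: "s * (ra * rb) = 0"
  note b = unlift_CS[OF s, THEN conjunct1] unlift_CS[OF s, THEN conjunct2]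
  have "lift (unlift s * ab) = 0" using z by (simp add: lift_mult[OF b(1) GA_ab] b(2) lift_ab)
  then have "unlift s * ab = 0" using unlift_lift[OF GA_mult[OF b(1) GA_ab]] by (simp add: unlift_def pushforward_zero)
  then have "gen s = \<zero>\<^bsub>\<Delta>\<^esub>"
    using ten_lift[OF FC_one GA_YC[OF b(1)]] ten_zero_right[OF FC_one] y_to_zero_id[OF b(1)] b(2) by simp
  then show ?thesis using CS_FC[OF s] by (simp add: gen_kernel_def)
qed

text \<open>By \<open>act_rep\<close> the choice of representative does not affect the action on
  functions supported on affine permutations.\<close>

definition rep :: "cherednik_elem \<Rightarrow> wperm \<Rightarrow>\<^sub>0 complex" where
  "rep r = (SOME h. h \<in> FC n \<and> cherednik_class n c h = r)"

lemma act_rep: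
  assumes h: "h \<in> FC n" and f: "affsupp n f"
  shows "act (rep (cherednik_class n c h)) f = act h f"
proof -
  let ?r = "rep (cherednik_class n c h)"
  have "?r \<in> FC n \<and> cherednik_class n c ?r = cherednik_class n c h"
    unfolding rep_def by (rule someI) (use h in blast)
  then have "?r - h \<in> cherednik_ideal n c" using class_eqD[OF _ h] by blast
  from ideal_act[OF this f] show ?thesis by (simp add: act_diff fun_eq_iff)
qed

lemma Y_CS: "s \<in> CS n \<Longrightarrow> i \<in> {1..n} \<Longrightarrow> Y i (act s e0) = (\<lambda>P. 0)"
proof (induction arbitrary: i rule: CS_induct)
  case zero
  show ?case using act_linear(2)[OF FC_gy[OF zero], of 0 "\<lambda>P. 0"] by (simp add: act_gy)
next
  case (single g z)
  define j where "j = inv g i"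
  have j: "j \<in> {1..n}" "g j = i"
    using single permutes_in_image[OF permutes_inv[OF single(1)]] permutes_inverses[OF single(1)] by (auto simp: j_def)
  have "Y i (act (scalar z * sg g) e0) = act (gy i * (scalar z * sg g)) e0"
    using single by (subst act_mult) (auto simp: act_gy intro!: FC_intros)
  also have "gy i * (scalar z * sg g) = scalar z * (sg g * gy j)"
    by (simp only: sg_gy j(2) mult.assoc[symmetric] scalar_mult_commute[of z "gy i"])
  also have "act \<dots> e0 = (\<lambda>P. z * act (sg g * gy j) e0 P)"
    by (rule act_scalar_mult[OF FC_mult[OF FC_sg[OF single(1)] FC_gy[OF j(1)]]])
  also have "\<dots> = (\<lambda>P. 0)"
    by (simp add: act_mult[OF FC_sg[OF single(1)] FC_gy[OF j(1)]] act_gy Y_e0[OF j(1)] act_sg rho_zero[OF single(1)])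
  finally show ?case .
next
  case (add s t)
  then show ?case using act_linear(1)[OF FC_gy[OF add(3)], of "act s e0" "act t e0"] by (simp add: act_add act_gy)
qed

text \<open>On images of \<open>e0\<close> under the group algebra the y_i act by 0, as they do on
  the irreducible module. This is the balancedness of the form in
  \<open>gen_kernel_act\<close>.\<close>

lemma act_lift_y_to_zero:
  assumes b: "b \<in> YC n" and s: "s \<in> CS n"
  shows "act (lift b) (act s e0) = act (lift (y_to_zero b)) (act s e0)"
proof -
  have "\<forall>p\<in>Poly_Mapping.keys b. set_mset (yp_mon p) \<subseteq> {1..n} \<and> yp_perm p permutes {1..n}"
    using b by (simp add: YC_iff)
  then show ?thesis
  proof (induction b rule: poly_mapping_span_induct)
    case (single p z)
    show ?case
    proof (cases "yp_mon p = {#}")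
      case True
      then show ?thesis by (simp add: y_to_zero_single)
    next
      case False
      let ?w = "sorted_list_of_multiset (yp_mon p)" and ?g = "yp_perm p"
      have "?w \<noteq> []" using False by (metis mset_sorted_list_of_multiset mset_zero_iff)
      then obtain w i where w: "?w = w @ [i]" by (metis append_butlast_last_id)
      have "set ?w \<subseteq> {1..n}" using single by (metis set_sorted_list_of_multiset)
      then have wi: "set w \<subseteq> {1..n}" "i \<in> {1..n}" unfolding w by auto
      have "\<rho> ?g (act s e0) = act (sg ?g * s) e0"
        using single by (simp add: act_mult[OF FC_sg CS_FC[OF s]] act_sg)
      then have "Y i (\<rho> ?g (act s e0)) = (\<lambda>P. 0)"
        using Y_CS[OF CS_mult[OF CS_sg s] wi(2)] single by simp
      moreover have "foldr opl (map LY w) (\<lambda>P. 0) = (\<lambda>P. 0)"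
        using wi(1)
      proof (induction w)
        case (Cons j w)
        then show ?case using opl_linear(2)[of "LY j" 0 "\<lambda>P. 0"] by simp
      qed simp
      ultimately have "actp (enc p) (act s e0) = (\<lambda>P. 0)" by (simp add: actp_def enc_def w)
      then show ?thesis using False by (simp add: enc_single act_single y_to_zero_single lift_zero)
    qed
  qed (simp_all add: y_to_zero_zero y_to_zero_add lift_zero lift_add act_add)
qed

text \<open>The form sends r tensor v to the value at Q of r v applied to \<open>e0\<close>. It is
  biadditive and balanced, so it vanishes on zero tensors; on h tensor \<open>ab\<close> it gives
  \<open>youngL\<close> times the value of h on \<open>e0\<close>, and \<open>youngL\<close> is
  nonzero.\<close>

lemma gen_kernel_act: "h \<in> gen_kernel \<Longrightarrow> act h e0 = (\<lambda>P. 0)"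
proof
  fix Q
  assume "h \<in> gen_kernel"
  then have h: "h \<in> FC n" "ID.ten (cherednik_class n c h) ab = \<zero>\<^bsub>\<Delta>\<^esub>" by (simp_all add: gen_kernel_def gen_def)
  define \<beta> where "\<beta> r v = act (rep r) (act (lift v) e0) Q" for r v
  have e0: "affsupp n e0" by (rule W_affsupp[OF W_e0])
  have aff: "affsupp n (act (lift v) e0)" if "v \<in> carrier V" for v
    by (rule affsupp_act[OF CS_FC[OF lift_CS[OF V_GA[OF that]]] e0])
  have \<beta>: "\<beta> (cherednik_class n c f) v = act f (act (lift v) e0) Q" if "f \<in> FC n" "v \<in> carrier V" for f v
    unfolding \<beta>_def act_rep[OF that(1) aff[OF that(2)]] ..
  have "\<beta> (cherednik_class n c h) ab = 0"
  proof (rule ID.ten_zeroD[OF _ _ _ class_closed[OF h(1)] ab_closed h(2)])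
    fix r s v assume "r \<in> carrier (cherednik n c)" "s \<in> carrier (cherednik n c)" and v: "v \<in> carrier V"
    then obtain f g where "f \<in> FC n" "r = cherednik_class n c f" "g \<in> FC n" "s = cherednik_class n c g"
      unfolding carrier_cherednik by blast
    then show "\<beta> (r \<oplus>\<^bsub>cherednik n c\<^esub> s) v = \<beta> r v + \<beta> s v"
      using v by (simp add: class_add \<beta> FC_add act_add)
  next
    fix r v w assume "r \<in> carrier (cherednik n c)" and v: "v \<in> carrier V" "w \<in> carrier V"
    then obtain f where "f \<in> FC n" "r = cherednik_class n c f" unfolding carrier_cherednik by blast
    then show "\<beta> r (v \<oplus>\<^bsub>V\<^esub> w) = \<beta> r v + \<beta> r w"
      using v by (simp add: \<beta> V_add lift_add act_add act_linear)
  next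
    fix r b v assume "r \<in> carrier (cherednik n c)" and b: "b \<in> YC n" and v: "v \<in> carrier V"
    then obtain f where f: "f \<in> FC n" "r = cherednik_class n c f" unfolding carrier_cherednik by blast
    have zb: "y_to_zero b \<in> group_algebra n" by (rule y_to_zero_GA[OF b])
    have lv: "lift v \<in> CS n" by (rule lift_CS[OF V_GA[OF v]])
    have "act (f * lift b) (act (lift v) e0) = act f (act (lift (y_to_zero b)) (act (lift v) e0))"
      unfolding act_mult[OF f(1) lift_FC[OF b]] act_lift_y_to_zero[OF b lv] ..
    also have "\<dots> = act f (act (lift (y_to_zero b * v)) e0)"
      unfolding lift_mult[OF zb V_GA[OF v]] act_mult[OF CS_FC[OF lift_CS[OF zb]] CS_FC[OF lv]] ..
    finally show "\<beta> (r \<otimes>\<^bsub>cherednik n c\<^esub> y_to_cherednik n c b) v = \<beta> r (b \<odot>\<^bsub>V\<^esub> v)"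
      using \<beta>[OF FC_mult[OF f(1) lift_FC[OF b]] v] \<beta>[OF f(1) ID.V_op_closed[OF b v]] f
      by (simp add: y_to_cherednik_lift class_mult[OF f(1) lift_FC[OF b]])
  qed
  then have "youngL * act h e0 Q = 0"
    using \<beta>[OF h(1) ab_closed] by (simp add: lift_ab act_young act_linear(2)[OF h(1)])
  then show "act h e0 Q = 0" using youngL_nonzero by simp
qed

sublocale std: cyclic_module n m l gen_kernel \<Delta> gen
proof unfold_locales
  show "h \<in> gen_kernel \<Longrightarrow> h \<in> FC n" for h by (simp add: gen_kernel_def)
  show "a \<in> gen_kernel \<Longrightarrow> b \<in> gen_kernel \<Longrightarrow> a + b \<in> gen_kernel" for a b
    by (simp add: gen_kernel_def FC_add gen_add)
  show "g * a \<in> gen_kernel" if "g \<in> FC n" "a \<in> gen_kernel" for g a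
  proof -
    have "gen (g * a) = cherednik_class n c g \<odot>\<^bsub>\<Delta>\<^esub> \<zero>\<^bsub>\<Delta>\<^esub>"
      using that gen_smult[of g a] by (simp add: gen_kernel_def)
    then show ?thesis using that ID.IndQ.op_zero[OF class_closed] by (simp add: gen_kernel_def FC_mult)
  qed
  show "a \<in> gen_kernel" if "a \<in> cherednik_ideal n c" for a
    using that gen_zero class_ideal[OF that] by (simp add: gen_kernel_def ideal_FC gen_def)
  show "gy i \<in> gen_kernel" if "i \<in> {1..n}" for i by (rule gen_kernel_y[OF that])
  show "JM i - scalar (of_int (ct0 i)) \<in> gen_kernel" if i: "i \<in> {1..n}" for i
    using i JM_young[of i] by (intro gen_kernel_young CS_diff CS_JM CS_scalar) (auto simp: algebra_simps)
  show "s \<in> gen_kernel" if "s \<in> CS n" "s * (ra * rb) = 0" for s by (rule gen_kernel_young[OF that])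
  show "act h e0 = (\<lambda>P. 0)" if "h \<in> gen_kernel" for h by (rule gen_kernel_act[OF that])
  show "carrier \<Delta> = gen ` FC n" by (rule gen_image)
  show "gen (f + g) = gen f \<oplus>\<^bsub>\<Delta>\<^esub> gen g" if "f \<in> FC n" "g \<in> FC n" for f g by (rule gen_add[OF that])
  show "cherednik_class n c f \<odot>\<^bsub>\<Delta>\<^esub> gen g = gen (f * g)" if "f \<in> FC n" "g \<in> FC n" for f g by (rule gen_smult[OF that])
  show "gen f = \<zero>\<^bsub>\<Delta>\<^esub> \<longleftrightarrow> f \<in> gen_kernel" if "f \<in> FC n" for f using that by (simp add: gen_kernel_def)
qed

end

section \<open>Tableaux and exponents as affine permutations\<close>

lemma rank_less:
  fixes v :: "'a \<Rightarrow> nat"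
  assumes "finite S" "k \<in> S" "v i < v k"
  shows "card {j \<in> S. v j \<le> v i} < card {j \<in> S. v j \<le> v k}"
proof (rule psubset_card_mono)
  have "k \<in> {j \<in> S. v j \<le> v k}" "k \<notin> {j \<in> S. v j \<le> v i}" using assms by auto
  then show "{j \<in> S. v j \<le> v i} \<subset> {j \<in> S. v j \<le> v k}" using assms(3) by fastforce
qed (use assms in simp)

lemma rank_bij:
  fixes v :: "'a \<Rightarrow> nat"
  assumes S: "finite S" "inj_on v S"
  shows "bij_betw (\<lambda>i. card {j \<in> S. v j \<le> v i}) S {1..card S}"
proof -
  let ?r = "\<lambda>i. card {j \<in> S. v j \<le> v i}"
  have "i = k" if "i \<in> S" "k \<in> S" "?r i = ?r k" for i k
  proof -
    have "\<not> v i < v k" "\<not> v k < v i" using rank_less[OF S(1) that(2), of v i] rank_less[OF S(1) that(1), of v k] that(3) by auto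
    then show ?thesis using that S(2) by (auto simp: inj_on_def)
  qed
  then have inj: "inj_on ?r S" by (auto simp: inj_on_def)
  have "?r ` S \<subseteq> {1..card S}"
  proof (rule image_subsetI)
    fix i assume i: "i \<in> S"
    have "0 < ?r i" using i S(1) by (subst card_gt_0_iff) auto
    moreover have "?r i \<le> card S" using S(1) by (intro card_mono) auto
    ultimately show "?r i \<in> {1..card S}" by simp
  qed
  then have "?r ` S = {1..card S}" using card_image[OF inj] by (intro card_subset_eq) auto
  with inj show ?thesis by (simp add: bij_betw_def)
qed

text \<open>Encodes in one number the order behind the sorting permutation: by exponent first, then
  by index. The same number is the position of a box in the affine permutation of the pair.\<close>

definition vpos :: "nat \<Rightarrow> (nat \<Rightarrow> nat) \<Rightarrow> nat \<Rightarrow> nat" where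
  "vpos n a i = n * a i + i"

lemma vpos_less_iff:
  fixes n i j x y :: nat
  assumes "i \<in> {1..n}" "j \<in> {1..n}"
  shows "n * x + j < n * y + i \<longleftrightarrow> x < y \<or> x = y \<and> j < i"
proof -
  have "n * x + j < n * y + i" if xy: "x < y" "i \<in> {1..n}" "j \<in> {1..n}" for x y i j :: nat
  proof -
    obtain d where "y = x + 1 + d" using xy(1) le_Suc_ex[of "Suc x" y] by auto
    then have "n * y = n * x + n + n * d" by (simp add: algebra_simps)
    then show ?thesis using xy by simp
  qed
  from this[of x y i j] this[of y x j i] show ?thesis using assms by (cases x y rule: linorder_cases) auto
qed

lemma vpos_inj: "inj_on (vpos n a) {1..n}"
proof (rule inj_onI)
  fix i j assume ij: "i \<in> {1..n}" "j \<in> {1..n}" and "vpos n a i = vpos n a j"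
  then have "\<not> (a j < a i \<or> a j = a i \<and> j < i)" "\<not> (a i < a j \<or> a i = a j \<and> i < j)"
    using vpos_less_iff[OF ij, of "a j" "a i"] vpos_less_iff[OF ij(2,1), of "a i" "a j"] by (auto simp: vpos_def)
  then show "i = j" by linarith
qed

lemma sorting_perm_rank:
  assumes i: "i \<in> {1..n}"
  shows "sorting_perm n a i = card {j \<in> {1..n}. vpos n a j \<le> vpos n a i}"
proof -
  have eq: "{j \<in> {1..n}. vpos n a j \<le> vpos n a i} = {j \<in> {1..n}. a j < a i} \<union> {j \<in> {1..n}. j \<le> i \<and> a j = a i}"
  proof (rule Set.set_eqI)
    fix j
    show "j \<in> {j \<in> {1..n}. vpos n a j \<le> vpos n a i} \<longleftrightarrow> j \<in> {j \<in> {1..n}. a j < a i} \<union> {j \<in> {1..n}. j \<le> i \<and> a j = a i}"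
    proof (cases "j \<in> {1..n}")
      case True
      have "vpos n a j \<le> vpos n a i \<longleftrightarrow> \<not> (a i < a j \<or> a i = a j \<and> i < j)"
        using vpos_less_iff[OF True i, of "a i" "a j"] by (auto simp: vpos_def)
      then show ?thesis using True by (simp del: atLeastAtMost_iff) linarith
    qed auto
  qed
  show ?thesis unfolding sorting_perm_def eq by (rule card_Un_disjoint[symmetric]) auto
qed

lemma sorting_perm_bij: "bij_betw (sorting_perm n a) {1..n} {1..n}"
proof -
  have "bij_betw (sorting_perm n a) {1..n} {1..n}
      \<longleftrightarrow> bij_betw (\<lambda>i. card {j \<in> {1..n}. vpos n a j \<le> vpos n a i}) {1..n} {1..n}"
    by (rule bij_betw_cong) (rule sorting_perm_rank)
  then show ?thesis using rank_bij[OF finite_atLeastAtMost vpos_inj[of n a]] by (simp only: card_atLeastAtMost diff_Suc_1)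
qed

lemma sorting_perm_less_iff:
  assumes "i \<in> {1..n}" "k \<in> {1..n}"
  shows "sorting_perm n a i < sorting_perm n a k \<longleftrightarrow> vpos n a i < vpos n a k"
proof -
  have imp: "sorting_perm n a i < sorting_perm n a k" if "i \<in> {1..n}" "k \<in> {1..n}" "vpos n a i < vpos n a k" for i k
    unfolding sorting_perm_rank[OF that(1)] sorting_perm_rank[OF that(2)] by (rule rank_less[OF _ that(2,3)]) simp
  consider "vpos n a i < vpos n a k" | "i = k" | "vpos n a k < vpos n a i"
    using vpos_inj[of n a] assms unfolding inj_on_def by (meson linorder_neqE_nat)
  then show ?thesis by cases (use imp[OF assms] imp[OF assms(2,1)] in auto)
qed

lemma sorting_inv:
  assumes "x \<in> {1..n}"
  shows "sorting_inv n a x \<in> {1..n}" "sorting_perm n a (sorting_inv n a x) = x"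
  unfolding sorting_inv_def using assms sorting_perm_bij[of n a]
  by (auto simp del: atLeastAtMost_iff simp: bij_betw_def intro: inv_into_into f_inv_into_f)

lemma sorting_inv_perm: "i \<in> {1..n} \<Longrightarrow> sorting_inv n a (sorting_perm n a i) = i"
  unfolding sorting_inv_def by (rule inv_into_f_f[OF bij_betw_imp_inj_on[OF sorting_perm_bij]])

lemma sorting_inv_less_iff:
  "x \<in> {1..n} \<Longrightarrow> y \<in> {1..n} \<Longrightarrow> vpos n a (sorting_inv n a x) < vpos n a (sorting_inv n a y) \<longleftrightarrow> x < y"
  using sorting_perm_less_iff[of "sorting_inv n a x" n "sorting_inv n a y" a] sorting_inv[of _ n a] by simp

context hook_model
begin

section \<open>Contents and labels of hook tableaux\<close>

text \<open>A box of a hook is determined by its content, so an interval of integers replaces the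
  shape: nonnegative contents form the arm, negative ones the rest of the leg.\<close>

definition content_box :: "int \<Rightarrow> nat \<times> nat" where
  "content_box d = (if 0 \<le> d then (0, nat d) else (nat (- d), 0))"

definition contents :: "int set" where "contents = {- int l..<int n - int l}"

lemma content_box_boxes: "d \<in> contents \<Longrightarrow> content_box d \<in> boxes (hook n l)"
  using ln by (auto simp: content_box_def mem_boxes contents_def)

lemma content_box_content: "box_content (content_box d) = d"
  by (simp add: content_box_def box_content_def)

lemma boxes_content_box: "b \<in> boxes (hook n l) \<Longrightarrow> content_box (box_content b) = b \<and> box_content b \<in> contents"
  using ln by (cases b) (auto simp: content_box_def box_content_def mem_boxes contents_def)

lemma boxes_image: "boxes (hook n l) = content_box ` contents"
  using content_box_boxes boxes_content_box by (metis image_eqI image_subsetI subsetI subset_antisym)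

lemma content_box_bij: "bij_betw content_box contents (boxes (hook n l))"
  unfolding bij_betw_def boxes_image by (auto intro: inj_on_inverseI content_box_content)

lemma finite_boxes: "finite (boxes (hook n l))"
  by (simp add: boxes_image contents_def)

lemma zero_contents: "0 \<in> contents"
  using ln by (simp add: contents_def)

lemma leg_contents: "- int l \<in> contents" and arm_contents: "int n - int l - 1 \<in> contents"
  using ln by (auto simp: contents_def)

lemma min_content_label_eq: "min_content_label (hook n l) TT = TT (content_box (- int l))"
proof -
  let ?b = "arg_min_on box_content (boxes (hook n l))"
  have b: "?b \<in> boxes (hook n l)" using arg_min_if_finite(1)[OF finite_boxes] content_box_boxes[OF zero_contents] by blast
  have "box_content ?b \<le> box_content (content_box (- int l))"
    by (rule arg_min_least[OF finite_boxes _ content_box_boxes[OF leg_contents]]) (use content_box_boxes[OF zero_contents] in blast)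
  then have "box_content ?b = - int l" using boxes_content_box[OF b] by (simp add: content_box_content contents_def)
  then show ?thesis using boxes_content_box[OF b] unfolding min_content_label_def by metis
qed

definition lab :: "(nat \<times> nat \<Rightarrow> nat) \<Rightarrow> int \<Rightarrow> nat" where "lab TT d = TT (content_box d)"

abbreviation tableaux where "tableaux \<equiv> SYT (hook n l)"

lemma SYT_bij: "TT \<in> tableaux \<Longrightarrow> bij_betw TT (boxes (hook n l)) {1..n}"
  unfolding SYT_def sum_list_hook by blast

lemma lab_bij: "TT \<in> tableaux \<Longrightarrow> bij_betw (lab TT) contents {1..n}"
  using bij_betw_trans[OF content_box_bij SYT_bij] by (simp add: lab_def comp_def cong: bij_betw_cong)

lemma lab_range: "TT \<in> tableaux \<Longrightarrow> d \<in> contents \<Longrightarrow> lab TT d \<in> {1..n}"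
  by (rule bij_betwE[OF lab_bij, rule_format])

lemma lab_arm: "TT \<in> tableaux \<Longrightarrow> 0 \<le> j \<Longrightarrow> j < d \<Longrightarrow> d \<in> contents \<Longrightarrow> lab TT j < lab TT d"
proof -
  assume T: "TT \<in> tableaux" and jk: "0 \<le> j" "j < d" "d \<in> contents"
  have "j \<in> contents" using jk by (auto simp: contents_def)
  then have "(0, nat j) \<in> boxes (hook n l)" "(0, nat d) \<in> boxes (hook n l)"
    using content_box_boxes[of j] content_box_boxes[OF jk(3)] jk by (simp_all add: content_box_def)
  moreover have "nat j < nat d" using jk by simp
  ultimately have "TT (0, nat j) < TT (0, nat d)" using T unfolding SYT_def by blast
  then show ?thesis using jk by (simp add: lab_def content_box_def)
qed

lemma lab_leg: "TT \<in> tableaux \<Longrightarrow> j \<le> 0 \<Longrightarrow> d < j \<Longrightarrow> d \<in> contents \<Longrightarrow> lab TT j < lab TT d"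
proof -
  assume T: "TT \<in> tableaux" and jk: "j \<le> 0" "d < j" "d \<in> contents"
  have "j \<in> contents" using jk ln by (auto simp: contents_def)
  then have "(nat (- j), 0) \<in> boxes (hook n l)" "(nat (- d), 0) \<in> boxes (hook n l)"
    using content_box_boxes[of j] content_box_boxes[OF jk(3)] jk by (auto simp: content_box_def split: if_splits)
  moreover have "nat (- j) < nat (- d)" using jk by simp
  ultimately have "TT (nat (- j), 0) < TT (nat (- d), 0)" using T unfolding SYT_def by blast
  then show ?thesis using jk by (auto simp: lab_def content_box_def)
qed

lemma lab_max: "TT \<in> tableaux \<Longrightarrow> lab TT (int n - int l - 1) = n \<or> lab TT (- int l) = n"
proof (rule ccontr)
  assume T: "TT \<in> tableaux" and no: "\<not> (lab TT (int n - int l - 1) = n \<or> lab TT (- int l) = n)"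
  have "n \<in> {1..n}" using n2 by simp
  then obtain d where d: "d \<in> contents" "lab TT d = n" using lab_bij[OF T] unfolding bij_betw_def by (metis imageE)
  have "d \<noteq> int n - int l - 1" "d \<noteq> - int l" using no d by auto
  then have "0 \<le> d \<and> d < int n - int l - 1 \<or> d \<le> 0 \<and> - int l < d" using d(1) by (auto simp: contents_def)
  then have "lab TT d < lab TT (int n - int l - 1) \<or> lab TT d < lab TT (- int l)"
    using lab_arm[OF T _ _ arm_contents] lab_leg[OF T _ _ leg_contents] by blast
  then show False using lab_range[OF T arm_contents] lab_range[OF T leg_contents] d(2) by auto
qed

lemma ct_lab: "TT \<in> tableaux \<Longrightarrow> d \<in> contents \<Longrightarrow> ct (hook n l) TT (lab TT d) = d"
  unfolding ct_def lab_def by (simp add: inv_into_f_f[OF bij_betw_imp_inj_on[OF SYT_bij]] content_box_boxes content_box_content)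

lemma label_content:
  assumes T: "TT \<in> tableaux" and x: "x \<in> {1..n}"
  shows "ct (hook n l) TT x \<in> contents" "lab TT (ct (hook n l) TT x) = x"
proof -
  obtain d where "d \<in> contents" "lab TT d = x" using lab_bij[OF T] x unfolding bij_betw_def by (metis imageE)
  then show "ct (hook n l) TT x \<in> contents" "lab TT (ct (hook n l) TT x) = x" using ct_lab[OF T] by auto
qed

definition affine_of :: "(nat \<Rightarrow> nat) \<times> (nat \<times> nat \<Rightarrow> nat) \<Rightarrow> int \<Rightarrow> int" where
  "affine_of aT z = (let i = nat ((z - 1) mod int n + 1) in
     int m * ct (hook n l) (snd aT) (sorting_perm n (fst aT) i) + int n * ((z - 1) div int n - int (fst aT i)))"

lemma affine_of_at:
  assumes i: "i \<in> {1..n}"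
  shows "affine_of (a, TT) (int i + int n * r) = int m * ct (hook n l) TT (sorting_perm n a i) + int n * (r - int (a i))"
proof -
  have e: "int i + int n * r - 1 = (int i - 1) + int n * r" by simp
  have "(int i - 1 + int n * r) mod int n = int i - 1" "(int i - 1 + int n * r) div int n = r"
    using i by auto
  then have d: "(int i + int n * r - 1) mod int n = int i - 1" "(int i + int n * r - 1) div int n = r"
    unfolding e .
  show ?thesis unfolding affine_of_def Let_def d fst_conv snd_conv by simp
qed

lemma affine_of_wt: "i \<in> {1..n} \<Longrightarrow> weight c (hook n l) a TT i = wt (affine_of (a, TT)) i"
proof -
  assume i: "i \<in> {1..n}"
  have e: "affine_of (a, TT) (int i) = int m * ct (hook n l) TT (sorting_perm n a i) - int n * int (a i)"
    using affine_of_at[OF i, of a TT 0] by (simp add: algebra_simps)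
  show ?thesis unfolding wt_def e weight_def sum_list_hook using n2 by (simp add: c_def field_simps)
qed

abbreviation spos :: "(nat \<Rightarrow> nat) \<Rightarrow> (nat \<times> nat \<Rightarrow> nat) \<Rightarrow> int \<Rightarrow> nat" where
  "spos a TT d \<equiv> sorting_inv n a (lab TT d)"

lemma spos_range: "TT \<in> tableaux \<Longrightarrow> d \<in> contents \<Longrightarrow> spos a TT d \<in> {1..n}"
  by (intro sorting_inv lab_range)

lemma affine_of_spos:
  assumes T: "TT \<in> tableaux" and d: "d \<in> contents"
  shows "affine_of (a, TT) (int (spos a TT d) + int n * r) = int m * d + int n * (r - int (a (spos a TT d)))"
  unfolding affine_of_at[OF spos_range[OF T d]] sorting_inv(2)[OF lab_range[OF T d]] ct_lab[OF T d] ..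

lemma spos_rep:
  assumes T: "TT \<in> tableaux"
  obtains d r where "d \<in> contents" "z = int (spos a TT d) + int n * r"
proof -
  obtain i r where i: "1 \<le> i" "i \<le> n" and z: "z = int i + int n * r" by (rule int_rep)
  have i': "i \<in> {1..n}" using i by simp
  have p: "sorting_perm n a i \<in> {1..n}" by (rule bij_betwE[OF sorting_perm_bij, rule_format, OF i'])
  let ?d = "ct (hook n l) TT (sorting_perm n a i)"
  have e: "spos a TT ?d = i" by (simp only: label_content(2)[OF T p] sorting_inv_perm[OF i'])
  show thesis by (rule that[OF label_content(1)[OF T p], of r]) (simp only: e z)
qed

lemma aff_affine_of:
  assumes T: "TT \<in> tableaux"
  shows "aff n (affine_of (a, TT))"
  unfolding aff_def
proof (intro conjI allI)
  fix z
  obtain d r where d: "d \<in> contents" and z: "z = int (spos a TT d) + int n * r" by (rule spos_rep[OF T])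
  have "z + int n = int (spos a TT d) + int n * (r + 1)" by (simp add: z algebra_simps)
  then show "affine_of (a, TT) (z + int n) = affine_of (a, TT) z + int n"
    unfolding z by (simp only: affine_of_spos[OF T d]) (simp add: algebra_simps)
next
  show "bij (affine_of (a, TT))"
  proof (rule bijI)
    show "inj (affine_of (a, TT))"
    proof (rule injI)
      fix x y assume eq: "affine_of (a, TT) x = affine_of (a, TT) y"
      obtain d r where d: "d \<in> contents" and x: "x = int (spos a TT d) + int n * r" by (rule spos_rep[OF T])
      obtain j s where j: "j \<in> contents" and y: "y = int (spos a TT j) + int n * s" by (rule spos_rep[OF T])
      have e: "int m * d + int n * (r - int (a (spos a TT d))) = int m * j + int n * (s - int (a (spos a TT j)))"
        using eq by (simp only: x y affine_of_spos[OF T d] affine_of_spos[OF T j])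
      then have "int m * d - int m * j = int n * ((s - int (a (spos a TT j))) - (r - int (a (spos a TT d))))"
        by (simp add: algebra_simps)
      then have "int n dvd int m * d - int m * j" by simp
      then have kj: "d = j" using d j unfolding contents_def by (intro content_unique) auto
      then have "r = s" using e n2 by simp
      then show "x = y" using kj by (simp add: x y)
    qed
    show "surj (affine_of (a, TT))"
      unfolding surj_def
    proof
      fix x
      obtain d r where "- int l \<le> d" "d < int n - int l" and x: "x = int m * d + int n * r" by (rule content_exists)
      then have d: "d \<in> contents" by (simp add: contents_def)
      show "\<exists>z. x = affine_of (a, TT) z"
        using affine_of_spos[OF T d, of a "r + int (a (spos a TT d))"] x by (metis add_diff_cancel_right')
    qed
  qed
qed

text \<open>The exponent a lowers the value at i by n a; moving a periods to the right restores m d,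
  hence the position n a + i.\<close>

lemma pos_affine_of: "TT \<in> tableaux \<Longrightarrow> d \<in> contents \<Longrightarrow> pos (affine_of (a, TT)) (int m * d) = int (vpos n a (spos a TT d))"
  using affine_of_spos[of TT d a "int (a (spos a TT d))"] by (simp add: pos_iff[OF aff_affine_of] vpos_def add.commute)

text \<open>Standardness of the tableau supplies the inequalities inside arm and leg, which leaves
  the one around the cylinder between the two ends. There the label n may replace the arm end: if n
  is at the leg end instead, both comparisons hold because n m is positive.\<close>

lemma J_affine_of:
  assumes T: "TT \<in> tableaux"
  shows "J (affine_of (a, TT)) \<longleftrightarrow> vpos n a (sorting_inv n a n) < vpos n a (spos a TT (- int l)) + n * m"
proof -
  let ?P = "affine_of (a, TT)" and ?v = "\<lambda>d. vpos n a (spos a TT d)"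
  have less: "?v j < ?v d \<longleftrightarrow> lab TT j < lab TT d" if "j \<in> contents" "d \<in> contents" for j d
    by (rule sorting_inv_less_iff[OF lab_range[OF T that(1)] lab_range[OF T that(2)]])
  \<comment> \<open>m (n - l) exceeds m (- l) by m periods, and positions follow periods.\<close>
  have around: "pos ?P (int m * (int n - int l)) = int (?v (- int l) + n * m)"
  proof -
    have "int m * (int n - int l) = int m * (- int l) + int n * int m" by (simp add: algebra_simps)
    then show ?thesis by (simp only: pos_per_mult[OF aff_affine_of[OF T]] pos_affine_of[OF T leg_contents]) simp
  qed
  have corner: "1 \<le> pos ?P 0"
  proof -
    have "1 \<le> vpos n a (spos a TT 0)" using spos_range[OF T zero_contents, of a] by (simp add: vpos_def)
    then show ?thesis using pos_affine_of[OF T zero_contents, of a] by simp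
  qed
  have arm: "pos ?P (int m * d) < pos ?P (int m * (d + 1))" if "0 \<le> d" "d < int n - int l - 1" for d
  proof -
    have d: "d \<in> contents" "d + 1 \<in> contents" using that by (auto simp: contents_def)
    show ?thesis unfolding pos_affine_of[OF T d(1)] pos_affine_of[OF T d(2)] using less[OF d] lab_arm[OF T that(1) _ d(2)] by simp
  qed
  have leg: "pos ?P (int m * (d + 1)) < pos ?P (int m * d)" if "- int l \<le> d" "d < 0" for d
  proof -
    have d: "d + 1 \<in> contents" "d \<in> contents" using that ln by (auto simp: contents_def)
    show ?thesis unfolding pos_affine_of[OF T d(1)] pos_affine_of[OF T d(2)] using less[OF d] lab_leg[OF T _ _ d(2), of "d + 1"] that by simp
  qed
  have "J ?P \<longleftrightarrow> ?v (int n - int l - 1) < ?v (- int l) + n * m"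
  proof
    assume "J ?P"
    then have "pos ?P (int m * (int n - int l - 1)) < pos ?P (int m * (int n - int l - 1 + 1))"
      using ln by (intro J_arm) auto
    then have "int (?v (int n - int l - 1)) < int (?v (- int l) + n * m)"
      unfolding pos_affine_of[OF T arm_contents] using around by (simp only: diff_add_cancel)
    then show "?v (int n - int l - 1) < ?v (- int l) + n * m" by (simp only: of_nat_less_iff)
  next
    assume last: "?v (int n - int l - 1) < ?v (- int l) + n * m"
    show "J ?P"
      unfolding J_pos
    proof (intro conjI allI impI aff_affine_of[OF T] corner)
      fix d assume d: "0 \<le> d \<and> d < int n - int l"
      show "pos ?P (int m * d) < pos ?P (int m * (d + 1))"
      proof (cases "d = int n - int l - 1")
        case True
        then have k1: "d + 1 = int n - int l" by simp
        have "pos ?P (int m * d) = int (?v (int n - int l - 1))" unfolding True by (rule pos_affine_of[OF T arm_contents])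
        moreover have "pos ?P (int m * (d + 1)) = int (?v (- int l) + n * m)" unfolding k1 by (rule around)
        ultimately show ?thesis using last by (simp only: of_nat_less_iff)
      qed (use d arm in simp)
    qed (use leg in blast)
  qed
  also have "\<dots> \<longleftrightarrow> vpos n a (sorting_inv n a n) < ?v (- int l) + n * m"
  proof (cases "lab TT (int n - int l - 1) = n")
    case False
    then have leg: "lab TT (- int l) = n" using lab_max[OF T] by blast
    have "lab TT (int n - int l - 1) < lab TT (- int l)" using False leg lab_range[OF T arm_contents] by simp
    then have "?v (int n - int l - 1) < ?v (- int l)" using less[OF arm_contents leg_contents] by simp
    then show ?thesis using leg m0 n2 by simp
  qed simp
  finally show ?thesis .
qed

text \<open>The position n a + i with 1 <= i <= n determines a and i; over all contents this
  recovers the exponents and then, through the sorting permutation, the labels.\<close>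

lemma affine_of_inj: "inj_on affine_of (exponents n \<times> tableaux)"
proof (rule inj_onI)
  fix x y assume xy: "x \<in> exponents n \<times> tableaux" "y \<in> exponents n \<times> tableaux" and eq: "affine_of x = affine_of y"
  obtain a TT where x: "x = (a, TT)" "a \<in> exponents n" "TT \<in> tableaux" using xy(1) by blast
  obtain b SS where y: "y = (b, SS)" "b \<in> exponents n" "SS \<in> tableaux" using xy(2) by blast
  have eqs: "a (spos a TT d) = b (spos b SS d) \<and> spos a TT d = spos b SS d" if d: "d \<in> contents" for d
  proof -
    have v: "vpos n a (spos a TT d) = vpos n b (spos b SS d)"
      using pos_affine_of[OF x(3) d, of a] pos_affine_of[OF y(3) d, of b] eq unfolding x(1) y(1) by simp
    note r = spos_range[OF x(3) d, of a] spos_range[OF y(3) d, of b]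
    show ?thesis using v vpos_less_iff[OF r] vpos_less_iff[OF r(2,1)] unfolding vpos_def
      by (metis less_irrefl linorder_neqE_nat)
  qed
  have *: "a (spos a TT d) = b (spos a TT d)" "spos a TT d = spos b SS d" if "d \<in> contents" for d
    using eqs[OF that] by metis+
  have "a i = b i" if i: "i \<in> {1..n}" for i
  proof -
    have p: "sorting_perm n a i \<in> {1..n}" by (rule bij_betwE[OF sorting_perm_bij, rule_format, OF i])
    show ?thesis
      using *(1)[OF label_content(1)[OF x(3) p]] by (simp only: label_content(2)[OF x(3) p] sorting_inv_perm[OF i])
  qed
  then have ab: "a = b" using x(2) y(2) unfolding exponents_def by (intro PiE_ext) auto
  have "TT b = SS b" if b: "b \<in> boxes (hook n l)" for b
  proof -
    have d: "box_content b \<in> contents" "content_box (box_content b) = b" using boxes_content_box[OF b] by auto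
    have "lab TT (box_content b) = lab SS (box_content b)"
      using *(2)[OF d(1)] sorting_inv(2)[OF lab_range[OF x(3) d(1)], of a] sorting_inv(2)[OF lab_range[OF y(3) d(1)], of a]
      unfolding ab by metis
    then show ?thesis unfolding lab_def d(2) .
  qed
  moreover have "TT \<in> boxes (hook n l) \<rightarrow>\<^sub>E {1..n}" "SS \<in> boxes (hook n l) \<rightarrow>\<^sub>E {1..n}"
    using x(3) y(3) unfolding SYT_def sum_list_hook by blast+
  ultimately have "TT = SS" by (metis PiE_ext)
  then show "x = y" using ab x y by simp
qed

lemma J_increasing:
  assumes P: "J P" and "0 \<le> j" "j < d" "d \<in> contents"
  shows "pos P (int m * j) < pos P (int m * d)"
proof -
  have "j < d \<longrightarrow> d \<in> contents \<longrightarrow> pos P (int m * j) < pos P (int m * d)" if "j \<le> d" for d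
    using that
  proof (induction d rule: int_ge_induct)
    case (step d)
    have "pos P (int m * d) < pos P (int m * (d + 1))" if "d + 1 \<in> contents"
      using that step(1) assms(2) by (intro J_arm[OF P]) (auto simp: contents_def)
    then show ?case using step assms(2) by (cases "j = d") (auto simp: contents_def)
  qed simp
  then show ?thesis using assms by simp
qed

lemma J_decreasing:
  assumes P: "J P" and "j \<le> 0" "d < j" "d \<in> contents"
  shows "pos P (int m * j) < pos P (int m * d)"
proof -
  have "d < j \<longrightarrow> d \<in> contents \<longrightarrow> pos P (int m * j) < pos P (int m * d)" if "d \<le> j" for d
    using that
  proof (induction d rule: int_le_induct)
    case (step d)
    have "pos P (int m * (d - 1 + 1)) < pos P (int m * (d - 1))" if "d - 1 \<in> contents"
      using that step(1) assms(2) by (intro J_leg[OF P]) (auto simp: contents_def)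
    then show ?case using step assms(2) ln by (cases "j = d") (auto simp: contents_def)
  qed simp
  then show ?thesis using assms by simp
qed

text \<open>The pair is read off from the positions of the m d, written as n a + i with i in 1 to n.
  The corner condition makes all positions positive, so the exponents are natural numbers; the arm
  and leg inequalities make the tableau standard.\<close>

lemma affine_of_surj:
  assumes P: "J P"
  obtains a TT where "a \<in> exponents n" "TT \<in> tableaux" "affine_of (a, TT) = P"
proof -
  note aff = J_aff[OF P]
  define q where "q d = pos P (int m * d)" for d
  define i where "i d = nat ((q d - 1) mod int n + 1)" for d
  define r where "r d = (q d - 1) div int n" for d
  have mod: "0 \<le> x mod int n" "x mod int n < int n" for x using n2 by auto
  have i: "i d \<in> {1..n}" for d unfolding i_def using mod[of "q d - 1"] by auto
  have qi: "q d = int (i d) + int n * r d" for d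
    unfolding i_def r_def using mod[of "q d - 1"] mult_div_mod_eq[of "int n" "q d - 1"] by simp
  have q1: "1 \<le> q d" if d: "d \<in> contents" for d
  proof -
    have "q 0 \<le> q d"
      using J_increasing[OF P, of 0 d] J_decreasing[OF P, of 0 d] d unfolding q_def by (cases d "0::int" rule: linorder_cases) auto
    then show ?thesis using J_corner[OF P] by (simp add: q_def)
  qed
  have r0: "0 \<le> r d" if "d \<in> contents" for d
    unfolding r_def using q1[OF that] n2 by (simp add: pos_imp_zdiv_nonneg_iff)
  have inj: "inj_on i contents"
  proof (rule inj_onI)
    fix j d assume jk: "j \<in> contents" "d \<in> contents" "i j = i d"
    have "q j = q d + int n * (r j - r d)" using jk(3) by (simp add: qi algebra_simps)
    then have "pos P (int m * j) = pos P (int m * d + int n * (r j - r d))" by (simp add: q_def pos_per_mult[OF aff])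
    then have "int m * j = int m * d + int n * (r j - r d)" using P_pos[OF aff] by metis
    then have "int n dvd int m * j - int m * d" by simp
    then show "j = d" using jk unfolding contents_def by (intro content_unique) auto
  qed
  have cc: "card contents = n" using ln by (simp add: contents_def)
  have img: "i ` contents = {1..n}"
    using i card_image[OF inj] cc by (intro card_subset_eq) auto
  define a where "a = (\<lambda>x\<in>{1..n}. nat (r (inv_into contents i x)))"
  have ai: "a (i d) = nat (r d)" if "d \<in> contents" for d
    using that i by (simp add: a_def inv_into_f_f[OF inj] del: atLeastAtMost_iff)
  have v: "int (vpos n a (i d)) = q d" if "d \<in> contents" for d
    using ai[OF that] r0[OF that] qi[of d] by (simp add: vpos_def)
  let ?g = "sorting_perm n a"
  define TT where "TT = (\<lambda>b\<in>boxes (hook n l). ?g (i (box_content b)))"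
  have lab: "lab TT d = ?g (i d)" if "d \<in> contents" for d
    using content_box_boxes[OF that] by (simp add: lab_def TT_def content_box_content)
  have less: "TT (content_box j) < TT (content_box d) \<longleftrightarrow> q j < q d" if "j \<in> contents" "d \<in> contents" for j d
  proof -
    have "int (vpos n a (i j)) < int (vpos n a (i d)) \<longleftrightarrow> q j < q d" unfolding v[OF that(1)] v[OF that(2)] ..
    then show ?thesis
      using lab[OF that(1)] lab[OF that(2)] sorting_perm_less_iff[OF i[of j] i[of d], of a]
      by (simp only: lab_def of_nat_less_iff)
  qed
  have "bij_betw (?g \<circ> (i \<circ> box_content)) (boxes (hook n l)) {1..n}"
  proof (intro bij_betw_trans[OF bij_betw_trans])
    show "bij_betw box_content (boxes (hook n l)) contents"
      by (rule bij_betw_byWitness[where f' = content_box]) (use boxes_content_box content_box_content content_box_boxes in auto)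
    show "bij_betw i contents {1..n}" using inj img by (simp add: bij_betw_def)
  qed (rule sorting_perm_bij)
  then have bij: "bij_betw TT (boxes (hook n l)) {1..n}"
    by (rule iffD1[OF bij_betw_cong, rotated]) (simp add: TT_def)
  have T: "TT \<in> tableaux"
    unfolding SYT_def sum_list_hook
  proof (intro CollectI conjI allI impI)
    show "TT \<in> boxes (hook n l) \<rightarrow>\<^sub>E {1..n}"
      using bij_betwE[OF bij] by (intro PiE_I) (auto simp: TT_def)
    show "bij_betw TT (boxes (hook n l)) {1..n}" by (rule bij)
  next
    fix s j d assume jk: "(s, j) \<in> boxes (hook n l) \<and> (s, d) \<in> boxes (hook n l) \<and> j < d"
    then have "s = 0" by (auto simp: mem_boxes)
    then have e: "(s, j) = content_box (int j)" "(s, d) = content_box (int d)" by (simp_all add: content_box_def)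
    have c: "int j \<in> contents" "int d \<in> contents" using boxes_content_box[of "(s, j)"] boxes_content_box[of "(s, d)"] jk unfolding e content_box_content by auto
    show "TT (s, j) < TT (s, d)"
      unfolding e less[OF c] unfolding q_def using jk by (intro J_increasing[OF P _ _ c(2)]) auto
  next
    fix j d s assume jk: "(j, s) \<in> boxes (hook n l) \<and> (d, s) \<in> boxes (hook n l) \<and> j < d"
    then have "s = 0" by (auto simp: mem_boxes)
    then have e: "(j, s) = content_box (- int j)" "(d, s) = content_box (- int d)" by (auto simp: content_box_def)
    have c: "- int j \<in> contents" "- int d \<in> contents" using boxes_content_box[of "(j, s)"] boxes_content_box[of "(d, s)"] jk unfolding e content_box_content by auto
    show "TT (j, s) < TT (d, s)"
      unfolding e less[OF c] unfolding q_def using jk by (intro J_decreasing[OF P _ _ c(2)]) auto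
  qed
  have spos: "spos a TT d = i d" if "d \<in> contents" for d
    unfolding lab[OF that] by (rule sorting_inv_perm[OF i])
  have "affine_of (a, TT) z = P z" for z
  proof -
    obtain d s where d: "d \<in> contents" and z: "z = int (spos a TT d) + int n * s" by (rule spos_rep[OF T])
    have z': "z = pos P (int m * d) + int n * (s - r d)"
      using qi[of d] unfolding z spos[OF d] q_def by (simp add: algebra_simps)
    have "P z = int m * d + int n * (s - r d)"
      unfolding z' pos_per_mult[OF aff, symmetric] by (rule P_pos[OF aff])
    moreover have "affine_of (a, TT) z = int m * d + int n * (s - int (a (spos a TT d)))"
      unfolding z by (rule affine_of_spos[OF T d])
    ultimately show ?thesis using ai[OF d] r0[OF d] spos[OF d] by simp
  qed
  moreover have "a \<in> exponents n" by (simp add: a_def exponents_def)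
  ultimately show thesis using that T by blast
qed

end

theorem corollary5p26:
  fixes m n l :: nat and c :: complex
  assumes "m > 0" and "n > 0" and "coprime m n"
    and "c = of_nat m / of_nat n"
    and "l < n - 1"
  defines "\<mu> \<equiv> hook n l"
  defines "\<Delta> \<equiv> standard_module c \<mu>"
  defines "I \<equiv> the_maximal_submodule (cherednik n c) \<Delta>"
  defines "P \<equiv> exponents n \<times> SYT \<mu>"
  defines "top_pos \<equiv> (\<lambda>a. sorting_inv n a n)"
    and "min_pos \<equiv> (\<lambda>a T. sorting_inv n a (min_content_label \<mu> T))"
  defines "J \<equiv> {(a, T) \<in> P.
      int (a (top_pos a)) - int m < int (a (min_pos a T)) \<or>
      int (a (top_pos a)) - int m = int (a (min_pos a T)) \<and> top_pos a < min_pos a T}"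
  shows "(\<forall>(a, T) \<in> P. \<forall>v. weight_vector n c \<Delta> (weight c \<mu> a T) v \<longrightarrow>
           (v \<in> I \<longleftrightarrow>
              int (a (top_pos a)) - int m > int (a (min_pos a T)) \<or>
              int (a (top_pos a)) - int m = int (a (min_pos a T)) \<and> top_pos a > min_pos a T)) \<and>
         simple_module c \<mu> = quotient_module \<Delta> I \<and>
         (\<exists>e. is_basis n c (simple_module c \<mu>) J e \<and>
              (\<forall>(a, T) \<in> J. weight_vector n c (simple_module c \<mu>) (weight c \<mu> a T) (e (a, T))))"
proof -
  interpret hm: hook_model n m l
    using assms(1,3,5) by unfold_locales auto
  have c: "c = hm.c" by (simp add: assms(4) hm.c_def)
  have \<Delta>: "\<Delta> = hm.\<Delta>" unfolding \<Delta>_def \<mu>_def c by (rule hm.standard_module_eq)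
  have I: "I = hm.std.Imax" unfolding I_def \<Delta> c by (rule hm.std.the_maximal)
  have simple: "simple_module c \<mu> = quotient_module \<Delta> I"
    using hm.std.irreducible_quotient_eq hm.standard_module_eq
    by (simp add: simple_module_def \<mu>_def hm.sum_list_hook I \<Delta> c)
  have n: "n \<in> {1..n}" using assms(2) by simp
  have pos: "top_pos a \<in> {1..n}" "min_pos a T \<in> {1..n}" "min_pos a T = hm.spos a T (- int l)"
    if "T \<in> SYT \<mu>" for a T
    using that n sorting_inv(1) hm.spos_range hm.leg_contents
    unfolding top_pos_def min_pos_def \<mu>_def hm.min_content_label_eq hm.lab_def by auto
  have J_iff: "hm.J (hm.affine_of (a, T)) \<longleftrightarrow>
      int (a (top_pos a)) - int m < int (a (min_pos a T)) \<or>
      int (a (top_pos a)) - int m = int (a (min_pos a T)) \<and> top_pos a < min_pos a T"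
    if T: "T \<in> SYT \<mu>" for a T
  proof -
    have "hm.J (hm.affine_of (a, T)) \<longleftrightarrow> vpos n a (top_pos a) < vpos n a (min_pos a T) + n * m"
      using hm.J_affine_of[of T a] T pos(3)[OF T] by (simp add: \<mu>_def top_pos_def)
    \<comment> \<open>Adding n m to a position raises its exponent by m and keeps its index, so the
      comparison becomes lexicographic.\<close>
    also have "\<dots> \<longleftrightarrow> n * a (top_pos a) + top_pos a < n * (a (min_pos a T) + m) + min_pos a T"
      by (simp add: vpos_def algebra_simps)
    also have "\<dots> \<longleftrightarrow> a (top_pos a) < a (min_pos a T) + m
        \<or> a (top_pos a) = a (min_pos a T) + m \<and> top_pos a < min_pos a T"
      by (rule vpos_less_iff[OF pos(2,1)[OF T]])
    also have "\<dots> \<longleftrightarrow> int (a (top_pos a)) - int m < int (a (min_pos a T)) \<or>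
      int (a (top_pos a)) - int m = int (a (min_pos a T)) \<and> top_pos a < min_pos a T" by linarith
    finally show ?thesis .
  qed
  have not_J: "\<not> hm.J (hm.affine_of (a, T)) \<longleftrightarrow>
      int (a (top_pos a)) - int m > int (a (min_pos a T)) \<or>
      int (a (top_pos a)) - int m = int (a (min_pos a T)) \<and> top_pos a > min_pos a T"
    if T: "T \<in> SYT \<mu>" for a T
  proof -
    \<comment> \<open>Coinciding indices would have equal exponents and force m = 0; hence in a tie
      the negated comparison is strict.\<close>
    have "top_pos a \<noteq> min_pos a T" if "int (a (top_pos a)) - int m = int (a (min_pos a T))"
      using that assms(1) by auto
    then show ?thesis unfolding J_iff[OF T] by linarith
  qed
  have wt: "weight c \<mu> a T i = hm.wt (hm.affine_of (a, T)) i" if "i \<in> {1..n}" for a T i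
    unfolding c \<mu>_def by (rule hm.affine_of_wt[OF that])
  have JP: "J = {x \<in> P. hm.J (hm.affine_of x)}"
    unfolding J_def P_def using J_iff by (auto simp del: int_ops)
  have bij: "bij_betw hm.affine_of J {Q. hm.J Q}"
    unfolding bij_betw_def
  proof (intro conjI equalityI subsetI)
    show "inj_on hm.affine_of J" by (rule inj_on_subset[OF hm.affine_of_inj]) (auto simp: JP P_def \<mu>_def)
    fix Q assume "Q \<in> {Q. hm.J Q}"
    then obtain a T where "a \<in> exponents n" "T \<in> SYT \<mu>" "hm.affine_of (a, T) = Q"
      unfolding \<mu>_def using hm.affine_of_surj by blast
    then show "Q \<in> hm.affine_of ` J" using \<open>Q \<in> {Q. hm.J Q}\<close> unfolding JP P_def by blast
  qed (auto simp: JP)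
  let ?e = "\<lambda>x. hm.std.basis_vec (hm.affine_of x)"
  have "is_basis n c (simple_module c \<mu>) J ?e"
    unfolding simple I \<Delta> unfolding c by (rule hm.std.basis[OF bij])
  moreover have "weight_vector n c (simple_module c \<mu>) (weight c \<mu> a T) (?e (a, T))" if "(a, T) \<in> J" for a T
    unfolding simple I \<Delta> using that wt unfolding JP c by (intro hm.std.basis_vec_weight) auto
  moreover have "v \<in> I \<longleftrightarrow> int (a (top_pos a)) - int m > int (a (min_pos a T)) \<or>
      int (a (top_pos a)) - int m = int (a (min_pos a T)) \<and> top_pos a > min_pos a T"
    if "(a, T) \<in> P" "weight_vector n c \<Delta> (weight c \<mu> a T) v" for a T v
  proof -
    have T: "T \<in> SYT \<mu>" using that(1) by (simp add: P_def)
    have "v \<in> I \<longleftrightarrow> \<not> hm.J (hm.affine_of (a, T))"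
      unfolding I
    proof (rule hm.std.weight_vector_in_Imax)
      show "aff n (hm.affine_of (a, T))" using hm.aff_affine_of T unfolding \<mu>_def .
      show "weight_vector n hm.c hm.\<Delta> (weight c \<mu> a T) v" using that(2) unfolding c \<Delta> .
    qed (rule wt)
    then show ?thesis unfolding not_J[OF T] .
  qed
  ultimately show ?thesis using simple by blast
qed

end
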